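(* There exists no complete conformal CMC-$1$ immersion $f\colon(\mathbb{C}\cup\{\infty\})\setminus\{p_1,p_2,p_3\}\to H^3$ (with $p_1,p_2,p_3$ distinct points) of type $\mathbf{O}(1,-2,-3)$ with $\mathrm{TA}(f)\le 8\pi$.
   Context: $H^3$ is hyperbolic $3$-space of constant sectional curvature $-1$. CMC-$1$ means constant mean curvature $1$. For a conformal CMC-$1$ immersion $f\colon M\to H^3$ of a connected Riemann surface $M$ with induced metric $ds^2$, area element $dA$ and Gaussian curvature $K$ (one has $K\le0$), $\mathrm{TA}(f)=\int_M(-K)\,dA$ is the total absolute curvature; $f$ is complete if $ds^2$ is complete. The Hopf differential $Q$ is the holomorphic quadratic differential on $M$ such that $-Q$ is the $(2,0)$-part of the complexified second fundamental form. If $f$ is complete with $\mathrm{TA}(f)<\infty$ and $M=(\mathbb{C}\cup\{\infty\})\setminus\{p_1,\dots,p_n\}$, then $Q$ extends meromorphically to $\mathbb{C}\cup\{\infty\}$; $f$ is said to be of type $\mathbf{O}(d_1,\dots,d_n)$ if (after ordering the ends $p_1,\dots,p_n$ suitably) $\mathrm{ord}_{p_j}Q=d_j$ for $j=1,\dots,n$ (e.g. $d_j=-2$ means a pole of order $2$, $d_j=1$ means a simple zero). *)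

theory Defs
  imports "HOL-Complex_Analysis.Complex_Analysis"
begin

section \<open>Smooth maps and partial derivatives\<close>

definition dir_deriv ::
    "'a::real_normed_vector \<Rightarrow> ('a \<Rightarrow> 'b::real_normed_vector) \<Rightarrow> 'a \<Rightarrow> 'b"
  where "dir_deriv v g = (\<lambda>z. frechet_derivative g (at z) v)"

text \<open>Only used for open sets \<open>S\<close>.\<close>

primrec Ck_on ::
    "nat \<Rightarrow> ('a::real_normed_vector \<Rightarrow> 'b::real_normed_vector) \<Rightarrow> 'a set \<Rightarrow> bool"
  where
    "Ck_on 0 g S \<longleftrightarrow> continuous_on S g"
  | "Ck_on (Suc k) g S \<longleftrightarrow> g differentiable_on S \<and> (\<forall>v. Ck_on k (dir_deriv v g) S)"

definition smooth_on ::
    "('a::real_normed_vector \<Rightarrow> 'b::real_normed_vector) \<Rightarrow> 'a set \<Rightarrow> bool"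
  where "smooth_on g S \<longleftrightarrow> (\<forall>k. Ck_on k g S)"

section \<open>The Riemann sphere\<close>

text \<open>
  The Riemann sphere is \<^typ>\<open>complex option\<close>, with \<^term>\<open>None\<close> as the point at infinity (the
  encoding used by \<^const>\<open>Alexandroff_compactification\<close>). Its complex structure is given by two
  holomorphic parametrizations, \<^term>\<open>Some\<close> and \<open>at_inf\<close>, that is, by the coordinates
  \<open>z\<close> and \<open>w = 1 / z\<close>. A map on a domain \<open>M\<close> of the sphere is studied through its two local
  expressions \<open>f \<circ> \<phi>\<close> on \<open>\<phi> -` M\<close>.
\<close>

type_synonym sphere = "complex option"

definition at_inf :: "complex \<Rightarrow> sphere"
  where "at_inf w = (if w = 0 then None else Some (inverse w))"

definition sphere_params :: "(complex \<Rightarrow> sphere) set"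
  where "sphere_params = {Some, at_inf}"

section \<open>Hyperbolic space\<close>

text \<open>
  Minkowski 4-space, with the time coordinate as first component, and hyperbolic 3-space of
  constant curvature \<open>-1\<close> as the upper sheet of the unit hyperboloid in it.
\<close>

type_synonym minkowski = "real \<times> (real ^ 3)"

definition mink :: "minkowski \<Rightarrow> minkowski \<Rightarrow> real"
  where "mink x y = snd x \<bullet> snd y - fst x * fst y"

definition hyp3 :: "minkowski set"
  where "hyp3 = {x. mink x x = -1 \<and> fst x > 0}"

section \<open>Local surface theory\<close>

text \<open>
  In this section \<open>g\<close> is a local parametrization of a surface in \<^const>\<open>hyp3\<close> and \<open>n\<close> a unit
  normal field along it. The coordinate vectors of \<open>z = x + \<i> y\<close> are \<open>1\<close> and \<open>\<i>\<close>.
\<close>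

definition fst_form :: "(complex \<Rightarrow> minkowski) \<Rightarrow> complex \<Rightarrow> complex \<Rightarrow> complex \<Rightarrow> real"
  where "fst_form g z u v = mink (dir_deriv u g z) (dir_deriv v g z)"

text \<open>
  The Levi-Civita connection of \<^const>\<open>hyp3\<close> is the tangential part of the flat connection of
  Minkowski space, and \<open>n\<close> is tangent to \<^const>\<open>hyp3\<close>; hence flat second derivatives suffice.
\<close>

definition snd_form ::
    "(complex \<Rightarrow> minkowski) \<Rightarrow> (complex \<Rightarrow> minkowski) \<Rightarrow> complex \<Rightarrow> complex \<Rightarrow> complex \<Rightarrow> real"
  where "snd_form g n z u v = mink (dir_deriv u (dir_deriv v g) z) (n z)"

definition unit_normal_at :: "(complex \<Rightarrow> minkowski) \<Rightarrow> (complex \<Rightarrow> minkowski) \<Rightarrow> complex \<Rightarrow> bool"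
  where "unit_normal_at g n z \<longleftrightarrow>
    mink (n z) (n z) = 1 \<and> mink (n z) (g z) = 0 \<and> (\<forall>v. mink (n z) (dir_deriv v g z) = 0)"

definition conformal_at :: "(complex \<Rightarrow> minkowski) \<Rightarrow> complex \<Rightarrow> bool"
  where "conformal_at g z \<longleftrightarrow>
    fst_form g z 1 1 = fst_form g z \<i> \<i> \<and> fst_form g z 1 \<i> = 0"

definition area_density :: "(complex \<Rightarrow> minkowski) \<Rightarrow> complex \<Rightarrow> real"
  where "area_density g z = sqrt (fst_form g z 1 1 * fst_form g z \<i> \<i> - (fst_form g z 1 \<i>)\<^sup>2)"

text \<open>Half the trace of the second fundamental form with respect to the first.\<close>

definition mean_curv :: "(complex \<Rightarrow> minkowski) \<Rightarrow> (complex \<Rightarrow> minkowski) \<Rightarrow> complex \<Rightarrow> real"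
  where "mean_curv g n z =
    (fst_form g z \<i> \<i> * snd_form g n z 1 1 - 2 * fst_form g z 1 \<i> * snd_form g n z 1 \<i>
       + fst_form g z 1 1 * snd_form g n z \<i> \<i>)
    / (2 * (fst_form g z 1 1 * fst_form g z \<i> \<i> - (fst_form g z 1 \<i>)\<^sup>2))"

text \<open>
  Gaussian curvature of a conformal metric \<open>e\<^bsup>2u\<^esup> (dx\<^sup>2 + dy\<^sup>2)\<close>, namely
  \<open>K = - e\<^bsup>-2u\<^esup> (u\<^sub>x\<^sub>x + u\<^sub>y\<^sub>y)\<close>; it is meaningful for conformal \<open>g\<close> only.
\<close>

definition gauss_curv :: "(complex \<Rightarrow> minkowski) \<Rightarrow> complex \<Rightarrow> real"
  where "gauss_curv g z =
    (let u = (\<lambda>w. ln (fst_form g w 1 1) / 2)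
     in - (dir_deriv 1 (dir_deriv 1 u) z + dir_deriv \<i> (dir_deriv \<i> u) z) / fst_form g z 1 1)"

text \<open>
  The coefficient \<open>q\<close> of the Hopf differential \<open>Q = q dz\<^sup>2\<close>: minus the complex bilinear extension
  of the second fundamental form, evaluated twice at \<open>\<partial>\<^sub>z = (\<partial>\<^sub>x - \<i> \<partial>\<^sub>y) / 2\<close>.
\<close>

definition hopf_coeff :: "(complex \<Rightarrow> minkowski) \<Rightarrow> (complex \<Rightarrow> minkowski) \<Rightarrow> complex \<Rightarrow> complex"
  where "hopf_coeff g n z =
    - (of_real (snd_form g n z 1 1) - of_real (snd_form g n z \<i> \<i>)
         - 2 * \<i> * of_real (snd_form g n z 1 \<i>)) / 4"

section \<open>Surfaces over domains of the sphere\<close>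

definition conformal_immersion :: "sphere set \<Rightarrow> (sphere \<Rightarrow> minkowski) \<Rightarrow> bool"
  where "conformal_immersion M f \<longleftrightarrow> f ` M \<subseteq> hyp3 \<and>
    (\<forall>\<phi>\<in>sphere_params. smooth_on (f \<circ> \<phi>) (\<phi> -` M) \<and>
       (\<forall>z\<in>\<phi> -` M. inj (frechet_derivative (f \<circ> \<phi>) (at z)) \<and> conformal_at (f \<circ> \<phi>) z))"

text \<open>
  Mean curvature one with respect to the unit normal field \<open>N\<close>. As the mean curvature vector
  is then \<open>N\<close>, the field \<open>N\<close> is determined by \<open>f\<close>.
\<close>

definition cmc1_with_normal :: "sphere set \<Rightarrow> (sphere \<Rightarrow> minkowski) \<Rightarrow> (sphere \<Rightarrow> minkowski) \<Rightarrow> bool"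
  where "cmc1_with_normal M f N \<longleftrightarrow>
    (\<forall>\<phi>\<in>sphere_params. smooth_on (N \<circ> \<phi>) (\<phi> -` M) \<and>
       (\<forall>z\<in>\<phi> -` M. unit_normal_at (f \<circ> \<phi>) (N \<circ> \<phi>) z \<and> mean_curv (f \<circ> \<phi>) (N \<circ> \<phi>) z = 1))"

definition arc_length :: "(complex \<Rightarrow> minkowski) \<Rightarrow> (real \<Rightarrow> complex) \<Rightarrow> real"
  where "arc_length g \<gamma> =
    integral {0..1}
      (\<lambda>t. let v = vector_derivative \<gamma> (at t within {0..1}) in sqrt (fst_form g (\<gamma> t) v v))"

text \<open>
  \<open>curve_of_length M f p q L\<close>: there is a piecewise \<open>C\<^sup>1\<close> curve in \<open>M\<close> from \<open>p\<close> to \<open>q\<close> of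
  length \<open>L\<close> in the metric induced by \<open>f\<close>. Such a curve is a finite concatenation of arcs,
  each lying in one of the two coordinate domains.
\<close>

inductive curve_of_length ::
    "sphere set \<Rightarrow> (sphere \<Rightarrow> minkowski) \<Rightarrow> sphere \<Rightarrow> sphere \<Rightarrow> real \<Rightarrow> bool"
  for M f
  where
    const: "p \<in> M \<Longrightarrow> curve_of_length M f p p 0"
  | append: "curve_of_length M f p (\<phi> (pathstart \<gamma>)) L \<Longrightarrow> \<phi> \<in> sphere_params \<Longrightarrow> valid_path \<gamma> \<Longrightarrow>
      \<phi> ` path_image \<gamma> \<subseteq> M \<Longrightarrow>
      curve_of_length M f p (\<phi> (pathfinish \<gamma>)) (L + arc_length (f \<circ> \<phi>) \<gamma>)"

text \<open>
  The distance function of the induced Riemannian metric. It is only of interest for connected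
  open \<open>M\<close>, where any two points are joined by a curve; the value \<open>0\<close> off \<open>M\<close> is a dummy.
\<close>

definition induced_dist :: "sphere set \<Rightarrow> (sphere \<Rightarrow> minkowski) \<Rightarrow> sphere \<Rightarrow> sphere \<Rightarrow> real"
  where "induced_dist M f p q =
    (if p \<in> M \<and> q \<in> M then Inf {L. curve_of_length M f p q L} else 0)"

definition complete_surface :: "sphere set \<Rightarrow> (sphere \<Rightarrow> minkowski) \<Rightarrow> bool"
  where "complete_surface M f \<longleftrightarrow> Metric_space.mcomplete M (induced_dist M f)"

text \<open>
  The integral of \<open>-K dA\<close>, computed in the coordinate \<open>z\<close>, which misses at most one point of
  \<open>M\<close>. No truncation takes place in \<^const>\<open>ennreal\<close>, as \<open>K \<le> 0\<close> for surfaces of constant mean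
  curvature one.
\<close>

definition total_abs_curv :: "sphere set \<Rightarrow> (sphere \<Rightarrow> minkowski) \<Rightarrow> ennreal"
  where "total_abs_curv M f =
    (\<integral>\<^sup>+ z \<in> Some -` M. ennreal (- gauss_curv (f \<circ> Some) z * area_density (f \<circ> Some) z) \<partial>lborel)"

text \<open>
  The order of the Hopf differential at a point \<open>p\<close> is that of its coefficient in a coordinate
  around \<open>p\<close>. The extra conditions make \<^const>\<open>zorder\<close> meaningful.
\<close>

definition has_order_at :: "(complex \<Rightarrow> complex) \<Rightarrow> complex \<Rightarrow> int \<Rightarrow> bool"
  where "has_order_at q a d \<longleftrightarrow>
    q meromorphic_on {a} \<and> (\<exists>\<^sub>F z in at a. q z \<noteq> 0) \<and> zorder q a = d"

definition hopf_order_at :: "(sphere \<Rightarrow> minkowski) \<Rightarrow> (sphere \<Rightarrow> minkowski) \<Rightarrow> sphere \<Rightarrow> int \<Rightarrow> bool"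
  where "hopf_order_at f N p d =
    (case p of
       Some a \<Rightarrow> has_order_at (hopf_coeff (f \<circ> Some) (N \<circ> Some)) a d
     | None \<Rightarrow> has_order_at (hopf_coeff (f \<circ> at_inf) (N \<circ> at_inf)) 0 d)"

text \<open>Here \<open>P\<close> is the finite set of punctures.\<close>

definition of_type_O ::
    "sphere set \<Rightarrow> (sphere \<Rightarrow> minkowski) \<Rightarrow> (sphere \<Rightarrow> minkowski) \<Rightarrow> int list \<Rightarrow> bool"
  where "of_type_O P f N ds \<longleftrightarrow>
    (\<exists>ps. distinct ps \<and> set ps = P \<and> list_all2 (hopf_order_at f N) ps ds)"

end

theory Submission
  imports Defs
begin

text \<open>
  The obstruction is local, at the end where \<open>Q = q dt\<^sup>2\<close> has a pole of order three. In a coordinate \<open>t\<close> vanishing there,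
  the metric \<open>- K ds\<^sup>2\<close> of curvature one is \<open>\<phi>\<^sup>-\<^sup>2 |dt|\<^sup>2\<close> with \<open>\<phi>\<^sub>t\<^sub>t / \<phi>\<close> holomorphic, and as its area is finite,
  \<open>\<phi>\<^sub>t\<^sub>t / \<phi>\<close> has a pole of order at most two. The null field \<open>f + N\<close>, multiplied by \<open>\<phi>\<close>, satisfies
  \<open>Y\<^sub>t\<^sub>t = (\<phi>\<^sub>t\<^sub>t / \<phi> + q) Y\<close>. Its components are four independent Hermitian forms in the solutions of
  \<open>y'' = (\<phi>\<^sub>t\<^sub>t / \<phi> + q) y\<close>, and they are single-valued, so this equation has scalar monodromy around \<open>t = 0\<close>. However,
  its coefficient has a pole of order exactly three, and the solutions behave like
  \<open>t\<^bsup>3/4\<^esup> exp (\<plusminus> c t\<^bsup>-1/2\<^esup>)\<close>; continuation around \<open>t = 0\<close> exchanges the two exponentials, so the monodromy is not scalar.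
\<close>

text \<open>Behind the two linear equations stand the secondary Gauss map, with Schwarzian
  \<open>- 2 phi_tt / phi\<close>, and the hyperbolic Gauss map; the two Schwarzians differ by
  \<open>2 Q\<close>. The first map is multivalued with unitary monodromy, the second is
  single-valued. Neither map, nor a lift to SL(2,C), is constructed: single-valued real functions,
  \<open>phi\<close> and the components of \<open>phi * (G + N)\<close>, carry the same information,
  and branches occur only through \<open>t = exp \<zeta>\<close>.

  Two steps need analysis. The bound on the pole of \<open>phi_tt / phi\<close> is not a formal
  consequence of Liouville's equation: \<open>- ln phi\<close> is superharmonic, the area controls
  its circle means, and the mean value inequality turns this into power growth of
  \<open>phi\<close>. Since \<open>phi\<close> is a definite Hermitian form in the solutions of
  \<open>y'' = (phi_tt / phi) y\<close>, it bounds an eigensolution, which is then a power of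
  \<open>t\<close> times a power series and determines the leading behaviour of its own coefficient.
  At the irregular point a single decaying solution is followed; its estimate has to hold on a
  sector that is a full turn in \<open>t\<close>.\<close>

section \<open>Smooth functions\<close>

lemma differentiable_on_cong_open:
  assumes "open S" "\<And>x. x \<in> S \<Longrightarrow> f x = g x" "f differentiable_on S"
  shows "g differentiable_on S"
proof -
  have "g differentiable (at x)" if "x \<in> S" for x
  proof -
    have "f differentiable (at x)"
      using assms(1,3) that by (simp add: differentiable_on_eq_differentiable_at)
    then obtain D where "(f has_derivative D) (at x)" unfolding differentiable_def by blast
    then have "(g has_derivative D) (at x)"
      using has_derivative_transform_within_open[OF _ assms(1) that] assms(2) by blast
    then show ?thesis unfolding differentiable_def by blast
  qed
  then show ?thesis using assms(1) by (simp add: differentiable_on_eq_differentiable_at)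
qed

lemma dir_deriv_eqI: "(f has_derivative D) (at x) \<Longrightarrow> dir_deriv v f x = D v"
  unfolding dir_deriv_def by (metis frechet_derivative_at)

lemma dir_deriv_cong:
  assumes "open S" "x \<in> S" "\<And>y. y \<in> S \<Longrightarrow> f y = g y"
  shows "dir_deriv v f x = dir_deriv v g x"
proof -
  have "((f has_derivative D) (at x)) = ((g has_derivative D) (at x))" for D
    using has_derivative_transform_within_open[OF _ assms(1,2)] assms(3) by metis
  then show ?thesis unfolding dir_deriv_def frechet_derivative_def by simp
qed

lemma Ck_on_cong:
  assumes "open S" "\<And>x. x \<in> S \<Longrightarrow> f x = g x" "Ck_on k f S"
  shows "Ck_on k g S"
  using assms(2,3)
proof (induction k arbitrary: f g)
  case 0
  then show ?case using continuous_on_cong by fastforce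
next
  case (Suc k)
  have "Ck_on k (dir_deriv v g) S" for v
  proof (rule Suc.IH)
    show "Ck_on k (dir_deriv v f) S" using Suc.prems by simp
    show "dir_deriv v f x = dir_deriv v g x" if "x \<in> S" for x
      using dir_deriv_cong[OF assms(1) that] Suc.prems(1) by blast
  qed
  moreover have "g differentiable_on S"
    using differentiable_on_cong_open[OF assms(1) Suc.prems(1)] Suc.prems(2) by simp
  ultimately show ?case by simp
qed

lemma Ck_on_SucD: "Ck_on (Suc k) f S \<Longrightarrow> Ck_on k f S"
proof (induction k arbitrary: f)
  case 0
  then show ?case by (simp add: differentiable_imp_continuous_on)
next
  case (Suc k)
  then show ?case by (metis Ck_on.simps(2))
qed

lemma smooth_on_cong:
  "open S \<Longrightarrow> (\<And>x. x \<in> S \<Longrightarrow> f x = g x) \<Longrightarrow> smooth_on f S \<Longrightarrow> smooth_on g S"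
  unfolding smooth_on_def using Ck_on_cong by blast

lemma smooth_on_differentiable:
  "smooth_on f S \<Longrightarrow> open S \<Longrightarrow> x \<in> S \<Longrightarrow> f differentiable (at x)"
  unfolding smooth_on_def by (metis Ck_on.simps(2) differentiable_on_eq_differentiable_at)

lemma smooth_on_continuous: "smooth_on f S \<Longrightarrow> continuous_on S f"
  unfolding smooth_on_def by (metis Ck_on.simps(1))

lemma smooth_on_dir_deriv: "smooth_on f S \<Longrightarrow> smooth_on (dir_deriv v f) S"
  unfolding smooth_on_def by (metis Ck_on.simps(2))

lemma differentiable_has_derivative_dir:
  "f differentiable (at x) \<Longrightarrow> (f has_derivative (\<lambda>v. dir_deriv v f x)) (at x)"
  unfolding dir_deriv_def by (simp add: frechet_derivative_works[symmetric])

lemma Ck_on_differentiable: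
  "Ck_on (Suc k) f S \<Longrightarrow> open S \<Longrightarrow> x \<in> S \<Longrightarrow> (f has_derivative (\<lambda>v. dir_deriv v f x)) (at x)"
  by (metis Ck_on.simps(2) differentiable_on_eq_differentiable_at differentiable_has_derivative_dir)

text \<open>Lets a derivative be supplied by a formula valid on \<open>S\<close>;
  \<open>frechet_derivative\<close>, which is defined by choice, then need not be unfolded in the
  closure properties below.\<close>

lemma Ck_on_SucI:
  assumes "open S" "\<And>x. x \<in> S \<Longrightarrow> (f has_derivative (\<lambda>v. D v x)) (at x)" "\<And>v. Ck_on k (D v) S"
  shows "Ck_on (Suc k) f S"
proof -
  have "f differentiable_on S"
    using assms(1,2) by (auto simp: differentiable_on_eq_differentiable_at differentiable_def)
  moreover have "Ck_on k (dir_deriv v f) S" for v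
    by (rule Ck_on_cong[OF assms(1) _ assms(3)]) (simp add: dir_deriv_eqI[OF assms(2)])
  ultimately show ?thesis by simp
qed

lemma Ck_on_subset: "open S \<Longrightarrow> T \<subseteq> S \<Longrightarrow> Ck_on k f S \<Longrightarrow> Ck_on k f T"
  by (induction k arbitrary: f) (auto intro: continuous_on_subset differentiable_on_subset)

lemma smooth_on_subset: "smooth_on f S \<Longrightarrow> open S \<Longrightarrow> T \<subseteq> S \<Longrightarrow> smooth_on f T"
  unfolding smooth_on_def using Ck_on_subset by blast

lemma Ck_on_const: "open S \<Longrightarrow> Ck_on k (\<lambda>x. c) S"
proof (induction k arbitrary: c)
  case (Suc k)
  show ?case by (rule Ck_on_SucI[where D="\<lambda>v x. 0"]) (auto intro: Suc)
qed simp

lemma smooth_on_const: "open S \<Longrightarrow> smooth_on (\<lambda>x. c) S"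
  unfolding smooth_on_def using Ck_on_const by blast

lemma Ck_on_linear:
  assumes "bounded_linear L" "open S"
  shows "Ck_on k f S \<Longrightarrow> Ck_on k (\<lambda>x. L (f x)) S"
proof (induction k arbitrary: f)
  case 0
  then show ?case by (simp add: bounded_linear.continuous_on[OF assms(1)])
next
  case (Suc k)
  show ?case
  proof (rule Ck_on_SucI[OF assms(2), where D="\<lambda>v x. L (dir_deriv v f x)"])
    show "((\<lambda>x. L (f x)) has_derivative (\<lambda>v. L (dir_deriv v f x))) (at x)" if "x \<in> S" for x
      using bounded_linear.has_derivative[OF assms(1) Ck_on_differentiable[OF Suc.prems assms(2) that]] .
    show "Ck_on k (\<lambda>x. L (dir_deriv v f x)) S" for v
      using Suc by simp
  qed
qed

lemma smooth_on_linear: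
  "bounded_linear L \<Longrightarrow> open S \<Longrightarrow> smooth_on f S \<Longrightarrow> smooth_on (\<lambda>x. L (f x)) S"
  unfolding smooth_on_def using Ck_on_linear by blast

lemma Ck_on_add:
  assumes "open S"
  shows "Ck_on k f S \<Longrightarrow> Ck_on k g S \<Longrightarrow> Ck_on k (\<lambda>x. f x + g x) S"
proof (induction k arbitrary: f g)
  case 0
  then show ?case by (simp add: continuous_on_add)
next
  case (Suc k)
  show ?case
  proof (rule Ck_on_SucI[OF assms, where D="\<lambda>v x. dir_deriv v f x + dir_deriv v g x"])
    show "((\<lambda>x. f x + g x) has_derivative (\<lambda>v. dir_deriv v f x + dir_deriv v g x)) (at x)"
      if "x \<in> S" for x
      using Suc.prems assms that by (intro has_derivative_add Ck_on_differentiable)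
    show "Ck_on k (\<lambda>x. dir_deriv v f x + dir_deriv v g x) S" for v
      using Suc by simp
  qed
qed

lemma smooth_on_add:
  "open S \<Longrightarrow> smooth_on f S \<Longrightarrow> smooth_on g S \<Longrightarrow> smooth_on (\<lambda>x. f x + g x) S"
  unfolding smooth_on_def using Ck_on_add by blast

lemma Ck_on_bilinear:
  assumes "bounded_bilinear B" "open S"
  shows "Ck_on k f S \<Longrightarrow> Ck_on k g S \<Longrightarrow> Ck_on k (\<lambda>x. B (f x) (g x)) S"
proof (induction k arbitrary: f g)
  case 0
  then show ?case by (simp add: bounded_bilinear.continuous_on[OF assms(1)])
next
  case (Suc k)
  show ?case
  proof (rule Ck_on_SucI[OF assms(2), where D="\<lambda>v x. B (f x) (dir_deriv v g x) + B (dir_deriv v f x) (g x)"])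
    show "((\<lambda>x. B (f x) (g x)) has_derivative
        (\<lambda>v. B (f x) (dir_deriv v g x) + B (dir_deriv v f x) (g x))) (at x)"
      if "x \<in> S" for x
      using Suc.prems assms that
      by (intro bounded_bilinear.FDERIV[OF assms(1)] Ck_on_differentiable)
    show "Ck_on k (\<lambda>x. B (f x) (dir_deriv v g x) + B (dir_deriv v f x) (g x)) S" for v
      using Suc.prems Ck_on_SucD[OF Suc.prems(1)] Ck_on_SucD[OF Suc.prems(2)]
      by (intro Ck_on_add assms Suc.IH) auto
  qed
qed

lemma smooth_on_bilinear:
  "bounded_bilinear B \<Longrightarrow> open S \<Longrightarrow> smooth_on f S \<Longrightarrow> smooth_on g S \<Longrightarrow>
    smooth_on (\<lambda>x. B (f x) (g x)) S"
  unfolding smooth_on_def using Ck_on_bilinear by blast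

lemma smooth_on_mult:
  fixes f g :: "'a::real_normed_vector \<Rightarrow> 'b::real_normed_algebra"
  shows "open S \<Longrightarrow> smooth_on f S \<Longrightarrow> smooth_on g S \<Longrightarrow> smooth_on (\<lambda>x. f x * g x) S"
  by (rule smooth_on_bilinear[OF bounded_bilinear_mult])

lemma smooth_on_uminus:
  "open S \<Longrightarrow> smooth_on f S \<Longrightarrow> smooth_on (\<lambda>x. - f x) S"
  by (rule smooth_on_linear[OF bounded_linear_minus[OF bounded_linear_ident]])

lemma smooth_on_diff:
  "open S \<Longrightarrow> smooth_on f S \<Longrightarrow> smooth_on g S \<Longrightarrow> smooth_on (\<lambda>x. f x - g x) S"
  using smooth_on_add[of S f "\<lambda>x. - g x"] smooth_on_uminus by auto

lemma smooth_on_cnj: "open S \<Longrightarrow> smooth_on f S \<Longrightarrow> smooth_on (\<lambda>x. cnj (f x)) S"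
  by (rule smooth_on_linear[OF bounded_linear_cnj])

lemma smooth_on_Re: "open S \<Longrightarrow> smooth_on f S \<Longrightarrow> smooth_on (\<lambda>x. Re (f x)) S"
  by (rule smooth_on_linear[OF bounded_linear_Re])

lemma smooth_on_of_real:
  fixes f :: "'a::real_normed_vector \<Rightarrow> real"
  shows "open S \<Longrightarrow> smooth_on f S \<Longrightarrow> smooth_on (\<lambda>x. of_real (f x) :: complex) S"
  by (rule smooth_on_linear[OF bounded_linear_of_real])

lemma smooth_on_sum:
  assumes "open S" "finite A" "\<And>i. i \<in> A \<Longrightarrow> smooth_on (f i) S"
  shows "smooth_on (\<lambda>x. \<Sum>i\<in>A. f i x) S"
  using assms(2,3) by (induction A) (auto intro!: smooth_on_add smooth_on_const assms(1))

section \<open>Holomorphic functions and compositions with them\<close>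

lemma Ck_on_holomorphic:
  assumes "open S"
  shows "f holomorphic_on S \<Longrightarrow> Ck_on k f S"
proof (induction k arbitrary: f)
  case 0
  then show ?case by (simp add: holomorphic_on_imp_continuous_on)
next
  case (Suc k)
  show ?case
  proof (rule Ck_on_SucI[OF assms, where D="\<lambda>v x. deriv f x * v"])
    show "(f has_derivative (\<lambda>v. deriv f x * v)) (at x)" if "x \<in> S" for x
      using holomorphic_derivI[OF Suc.prems assms that] has_field_derivative_imp_has_derivative
      by blast
    show "Ck_on k (\<lambda>x. deriv f x * v) S" for v
      using Suc.prems assms by (intro Suc.IH holomorphic_intros)
  qed
qed

lemma smooth_on_holomorphic: "open S \<Longrightarrow> f holomorphic_on S \<Longrightarrow> smooth_on f S"
  unfolding smooth_on_def using Ck_on_holomorphic by blast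

lemma Ck_on_holomorphic_o:
  assumes "open S" "open W"
  shows "h holomorphic_on W \<Longrightarrow> f ` S \<subseteq> W \<Longrightarrow> Ck_on k f S \<Longrightarrow> Ck_on k (\<lambda>x. h (f x)) S"
proof (induction k arbitrary: h)
  case 0
  then show ?case
    by (metis Ck_on.simps(1) continuous_on_compose2 holomorphic_on_imp_continuous_on)
next
  case (Suc k)
  show ?case
  proof (rule Ck_on_SucI[OF assms(1), where D="\<lambda>v x. deriv h (f x) * dir_deriv v f x"])
    show "((\<lambda>x. h (f x)) has_derivative (\<lambda>v. deriv h (f x) * dir_deriv v f x)) (at x)"
      if "x \<in> S" for x
    proof -
      have "(h has_derivative (*) (deriv h (f x))) (at (f x))"
        using holomorphic_derivI[OF Suc.prems(1) assms(2)] that Suc.prems(2)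
          has_field_derivative_def by blast
      from diff_chain_at[OF Ck_on_differentiable[OF Suc.prems(3) assms(1) that] this]
      show ?thesis by (simp add: o_def)
    qed
    show "Ck_on k (\<lambda>x. deriv h (f x) * dir_deriv v f x) S" for v
    proof (rule Ck_on_bilinear[OF bounded_bilinear_mult assms(1)])
      show "Ck_on k (\<lambda>x. deriv h (f x)) S"
        by (rule Suc.IH[OF holomorphic_deriv[OF Suc.prems(1) assms(2)] Suc.prems(2) Ck_on_SucD[OF Suc.prems(3)]])
      show "Ck_on k (\<lambda>x. dir_deriv v f x) S" using Suc.prems(3) by simp
    qed
  qed
qed

lemma smooth_on_holomorphic_o:
  "open S \<Longrightarrow> open W \<Longrightarrow> h holomorphic_on W \<Longrightarrow> f ` S \<subseteq> W \<Longrightarrow> smooth_on f S \<Longrightarrow>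
    smooth_on (\<lambda>x. h (f x)) S"
  unfolding smooth_on_def using Ck_on_holomorphic_o by blast

lemma smooth_on_inverse:
  fixes f :: "'a::real_normed_vector \<Rightarrow> complex"
  assumes "open S" "smooth_on f S" "\<And>x. x \<in> S \<Longrightarrow> f x \<noteq> 0"
  shows "smooth_on (\<lambda>x. inverse (f x)) S"
  by (rule smooth_on_holomorphic_o[where W="-{0}"]) (use assms in \<open>auto intro!: holomorphic_intros\<close>)

lemma smooth_on_divide:
  fixes f g :: "'a::real_normed_vector \<Rightarrow> complex"
  assumes "open S" "smooth_on f S" "smooth_on g S" "\<And>x. x \<in> S \<Longrightarrow> g x \<noteq> 0"
  shows "smooth_on (\<lambda>x. f x / g x) S"
  unfolding divide_inverse using assms by (intro smooth_on_mult smooth_on_inverse)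

lemma has_derivative_compose_holomorphic:
  assumes "(f has_derivative (\<lambda>v. dir_deriv v f (\<tau> z))) (at (\<tau> z))" "(\<tau> has_field_derivative c) (at z)"
  shows "((\<lambda>z. f (\<tau> z)) has_derivative (\<lambda>v. dir_deriv (c * v) f (\<tau> z))) (at z)"
  using diff_chain_at[OF assms(2)[THEN has_field_derivative_imp_has_derivative] assms(1)]
  by (simp add: o_def)

lemma dir_deriv_Re_Im:
  fixes f :: "complex \<Rightarrow> 'b::real_normed_vector"
  assumes "f differentiable (at z)"
  shows "dir_deriv v f z = Re v *\<^sub>R dir_deriv 1 f z + Im v *\<^sub>R dir_deriv \<i> f z"
proof -
  have l: "linear (\<lambda>v. dir_deriv v f z)"
    using differentiable_has_derivative_dir[OF assms] has_derivative_linear by blast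
  have "v = Re v *\<^sub>R 1 + Im v *\<^sub>R \<i>" by (simp add: complex_eq_iff)
  then have "dir_deriv v f z = dir_deriv (Re v *\<^sub>R 1 + Im v *\<^sub>R \<i>) f z" by simp
  then show ?thesis by (simp only: linear_add[OF l] linear_scale[OF l])
qed

lemma Ck_on_o_holomorphic:
  fixes f :: "complex \<Rightarrow> 'b::real_normed_vector"
  assumes "open S" "open V" "\<tau> holomorphic_on V" "\<tau> ` V \<subseteq> S"
  shows "Ck_on k f S \<Longrightarrow> Ck_on k (\<lambda>z. f (\<tau> z)) V"
proof (induction k arbitrary: f)
  case 0
  then show ?case
    by (metis Ck_on.simps(1) continuous_on_compose2 holomorphic_on_imp_continuous_on assms(3,4))
next
  case (Suc k)
  \<comment> \<open>The chain rule differentiates \<open>f\<close> in the direction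
    \<open>deriv \<tau> z * v\<close>, which moves with \<open>z\<close>. Splitting it along 1 and
    \<i> leaves two fixed directions, to which the induction hypothesis applies.\<close>
  let ?D = "\<lambda>v z. Re (deriv \<tau> z * v) *\<^sub>R dir_deriv 1 f (\<tau> z) + Im (deriv \<tau> z * v) *\<^sub>R dir_deriv \<i> f (\<tau> z)"
  show ?case
  proof (rule Ck_on_SucI[OF assms(2), where D="?D"])
    show "((\<lambda>z. f (\<tau> z)) has_derivative (\<lambda>v. ?D v z)) (at z)" if "z \<in> V" for z
    proof -
      have d: "(f has_derivative (\<lambda>v. dir_deriv v f (\<tau> z))) (at (\<tau> z))"
        using Ck_on_differentiable[OF Suc.prems assms(1)] assms(4) that by auto
      have "((\<lambda>z. f (\<tau> z)) has_derivative (\<lambda>v. dir_deriv (deriv \<tau> z * v) f (\<tau> z))) (at z)"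
        using has_derivative_compose_holomorphic[OF d holomorphic_derivI[OF assms(3,2) that]] .
      moreover have "dir_deriv (deriv \<tau> z * v) f (\<tau> z) = ?D v z" for v
        using d dir_deriv_Re_Im differentiable_def by blast
      ultimately show ?thesis by simp
    qed
    have "Ck_on k (\<lambda>z. Re (deriv \<tau> z * v)) V" "Ck_on k (\<lambda>z. Im (deriv \<tau> z * v)) V" for v
      by (intro Ck_on_linear[OF bounded_linear_Re] Ck_on_linear[OF bounded_linear_Im]
          Ck_on_holomorphic holomorphic_intros assms)+
    moreover have "Ck_on k (\<lambda>z. dir_deriv v f (\<tau> z)) V" for v
      using Suc by simp
    ultimately show "Ck_on k (?D v) V" for v
      by (intro Ck_on_add Ck_on_bilinear[OF bounded_bilinear_scaleR] assms)
  qed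
qed

lemma smooth_on_o_holomorphic:
  fixes f :: "complex \<Rightarrow> 'b::real_normed_vector"
  shows "open S \<Longrightarrow> open V \<Longrightarrow> \<tau> holomorphic_on V \<Longrightarrow> \<tau> ` V \<subseteq> S \<Longrightarrow> smooth_on f S \<Longrightarrow>
    smooth_on (\<lambda>z. f (\<tau> z)) V"
  unfolding smooth_on_def using Ck_on_o_holomorphic by blast

text \<open>The second difference quotient is symmetric in the two directions.\<close>

lemma second_difference_limit:
  fixes F :: "'a::real_normed_vector \<Rightarrow> real"
  assumes "open S" "smooth_on F S" "z \<in> S" "e > 0"
  shows "eventually (\<lambda>h. \<bar>(F (z + h *\<^sub>R u + h *\<^sub>R v) - F (z + h *\<^sub>R u) - F (z + h *\<^sub>R v) + F z)
      / h\<^sup>2 - dir_deriv v (dir_deriv u F) z\<bar> < e) (at_right 0)"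
proof -
  have sm: "smooth_on (dir_deriv u F) S" "smooth_on (dir_deriv v (dir_deriv u F)) S"
    using assms(2) smooth_on_dir_deriv by blast+
  have "continuous (at z) (dir_deriv v (dir_deriv u F))"
    using smooth_on_continuous[OF sm(2)] assms(1,3) continuous_on_eq_continuous_at by blast
  then obtain d0 where d0: "d0 > 0"
    "\<And>y. dist y z < d0 \<Longrightarrow> dist (dir_deriv v (dir_deriv u F) y) (dir_deriv v (dir_deriv u F) z) < e"
    using assms(4) unfolding continuous_at_eps_delta by blast
  obtain d1 where d1: "d1 > 0" "ball z d1 \<subseteq> S" using assms(1,3) openE by blast
  define d where "d = min d0 d1"
  have dpos: "d > 0" using d0 d1 d_def by simp
  \<comment> \<open>Keeps every corner of the parallelogram within \<open>d\<close> of
    \<open>z\<close>; the summand 1 covers \<open>u = v = 0\<close>.\<close>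
  define h0 where "h0 = d / (norm u + norm v + 1)"
  have h0: "h0 > 0" using dpos unfolding h0_def by (simp add: add_nonneg_pos)
  have inb: "dist (z + s *\<^sub>R u + t *\<^sub>R v) z < d" if "0 \<le> s" "s \<le> h" "0 \<le> t" "t \<le> h" "h < h0" for s t h
  proof -
    have "norm (s *\<^sub>R u + t *\<^sub>R v) \<le> s * norm u + t * norm v"
      using norm_triangle_ineq[of "s *\<^sub>R u" "t *\<^sub>R v"] that by simp
    also have "\<dots> \<le> h * norm u + h * norm v" using that by (intro add_mono mult_right_mono) auto
    also have "\<dots> \<le> h * (norm u + norm v + 1)" using that by (simp add: algebra_simps)
    also have "\<dots> < h0 * (norm u + norm v + 1)"
      using that by (intro mult_strict_right_mono) (auto simp: add_nonneg_pos)
    also have "\<dots> = d" unfolding h0_def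
      by (metis add_nonneg_pos less_irrefl nonzero_eq_divide_eq norm_ge_zero add_nonneg_nonneg zero_less_one)
    finally show ?thesis by (simp add: dist_norm add.assoc)
  qed
  have inS: "z + s *\<^sub>R u + t *\<^sub>R v \<in> S" if "0 \<le> s" "s \<le> h" "0 \<le> t" "t \<le> h" "h < h0" for s t h
    using inb[OF that] d1 unfolding d_def by (simp add: dist_commute subset_eq)
  have der: "((\<lambda>s. G (z + s *\<^sub>R u + t *\<^sub>R v)) has_field_derivative dir_deriv u G (z + s *\<^sub>R u + t *\<^sub>R v)) (at s)"
    "((\<lambda>t. G (z + s *\<^sub>R u + t *\<^sub>R v)) has_field_derivative dir_deriv v G (z + s *\<^sub>R u + t *\<^sub>R v)) (at t)"
    if G: "smooth_on G S" and I: "z + s *\<^sub>R u + t *\<^sub>R v \<in> S" for G :: "'a \<Rightarrow> real" and s t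
  proof -
    let ?p = "z + s *\<^sub>R u + t *\<^sub>R v"
    have D: "(G has_derivative (\<lambda>v. dir_deriv v G ?p)) (at ?p)"
      using smooth_on_differentiable[OF G assms(1) I] differentiable_has_derivative_dir by blast
    then have l: "linear (\<lambda>v. dir_deriv v G ?p)" by (rule has_derivative_linear)
    have "((\<lambda>s. z + s *\<^sub>R u + t *\<^sub>R v) has_derivative (\<lambda>k. k *\<^sub>R u)) (at s)"
      by (auto intro!: derivative_eq_intros)
    from diff_chain_at[OF this D] have "((\<lambda>s. G (z + s *\<^sub>R u + t *\<^sub>R v)) has_derivative (\<lambda>k. dir_deriv (k *\<^sub>R u) G ?p)) (at s)"
      by (simp add: o_def)
    then show "((\<lambda>s. G (z + s *\<^sub>R u + t *\<^sub>R v)) has_field_derivative dir_deriv u G ?p) (at s)"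
      unfolding has_field_derivative_def linear_scale[OF l] by (simp add: mult_commute_abs)
    have "((\<lambda>t. z + s *\<^sub>R u + t *\<^sub>R v) has_derivative (\<lambda>k. k *\<^sub>R v)) (at t)"
      by (auto intro!: derivative_eq_intros)
    from diff_chain_at[OF this D] have "((\<lambda>t. G (z + s *\<^sub>R u + t *\<^sub>R v)) has_derivative (\<lambda>k. dir_deriv (k *\<^sub>R v) G ?p)) (at t)"
      by (simp add: o_def)
    then show "((\<lambda>t. G (z + s *\<^sub>R u + t *\<^sub>R v)) has_field_derivative dir_deriv v G ?p) (at t)"
      unfolding has_field_derivative_def linear_scale[OF l] by (simp add: mult_commute_abs)
  qed
  have main: "\<bar>(F (z + h *\<^sub>R u + h *\<^sub>R v) - F (z + h *\<^sub>R u) - F (z + h *\<^sub>R v) + F z)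
      / h\<^sup>2 - dir_deriv v (dir_deriv u F) z\<bar> < e" if h: "0 < h" "h < h0" for h
  proof -
    \<comment> \<open>The second difference is a difference in the direction \<open>u\<close> of a
      difference in the direction \<open>v\<close>: the mean value theorem is applied to the outer
      one first, then to the inner one.\<close>
    have "\<exists>s>0. s < h \<and> (F (z + h *\<^sub>R u + h *\<^sub>R v) - F (z + h *\<^sub>R u + 0 *\<^sub>R v)) - (F (z + 0 *\<^sub>R u + h *\<^sub>R v) - F (z + 0 *\<^sub>R u + 0 *\<^sub>R v))
       = (h - 0) * (dir_deriv u F (z + s *\<^sub>R u + h *\<^sub>R v) - dir_deriv u F (z + s *\<^sub>R u + 0 *\<^sub>R v))"
      using h by (intro MVT2[of 0 h "\<lambda>s. F (z + s *\<^sub>R u + h *\<^sub>R v) - F (z + s *\<^sub>R u + 0 *\<^sub>R v)"]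
          DERIV_diff[OF der(1)[OF assms(2)] der(1)[OF assms(2)]])
        (auto simp del: scaleR_zero_left intro!: inS[of _ h _, OF _ _ _ _ h(2)])
    then obtain s where s: "0 < s" "s < h" "F (z + h *\<^sub>R u + h *\<^sub>R v) - F (z + h *\<^sub>R u) - (F (z + h *\<^sub>R v) - F z)
       = h * (dir_deriv u F (z + s *\<^sub>R u + h *\<^sub>R v) - dir_deriv u F (z + s *\<^sub>R u + 0 *\<^sub>R v))" by auto
    have "\<exists>t>0. t < h \<and> dir_deriv u F (z + s *\<^sub>R u + h *\<^sub>R v) - dir_deriv u F (z + s *\<^sub>R u + 0 *\<^sub>R v)
       = (h - 0) * dir_deriv v (dir_deriv u F) (z + s *\<^sub>R u + t *\<^sub>R v)"
      using h s by (intro MVT2[of 0 h "\<lambda>t. dir_deriv u F (z + s *\<^sub>R u + t *\<^sub>R v)"])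
        (auto simp del: scaleR_zero_left intro!: der(2) sm inS[of _ h _, OF _ _ _ _ h(2)])
    then obtain t where t: "0 < t" "t < h" "dir_deriv u F (z + s *\<^sub>R u + h *\<^sub>R v) - dir_deriv u F (z + s *\<^sub>R u + 0 *\<^sub>R v)
       = h * dir_deriv v (dir_deriv u F) (z + s *\<^sub>R u + t *\<^sub>R v)" by auto
    have "(F (z + h *\<^sub>R u + h *\<^sub>R v) - F (z + h *\<^sub>R u) - F (z + h *\<^sub>R v) + F z) / h\<^sup>2
        = dir_deriv v (dir_deriv u F) (z + s *\<^sub>R u + t *\<^sub>R v)"
      using s(3) t(3) h by (simp add: power2_eq_square field_simps)
    then show ?thesis using d0(2)[of "z + s *\<^sub>R u + t *\<^sub>R v"] inb[of s h t] h s t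
      unfolding d_def dist_real_def by auto
  qed
  show ?thesis unfolding eventually_at_right_field
    using main h0 by (intro exI[of _ h0]) auto
qed

lemma dir_deriv_commute_real:
  fixes F :: "'a::real_normed_vector \<Rightarrow> real"
  assumes "open S" "smooth_on F S" "z \<in> S"
  shows "dir_deriv v (dir_deriv u F) z = dir_deriv u (dir_deriv v F) z"
proof (rule ccontr)
  assume neq: "\<not> ?thesis"
  let ?a = "dir_deriv v (dir_deriv u F) z" and ?b = "dir_deriv u (dir_deriv v F) z"
  define e where "e = \<bar>?a - ?b\<bar> / 2"
  have e: "e > 0" using neq e_def by simp
  let ?q = "\<lambda>h. (F (z + h *\<^sub>R u + h *\<^sub>R v) - F (z + h *\<^sub>R u) - F (z + h *\<^sub>R v) + F z) / h\<^sup>2"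
  have "eventually (\<lambda>h. \<bar>?q h - ?a\<bar> < e \<and> \<bar>?q h - ?b\<bar> < e) (at_right 0)"
    using second_difference_limit[OF assms e, of u v] second_difference_limit[OF assms e, of v u]
    by eventually_elim (simp add: algebra_simps)
  then obtain h where "\<bar>?q h - ?a\<bar> < e" "\<bar>?q h - ?b\<bar> < e"
    using eventually_happens trivial_limit_at_right_real by blast
  then show False unfolding e_def by argo
qed

lemma dir_deriv_linear:
  assumes "bounded_linear L" "f differentiable (at x)"
  shows "dir_deriv v (\<lambda>x. L (f x)) x = L (dir_deriv v f x)"
  by (rule dir_deriv_eqI[OF bounded_linear.has_derivative[OF assms(1) differentiable_has_derivative_dir[OF assms(2)]]])

lemma dir_deriv2_linear:
  assumes "bounded_linear L" "open S" "smooth_on f S" "x \<in> S"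
  shows "dir_deriv u (dir_deriv v (\<lambda>x. L (f x))) x = L (dir_deriv u (dir_deriv v f) x)"
proof -
  have "dir_deriv u (dir_deriv v (\<lambda>x. L (f x))) x = dir_deriv u (\<lambda>x. L (dir_deriv v f x)) x"
    using assms by (intro dir_deriv_cong[OF assms(2,4)] dir_deriv_linear smooth_on_differentiable)
  also have "\<dots> = L (dir_deriv u (dir_deriv v f) x)"
    by (intro dir_deriv_linear assms smooth_on_differentiable[OF smooth_on_dir_deriv[OF assms(3)]])
  finally show ?thesis .
qed

lemma dir_deriv_commute:
  fixes F :: "'a::real_normed_vector \<Rightarrow> complex"
  assumes "open S" "smooth_on F S" "z \<in> S"
  shows "dir_deriv v (dir_deriv u F) z = dir_deriv u (dir_deriv v F) z"
proof (rule complex_eqI)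
  show "Re (dir_deriv v (dir_deriv u F) z) = Re (dir_deriv u (dir_deriv v F) z)"
    using dir_deriv_commute_real[OF assms(1) smooth_on_linear[OF bounded_linear_Re assms(1,2)] assms(3), of v u]
    by (simp add: dir_deriv2_linear[OF bounded_linear_Re assms])
  show "Im (dir_deriv v (dir_deriv u F) z) = Im (dir_deriv u (dir_deriv v F) z)"
    using dir_deriv_commute_real[OF assms(1) smooth_on_linear[OF bounded_linear_Im assms(1,2)] assms(3), of v u]
    by (simp add: dir_deriv2_linear[OF bounded_linear_Im assms])
qed

section \<open>Wirtinger derivatives\<close>

text \<open>The real differential written as \<open>a dz + b d(cnj z)\<close>. The relational form
  lets sum, product and chain rules be composed by \<open>OF\<close> without differentiability side
  conditions; \<open>dz\<close> and \<open>dzb\<close> are read off at the end.\<close>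

definition has_wirtinger :: "(complex \<Rightarrow> complex) \<Rightarrow> complex \<Rightarrow> complex \<Rightarrow> complex \<Rightarrow> bool"
  where "has_wirtinger F a b z \<longleftrightarrow> (F has_derivative (\<lambda>h. a * h + b * cnj h)) (at z)"

definition dz :: "(complex \<Rightarrow> complex) \<Rightarrow> complex \<Rightarrow> complex"
  where "dz F z = (dir_deriv 1 F z - \<i> * dir_deriv \<i> F z) / 2"

definition dzb :: "(complex \<Rightarrow> complex) \<Rightarrow> complex \<Rightarrow> complex"
  where "dzb F z = (dir_deriv 1 F z + \<i> * dir_deriv \<i> F z) / 2"

lemma has_wirtinger_imp:
  assumes "has_wirtinger F a b z"
  shows "dz F z = a" "dzb F z = b"
proof -
  have "dir_deriv v F z = a * v + b * cnj v" for v
    using dir_deriv_eqI assms unfolding has_wirtinger_def by blast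
  then show "dz F z = a" "dzb F z = b" unfolding dz_def dzb_def by (simp_all add: algebra_simps)
qed

lemma differentiable_has_wirtinger:
  assumes "F differentiable (at z)"
  shows "has_wirtinger F (dz F z) (dzb F z) z"
proof -
  have "dir_deriv v F z = dz F z * v + dzb F z * cnj v" for v
  proof -
    have "dir_deriv v F z = of_real (Re v) * dir_deriv 1 F z + of_real (Im v) * dir_deriv \<i> F z"
      using dir_deriv_Re_Im[OF assms, of v] by (simp add: scaleR_conv_of_real)
    also have "\<dots> = dz F z * v + dzb F z * cnj v"
    proof -
      have 1: "(v + cnj v) / 2 = of_real (Re v)" "\<i> * (cnj v - v) / 2 = of_real (Im v)"
        by (simp_all add: complex_eq_iff)
      show ?thesis unfolding dz_def dzb_def 1[symmetric] by (simp add: field_simps)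
    qed
    finally show ?thesis .
  qed
  then show ?thesis
    using differentiable_has_derivative_dir[OF assms] unfolding has_wirtinger_def by simp
qed

lemma smooth_on_has_wirtinger:
  "smooth_on F S \<Longrightarrow> open S \<Longrightarrow> z \<in> S \<Longrightarrow> has_wirtinger F (dz F z) (dzb F z) z"
  using differentiable_has_wirtinger smooth_on_differentiable by blast

lemma has_wirtinger_const: "has_wirtinger (\<lambda>z. c) 0 0 z"
  unfolding has_wirtinger_def by simp

lemma has_wirtinger_cong:
  assumes "has_wirtinger F a b z" "open S" "z \<in> S" "\<And>y. y \<in> S \<Longrightarrow> F y = G y"
  shows "has_wirtinger G a b z"
  using has_derivative_transform_within_open[OF assms(1)[unfolded has_wirtinger_def] assms(2-4)]
  unfolding has_wirtinger_def by blast

lemma has_wirtinger_eq: "has_wirtinger F a b z \<Longrightarrow> a = c \<Longrightarrow> b = d \<Longrightarrow> has_wirtinger F c d z"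
  by simp

lemma has_wirtinger_add:
  assumes "has_wirtinger F a b z" "has_wirtinger G c d z"
  shows "has_wirtinger (\<lambda>z. F z + G z) (a + c) (b + d) z"
  using has_derivative_add[OF assms[unfolded has_wirtinger_def]]
  unfolding has_wirtinger_def by (simp add: algebra_simps)

lemma has_wirtinger_diff:
  assumes "has_wirtinger F a b z" "has_wirtinger G c d z"
  shows "has_wirtinger (\<lambda>z. F z - G z) (a - c) (b - d) z"
  using has_derivative_diff[OF assms[unfolded has_wirtinger_def]]
  unfolding has_wirtinger_def by (simp add: algebra_simps)

lemma has_wirtinger_mult:
  assumes "has_wirtinger F a b z" "has_wirtinger G c d z"
  shows "has_wirtinger (\<lambda>z. F z * G z) (a * G z + F z * c) (b * G z + F z * d) z"
  using has_derivative_mult[OF assms[unfolded has_wirtinger_def]]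
  unfolding has_wirtinger_def by (simp add: algebra_simps)

lemma has_wirtinger_cmult:
  assumes "has_wirtinger F a b z"
  shows "has_wirtinger (\<lambda>z. k * F z) (k * a) (k * b) z"
  using has_wirtinger_mult[OF has_wirtinger_const assms, of k] by simp

lemma has_wirtinger_cnj:
  assumes "has_wirtinger F a b z"
  shows "has_wirtinger (\<lambda>z. cnj (F z)) (cnj b) (cnj a) z"
  using bounded_linear.has_derivative[OF bounded_linear_cnj assms[unfolded has_wirtinger_def]]
  unfolding has_wirtinger_def by (simp add: algebra_simps)

lemma has_wirtinger_sum:
  assumes "finite A" "\<And>i. i \<in> A \<Longrightarrow> has_wirtinger (F i) (a i) (b i) z"
  shows "has_wirtinger (\<lambda>z. \<Sum>i\<in>A. F i z) (\<Sum>i\<in>A. a i) (\<Sum>i\<in>A. b i) z"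
  using assms by (induction A) (auto intro: has_wirtinger_add has_wirtinger_const)

lemma has_wirtinger_holomorphic:
  assumes "(f has_field_derivative c) (at z)"
  shows "has_wirtinger f c 0 z"
  using assms unfolding has_wirtinger_def has_field_derivative_def by simp

lemma has_wirtinger_holomorphic_o:
  assumes "(f has_field_derivative c) (at (F z))" "has_wirtinger F a b z"
  shows "has_wirtinger (\<lambda>z. f (F z)) (c * a) (c * b) z"
  using diff_chain_at[OF assms(2)[unfolded has_wirtinger_def] assms(1)[unfolded has_field_derivative_def]]
  unfolding has_wirtinger_def by (simp add: o_def algebra_simps)

lemma has_wirtinger_o_holomorphic:
  assumes "has_wirtinger F a b (\<tau> z)" "(\<tau> has_field_derivative c) (at z)"
  shows "has_wirtinger (\<lambda>z. F (\<tau> z)) (a * c) (b * cnj c) z"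
  using diff_chain_at[OF assms(2)[unfolded has_field_derivative_def] assms(1)[unfolded has_wirtinger_def]]
  unfolding has_wirtinger_def by (simp add: o_def algebra_simps)

lemma has_wirtinger_divide:
  assumes "has_wirtinger F a b z" "has_wirtinger G c d z" "G z \<noteq> 0"
  shows "has_wirtinger (\<lambda>z. F z / G z) ((a * G z - F z * c) / (G z)\<^sup>2) ((b * G z - F z * d) / (G z)\<^sup>2) z"
proof -
  have "(inverse has_field_derivative (- (inverse (G z))\<^sup>2)) (at (G z))"
    using DERIV_inverse[OF assms(3)] by (simp add: power2_eq_square)
  from has_wirtinger_mult[OF assms(1) has_wirtinger_holomorphic_o[OF this assms(2)]]
  show ?thesis unfolding divide_inverse[of "F _"]
    by (rule has_wirtinger_eq) (use assms(3) in \<open>simp_all add: field_simps power2_eq_square\<close>)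
qed

lemma has_wirtinger_field_derivative:
  "has_wirtinger F a 0 z \<Longrightarrow> (F has_field_derivative a) (at z)"
  unfolding has_wirtinger_def has_field_derivative_def by simp

lemma smooth_on_dz:
  assumes "open S" "smooth_on F S"
  shows "smooth_on (dz F) S"
proof -
  have e: "dz F = (\<lambda>z. (dir_deriv 1 F z - \<i> * dir_deriv \<i> F z) * (1/2))" by (auto simp: dz_def)
  show ?thesis unfolding e
    by (intro smooth_on_mult smooth_on_diff smooth_on_const smooth_on_dir_deriv assms)
qed

lemma smooth_on_dzb:
  assumes "open S" "smooth_on F S"
  shows "smooth_on (dzb F) S"
proof -
  have e: "dzb F = (\<lambda>z. (dir_deriv 1 F z + \<i> * dir_deriv \<i> F z) * (1/2))" by (auto simp: dzb_def)
  show ?thesis unfolding e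
    by (intro smooth_on_mult smooth_on_add smooth_on_const smooth_on_dir_deriv assms)
qed

lemma dz_cong:
  assumes "open S" "z \<in> S" "\<And>y. y \<in> S \<Longrightarrow> f y = g y"
  shows "dz f z = dz g z" "dzb f z = dzb g z"
  unfolding dz_def dzb_def using dir_deriv_cong[OF assms] by auto

lemma dir_deriv_combination:
  fixes F G :: "complex \<Rightarrow> complex"
  assumes "F differentiable (at z)" "G differentiable (at z)"
  shows "dir_deriv v (\<lambda>z. (F z + k * G z) / 2) z = (dir_deriv v F z + k * dir_deriv v G z) / 2"
  by (rule dir_deriv_eqI)
    (auto intro!: derivative_eq_intros differentiable_has_derivative_dir[OF assms(1)]
      differentiable_has_derivative_dir[OF assms(2)])

text \<open>The only place where the symmetry of second derivatives enters; from here on it is used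
  in the form \<open>dzb (dz F) = dz (dzb F)\<close>.\<close>

lemma dz2_dir_deriv:
  assumes S: "open S" "smooth_on F S" "z \<in> S"
  shows "dz (dz F) z = (dir_deriv 1 (dir_deriv 1 F) z - dir_deriv \<i> (dir_deriv \<i> F) z
            - 2 * \<i> * dir_deriv 1 (dir_deriv \<i> F) z) / 4"
    and "dz (dzb F) z = (dir_deriv 1 (dir_deriv 1 F) z + dir_deriv \<i> (dir_deriv \<i> F) z) / 4"
    and "dzb (dz F) z = dz (dzb F) z"
proof -
  have D: "dir_deriv v F differentiable (at z)" for v
    by (rule smooth_on_differentiable[OF smooth_on_dir_deriv[OF S(2)] S(1,3)])
  have 1: "dir_deriv v (dz F) z = (dir_deriv v (dir_deriv 1 F) z + (-\<i>) * dir_deriv v (dir_deriv \<i> F) z) / 2" for v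
    using dir_deriv_combination[OF D D, of v 1 "-\<i>" \<i>] unfolding dz_def[abs_def] by simp
  have 2: "dir_deriv v (dzb F) z = (dir_deriv v (dir_deriv 1 F) z + \<i> * dir_deriv v (dir_deriv \<i> F) z) / 2" for v
    using dir_deriv_combination[OF D D, of v 1 "\<i>" \<i>] unfolding dzb_def[abs_def] by simp
  have c: "dir_deriv \<i> (dir_deriv 1 F) z = dir_deriv 1 (dir_deriv \<i> F) z"
    using dir_deriv_commute[OF S] .
  show "dz (dz F) z = (dir_deriv 1 (dir_deriv 1 F) z - dir_deriv \<i> (dir_deriv \<i> F) z
            - 2 * \<i> * dir_deriv 1 (dir_deriv \<i> F) z) / 4"
    unfolding dz_def[of "dz F"] 1 c by (simp add: field_simps)
  show "dz (dzb F) z = (dir_deriv 1 (dir_deriv 1 F) z + dir_deriv \<i> (dir_deriv \<i> F) z) / 4"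
    unfolding dz_def[of "dzb F"] 2 c by (simp add: field_simps)
  show "dzb (dz F) z = dz (dzb F) z"
    unfolding dz_def[of "dzb F"] dzb_def[of "dz F"] 1 2 c by (simp add: field_simps)
qed

lemma dz_cnj:
  assumes "F differentiable (at z)"
  shows "dz (\<lambda>z. cnj (F z)) z = cnj (dzb F z)" "dzb (\<lambda>z. cnj (F z)) z = cnj (dz F z)"
  using has_wirtinger_imp[OF has_wirtinger_cnj[OF differentiable_has_wirtinger[OF assms]]] by auto

lemma constant_wirtinger:
  assumes "connected S" "open S" "\<And>z. z \<in> S \<Longrightarrow> has_wirtinger F 0 0 z" "w \<in> S" "z \<in> S"
  shows "F z = F w"
proof -
  have "(F has_derivative (\<lambda>h. 0)) (at z)" if "z \<in> S" for z
    using assms(3)[OF that] unfolding has_wirtinger_def by simp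
  from has_derivative_zero_unique_connected[OF assms(2,1) this assms(5,4)] show ?thesis .
qed

lemma dz_mult:
  assumes "F differentiable (at z)" "G differentiable (at z)"
  shows "dz (\<lambda>z. F z * G z) z = dz F z * G z + F z * dz G z"
    and "dzb (\<lambda>z. F z * G z) z = dzb F z * G z + F z * dzb G z"
  using has_wirtinger_imp[OF has_wirtinger_mult[OF assms[THEN differentiable_has_wirtinger]]] by auto

lemma dz_add:
  assumes "F differentiable (at z)" "G differentiable (at z)"
  shows "dz (\<lambda>z. F z + G z) z = dz F z + dz G z"
    and "dzb (\<lambda>z. F z + G z) z = dzb F z + dzb G z"
  using has_wirtinger_imp[OF has_wirtinger_add[OF assms[THEN differentiable_has_wirtinger]]] by auto

lemma dz_holomorphic:
  assumes "f holomorphic_on S" "open S" "z \<in> S"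
  shows "dz f z = deriv f z" "dzb f z = 0"
  using has_wirtinger_imp[OF has_wirtinger_holomorphic[OF holomorphic_derivI[OF assms]]] by auto

lemma dz_real:
  assumes "open S" "z \<in> S" "smooth_on f S" "\<And>z. z \<in> S \<Longrightarrow> cnj (f z) = f z"
  shows "dzb f z = cnj (dz f z)"
proof -
  have "dzb f z = dzb (\<lambda>z. cnj (f z)) z" by (rule dz_cong[OF assms(1,2)]) (simp add: assms(4))
  also have "\<dots> = cnj (dz f z)" by (rule dz_cnj[OF smooth_on_differentiable[OF assms(3,1,2)]])
  finally show ?thesis .
qed

lemma holomorphic_on_dzb_zero:
  assumes "open S" "smooth_on f S" "\<And>z. z \<in> S \<Longrightarrow> dzb f z = 0"
  shows "f holomorphic_on S"
proof -
  have "(f has_field_derivative dz f z) (at z)" if "z \<in> S" for z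
    using has_wirtinger_field_derivative smooth_on_has_wirtinger[OF assms(2,1) that] assms(3)[OF that] by metis
  then show ?thesis using assms(1) holomorphic_on_open by blast
qed

text \<open>
  The equation \<open>\<phi> \<phi>\<^sub>z\<^sub>\<zeta> - \<phi>\<^sub>z \<phi>\<^sub>\<zeta> = 1/4\<close>, with \<open>\<zeta>\<close> the conjugate variable, is Liouville's equation for the
  metric \<open>\<phi>\<^sup>-\<^sup>2 |dz|\<^sup>2\<close> of curvature one, and \<open>- 2 \<phi>\<^sub>z\<^sub>z / \<phi>\<close> is the Schwarzian derivative of its
  developing map.
\<close>

lemma liouville_schwarzian_holomorphic:
  assumes S: "open S" "smooth_on \<phi> S" "\<And>z. z \<in> S \<Longrightarrow> \<phi> z \<noteq> 0"
    and L: "\<And>z. z \<in> S \<Longrightarrow> \<phi> z * dz (dzb \<phi>) z - dz \<phi> z * dzb \<phi> z = 1/4"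
  shows "(\<lambda>z. dz (dz \<phi>) z / \<phi> z) holomorphic_on S"
proof (rule holomorphic_on_dzb_zero[OF S(1)])
  have s: "smooth_on (dz \<phi>) S" "smooth_on (dzb \<phi>) S" "smooth_on (dz (dz \<phi>)) S" "smooth_on (dz (dzb \<phi>)) S"
    by (intro smooth_on_dz smooth_on_dzb S)+
  show "smooth_on (\<lambda>z. dz (dz \<phi>) z / \<phi> z) S" by (intro smooth_on_divide S s)
  fix z assume z: "z \<in> S"
  note w = smooth_on_has_wirtinger[OF _ S(1) z]
  have "has_wirtinger (\<lambda>z. \<phi> z * dz (dzb \<phi>) z - dz \<phi> z * dzb \<phi> z) 0 0 z"
    by (rule has_wirtinger_cong[OF has_wirtinger_const[of "1/4"] S(1) z]) (simp add: L)
  note * = has_wirtinger_imp(1)[OF this]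
  note ** = has_wirtinger_imp(1)[OF has_wirtinger_diff[OF has_wirtinger_mult[OF w[OF S(2)] w[OF s(4)]] has_wirtinger_mult[OF w[OF s(1)] w[OF s(2)]]]]
  \<comment> \<open>Differentiating Liouville's equation once, the products of first and mixed
    derivatives cancel, and what remains is the numerator of \<open>dzb\<close> of the
    quotient.\<close>
  have 1: "dz \<phi> z * dz (dzb \<phi>) z + \<phi> z * dz (dz (dzb \<phi>)) z
      - (dz (dz \<phi>) z * dzb \<phi> z + dz \<phi> z * dz (dzb \<phi>) z) = 0"
    using * ** by simp
  have 2: "dzb (dz (dz \<phi>)) z = dz (dz (dzb \<phi>)) z"
  proof -
    have "dzb (dz (dz \<phi>)) z = dz (dzb (dz \<phi>)) z" by (rule dz2_dir_deriv(3)[OF S(1) s(1) z])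
    also have "\<dots> = dz (dz (dzb \<phi>)) z"
      by (rule dz_cong[OF S(1) z]) (rule dz2_dir_deriv(3)[OF S(1,2)])
    finally show ?thesis .
  qed
  have "dzb (\<lambda>z. dz (dz \<phi>) z / \<phi> z) z = (dzb (dz (dz \<phi>)) z * \<phi> z - dz (dz \<phi>) z * dzb \<phi> z) / (\<phi> z)\<^sup>2"
    by (rule has_wirtinger_imp(2)[OF has_wirtinger_divide[OF w[OF s(3)] w[OF S(2)] S(3)[OF z]]])
  also have "\<dots> = 0" using 1 unfolding 2 by (simp add: algebra_simps)
  finally show "dzb (\<lambda>z. dz (dz \<phi>) z / \<phi> z) z = 0" .
qed

section \<open>Local theory of surfaces of constant mean curvature one\<close>

text \<open>Complexified Minkowski space, with the time coordinate at index \<open>4\<close>.\<close>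

definition eta :: "4 \<Rightarrow> complex"
  where "eta j = (if j = 4 then -1 else 1)"

text \<open>Complex bilinear, not Hermitian: a conformal parametrization is then one whose
  \<open>dz\<close> derivative is a null vector, and conjugation is always written out.\<close>

definition cmink :: "(4 \<Rightarrow> complex) \<Rightarrow> (4 \<Rightarrow> complex) \<Rightarrow> complex"
  where "cmink x y = (\<Sum>j\<in>UNIV. eta j * x j * y j)"

lemma cmink_commute: "cmink x y = cmink y x"
  unfolding cmink_def by (simp add: mult.commute mult.left_commute)

lemma cmink_add:
  "cmink (\<lambda>j. x j + x' j) y = cmink x y + cmink x' y"
  "cmink y (\<lambda>j. x j + x' j) = cmink y x + cmink y x'"
  unfolding cmink_def by (simp_all add: algebra_simps sum.distrib)

lemma cmink_diff:
  "cmink (\<lambda>j. x j - x' j) y = cmink x y - cmink x' y"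
  "cmink y (\<lambda>j. x j - x' j) = cmink y x - cmink y x'"
  unfolding cmink_def by (simp_all add: algebra_simps sum_subtractf)

lemma cmink_scale:
  "cmink (\<lambda>j. k * x j) y = k * cmink x y"
  "cmink y (\<lambda>j. k * x j) = k * cmink y x"
  unfolding cmink_def by (simp_all add: sum_distrib_left mult.commute mult.left_commute)

lemma cmink_scale_divide:
  "cmink (\<lambda>j. k * x j / d) y = k / d * cmink x y"
  "cmink y (\<lambda>j. k * x j / d) = k / d * cmink y x"
  using cmink_scale(1)[of "k / d" x y] cmink_scale(2)[of y "k / d" x] by simp_all

lemma cmink_minus:
  "cmink (\<lambda>j. - x j) y = - cmink x y"
  "cmink y (\<lambda>j. - x j) = - cmink y x"
  unfolding cmink_def by (simp_all add: sum_negf)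

lemma cmink_zero: "cmink (\<lambda>j. 0) y = 0" "cmink y (\<lambda>j. 0) = 0"
  unfolding cmink_def by simp_all

lemma cnj_cmink: "cnj (cmink x y) = cmink (\<lambda>j. cnj (x j)) (\<lambda>j. cnj (y j))"
proof -
  have "cnj (eta j) = eta j" for j by (simp add: eta_def)
  then show ?thesis unfolding cmink_def by simp
qed

text \<open>A frame with this Gram matrix has an explicit dual frame: \<open>a\<close> and
  \<open>b\<close> are null and pair to \<open>E\<close>, so each is dual to the other up to that
  factor. The frame matrix is therefore invertible.\<close>

lemma cmink_frame_zero:
  fixes x :: "4 \<Rightarrow> complex"
  assumes "cmink g g = -1" "cmink n n = 1" "cmink g n = 0" "cmink g a = 0" "cmink g b = 0"
    "cmink n a = 0" "cmink n b = 0" "cmink a a = 0" "cmink b b = 0" "cmink a b = E" "E \<noteq> 0"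
    and x: "cmink x g = 0" "cmink x n = 0" "cmink x a = 0" "cmink x b = 0"
  shows "x j = 0"
proof -
  define fr where "fr i = (if i = 1 then g else if i = 2 then n else if i = 3 then a else b)" for i :: 4
  define du where "du i = (if i = 1 then (\<lambda>j. - g j) else if i = 2 then n
     else if i = 3 then (\<lambda>j. inverse E * b j) else (\<lambda>j. inverse E * a j))" for i :: 4
  define F where "F = (\<chi> i j. fr i j)"
  define R where "R = (\<chi> j i. eta j * du i j)"
  have "cmink (fr i) (du k) = (if i = k then 1 else 0)" for i k :: 4
    using assms(1-11) exhaust_4[of i] exhaust_4[of k] cmink_commute
    unfolding fr_def du_def by (auto simp: cmink_scale cmink_minus)
  then have "F ** R = mat 1"
    unfolding F_def R_def matrix_matrix_mult_def mat_def cmink_def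
    by (simp add: vec_eq_iff mult.assoc mult.left_commute)
  then have RF: "R ** F = mat 1" by (rule matrix_left_right_inverse[THEN iffD1])
  define X where "X = (\<chi> j. eta j * x j)"
  have "cmink x (fr i) = 0" for i using x exhaust_4[of i] unfolding fr_def by auto
  then have "F *v X = 0"
    unfolding F_def X_def matrix_vector_mult_def cmink_def by (simp add: vec_eq_iff mult_ac)
  then have "(R ** F) *v X = 0" by (metis matrix_vector_mul_assoc matrix_vector_mult_0_right)
  then have "X $ j = 0" unfolding RF by simp
  then show ?thesis unfolding X_def by (simp add: eta_def split: if_splits)
qed

abbreviation vec_at :: "(4 \<Rightarrow> complex \<Rightarrow> complex) \<Rightarrow> complex \<Rightarrow> 4 \<Rightarrow> complex"
  where "vec_at X z \<equiv> (\<lambda>j. X j z)"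

abbreviation vdz :: "(4 \<Rightarrow> complex \<Rightarrow> complex) \<Rightarrow> 4 \<Rightarrow> complex \<Rightarrow> complex"
  where "vdz X \<equiv> (\<lambda>j. dz (X j))"

abbreviation vdzb :: "(4 \<Rightarrow> complex \<Rightarrow> complex) \<Rightarrow> 4 \<Rightarrow> complex \<Rightarrow> complex"
  where "vdzb X \<equiv> (\<lambda>j. dzb (X j))"

lemma has_wirtinger_cmink:
  assumes "\<And>j. X j differentiable (at z)" "\<And>j. Y j differentiable (at z)"
  shows "has_wirtinger (\<lambda>z. cmink (vec_at X z) (vec_at Y z))
    (cmink (vec_at (vdz X) z) (vec_at Y z) + cmink (vec_at X z) (vec_at (vdz Y) z))
    (cmink (vec_at (vdzb X) z) (vec_at Y z) + cmink (vec_at X z) (vec_at (vdzb Y) z)) z"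
proof -
  have "has_wirtinger (\<lambda>z. eta j * (X j z * Y j z)) (eta j * (dz (X j) z * Y j z + X j z * dz (Y j) z))
     (eta j * (dzb (X j) z * Y j z + X j z * dzb (Y j) z)) z" for j
    by (intro has_wirtinger_cmult has_wirtinger_mult differentiable_has_wirtinger assms)
  from has_wirtinger_sum[OF finite[of UNIV] this] show ?thesis
    unfolding cmink_def by (rule has_wirtinger_eq[THEN has_wirtinger_cong[OF _ open_UNIV UNIV_I]])
      (auto simp: algebra_simps sum.distrib)
qed

lemma smooth_on_cmink:
  assumes "open U" "\<And>j. smooth_on (X j) U" "\<And>j. smooth_on (Y j) U"
  shows "smooth_on (\<lambda>z. cmink (vec_at X z) (vec_at Y z)) U"
  unfolding cmink_def by (intro smooth_on_sum smooth_on_mult smooth_on_const assms) simp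

text \<open>With \<open>e\<close> the coefficient of the first fundamental form, \<open>half_metric\<close> is \<open>e / 2\<close>.\<close>

definition half_metric :: "(4 \<Rightarrow> complex \<Rightarrow> complex) \<Rightarrow> complex \<Rightarrow> complex"
  where "half_metric G z = cmink (vec_at (vdz G) z) (vec_at (vdzb G) z)"

definition hopf :: "(4 \<Rightarrow> complex \<Rightarrow> complex) \<Rightarrow> (4 \<Rightarrow> complex \<Rightarrow> complex) \<Rightarrow> complex \<Rightarrow> complex"
  where "hopf G N z = - cmink (vec_at (vdz (vdz G)) z) (vec_at N z)"

text \<open>All conditions are scalar identities in complex derivatives. The left side of
  \<open>mean1\<close> is a quarter of the sum of the two diagonal second form coefficients and
  \<open>half_metric\<close> is half the metric coefficient, so their equality is mean curvature
  one; the relations for the conjugate vectors follow from reality.\<close>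

locale cmc_chart =
  fixes G N :: "4 \<Rightarrow> complex \<Rightarrow> complex" and U :: "complex set"
  assumes open_U: "open U"
    and smG: "smooth_on (G j) U" and smN: "smooth_on (N j) U"
    and realG: "z \<in> U \<Longrightarrow> cnj (G j z) = G j z" and realN: "z \<in> U \<Longrightarrow> cnj (N j z) = N j z"
    and GG: "z \<in> U \<Longrightarrow> cmink (vec_at G z) (vec_at G z) = -1"
    and NN: "z \<in> U \<Longrightarrow> cmink (vec_at N z) (vec_at N z) = 1"
    and NG: "z \<in> U \<Longrightarrow> cmink (vec_at N z) (vec_at G z) = 0"
    and NGz: "z \<in> U \<Longrightarrow> cmink (vec_at N z) (vec_at (vdz G) z) = 0"
    and conf: "z \<in> U \<Longrightarrow> cmink (vec_at (vdz G) z) (vec_at (vdz G) z) = 0"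
    and pos: "z \<in> U \<Longrightarrow> Re (half_metric G z) > 0"
    and mean1: "z \<in> U \<Longrightarrow> cmink (vec_at (vdz (vdzb G)) z) (vec_at N z) = half_metric G z"
begin

abbreviation "E \<equiv> half_metric G"
abbreviation "Q \<equiv> hopf G N"

lemma smooth_derivs [intro]:
  "smooth_on (vdz G j) U" "smooth_on (vdzb G j) U" "smooth_on (vdz (vdz G) j) U"
  "smooth_on (vdz (vdzb G) j) U" "smooth_on (vdzb (vdzb G) j) U" "smooth_on (vdz N j) U" "smooth_on (vdzb N j) U"
  by (intro smooth_on_dz smooth_on_dzb open_U smG smN)+

lemma smooth_half_metric: "smooth_on E U"
proof -
  have "E = (\<lambda>z. cmink (vec_at (vdz G) z) (vec_at (vdzb G) z))" by (auto simp: half_metric_def)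
  then show ?thesis using smooth_on_cmink[OF open_U] smooth_derivs by metis
qed

lemma smooth_hopf: "smooth_on Q U"
proof -
  have "Q = (\<lambda>z. - cmink (vec_at (vdz (vdz G)) z) (vec_at N z))" by (auto simp: hopf_def)
  moreover have "smooth_on (\<lambda>z. - cmink (vec_at (vdz (vdz G)) z) (vec_at N z)) U"
    by (intro smooth_on_uminus smooth_on_cmink open_U smooth_derivs smN)
  ultimately show ?thesis by simp
qed

lemma cmink_derivative:
  assumes "z \<in> U" "\<And>j. smooth_on (X j) U" "\<And>j. smooth_on (Y j) U"
    "\<And>z. z \<in> U \<Longrightarrow> cmink (vec_at X z) (vec_at Y z) = F z"
  shows "cmink (vec_at (vdz X) z) (vec_at Y z) + cmink (vec_at X z) (vec_at (vdz Y) z) = dz F z"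
    "cmink (vec_at (vdzb X) z) (vec_at Y z) + cmink (vec_at X z) (vec_at (vdzb Y) z) = dzb F z"
proof -
  have "has_wirtinger F
    (cmink (vec_at (vdz X) z) (vec_at Y z) + cmink (vec_at X z) (vec_at (vdz Y) z))
    (cmink (vec_at (vdzb X) z) (vec_at Y z) + cmink (vec_at X z) (vec_at (vdzb Y) z)) z"
    by (rule has_wirtinger_cong[OF has_wirtinger_cmink open_U assms(1,4)])
      (use assms open_U smooth_on_differentiable in blast)+
  from has_wirtinger_imp[OF this] show
    "cmink (vec_at (vdz X) z) (vec_at Y z) + cmink (vec_at X z) (vec_at (vdz Y) z) = dz F z"
    "cmink (vec_at (vdzb X) z) (vec_at Y z) + cmink (vec_at X z) (vec_at (vdzb Y) z) = dzb F z" by auto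
qed

lemma dz_const: "dz (\<lambda>z. c) z = 0" "dzb (\<lambda>z. c) z = 0"
  using has_wirtinger_imp[OF has_wirtinger_const] by auto

lemma vdzb_eq:
  assumes "z \<in> U"
  shows "vec_at (vdzb G) z = (\<lambda>j. cnj (vdz G j z))" "vec_at (vdzb N) z = (\<lambda>j. cnj (vdz N j z))"
    "vec_at (vdzb (vdz G)) z = vec_at (vdz (vdzb G)) z"
    "vec_at (vdzb (vdzb G)) z = (\<lambda>j. cnj (vdz (vdz G) j z))"
proof -
  have 1: "dzb (G j) z = cnj (dz (G j) z)" if "z \<in> U" for z j
    by (rule dz_real[OF open_U that smG realG])
  then show "vec_at (vdzb G) z = (\<lambda>j. cnj (vdz G j z))" using assms by blast
  have "dzb (N j) z = cnj (dz (N j) z)" for j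
    by (rule dz_real[OF open_U assms smN realN])
  then show "vec_at (vdzb N) z = (\<lambda>j. cnj (vdz N j z))" using assms by blast
  show "vec_at (vdzb (vdz G)) z = vec_at (vdz (vdzb G)) z"
    using dz2_dir_deriv(3)[OF open_U smG assms] by blast
  have "dzb (dzb (G j)) z = cnj (dz (dz (G j)) z)" for j
  proof -
    have "dzb (dzb (G j)) z = dzb (\<lambda>z. cnj (dz (G j) z)) z"
      by (rule dz_cong[OF open_U assms 1])
    also have "\<dots> = cnj (dz (dz (G j)) z)"
      by (rule dz_cnj[OF smooth_on_differentiable[OF smooth_derivs(1) open_U assms]])
    finally show ?thesis .
  qed
  then show "vec_at (vdzb (vdzb G)) z = (\<lambda>j. cnj (vdz (vdz G) j z))" by blast
qed

lemma cnj_half_metric: "z \<in> U \<Longrightarrow> cnj (E z) = E z"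
  unfolding half_metric_def by (simp add: cnj_cmink vdzb_eq cmink_commute)

lemma half_metric_nonzero: "z \<in> U \<Longrightarrow> E z \<noteq> 0"
  using pos by fastforce

lemma first_order:
  assumes z: "z \<in> U"
  shows "cmink (vec_at G z) (vec_at (vdz G) z) = 0" "cmink (vec_at G z) (vec_at (vdzb G) z) = 0"
    "cmink (vec_at (vdzb G) z) (vec_at (vdzb G) z) = 0" "cmink (vec_at N z) (vec_at (vdzb G) z) = 0"
    "cmink (vec_at (vdz G) z) (vec_at (vdzb G) z) = E z"
proof -
  show 1: "cmink (vec_at G z) (vec_at (vdz G) z) = 0"
    using cmink_derivative(1)[where X = G and Y = G and F = "\<lambda>z. -1", OF z smG smG] GG dz_const(1)[of "-1" z]
      cmink_commute[of "vec_at G z" "vec_at (vdz G) z"] by simp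
  show "cmink (vec_at G z) (vec_at (vdzb G) z) = 0"
    using arg_cong[OF 1, of cnj] z by (simp add: cnj_cmink realG vdzb_eq)
  show "cmink (vec_at (vdzb G) z) (vec_at (vdzb G) z) = 0"
    using arg_cong[OF conf[OF z], of cnj] z by (simp add: cnj_cmink realG vdzb_eq)
  show "cmink (vec_at N z) (vec_at (vdzb G) z) = 0"
    using arg_cong[OF NGz[OF z], of cnj] z by (simp add: cnj_cmink realN vdzb_eq)
  show "cmink (vec_at (vdz G) z) (vec_at (vdzb G) z) = E z" by (simp add: half_metric_def)
qed

lemma frame_zero:
  assumes "z \<in> U" "cmink x (vec_at G z) = 0" "cmink x (vec_at N z) = 0"
    "cmink x (vec_at (vdz G) z) = 0" "cmink x (vec_at (vdzb G) z) = 0"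
  shows "x j = 0"
  by (rule cmink_frame_zero[OF GG NN _ first_order(1,2) NGz first_order(4) conf first_order(3,5) half_metric_nonzero assms(2-5)])
    (use assms NG cmink_commute in auto)

text \<open>The structure equations are all proved by testing both sides against the frame
  \<open>G\<close>, \<open>N\<close>, \<open>vdz G\<close>, \<open>vdzb G\<close>.\<close>

lemma frame_eqI:
  assumes "z \<in> U" "cmink x (vec_at G z) = cmink y (vec_at G z)" "cmink x (vec_at N z) = cmink y (vec_at N z)"
    "cmink x (vec_at (vdz G) z) = cmink y (vec_at (vdz G) z)" "cmink x (vec_at (vdzb G) z) = cmink y (vec_at (vdzb G) z)"
  shows "x j = y j"
  using frame_zero[of z "\<lambda>j. x j - y j"] assms by (simp add: cmink_diff)

lemmas first_order' = first_order NN GG NG NGz conf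

lemma second_order:
  assumes z: "z \<in> U"
  shows "cmink (vec_at (vdz (vdz G)) z) (vec_at (vdz G) z) = 0"
    "cmink (vec_at (vdz (vdzb G)) z) (vec_at (vdz G) z) = 0"
    "cmink (vec_at (vdz (vdzb G)) z) (vec_at (vdzb G) z) = 0"
    "cmink (vec_at (vdz (vdzb G)) z) (vec_at G z) = - E z"
    "cmink (vec_at (vdz (vdz G)) z) (vec_at G z) = 0"
    "cmink (vec_at (vdz (vdz G)) z) (vec_at (vdzb G) z) = dz E z"
proof -
  show 1: "cmink (vec_at (vdz (vdz G)) z) (vec_at (vdz G) z) = 0"
    using cmink_derivative(1)[where X = "vdz G" and Y = "vdz G" and F = "\<lambda>z. 0", OF z smooth_derivs(1) smooth_derivs(1)] conf dz_const(1)[of 0 z]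
      cmink_commute[of "vec_at (vdz G) z"] by simp
  show 2: "cmink (vec_at (vdz (vdzb G)) z) (vec_at (vdz G) z) = 0"
    using cmink_derivative(2)[where X = "vdz G" and Y = "vdz G" and F = "\<lambda>z. 0", OF z smooth_derivs(1) smooth_derivs(1)] conf dz_const(2)[of 0 z]
      cmink_commute[of "vec_at (vdz G) z"] vdzb_eq(3)[OF z] by simp
  show "cmink (vec_at (vdz (vdzb G)) z) (vec_at (vdzb G) z) = 0"
    using cmink_derivative(1)[where X = "vdzb G" and Y = "vdzb G" and F = "\<lambda>z. 0", OF z smooth_derivs(2) smooth_derivs(2)] first_order(3) dz_const(1)[of 0 z]
      cmink_commute[of "vec_at (vdzb G) z"] vdzb_eq(3)[OF z] by simp
  show "cmink (vec_at (vdz (vdzb G)) z) (vec_at G z) = - E z"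
    using cmink_derivative(1)[where X = G and Y = "vdzb G" and F = "\<lambda>z. 0", OF z smG smooth_derivs(2)] first_order dz_const(1)[of 0 z]
      cmink_commute[of "vec_at G z"] z by (simp add: add_eq_0_iff)
  show "cmink (vec_at (vdz (vdz G)) z) (vec_at G z) = 0"
    using cmink_derivative(1)[where X = G and Y = "vdz G" and F = "\<lambda>z. 0", OF z smG smooth_derivs(1)] first_order conf dz_const(1)[of 0 z]
      cmink_commute[of "vec_at G z"] z by (simp add: add_eq_0_iff)
  show "cmink (vec_at (vdz (vdz G)) z) (vec_at (vdzb G) z) = dz E z"
    using cmink_derivative(1)[where X = "vdz G" and Y = "vdzb G" and F = E, OF z smooth_derivs(1) smooth_derivs(2)] first_order(5) 2
      cmink_commute[of "vec_at (vdz G) z" "vec_at (vdz (vdzb G)) z"] by simp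
qed

text \<open>The part along \<open>G\<close> comes from the hyperboloid, the part along
  \<open>N\<close> from the mean curvature. Mean curvature one gives them equal weight, so that a
  null vector appears.\<close>

lemma vdz_vdzb: "z \<in> U \<Longrightarrow> vdz (vdzb G) j z = E z * (G j z + N j z)"
  by (rule frame_eqI[where z = z and y = "\<lambda>j. E z * (G j z + N j z)"])
    (simp_all add: cmink_scale cmink_add second_order mean1 first_order' cmink_commute[of "vec_at G z" "vec_at N z"])

text \<open>Weingarten equation. The coefficient of \<open>vdz G\<close> is minus the mean curvature
  and cancels when \<open>G\<close> is added.\<close>

lemma vdz_normal: "z \<in> U \<Longrightarrow> vdz N j z = - vdz G j z + Q z / E z * vdzb G j z"
proof (rule frame_eqI[where z = z and y = "\<lambda>j. - vdz G j z + Q z / E z * vdzb G j z"])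
  assume z: "z \<in> U"
  note c = cmink_commute
  note s = cmink_scale cmink_scale_divide cmink_add cmink_diff cmink_minus first_order'[OF z] half_metric_nonzero[OF z]
    c[of "vec_at (vdz G) z" "vec_at G z"] c[of "vec_at (vdzb G) z" "vec_at G z"]
    c[of "vec_at (vdz G) z" "vec_at N z"] c[of "vec_at (vdzb G) z" "vec_at N z"]
    c[of "vec_at (vdzb G) z" "vec_at (vdz G) z"]
  show "cmink (vec_at (vdz N) z) (vec_at G z) = cmink (\<lambda>j. - vdz G j z + Q z / E z * vdzb G j z) (vec_at G z)"
    using cmink_derivative(1)[where X = N and Y = G and F = "\<lambda>z. 0", OF z smN smG] NG dz_const(1)[of 0 z] by (simp add: s)
  show "cmink (vec_at (vdz N) z) (vec_at N z) = cmink (\<lambda>j. - vdz G j z + Q z / E z * vdzb G j z) (vec_at N z)"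
    using cmink_derivative(1)[where X = N and Y = N and F = "\<lambda>z. 1", OF z smN smN] NN dz_const(1)[of 1 z]
    by (simp add: s c[of "vec_at N z" "vec_at (vdz N) z"])
  show "cmink (vec_at (vdz N) z) (vec_at (vdz G) z) = cmink (\<lambda>j. - vdz G j z + Q z / E z * vdzb G j z) (vec_at (vdz G) z)"
    using cmink_derivative(1)[where X = N and Y = "vdz G" and F = "\<lambda>z. 0", OF z smN smooth_derivs(1)] NGz dz_const(1)[of 0 z]
    by (simp add: s hopf_def c[of "vec_at N z" "vec_at (vdz (vdz G)) z"] add_eq_0_iff)
  show "cmink (vec_at (vdz N) z) (vec_at (vdzb G) z) = cmink (\<lambda>j. - vdz G j z + Q z / E z * vdzb G j z) (vec_at (vdzb G) z)"
    using cmink_derivative(1)[where X = N and Y = "vdzb G" and F = "\<lambda>z. 0", OF z smN smooth_derivs(2)] first_order(4) dz_const(1)[of 0 z] mean1[OF z]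
    by (simp add: s c[of "vec_at N z" "vec_at (vdz (vdzb G)) z"] add_eq_0_iff)
qed auto

text \<open>Gauss formula; no part along \<open>G\<close> occurs because the parametrization is
  conformal.\<close>

lemma vdz_vdz: "z \<in> U \<Longrightarrow> vdz (vdz G) j z = dz E z / E z * vdz G j z - Q z * N j z"
proof (rule frame_eqI[where z = z and y = "\<lambda>j. dz E z / E z * vdz G j z - Q z * N j z"])
  assume z: "z \<in> U"
  note c = cmink_commute
  note s = cmink_scale cmink_scale_divide cmink_diff cmink_add first_order'[OF z] half_metric_nonzero[OF z] second_order[OF z]
    c[of "vec_at (vdz G) z" "vec_at G z"] c[of "vec_at (vdz G) z" "vec_at N z"]
  show "cmink (vec_at (vdz (vdz G)) z) (vec_at G z) = cmink (\<lambda>j. dz E z / E z * vdz G j z - Q z * N j z) (vec_at G z)"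
    by (simp add: s)
  show "cmink (vec_at (vdz (vdz G)) z) (vec_at N z) = cmink (\<lambda>j. dz E z / E z * vdz G j z - Q z * N j z) (vec_at N z)"
    by (simp add: s hopf_def)
  show "cmink (vec_at (vdz (vdz G)) z) (vec_at (vdz G) z) = cmink (\<lambda>j. dz E z / E z * vdz G j z - Q z * N j z) (vec_at (vdz G) z)"
    by (simp add: s)
  show "cmink (vec_at (vdz (vdz G)) z) (vec_at (vdzb G) z) = cmink (\<lambda>j. dz E z / E z * vdz G j z - Q z * N j z) (vec_at (vdzb G) z)"
    by (simp add: s)
qed auto

text \<open>The null vector field \<open>G + N\<close> represents the hyperbolic Gauss map.\<close>

definition "L j z = G j z + N j z"

lemma smooth_L: "smooth_on (L j) U"
  unfolding L_def[abs_def] by (intro smooth_on_add open_U smG smN)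

lemma dz_L: "z \<in> U \<Longrightarrow> dz (L j) z = Q z / E z * vdzb G j z"
  using vdz_normal[of z j] dz_add(1)[of "G j" z "N j"] smooth_on_differentiable[OF _ open_U] smG smN
  unfolding L_def[abs_def] by fastforce

text \<open>Comes from commuting the derivatives and differentiating \<open>vdz_vdzb\<close>. Paired
  with \<open>N\<close> it yields the Codazzi equation, paired with \<open>vdzb G\<close> the Gauss
  equation.\<close>

lemma vdzb_vdz_vdz:
  assumes z: "z \<in> U"
  shows "vdzb (vdz (vdz G)) j z = dz E z * L j z + Q z * vdzb G j z"
proof -
  have "dzb (dz (dz (G j))) z = dz (dzb (dz (G j))) z"
    by (rule dz2_dir_deriv(3)[OF open_U smooth_derivs(1) z])
  also have "\<dots> = dz (\<lambda>z. E z * L j z) z"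
    by (rule dz_cong(1)[OF open_U z]) (use vdzb_eq(3) vdz_vdzb L_def fun_cong in metis)
  also have "\<dots> = dz E z * L j z + E z * dz (L j) z"
    by (intro dz_mult smooth_on_differentiable[OF _ open_U z] smooth_half_metric smooth_L)
  finally show ?thesis using dz_L[OF z] half_metric_nonzero[OF z] by simp
qed

lemma cmink_L: "z \<in> U \<Longrightarrow> cmink (vec_at L z) (vec_at N z) = 1" "z \<in> U \<Longrightarrow> cmink (vec_at L z) (vec_at (vdzb G) z) = 0"
  unfolding L_def by (simp_all add: cmink_add first_order' cmink_commute[of "vec_at G z" "vec_at N z"])

text \<open>Codazzi equation: differentiating the two factors of the Hopf coefficient contributes
  \<open>dz E\<close> and \<open>- dz E\<close>.\<close>

lemma hopf_holomorphic: "Q holomorphic_on U"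
proof (rule holomorphic_on_dzb_zero[OF open_U smooth_hopf])
  fix z assume z: "z \<in> U"
  have Qe: "Q = (\<lambda>z. - 1 * cmink (vec_at (vdz (vdz G)) z) (vec_at N z))" by (auto simp: hopf_def)
  have "dzb Q z = - 1 * (cmink (vec_at (vdzb (vdz (vdz G))) z) (vec_at N z) + cmink (vec_at (vdz (vdz G)) z) (vec_at (vdzb N) z))"
    unfolding Qe
    by (rule has_wirtinger_imp(2)[OF has_wirtinger_cmult[OF has_wirtinger_cmink]])
      (use smooth_on_differentiable[OF _ open_U z] smooth_derivs smN in blast)+
  moreover have "cmink (vec_at (vdzb (vdz (vdz G))) z) (vec_at N z) = dz E z"
    using vdzb_vdz_vdz[OF z] cmink_L(1)[OF z] first_order'[OF z] cmink_commute[of "vec_at (vdzb G) z" "vec_at N z"]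
    by (simp add: cmink_add cmink_scale)
  moreover have "vec_at (vdzb N) z = (\<lambda>j. - vdzb G j z + cnj (Q z) / E z * vdz G j z)"
    using vdz_normal[OF z] vdzb_eq[OF z] cnj_half_metric[OF z] by (simp add: fun_eq_iff)
  then have "cmink (vec_at (vdz (vdz G)) z) (vec_at (vdzb N) z) = - dz E z"
    using second_order[OF z] half_metric_nonzero[OF z] by (simp add: cmink_add cmink_diff cmink_scale cmink_scale_divide cmink_minus)
  ultimately show "dzb Q z = 0" by simp
qed

text \<open>Divided by \<open>E\<close> squared, this says that \<open>ln E\<close> has mixed
  derivative \<open>Q * cnj Q / E\<close>. It results from differentiating \<open>dz E\<close>,
  written as a product of frame vectors, once more.\<close>

lemma gauss_equation:
  assumes z: "z \<in> U"
  shows "E z * dz (dzb E) z - dz E z * dzb E z = Q z * cnj (Q z) * E z"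
proof -
  have d: "dz E z = cmink (vec_at (vdz (vdz G)) z) (vec_at (vdzb G) z)" if "z \<in> U" for z
    using second_order(6)[OF that] by simp
  have "dzb (dz E) z = dzb (\<lambda>z. cmink (vec_at (vdz (vdz G)) z) (vec_at (vdzb G) z)) z"
    by (rule dz_cong(2)[OF open_U z d])
  also have "\<dots> = cmink (vec_at (vdzb (vdz (vdz G))) z) (vec_at (vdzb G) z) + cmink (vec_at (vdz (vdz G)) z) (vec_at (vdzb (vdzb G)) z)"
    by (rule has_wirtinger_imp(2)[OF has_wirtinger_cmink])
      (use smooth_on_differentiable[OF _ open_U z] smooth_derivs in blast)+
  also have "cmink (vec_at (vdzb (vdz (vdz G))) z) (vec_at (vdzb G) z) = 0"
    using vdzb_vdz_vdz[OF z] cmink_L(2)[OF z] first_order'[OF z] by (simp add: cmink_add cmink_scale)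
  also have "vec_at (vdzb (vdzb G)) z = (\<lambda>j. dzb E z / E z * vdzb G j z - cnj (Q z) * N j z)"
    using vdz_vdz[OF z] vdzb_eq[OF z] cnj_half_metric[OF z] realN[OF z]
      dz_real[OF open_U z smooth_half_metric cnj_half_metric] by (simp add: fun_eq_iff)
  also have "cmink (vec_at (vdz (vdz G)) z) (\<lambda>j. dzb E z / E z * vdzb G j z - cnj (Q z) * N j z)
      = dzb E z / E z * dz E z + cnj (Q z) * Q z"
    using second_order[OF z] by (simp add: cmink_diff cmink_add cmink_scale cmink_scale_divide hopf_def)
  finally have "dz (dzb E) z = dzb E z / E z * dz E z + cnj (Q z) * Q z"
    using dz2_dir_deriv(3)[OF open_U smooth_half_metric z] by simp
  then show ?thesis using half_metric_nonzero[OF z] by (simp add: field_simps)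
qed

text \<open>
  The metric \<open>- K ds\<^sup>2\<close> of curvature one is \<open>\<phi>\<^sup>-\<^sup>2 |dz|\<^sup>2\<close> for this \<open>\<phi>\<close>.
\<close>

definition "phi z = csqrt (E z / (2 * Q z * cnj (Q z)))"

context
  assumes Qnz: "\<And>z. z \<in> U \<Longrightarrow> Q z \<noteq> 0"
begin

lemma phi_aux:
  assumes "z \<in> U"
  obtains r where "r > 0" "E z / (2 * Q z * cnj (Q z)) = of_real r" "phi z = of_real (sqrt r)"
proof -
  have E: "E z = of_real (Re (E z))" using cnj_half_metric[OF assms] by (metis complex_cnj_cancel_iff Reals_cnj_iff of_real_Re)
  define r where "r = Re (E z) / (2 * (cmod (Q z))\<^sup>2)"
  have r: "r > 0" unfolding r_def using pos[OF assms] Qnz[OF assms] by simp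
  have "E z / (2 * Q z * cnj (Q z)) = of_real r"
  proof -
    have q: "Q z * cnj (Q z) = of_real ((cmod (Q z))\<^sup>2)" by (simp only: complex_norm_square)
    show ?thesis unfolding r_def by (subst E) (simp add: q mult.assoc)
  qed
  moreover have "csqrt (of_real r) = of_real (sqrt r)" using r by simp
  ultimately show ?thesis using that[OF r] unfolding phi_def by simp
qed

lemma phi_pos: "z \<in> U \<Longrightarrow> Re (phi z) > 0" "z \<in> U \<Longrightarrow> cnj (phi z) = phi z" "z \<in> U \<Longrightarrow> phi z \<noteq> 0"
  by (rule phi_aux[of z], assumption, simp)+

lemma phi_sq: "z \<in> U \<Longrightarrow> E z = phi z * phi z * (2 * (Q z * cnj (Q z)))"
proof -
  assume z: "z \<in> U"
  have "phi z * phi z = E z / (2 * Q z * cnj (Q z))" unfolding phi_def by (metis power2_csqrt power2_eq_square)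
  then show ?thesis using Qnz[OF z] by simp
qed

lemma smooth_phi: "smooth_on phi U"
  unfolding phi_def[abs_def]
proof (rule smooth_on_holomorphic_o[OF open_U, where W = "- \<real>\<^sub>\<le>\<^sub>0" and h = csqrt])
  show "open (- \<real>\<^sub>\<le>\<^sub>0 :: complex set)" by (simp add: open_Compl)
  show "csqrt holomorphic_on - \<real>\<^sub>\<le>\<^sub>0" by (intro holomorphic_intros) auto
  show "(\<lambda>z. E z / (2 * Q z * cnj (Q z))) ` U \<subseteq> - \<real>\<^sub>\<le>\<^sub>0"
  proof
    fix y assume "y \<in> (\<lambda>z. E z / (2 * Q z * cnj (Q z))) ` U"
    then obtain z where z: "z \<in> U" "y = E z / (2 * Q z * cnj (Q z))" by blast
    show "y \<in> - \<real>\<^sub>\<le>\<^sub>0" by (rule phi_aux[OF z(1)]) (use z in auto)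
  qed
  show "smooth_on (\<lambda>z. E z / (2 * Q z * cnj (Q z))) U"
    by (intro smooth_on_divide smooth_on_mult smooth_on_const smooth_on_cnj smooth_hopf smooth_half_metric open_U)
      (use Qnz in auto)
qed

text \<open>\<open>ln (Q * cnj Q)\<close> is harmonic, so the mixed derivative of
  \<open>ln phi\<close> is half that of \<open>ln E\<close>, and the Gauss equation makes it
  \<open>1 / (4 * phi * phi)\<close>. The computation is cleared of denominators and uses no
  logarithm.\<close>

lemma phi_liouville:
  assumes z: "z \<in> U"
  shows "phi z * dz (dzb phi) z - dz phi z * dzb phi z = 1/4"
proof -
  define K where "K z = 2 * (Q z * cnj (Q z))" for z
  have sK: "smooth_on K U" unfolding K_def[abs_def]
    by (intro smooth_on_mult smooth_on_const smooth_on_cnj smooth_hopf open_U)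
  note w = smooth_on_has_wirtinger[OF _ open_U]
  have dQ: "dzb Q z = 0" if "z \<in> U" for z using dz_holomorphic[OF hopf_holomorphic open_U that] by simp
  have wQ: "has_wirtinger Q (dz Q z) 0 z" "has_wirtinger (\<lambda>z. cnj (Q z)) 0 (cnj (dz Q z)) z" if "z \<in> U" for z
    using w[OF smooth_hopf that] has_wirtinger_cnj[OF w[OF smooth_hopf that]] dQ[OF that] by auto
  have wK: "dz K z = 2 * (dz Q z * cnj (Q z))" "dzb K z = 2 * (Q z * cnj (dz Q z))" if "z \<in> U" for z
    using has_wirtinger_imp[OF has_wirtinger_cmult[OF has_wirtinger_mult[OF wQ[OF that]], of 2]] unfolding K_def[abs_def] by auto
  have wQ': "has_wirtinger (\<lambda>z. cnj (dz Q z)) 0 (cnj (dz (dz Q) z)) z"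
  proof -
    have "dzb (dz Q) z = dz (dzb Q) z" by (rule dz2_dir_deriv(3)[OF open_U smooth_hopf z])
    also have "\<dots> = dz (\<lambda>z. 0) z" by (rule dz_cong[OF open_U z dQ])
    finally have "dzb (dz Q) z = 0" by (simp add: dz_const)
    then show ?thesis using has_wirtinger_cnj[OF w[OF smooth_on_dz[OF open_U smooth_hopf] z]] by simp
  qed
  have K12: "dz (dzb K) z = 2 * (dz Q z * cnj (dz Q z))"
  proof -
    have "dz (dzb K) z = dz (\<lambda>z. 2 * (Q z * cnj (dz Q z))) z" by (rule dz_cong[OF open_U z wK(2)])
    also have "\<dots> = 2 * (dz Q z * cnj (dz Q z))"
      using has_wirtinger_imp(1)[OF has_wirtinger_cmult[OF has_wirtinger_mult[OF wQ(1)[OF z] wQ']]] by simp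
    finally show ?thesis .
  qed
  let ?p = "phi z" and ?p1 = "dz phi z" and ?p2 = "dzb phi z" and ?p12 = "dz (dzb phi) z"
  let ?k = "K z" and ?k1 = "dz K z" and ?k2 = "dzb K z" and ?k12 = "dz (dzb K) z"
  have EK: "E z = phi z * phi z * K z" if "z \<in> U" for z using phi_sq[OF that] K_def by simp
  note wp = w[OF smooth_phi] and wk = w[OF sK] and wpb = w[OF smooth_on_dzb[OF open_U smooth_phi] z]
  have E1: "dz E z = (dz phi z * phi z + phi z * dz phi z) * K z + phi z * phi z * dz K z"
     "dzb E z = (dzb phi z * phi z + phi z * dzb phi z) * K z + phi z * phi z * dzb K z" if "z \<in> U" for z
    using has_wirtinger_imp[OF has_wirtinger_cong[OF has_wirtinger_mult[OF has_wirtinger_mult[OF wp[OF that] wp[OF that]] wk[OF that]]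
        open_U that EK[symmetric]]] by auto
  have "dz (dzb E) z = dz (\<lambda>z. (dzb phi z * phi z + phi z * dzb phi z) * K z + phi z * phi z * dzb K z) z"
    by (rule dz_cong[OF open_U z E1(2)])
  also have "\<dots> = ((?p12 * ?p + ?p2 * ?p1) + (?p1 * ?p2 + ?p * ?p12)) * ?k + (?p2 * ?p + ?p * ?p2) * ?k1
       + ((?p1 * ?p + ?p * ?p1) * ?k2 + ?p * ?p * ?k12)"
    by (rule has_wirtinger_imp(1)[OF has_wirtinger_add[OF
        has_wirtinger_mult[OF has_wirtinger_add[OF has_wirtinger_mult[OF wpb wp[OF z]] has_wirtinger_mult[OF wp[OF z] wpb]] wk[OF z]]
        has_wirtinger_mult[OF has_wirtinger_mult[OF wp[OF z] wp[OF z]] w[OF smooth_on_dzb[OF open_U sK] z]]]])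
  finally have E12: "dz (dzb E) z = \<dots>" .
  \<comment> \<open>Harmonicity of \<open>ln K\<close>, cleared of denominators; \<open>K\<close> is
    twice a holomorphic function times its conjugate.\<close>
  have kk: "?k * ?k12 = ?k1 * ?k2" unfolding K12 wK[OF z] K_def by (simp add: mult_ac)
  have "2 * ?p * ?p * ?k * ?k * (?p * ?p12 - ?p1 * ?p2) = E z * dz (dzb E) z - dz E z * dzb E z"
    unfolding E12 E1[OF z] EK[OF z] using kk by algebra
  also have "\<dots> = (?k / 2) * (?p * ?p * ?k)" using gauss_equation[OF z] EK[OF z] K_def by simp
  finally have "?p * ?p * ?k * ?k * (4 * (?p * ?p12 - ?p1 * ?p2)) = ?p * ?p * ?k * ?k * 1" by simp
  moreover have "?p * ?p * ?k * ?k \<noteq> 0" using phi_pos(3)[OF z] Qnz[OF z] K_def by simp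
  ultimately have "4 * (?p * ?p12 - ?p1 * ?p2) = 1" using mult_left_cancel by blast
  moreover have "x = 1 / 4" if "4 * x = 1" for x :: complex using that by (simp add: field_simps)
  ultimately show ?thesis by blast
qed

definition "Y j z = phi z * L j z"

lemma smooth_Y: "smooth_on (Y j) U"
  unfolding Y_def[abs_def] by (intro smooth_on_mult open_U smooth_phi smooth_L)

lemma Y_real: "z \<in> U \<Longrightarrow> cnj (Y j z) = Y j z"
  unfolding Y_def L_def using phi_pos(2) realG realN by simp

text \<open>By \<open>dz_L\<close>, the vector \<open>vdzb G\<close> is \<open>dz L\<close> times
  \<open>2 * cnj (Q z) * phi * phi\<close>. Differentiating this, the antiholomorphic factor passes
  through and cancels, which leaves \<open>phi * L_zz + 2 * phi_z * L_z = Q * phi * L\<close>. The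
  factor \<open>phi\<close> in \<open>Y\<close> is chosen to absorb the first-order term.\<close>

lemma dz_dz_Y:
  assumes z: "z \<in> U"
  shows "dz (dz (Y j)) z = (dz (dz phi) z / phi z + Q z) * Y j z"
proof -
  note w = smooth_on_has_wirtinger[OF _ open_U]
  have 1: "dz (Y j) z = dz phi z * L j z + phi z * dz (L j) z" if "z \<in> U" for z
    unfolding Y_def[abs_def] by (intro dz_mult smooth_on_differentiable[OF _ open_U that] smooth_phi smooth_L)
  have "dz (dz (Y j)) z = dz (\<lambda>z. dz phi z * L j z + phi z * dz (L j) z) z"
    by (rule dz_cong[OF open_U z 1])
  also have "\<dots> = (dz (dz phi) z * L j z + dz phi z * dz (L j) z) + (dz phi z * dz (L j) z + phi z * dz (dz (L j)) z)"
    by (rule has_wirtinger_imp(1)[OF has_wirtinger_add[OF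
        has_wirtinger_mult[OF w[OF smooth_on_dz[OF open_U smooth_phi] z] w[OF smooth_L z]]
        has_wirtinger_mult[OF w[OF smooth_phi z] w[OF smooth_on_dz[OF open_U smooth_L] z]]]])
  finally have Y11: "dz (dz (Y j)) z = \<dots>" .
  have 2: "vdzb G j z = 2 * cnj (Q z) * (phi z * phi z) * dz (L j) z" if "z \<in> U" for z
    using dz_L[OF that, of j] phi_sq[OF that] Qnz[OF that] phi_pos(3)[OF that] by (simp add: field_simps)
  have wQ: "has_wirtinger (\<lambda>z. cnj (Q z)) 0 (cnj (dz Q z)) z"
    using has_wirtinger_cnj[OF w[OF smooth_hopf z]] dz_holomorphic(2)[OF hopf_holomorphic open_U z] by simp
  have "vdz (vdzb G) j z = dz (\<lambda>z. 2 * cnj (Q z) * (phi z * phi z) * dz (L j) z) z"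
    by (rule dz_cong[OF open_U z 2])
  also have "\<dots> = ((2 * 0) * (phi z * phi z) + 2 * cnj (Q z) * (dz phi z * phi z + phi z * dz phi z)) * dz (L j) z
      + 2 * cnj (Q z) * (phi z * phi z) * dz (dz (L j)) z"
    by (rule has_wirtinger_imp(1)[OF has_wirtinger_mult[OF has_wirtinger_mult[OF has_wirtinger_cmult[OF wQ]
        has_wirtinger_mult[OF w[OF smooth_phi z] w[OF smooth_phi z]]] w[OF smooth_on_dz[OF open_U smooth_L] z]]])
  finally have "E z * L j z = \<dots>" using vdz_vdzb[OF z] L_def by simp
  then have "(2 * cnj (Q z) * phi z) * (2 * dz phi z * dz (L j) z + phi z * dz (dz (L j)) z)
     = (2 * cnj (Q z) * phi z) * (Q z * phi z * L j z)"
    unfolding phi_sq[OF z] by (simp add: algebra_simps)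
  then have "2 * dz phi z * dz (L j) z + phi z * dz (dz (L j)) z = Q z * phi z * L j z"
    using Qnz[OF z] phi_pos(3)[OF z] by simp
  note H = this
  have "dz (dz (Y j)) z = dz (dz phi) z * L j z + (2 * dz phi z * dz (L j) z + phi z * dz (dz (L j)) z)"
    unfolding Y11 by simp
  also have "\<dots> = (dz (dz phi) z / phi z + Q z) * Y j z"
    unfolding H Y_def using phi_pos(3)[OF z] by (simp add: distrib_right)
  finally show ?thesis .
qed

text \<open>A constant covector that annihilates \<open>L\<close> on an open set annihilates its
  derivatives, hence \<open>vdzb G\<close> and \<open>vdz G\<close>, then \<open>N\<close> by way of
  \<open>vdz (vdz G)\<close>, and finally \<open>G\<close>: the whole frame.\<close>

lemma Y_independent:
  assumes "open V" "V \<noteq> {}" "V \<subseteq> U" "\<And>z. z \<in> V \<Longrightarrow> (\<Sum>j\<in>UNIV. c j * Y j z) = 0"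
  shows "c j = 0"
proof -
  \<comment> \<open>Multiplication by \<open>eta\<close> turns the coefficients of the relation into
    a vector that \<open>cmink\<close> pairs with \<open>L\<close>.\<close>
  define x where "x j = c j * eta j" for j
  have ee: "eta j * eta j = 1" for j by (simp add: eta_def)
  have x0: "cmink x (vec_at L z) = 0" if z: "z \<in> V" for z
  proof -
    have "phi z * (\<Sum>j\<in>UNIV. c j * L j z) = 0"
      using assms(4)[OF z] unfolding Y_def by (simp add: sum_distrib_left mult_ac)
    then have "(\<Sum>j\<in>UNIV. c j * L j z) = 0" using phi_pos(3) z assms(3) by auto
    moreover have "cmink x (vec_at L z) = (\<Sum>j\<in>UNIV. c j * L j z)"
      unfolding cmink_def x_def by (rule sum.cong) (simp_all add: eta_def)
    ultimately show ?thesis by simp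
  qed
  have deriv: "cmink x (vec_at (vdz X) z) = dz F z" "cmink x (vec_at (vdzb X) z) = dzb F z"
    if z: "z \<in> V" and X: "\<And>j. smooth_on (X j) U" and F: "\<And>z. z \<in> V \<Longrightarrow> cmink x (vec_at X z) = F z" for X F z
  proof -
    have "has_wirtinger F (cmink (vec_at (vdz (\<lambda>j z. x j)) z) (vec_at X z) + cmink x (vec_at (vdz X) z))
       (cmink (vec_at (vdzb (\<lambda>j z. x j)) z) (vec_at X z) + cmink x (vec_at (vdzb X) z)) z"
      by (rule has_wirtinger_cong[OF has_wirtinger_cmink assms(1) z F])
        (use z assms(3) open_U smooth_on_differentiable[OF X open_U] in auto)
    then show "cmink x (vec_at (vdz X) z) = dz F z" "cmink x (vec_at (vdzb X) z) = dzb F z"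
      using has_wirtinger_imp by (auto simp: dz_const cmink_zero)
  qed
  have LX: "cmink x (vec_at (vdzb G) z) = 0" if z: "z \<in> V" for z
  proof -
    have "cmink x (vec_at (vdz L) z) = 0" using deriv(1)[OF z smooth_L x0] by (simp add: dz_const)
    moreover have "vec_at (vdz L) z = (\<lambda>j. Q z / E z * vdzb G j z)" using dz_L z assms(3) by blast
    ultimately show ?thesis using z assms(3) Qnz half_metric_nonzero by (auto simp: cmink_scale cmink_scale_divide)
  qed
  have dzbL: "dzb (L j) z = cnj (Q z) / E z * vdz G j z" if "z \<in> U" for z j
    using dz_real[OF open_U that smooth_L, of j] dz_L[OF that] realG realN vdzb_eq(1)[OF that] cnj_half_metric[OF that]
    unfolding L_def by (simp add: fun_eq_iff)
  have LX2: "cmink x (vec_at (vdz G) z) = 0" if z: "z \<in> V" for z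
  proof -
    have "cmink x (vec_at (vdzb L) z) = 0" using deriv(2)[OF z smooth_L x0] by (simp add: dz_const)
    moreover have "vec_at (vdzb L) z = (\<lambda>j. cnj (Q z) / E z * vdz G j z)" using dzbL z assms(3) by blast
    ultimately show ?thesis using z assms(3) Qnz half_metric_nonzero by (auto simp: cmink_scale cmink_scale_divide)
  qed
  obtain z where z: "z \<in> V" using assms(2) by blast
  then have zU: "z \<in> U" using assms(3) by blast
  have "cmink x (vec_at (vdz (vdz G)) z) = 0" using deriv(1)[OF z smooth_derivs(1) LX2] by (simp add: dz_const)
  moreover have "vec_at (vdz (vdz G)) z = (\<lambda>j. dz E z / E z * vdz G j z - Q z * N j z)" using vdz_vdz[OF zU] by blast
  ultimately have xN: "cmink x (vec_at N z) = 0" using LX2[OF z] Qnz[OF zU] by (simp add: cmink_diff cmink_scale cmink_scale_divide)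
  have "cmink x (vec_at G z) = 0" using x0[OF z] xN unfolding L_def by (simp add: cmink_add)
  then have "x j = 0" by (rule frame_zero[OF zU _ xN LX2[OF z] LX[OF z]])
  then show ?thesis unfolding x_def by (simp add: eta_def split: if_splits)
qed

end

end

section \<open>Linear differential equations on convex domains\<close>

text \<open>In the norm weighted by \<open>exp (N * cmod (z - z0))\<close>, integration from
  \<open>z0\<close> gains the factor \<open>1 / N\<close>. With \<open>N\<close> large the Picard
  terms decay geometrically on a whole convex set and not merely near \<open>z0\<close>.\<close>

lemma primitive_exp_bound:
  fixes f g :: "complex \<Rightarrow> complex"
  assumes K: "convex K" "z0 \<in> K" "z \<in> K" and "N > 0" "A \<ge> 0"
    and g: "\<And>z. z \<in> K \<Longrightarrow> (g has_field_derivative f z) (at z)" "g z0 = 0"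
    and f: "\<And>z. z \<in> K \<Longrightarrow> cmod (f z) \<le> A * exp (N * cmod (z - z0))"
  shows "cmod (g z) \<le> A / N * exp (N * cmod (z - z0))"
proof -
  let ?p = "\<lambda>s. z0 + of_real s * (z - z0)" and ?r = "cmod (z - z0)"
  have inK: "?p s \<in> K" if "0 \<le> s" "s \<le> 1" for s
  proof -
    have "?p s = (1 - s) *\<^sub>R z0 + s *\<^sub>R z" by (simp add: scaleR_conv_of_real algebra_simps)
    then show ?thesis using convexD_alt[OF K] that by auto
  qed
  have d1: "((\<lambda>s. g (?p s)) has_vector_derivative f (?p s) * (z - z0)) (at s)" if "0 \<le> s" "s \<le> 1" for s
  proof -
    have "(?p has_vector_derivative (z - z0)) (at s)"
      by (auto intro!: derivative_eq_intros simp: has_vector_derivative_def scaleR_conv_of_real)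
    from field_vector_diff_chain_at[OF this g(1)[OF inK[OF that]]]
    show ?thesis by (simp add: o_def mult.commute)
  qed
  have d2: "((\<lambda>s. A / N * exp (N * ?r * s)) has_vector_derivative (A * ?r * exp (N * ?r * s))) (at s)" for s
    using \<open>N > 0\<close> unfolding has_real_derivative_iff_has_vector_derivative[symmetric]
    by (auto intro!: derivative_eq_intros)
  have "cmod (g (?p 1) - g (?p 0)) \<le> A / N * exp (N * ?r * 1) - A / N * exp (N * ?r * 0)"
  proof (rule differentiable_bound_general[where f' = "\<lambda>s. f (?p s) * (z - z0)" and \<phi>' = "\<lambda>s. A * ?r * exp (N * ?r * s)"])
    show "continuous_on {0..1} (\<lambda>s. g (?p s))"
      by (intro continuous_at_imp_continuous_on ballI has_vector_derivative_continuous[OF d1]) auto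
    show "continuous_on {0..1} (\<lambda>s. A / N * exp (N * ?r * s))" by (intro continuous_intros)
    fix s :: real assume s: "0 < s" "s < 1"
    show "((\<lambda>s. g (?p s)) has_vector_derivative f (?p s) * (z - z0)) (at s)" using d1 s by simp
    show "((\<lambda>s. A / N * exp (N * ?r * s)) has_vector_derivative A * ?r * exp (N * ?r * s)) (at s)" by (rule d2)
    have "cmod (f (?p s)) \<le> A * exp (N * cmod (?p s - z0))" using f[OF inK[of s]] s by simp
    also have "\<dots> = A * exp (N * ?r * s)" using s by (simp add: norm_mult mult_ac)
    finally have "cmod (f (?p s)) * ?r \<le> A * exp (N * ?r * s) * ?r" by (rule mult_right_mono) simp
    then show "norm (f (?p s) * (z - z0)) \<le> A * ?r * exp (N * ?r * s)" by (simp add: norm_mult mult_ac)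
  qed simp
  also have "\<dots> \<le> A / N * exp (N * ?r)" using assms(4,5) by simp
  finally show ?thesis using g(2) by simp
qed

lemma linear_ode_exists:
  fixes h :: "complex \<Rightarrow> complex"
  assumes U: "open U" "convex U" "z0 \<in> U" and h: "h holomorphic_on U"
  obtains y where "y holomorphic_on U" "\<And>z. z \<in> U \<Longrightarrow> deriv (deriv y) z = h z * y z"
    "y z0 = a" "deriv y z0 = b"
proof -
  \<comment> \<open>A chosen primitive that vanishes at \<open>z0\<close>; convexity of the domain
    provides one for every holomorphic integrand.\<close>
  define I where "I f = (SOME g. (\<forall>z\<in>U. (g has_field_derivative f z) (at z)) \<and> g z0 = 0)"
    for f :: "complex \<Rightarrow> complex"
  have I: "(\<forall>z\<in>U. (I f has_field_derivative f z) (at z)) \<and> I f z0 = 0" if hf: "f holomorphic_on U" for f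
  proof -
    obtain g where g: "\<And>x. x \<in> U \<Longrightarrow> (g has_field_derivative f x) (at x within U)"
      using holomorphic_convex_primitive'[OF U(2,1) hf] by blast
    have "((\<lambda>z. g z - g z0) has_field_derivative f x) (at x)" if "x \<in> U" for x
      using g[OF that] at_within_open[OF that U(1)] by (auto intro!: derivative_eq_intros)
    then have "\<exists>g. (\<forall>z\<in>U. (g has_field_derivative f z) (at z)) \<and> g z0 = 0"
      by (intro exI[of _ "\<lambda>z. g z - g z0"]) simp
    then show ?thesis unfolding I_def by (rule someI_ex)
  qed
  \<comment> \<open>Terms of the Picard series for the first-order system: the first component sums
    to \<open>y\<close>, the second to its derivative.\<close>
  define S where "S = rec_nat (\<lambda>z. a, \<lambda>z. b) (\<lambda>n p. (I (snd p), I (\<lambda>z. h z * fst p z)))"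
  define Y where "Y n = fst (S n)" for n
  define V where "V n = snd (S n)" for n
  have Y0: "Y 0 = (\<lambda>z. a)" "V 0 = (\<lambda>z. b)" and
    Ys: "Y (Suc n) = I (V n)" "V (Suc n) = I (\<lambda>z. h z * Y n z)" for n
    unfolding Y_def V_def S_def by simp_all
  have hol_I: "I f holomorphic_on U" if "f holomorphic_on U" for f
    using I[OF that] U(1) holomorphic_on_open by blast
  have hol: "Y n holomorphic_on U \<and> V n holomorphic_on U" for n
    by (induction n) (auto simp: Y0 Ys intro!: hol_I holomorphic_intros h)
  \<comment> \<open>Derivatives of the terms: the index is shifted by one, and the constant term 0
    contributes nothing.\<close>
  define Y' where "Y' n = (case n of 0 \<Rightarrow> (\<lambda>z. 0) | Suc m \<Rightarrow> V m)" for n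
  define V' where "V' n = (case n of 0 \<Rightarrow> (\<lambda>z. 0) | Suc m \<Rightarrow> (\<lambda>z. h z * Y m z))" for n
  have dY: "(Y n has_field_derivative Y' n z) (at z)" "(V n has_field_derivative V' n z) (at z)" if "z \<in> U" for n z
    using that I[of "V m" for m] I[of "\<lambda>z. h z * Y m z" for m] hol h
    by (cases n; auto simp: Y0 Ys Y'_def V'_def holomorphic_on_mult)+
  have bound: "\<exists>d B. 0 < d \<and> (\<forall>n. \<forall>y\<in>ball x d \<inter> U. cmod (Y n y) \<le> B * (1/2)^n \<and> cmod (V n y) \<le> B * (1/2)^n) \<and> 0 \<le> B"
    if x: "x \<in> U" for x
  proof -
    obtain d where d: "d > 0" "cball x d \<subseteq> U" using U(1) x open_contains_cball by blast
    \<comment> \<open>The hull with \<open>z0\<close> contains the segments from \<open>z0\<close>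
      along which the primitives are estimated, and it is compact, so \<open>h\<close> is bounded on
      it.\<close>
    define K where "K = convex hull (insert z0 (cball x d))"
    have K: "compact K" "convex K" "K \<subseteq> U" "z0 \<in> K" "cball x d \<subseteq> K"
      unfolding K_def using U d hull_subset[of "insert z0 (cball x d)" convex]
      by (auto intro!: compact_convex_hull hull_minimal simp: hull_minimal subset_hull)
    have "continuous_on K h" using h K(3) holomorphic_on_imp_continuous_on holomorphic_on_subset by blast
    then have "bounded (h ` K)" using K(1) compact_continuous_image compact_imp_bounded by blast
    then obtain M where M: "M > 0" "\<And>z. z \<in> K \<Longrightarrow> cmod (h z) \<le> M" unfolding bounded_pos by auto
    \<comment> \<open>Chosen so that both \<open>1 / N\<close> and \<open>M / N\<close> are at most
      1/2.\<close>
    define N where "N = 2 * max 1 M"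
    define C where "C = max (cmod a) (cmod b)"
    have N: "N > 0" "1 / N \<le> 1/2" "M / N \<le> 1/2" using M unfolding N_def by (auto simp: field_simps max_def)
    have C: "C \<ge> 0" "cmod a \<le> C" "cmod b \<le> C" unfolding C_def by (auto simp: le_max_iff_disj)
    let ?e = "\<lambda>z. exp (N * cmod (z - z0))"
    have YV: "\<forall>z\<in>K. cmod (Y n z) \<le> C * (1/2)^n * ?e z \<and> cmod (V n z) \<le> C * (1/2)^n * ?e z" for n
    proof (induction n)
      case 0
      have "c \<le> C * exp (N * cmod (z - z0))" if "c \<le> C" for c z
      proof -
        have "C * 1 \<le> C * exp (N * cmod (z - z0))" using C N by (intro mult_left_mono) auto
        then show ?thesis using that by simp
      qed
      then show ?case using C by (simp add: Y0)
    next
      case (Suc n)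
      show ?case
      proof
        fix z assume z: "z \<in> K"
        have "cmod (Y (Suc n) z) \<le> (C * (1/2)^n) / N * ?e z"
          unfolding Ys
          by (rule primitive_exp_bound[OF K(2,4) z N(1), where f = "V n"])
            (use Suc I[of "V n"] hol K(3) C in auto)
        also have "\<dots> = (C * (1/2)^n * ?e z) * (1 / N)" by simp
        also have "\<dots> \<le> (C * (1/2)^n * ?e z) * (1 / 2)" using C N by (intro mult_left_mono) auto
        finally have 1: "cmod (Y (Suc n) z) \<le> C * (1/2)^Suc n * ?e z" by simp
        have "cmod (V (Suc n) z) \<le> (M * (C * (1/2)^n)) / N * ?e z"
          unfolding Ys
        proof (rule primitive_exp_bound[OF K(2,4) z N(1), where f = "\<lambda>z. h z * Y n z"])
          show "0 \<le> M * (C * (1 / 2) ^ n)" using M C by simp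
          show "(I (\<lambda>z. h z * Y n z) has_field_derivative h z * Y n z) (at z)" if "z \<in> K" for z
            using I[of "\<lambda>z. h z * Y n z"] hol h that K(3) by (auto intro: holomorphic_intros)
          show "I (\<lambda>z. h z * Y n z) z0 = 0"
            using I[of "\<lambda>z. h z * Y n z"] hol h by (auto intro: holomorphic_intros)
          show "cmod (h z * Y n z) \<le> M * (C * (1 / 2) ^ n) * ?e z" if "z \<in> K" for z
          proof -
            have "cmod (h z) * cmod (Y n z) \<le> M * (C * (1/2)^n * ?e z)"
              using Suc that M by (intro mult_mono) auto
            then show ?thesis by (simp add: norm_mult mult_ac)
          qed
        qed
        also have "\<dots> = (C * (1/2)^n * ?e z) * (M / N)" by simp
        also have "\<dots> \<le> (C * (1/2)^n * ?e z) * (1 / 2)" using C N by (intro mult_left_mono) auto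
        finally have 2: "cmod (V (Suc n) z) \<le> C * (1/2)^Suc n * ?e z" by simp
        show "cmod (Y (Suc n) z) \<le> C * (1/2)^Suc n * ?e z \<and> cmod (V (Suc n) z) \<le> C * (1/2)^Suc n * ?e z"
          using 1 2 by blast
      qed
    qed
    have "continuous_on K ?e" by (intro continuous_intros)
    then have "bounded (?e ` K)" using K(1) compact_continuous_image compact_imp_bounded by blast
    then obtain R where R: "R > 0" "\<And>z. z \<in> K \<Longrightarrow> ?e z \<le> R" unfolding bounded_pos by auto
    have "cmod (Y n y) \<le> (C * R) * (1/2)^n \<and> cmod (V n y) \<le> (C * R) * (1/2)^n" if "y \<in> ball x d \<inter> U" for n y
    proof -
      have y: "y \<in> K" using that K(5) by auto
      have "C * (1/2)^n * ?e y \<le> C * (1/2)^n * R" using R(2)[OF y] C by (intro mult_left_mono) auto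
      then show ?thesis using YV[of n] y by (force simp: mult_ac)
    qed
    moreover have "C * R \<ge> 0" using C R by simp
    ultimately show ?thesis using d(1) by blast
  qed
  have cond: "\<exists>d hh. 0 < d \<and> summable hh \<and> range hh \<subseteq> \<real>\<^sub>\<ge>\<^sub>0 \<and> (\<forall>\<^sub>F n in sequentially. \<forall>y\<in>ball x d \<inter> U. cmod (F n y) \<le> cmod (hh n :: complex))"
    if x: "x \<in> U" and F: "F = Y \<or> F = V" for F x
  proof -
    obtain d B where d: "0 < d" "0 \<le> B" "\<And>n y. y \<in> ball x d \<inter> U \<Longrightarrow> cmod (F n y) \<le> B * (1/2)^n"
      using bound[OF x] F by blast
    have "summable (\<lambda>n. complex_of_real (B * (1/2)^n))"
      unfolding summable_complex_of_real by (intro summable_mult summable_geometric) simp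
    moreover have "range (\<lambda>n. complex_of_real (B * (1/2)^n)) \<subseteq> \<real>\<^sub>\<ge>\<^sub>0" using d(2) by auto
    moreover have "\<forall>\<^sub>F n in sequentially. \<forall>y\<in>ball x d \<inter> U. cmod (F n y) \<le> cmod (complex_of_real (B * (1/2)^n))"
      using d by (simp add: norm_mult norm_power)
    ultimately show ?thesis using d(1) by blast
  qed
  obtain y y' where y: "\<And>x. x \<in> U \<Longrightarrow> (\<lambda>n. Y n x) sums y x \<and> (\<lambda>n. Y' n x) sums y' x \<and> (y has_field_derivative y' x) (at x)"
    using series_and_derivative_comparison_complex[where f = Y and f' = Y', OF U(1) dY(1) cond] by blast
  obtain v v' where v: "\<And>x. x \<in> U \<Longrightarrow> (\<lambda>n. V n x) sums v x \<and> (\<lambda>n. V' n x) sums v' x \<and> (v has_field_derivative v' x) (at x)"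
    using series_and_derivative_comparison_complex[where f = V and f' = V', OF U(1) dY(2) cond] by blast
  have y'v: "y' x = v x" if "x \<in> U" for x
  proof -
    have "(\<lambda>n. Y' (Suc n) x) sums v x" using v[OF that] unfolding Y'_def by simp
    then have "(\<lambda>n. Y' n x) sums (v x + Y' 0 x)" by (rule sums_Suc)
    then show ?thesis using y[OF that] sums_unique2 unfolding Y'_def by fastforce
  qed
  have v'y: "v' x = h x * y x" if "x \<in> U" for x
  proof -
    have "(\<lambda>n. h x * Y n x) sums (h x * y x)" using y[OF that] sums_mult by blast
    then have "(\<lambda>n. V' (Suc n) x) sums (h x * y x)" unfolding V'_def by simp
    then have "(\<lambda>n. V' n x) sums (h x * y x + V' 0 x)" by (rule sums_Suc)
    then show ?thesis using v[OF that] sums_unique2 unfolding V'_def by fastforce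
  qed
  have dy: "deriv y x = v x" if "x \<in> U" for x using y[OF that] y'v[OF that] DERIV_imp_deriv by metis
  have "y holomorphic_on U" using y U(1) holomorphic_on_open by blast
  moreover have "deriv (deriv y) x = h x * y x" if "x \<in> U" for x
  proof -
    have "deriv (deriv y) x = deriv v x"
      by (rule deriv_cong_ev) (use dy that U(1) eventually_nhds in \<open>blast, simp\<close>)
    also have "\<dots> = h x * y x" using v[OF that] v'y[OF that] DERIV_imp_deriv by metis
    finally show ?thesis .
  qed
  moreover have "y z0 = a"
  proof -
    have "Y (Suc n) z0 = 0" for n using I hol unfolding Ys by blast
    then have "(\<lambda>n. Y n z0) sums (0 + Y 0 z0)" by (intro sums_Suc) simp
    then show ?thesis using y[OF U(3)] sums_unique2 Y0 by fastforce
  qed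
  moreover have "deriv y z0 = b"
  proof -
    have "V (Suc n) z0 = 0" for n using I[of "\<lambda>z. h z * Y n z"] hol h unfolding Ys by (auto intro: holomorphic_intros)
    then have "(\<lambda>n. V n z0) sums (0 + V 0 z0)" by (intro sums_Suc) simp
    then show ?thesis using v[OF U(3)] sums_unique2 Y0 dy[OF U(3)] by fastforce
  qed
  ultimately show ?thesis using that by blast
qed

section \<open>Wronskians and Hermitian forms in the solutions\<close>

definition solves :: "(complex \<Rightarrow> complex) \<Rightarrow> complex set \<Rightarrow> (complex \<Rightarrow> complex) \<Rightarrow> bool"
  where "solves h U y \<longleftrightarrow> y holomorphic_on U \<and> (\<forall>z\<in>U. deriv (deriv y) z = h z * y z)"

definition wronskian :: "(complex \<Rightarrow> complex) \<Rightarrow> (complex \<Rightarrow> complex) \<Rightarrow> complex \<Rightarrow> complex"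
  where "wronskian u v z = u z * deriv v z - deriv u z * v z"

lemma solves_deriv:
  assumes "solves h U y" "open U" "z \<in> U"
  shows "(y has_field_derivative deriv y z) (at z)" "(deriv y has_field_derivative h z * y z) (at z)"
  using assms holomorphic_derivI[of y U z] holomorphic_derivI[of "deriv y" U z] holomorphic_deriv[of y U]
  unfolding solves_def by metis+

lemma solves_combination:
  assumes "solves h U u" "solves h U v" "open U"
  shows "solves h U (\<lambda>z. a * u z + b * v z)"
    "z \<in> U \<Longrightarrow> deriv (\<lambda>z. a * u z + b * v z) z = a * deriv u z + b * deriv v z"
proof -
  have 1: "((\<lambda>z. a * u z + b * v z) has_field_derivative a * deriv u z + b * deriv v z) (at z)" if "z \<in> U" for z
    by (intro DERIV_add DERIV_cmult solves_deriv(1)[OF assms(1,3) that] solves_deriv(1)[OF assms(2,3) that])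
  then show 2: "deriv (\<lambda>z. a * u z + b * v z) z = a * deriv u z + b * deriv v z" if "z \<in> U" for z
    using DERIV_imp_deriv that by blast
  have "deriv (deriv (\<lambda>z. a * u z + b * v z)) z = h z * (a * u z + b * v z)" if z: "z \<in> U" for z
  proof -
    have "deriv (deriv (\<lambda>z. a * u z + b * v z)) z = deriv (\<lambda>z. a * deriv u z + b * deriv v z) z"
      by (rule deriv_cong_ev) (use 2 z assms(3) eventually_nhds in \<open>blast, simp\<close>)
    also have "\<dots> = a * (h z * u z) + b * (h z * v z)"
      by (intro DERIV_imp_deriv DERIV_add DERIV_cmult solves_deriv(2)[OF assms(1,3) z] solves_deriv(2)[OF assms(2,3) z])
    finally show ?thesis by (simp add: algebra_simps)
  qed
  then show "solves h U (\<lambda>z. a * u z + b * v z)"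
    unfolding solves_def using 1 assms(3) holomorphic_on_open by blast
qed

lemma wronskian_constant:
  assumes "solves h U u" "solves h U v" "open U" "connected U" "z \<in> U" "w \<in> U"
  shows "wronskian u v z = wronskian u v w"
proof -
  have "(wronskian u v has_field_derivative 0) (at z)" if "z \<in> U" for z
    unfolding wronskian_def[abs_def]
    by (rule derivative_eq_intros solves_deriv[OF assms(1,3) that] solves_deriv[OF assms(2,3) that] | simp)+
  then show ?thesis
    using has_field_derivative_zero_constant[of U] assms DERIV_zero_connected_constant
      has_derivative_zero_unique_connected[of U "wronskian u v" z w]
    by (simp add: has_field_derivative_def lambda_zero)
qed

lemma solves_eq_combination:
  assumes "solves h U y" "solves h U u" "solves h U v" "open U" "connected U" "w \<in> U"
    and W: "wronskian u v w = 1" and z: "z \<in> U"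
  shows "y z = wronskian y v w * u z + wronskian u y w * v z"
proof -
  have "wronskian y v w * u z + wronskian u y w * v z = wronskian u v z * y z"
    unfolding wronskian_constant[OF assms(1,3,4,5,6) z] wronskian_constant[OF assms(2,1,4,5,6) z]
    unfolding wronskian_def by (simp add: algebra_simps)
  then show ?thesis using wronskian_constant[OF assms(2,3,4,5,6) z] W by simp
qed

text \<open>Variation of constants in \<open>z\<close> and in its conjugate, treated as independent
  variables. \<open>A y\<close> is the Wronskian of \<open>f\<close> with \<open>y\<close> in
  \<open>z\<close>, and \<open>B y x\<close> the Wronskian of \<open>A y\<close> with
  \<open>cnj x\<close> in the conjugate variable. Every \<open>B\<close> is constant, and Cramer's
  rule in both variables recovers \<open>f\<close>.\<close>

lemma solves_form_decomposition:
  assumes U: "open U" "connected U" "w \<in> U" and f: "smooth_on f U"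
    and f1: "\<And>z. z \<in> U \<Longrightarrow> dz (dz f) z = h z * f z" and real: "\<And>z. z \<in> U \<Longrightarrow> cnj (f z) = f z"
    and uv: "solves h U u" "solves h U v" "wronskian u v w = 1"
  obtains a b c d where "\<And>z. z \<in> U \<Longrightarrow> f z = a * u z * cnj (u z) + b * u z * cnj (v z) + c * v z * cnj (u z) + d * v z * cnj (v z)"
proof -
  have W: "wronskian u v z = 1" if "z \<in> U" for z
    using wronskian_constant[OF uv(1,2) U(1,2) that U(3)] uv(3) by simp
  define A where "A y z = f z * deriv y z - dz f z * y z" for y z
  define A2 where "A2 y z = dzb f z * deriv y z - dz (dzb f) z * y z" for y z
  define B where "B y x z = A y z * cnj (deriv x z) - A2 y z * cnj (x z)" for y x z
  have f2: "dzb (dzb f) z = cnj (h z) * f z" if z: "z \<in> U" for z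
  proof -
    have "dzb (dzb f) z = dzb (\<lambda>z. cnj (dz f z)) z"
      by (rule dz_cong[OF U(1) z dz_real[OF U(1) _ f real]])
    also have "\<dots> = cnj (dz (dz f) z)"
      by (rule dz_cnj[OF smooth_on_differentiable[OF smooth_on_dz[OF U(1) f] U(1) z]])
    finally show ?thesis using f1[OF z] real[OF z] by simp
  qed
  note wf = smooth_on_has_wirtinger[OF _ U(1)]
  have s: "smooth_on (dz f) U" "smooth_on (dzb f) U" "smooth_on (dz (dzb f)) U"
    by (intro smooth_on_dz smooth_on_dzb U f)+
  have hw: "has_wirtinger y (deriv y z) 0 z" "has_wirtinger (deriv y) (h z * y z) 0 z"
    if "solves h U y" "z \<in> U" for y z
    using has_wirtinger_holomorphic solves_deriv[OF that(1) U(1) that(2)] by blast+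
  have f12: "dzb (dz f) z = dz (dzb f) z" if "z \<in> U" for z by (rule dz2_dir_deriv(3)[OF U(1) f that])
  have f112: "dz (dz (dzb f)) z = h z * dzb f z" if z: "z \<in> U" for z
  proof -
    have "dz (dz (dzb f)) z = dz (dzb (dz f)) z" by (rule dz_cong[OF U(1) z]) (simp add: f12)
    also have "\<dots> = dzb (dz (dz f)) z" by (rule dz2_dir_deriv(3)[OF U(1) s(1) z, symmetric])
    also have "\<dots> = dzb (\<lambda>z. h z * f z) z" by (rule dz_cong[OF U(1) z f1])
    also have "\<dots> = h z * dzb f z"
    proof -
      \<comment> \<open>\<open>h\<close> is not assumed differentiable, but it is a quotient of solutions\<close>
      have "dzb (dz (dz f)) z * 1 = dzb (dz (dz f)) z * wronskian u v z" using W[OF z] by simp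
      have hh: "h z = deriv (deriv u) z * deriv v z - deriv u z * deriv (deriv v) z" if "z \<in> U" for z
        using uv that W[OF that] unfolding solves_def wronskian_def by (simp add: algebra_simps)
      have "(\<lambda>z. deriv (deriv u) z * deriv v z - deriv u z * deriv (deriv v) z) holomorphic_on U"
        using uv U(1) unfolding solves_def by (intro holomorphic_intros) auto
      then have "h holomorphic_on U" using hh holomorphic_cong by (metis (no_types, lifting))
      then have "has_wirtinger h (deriv h z) 0 z"
        using has_wirtinger_holomorphic holomorphic_derivI[OF _ U(1) z] by blast
      from has_wirtinger_imp(2)[OF has_wirtinger_mult[OF this wf[OF f z]]] show ?thesis by simp
    qed
    finally show ?thesis .
  qed
  have f122: "dzb (dz (dzb f)) z = cnj (h z) * dz f z" if z: "z \<in> U" for z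
  proof -
    have hc: "dz (dzb (dzb f)) z = cnj (dzb (dz (dz f)) z)"
    proof -
      have "dz (dzb (dzb f)) z = dz (\<lambda>z. cnj (dz (dz f) z)) z"
        by (rule dz_cong[OF U(1) z]) (use f1 f2 real in simp)
      also have "\<dots> = cnj (dzb (dz (dz f)) z)"
        by (rule dz_cnj[OF smooth_on_differentiable[OF smooth_on_dz[OF U(1) s(1)] U(1) z]])
      finally show ?thesis .
    qed
    have "dzb (dz (dzb f)) z = dz (dzb (dzb f)) z" by (rule dz2_dir_deriv(3)[OF U(1) s(2) z])
    also have "\<dots> = cnj (dz (dz (dzb f)) z)"
    proof -
      have "dzb (dz (dz f)) z = dz (dzb (dz f)) z" by (rule dz2_dir_deriv(3)[OF U(1) s(1) z])
      also have "\<dots> = dz (dz (dzb f)) z" by (rule dz_cong[OF U(1) z]) (simp add: f12)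
      finally show ?thesis using hc by simp
    qed
    also have "\<dots> = cnj (h z) * dz f z" using f112[OF z] dz_real[OF U(1) z f real] by simp
    finally show ?thesis .
  qed
  have wA: "has_wirtinger (A y) 0 (A2 y z) z" if y: "solves h U y" and z: "z \<in> U" for y z
    unfolding A_def[abs_def]
    by (rule has_wirtinger_eq[OF has_wirtinger_diff[OF has_wirtinger_mult[OF wf[OF f z] hw(2)[OF y z]]
          has_wirtinger_mult[OF wf[OF s(1) z] hw(1)[OF y z]]]])
      (simp_all add: f1[OF z] f12[OF z] A2_def)
  have wA2: "has_wirtinger (A2 y) 0 (cnj (h z) * A y z) z" if y: "solves h U y" and z: "z \<in> U" for y z
    unfolding A2_def[abs_def]
    by (rule has_wirtinger_eq[OF has_wirtinger_diff[OF has_wirtinger_mult[OF wf[OF s(2) z] hw(2)[OF y z]]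
          has_wirtinger_mult[OF wf[OF s(3) z] hw(1)[OF y z]]]])
      (simp_all add: f2[OF z] f112[OF z] f122[OF z] A_def algebra_simps)
  have wB: "has_wirtinger (B y x) 0 0 z" if y: "solves h U y" and x: "solves h U x" and z: "z \<in> U" for y x z
    unfolding B_def[abs_def]
    by (rule has_wirtinger_eq[OF has_wirtinger_diff[OF
          has_wirtinger_mult[OF wA[OF y z] has_wirtinger_cnj[OF hw(2)[OF x z]]]
          has_wirtinger_mult[OF wA2[OF y z] has_wirtinger_cnj[OF hw(1)[OF x z]]]]])
      simp_all
  have Bc: "B y x z = B y x w" if "solves h U y" "solves h U x" "z \<in> U" for y x z
    using constant_wirtinger[OF U(2,1) wB[OF that(1,2)] U(3) that(3)] .
  have "f z = B v v w * u z * cnj (u z) + (- B v u w) * u z * cnj (v z) + (- B u v w) * v z * cnj (u z) + B u u w * v z * cnj (v z)"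
    if z: "z \<in> U" for z
  proof -
    \<comment> \<open>Both Wronskian factors are one; expanding the product is Cramer's rule applied
      twice.\<close>
    have "f z = f z * wronskian u v z * cnj (wronskian u v z)" using W[OF z] by simp
    also have "\<dots> = B v v z * u z * cnj (u z) + (- B v u z) * u z * cnj (v z) + (- B u v z) * v z * cnj (u z) + B u u z * v z * cnj (v z)"
      unfolding B_def A_def A2_def wronskian_def by (simp add: algebra_simps)
    finally show ?thesis using Bc[OF uv(2,2) z] Bc[OF uv(2,1) z] Bc[OF uv(1,2) z] Bc[OF uv(1,1) z] by simp
  qed
  then show ?thesis using that by blast
qed

text \<open>Holomorphic and antiholomorphic factors separate: \<open>dz\<close> treats the
  conjugated solutions as constants, and the nonzero Wronskian of \<open>u\<close> and
  \<open>v\<close> kills their coefficients. Conjugation reduces the rest to ordinary linear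
  independence.\<close>

lemma solves_form_independent:
  assumes U: "open U" "w \<in> U" and uv: "u holomorphic_on U" "v holomorphic_on U" "\<And>z. z \<in> U \<Longrightarrow> wronskian u v z \<noteq> 0"
    and f: "\<And>z. z \<in> U \<Longrightarrow> a * u z * cnj (u z) + b * u z * cnj (v z) + c * v z * cnj (u z) + d * v z * cnj (v z) = 0"
  shows "a = 0" "b = 0" "c = 0" "d = 0"
proof -
  have lin: "p = 0 \<and> q = 0" if pq: "\<And>z. z \<in> U \<Longrightarrow> p * u z + q * v z = 0" for p q
  proof -
    have "((\<lambda>z. p * u z + q * v z) has_field_derivative p * deriv u w + q * deriv v w) (at w)"
      by (intro DERIV_add DERIV_cmult holomorphic_derivI[OF _ U] uv)
    moreover have "((\<lambda>z. p * u z + q * v z) has_field_derivative 0) (at w)"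
      by (rule has_field_derivative_transform_within_open[OF DERIV_const[of 0] U]) (simp add: pq)
    ultimately have d: "p * deriv u w + q * deriv v w = 0" by (rule DERIV_unique)
    note e = pq[OF U(2)]
    have "p * wronskian u v w = 0" "q * wronskian u v w = 0"
      unfolding wronskian_def using d e by algebra+
    then show ?thesis using uv(3)[OF U(2)] by simp
  qed
  have uz: "a * cnj (u z) + b * cnj (v z) = 0 \<and> c * cnj (u z) + d * cnj (v z) = 0" if z: "z \<in> U" for z
  proof -
    let ?F = "\<lambda>z. u z * (a * cnj (u z) + b * cnj (v z)) + v z * (c * cnj (u z) + d * cnj (v z))"
    have hw: "has_wirtinger y (deriv y z) 0 z" if "y holomorphic_on U" for y
      using has_wirtinger_holomorphic holomorphic_derivI[OF that U(1) z] by blast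
    have "has_wirtinger (\<lambda>z. a * cnj (u z) + b * cnj (v z)) 0 (a * cnj (deriv u z) + b * cnj (deriv v z)) z" for a b
      using has_wirtinger_add[OF has_wirtinger_cmult[OF has_wirtinger_cnj[OF hw[OF uv(1)]], of a] has_wirtinger_cmult[OF has_wirtinger_cnj[OF hw[OF uv(2)]], of b]]
      by simp
    from has_wirtinger_imp(1)[OF has_wirtinger_add[OF has_wirtinger_mult[OF hw[OF uv(1)] this[of a b]] has_wirtinger_mult[OF hw[OF uv(2)] this[of c d]]]]
    have "dz ?F z = deriv u z * (a * cnj (u z) + b * cnj (v z)) + deriv v z * (c * cnj (u z) + d * cnj (v z))" by simp
    moreover have "dz ?F z = 0"
    proof -
      have "dz ?F z = dz (\<lambda>z. 0) z"
      proof (rule dz_cong(1)[OF U(1) z])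
        fix y assume "y \<in> U"
        then show "?F y = 0" using f[of y] by (simp add: algebra_simps)
      qed
      then show ?thesis using has_wirtinger_imp(1)[OF has_wirtinger_const] by simp
    qed
    ultimately have 1: "deriv u z * (a * cnj (u z) + b * cnj (v z)) + deriv v z * (c * cnj (u z) + d * cnj (v z)) = 0" by simp
    have 2: "u z * (a * cnj (u z) + b * cnj (v z)) + v z * (c * cnj (u z) + d * cnj (v z)) = 0"
      using f[OF z] by (simp add: algebra_simps)
    have "wronskian u v z * (a * cnj (u z) + b * cnj (v z)) = 0" "wronskian u v z * (c * cnj (u z) + d * cnj (v z)) = 0"
      unfolding wronskian_def using 1 2 by algebra+
    then show ?thesis using uv(3)[OF z] by simp
  qed
  have "cnj a * u z + cnj b * v z = 0" "cnj c * u z + cnj d * v z = 0" if "z \<in> U" for z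
    using arg_cong[OF conjunct1[OF uz[OF that]], of cnj] arg_cong[OF conjunct2[OF uz[OF that]], of cnj] by simp_all
  then show "a = 0" "b = 0" "c = 0" "d = 0"
    using lin[of "cnj a" "cnj b"] lin[of "cnj c" "cnj d"] by auto
qed

section \<open>Periodic equations on a half-plane\<close>

text \<open>
  A punctured disc \<open>0 < |t| < exp a\<close> is studied through \<open>t = exp \<zeta>\<close> on the half-plane
  \<open>Re \<zeta> < a\<close>.
\<close>

abbreviation half_plane :: "real \<Rightarrow> complex set"
  where "half_plane a \<equiv> {\<zeta>. Re \<zeta> < a}"

abbreviation period :: complex
  where "period \<equiv> 2 * of_real pi * \<i>"

lemma exp_period: "exp (\<zeta> + period) = exp \<zeta>"
  by (simp add: exp_add)

lemma periodic_int:
  fixes f :: "complex \<Rightarrow> complex"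
  assumes "\<And>\<zeta>. Re \<zeta> < a \<Longrightarrow> f (\<zeta> + period) = f \<zeta>" "Re \<zeta> < a" "exp \<zeta> = exp \<omega>"
  shows "f \<zeta> = f \<omega>"
proof -
  have n: "f (\<zeta> + of_nat n * period) = f \<zeta>" if "Re \<zeta> < a" for n \<zeta>
  proof (induction n)
    case (Suc n)
    have "f (\<zeta> + of_nat n * period + period) = f (\<zeta> + of_nat n * period)"
      using that by (intro assms(1)) simp
    then show ?case using Suc by (simp add: algebra_simps)
  qed simp
  obtain m :: int where m: "\<zeta> = \<omega> + of_int (2 * m) * pi * \<i>" using assms(3) exp_eq by blast
  have r: "Re \<omega> < a" using m assms(2) by simp
  show ?thesis
  proof (cases "m \<ge> 0")
    case True
    then have "\<zeta> = \<omega> + of_nat (nat m) * period" using m by simp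
    then show ?thesis using n[OF r, of "nat m"] by metis
  next
    case False
    then have "\<omega> = \<zeta> + of_nat (nat (-m)) * period" using m by simp
    then show ?thesis using n[OF assms(2), of "nat (-m)"] by metis
  qed
qed

text \<open>The function is \<open>f\<close> composed with \<open>Ln\<close>, which jumps across the
  negative axis. Near \<open>t0\<close> the branch \<open>Ln (t / t0) + Ln t0\<close> is
  holomorphic, and by periodicity \<open>f\<close> does not distinguish the two.\<close>

lemma periodic_descend:
  assumes f: "f holomorphic_on half_plane a" "\<And>\<zeta>. Re \<zeta> < a \<Longrightarrow> f (\<zeta> + period) = f \<zeta>"
  obtains k where "k holomorphic_on ball 0 (exp a) - {0}" "\<And>\<zeta>. Re \<zeta> < a \<Longrightarrow> f \<zeta> = k (exp \<zeta>)"
proof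
  let ?k = "\<lambda>t. f (Ln t)"
  show k: "f \<zeta> = ?k (exp \<zeta>)" if "Re \<zeta> < a" for \<zeta>
    by (rule periodic_int[where f = f and a = a, OF f(2) that]) simp_all
  have "?k field_differentiable (at t0)" if t0: "t0 \<in> ball 0 (exp a) - {0}" for t0
  proof -
    let ?g = "\<lambda>t. Ln (t / t0) + Ln t0"
    define S where "S = (ball 0 (exp a) - {0}) \<inter> ball t0 (cmod t0)"
    have S: "open S" "t0 \<in> S" using t0 unfolding S_def by auto
    have Re: "Re (?g t) < a" and ex: "exp (?g t) = t" if "t \<in> S" for t
    proof -
      have "t \<noteq> 0" "cmod t < exp a" using that unfolding S_def by auto
      then show "exp (?g t) = t" using t0 by (simp add: exp_add)
      have "Re (?g t) = ln (cmod t)" using \<open>t \<noteq> 0\<close> t0 by (simp add: norm_divide ln_div)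
      also have "\<dots> < a" using \<open>cmod t < exp a\<close> \<open>t \<noteq> 0\<close> by (metis ln_exp ln_less_cancel_iff exp_gt_zero zero_less_norm_iff)
      finally show "Re (?g t) < a" .
    qed
    have "t0 / t0 \<notin> \<real>\<^sub>\<le>\<^sub>0" using t0 by simp
    then have "?g field_differentiable (at t0)" using t0 by (intro derivative_intros field_differentiable_compose[of "\<lambda>t. t / t0" t0 Ln, unfolded o_def] field_differentiable_at_Ln) auto
    moreover have "f field_differentiable (at (?g t0))"
      using f(1) Re[OF S(2)] open_halfspace_Re_lt holomorphic_on_imp_differentiable_at by blast
    ultimately have "(\<lambda>t. f (?g t)) field_differentiable (at t0)"
      using field_differentiable_compose[of ?g t0 f] by (simp add: o_def)
    then obtain D where "((\<lambda>t. f (?g t)) has_field_derivative D) (at t0)" unfolding field_differentiable_def by blast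
    then have "(?k has_field_derivative D) (at t0)"
      by (rule has_field_derivative_transform_within_open[OF _ S]) (use k Re ex in metis)
    then show ?thesis unfolding field_differentiable_def by blast
  qed
  then show "?k holomorphic_on ball 0 (exp a) - {0}"
    by (auto simp: holomorphic_on_def intro: field_differentiable_at_within)
qed

text \<open>A power of \<open>t = exp \<zeta>\<close> times a convergent power series with nonzero
  constant term. The exponent is real because the multipliers that occur have modulus one.\<close>

definition exponent_form :: "real \<Rightarrow> real \<Rightarrow> (complex \<Rightarrow> complex) \<Rightarrow> (complex \<Rightarrow> complex) \<Rightarrow> bool"
  where "exponent_form a \<sigma> k e \<longleftrightarrow> k holomorphic_on ball 0 (exp a) \<and> k 0 \<noteq> 0 \<and>
    (\<forall>\<zeta>. Re \<zeta> < a \<longrightarrow> e \<zeta> = exp (of_real \<sigma> * \<zeta>) * k (exp \<zeta>))"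

lemma holomorphic_extend_bounded:
  assumes "f holomorphic_on S - {\<xi>}" "open S" "\<xi> \<in> S" "\<forall>\<^sub>F z in at \<xi>. cmod (f z) \<le> C"
  obtains g where "g holomorphic_on S" "\<And>z. z \<in> S - {\<xi>} \<Longrightarrow> g z = f z"
proof -
  have "\<exists>B. \<forall>\<^sub>F z in at \<xi>. cmod (f z) \<le> B" using assms(4) by blast
  moreover have "\<xi> \<in> interior S" using assms by (simp add: interior_open)
  ultimately have "\<exists>g. g holomorphic_on S \<and> (\<forall>z\<in>S - {\<xi>}. g z = f z)"
    using holomorphic_on_extend_bounded[OF assms(1)] by simp
  then show ?thesis using that by blast
qed

text \<open>Division by \<open>exp (s * \<zeta>)\<close> makes \<open>e\<close> single-valued in
  \<open>t\<close>. Exponential growth in the real part of \<zeta> is power growth in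
  \<open>t\<close>, so the singularity is at most a pole, whose order is moved into the
  exponent.\<close>

lemma exponent_form_exists:
  assumes e: "e holomorphic_on half_plane a" "\<And>\<zeta>. Re \<zeta> < a \<Longrightarrow> e (\<zeta> + period) = \<mu> * e \<zeta>" "cmod \<mu> = 1"
    and nz: "Re \<zeta>0 < a" "e \<zeta>0 \<noteq> 0"
    and growth: "\<And>\<zeta>. Re \<zeta> \<le> a0 \<Longrightarrow> cmod (e \<zeta>) \<le> C * exp (N * \<bar>Re \<zeta>\<bar>)"
  obtains \<sigma> k where "exponent_form a \<sigma> k e" "\<mu> = exp (of_real \<sigma> * period)"
proof -
  obtain \<theta> where \<theta>: "\<mu> = exp (\<i> * of_real \<theta>)"
    using e(3) by (metis complex_norm_eq_1_exp)
  define s where "s = \<theta> / (2 * pi)"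
  have s: "\<mu> = exp (of_real s * period)" unfolding \<theta> s_def by (simp add: field_simps)
  define p where "p \<zeta> = e \<zeta> * exp (- (of_real s * \<zeta>))" for \<zeta>
  have "p holomorphic_on half_plane a" unfolding p_def[abs_def] by (intro holomorphic_intros e)
  moreover have "p (\<zeta> + period) = p \<zeta>" if "Re \<zeta> < a" for \<zeta>
  proof -
    have "exp (of_real s * period) * exp (- (of_real s * (\<zeta> + period))) = exp (- (of_real s * \<zeta>))"
      by (simp add: mult_exp_exp algebra_simps)
    then show ?thesis unfolding p_def using e(2)[OF that] s by (metis mult.assoc mult.commute)
  qed
  ultimately obtain k0 where k0: "k0 holomorphic_on ball 0 (exp a) - {0}" "\<And>\<zeta>. Re \<zeta> < a \<Longrightarrow> p \<zeta> = k0 (exp \<zeta>)"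
    using periodic_descend by blast
  \<comment> \<open>Large enough that \<open>exp ((m - N - s) * x)\<close> is at most one for
    negative \<open>x\<close>, hence that \<open>t ^ m\<close> removes the pole.\<close>
  define m where "m = nat \<lceil>\<bar>N\<bar> + \<bar>s\<bar>\<rceil>"
  have m: "real m \<ge> \<bar>N\<bar> + \<bar>s\<bar>" unfolding m_def by linarith
  define b where "b = min a0 (min 0 (a - 1))"
  have C0: "C \<ge> 0"
  proof -
    have "0 \<le> C * exp (N * \<bar>Re (of_real a0)\<bar>)"
      by (rule order_trans[OF norm_ge_zero growth]) simp
    then show ?thesis by (simp add: zero_le_mult_iff)
  qed
  have bd: "cmod (t ^ m * k0 t) \<le> C" if t: "t \<noteq> 0" "cmod t \<le> exp b" for t
  proof -
    define x where "x = ln (cmod t)"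
    have x: "x \<le> b" using t unfolding x_def by (metis ln_exp ln_le_cancel_iff exp_gt_zero zero_less_norm_iff)
    have r: "Re (Ln t) = x" "exp (Ln t) = t" using t unfolding x_def by auto
    have x0: "x \<le> 0" "x \<le> a0" "x < a" using x unfolding b_def by auto
    have "k0 t = p (Ln t)" using k0(2)[of "Ln t"] r x0 by simp
    then have "cmod (k0 t) = cmod (e (Ln t)) * exp (- s * x)" unfolding p_def using r by (simp add: norm_mult)
    also have "\<dots> \<le> C * exp (N * \<bar>x\<bar>) * exp (- s * x)"
      using growth[of "Ln t"] r x0 by (intro mult_right_mono) auto
    also have "\<dots> = C * exp (N * (- x) + - s * x)" using x0 by (simp add: mult_exp_exp)
    finally have "cmod (k0 t) \<le> C * exp (N * (- x) + - s * x)" .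
    moreover have "cmod t = exp x" using t unfolding x_def by simp
    then have "cmod (t ^ m) = exp (real m * x)" by (simp only: norm_power exp_of_nat_mult)
    ultimately have "cmod (t ^ m * k0 t) \<le> exp (real m * x) * (C * exp (N * (- x) + - s * x))"
      by (simp add: norm_mult mult_left_mono)
    also have "\<dots> = C * exp ((real m - N - s) * x)" by (simp add: mult_exp_exp algebra_simps)
    also have "\<dots> \<le> C * 1"
    proof (rule mult_left_mono[OF _ C0])
      have "(real m - N - s) * x \<le> 0" using m x0 by (intro mult_nonneg_nonpos) linarith+
      then show "exp ((real m - N - s) * x) \<le> 1" by simp
    qed
    finally show ?thesis by simp
  qed
  have h1: "(\<lambda>t. t ^ m * k0 t) holomorphic_on ball 0 (exp a) - {0}" by (intro holomorphic_intros k0)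
  have h3: "\<forall>\<^sub>F t in at 0. cmod (t ^ m * k0 t) \<le> C"
    unfolding eventually_at using bd by (intro exI[of _ "exp b"]) auto
  obtain g where g: "g holomorphic_on ball 0 (exp a)" "\<And>t. t \<in> ball 0 (exp a) - {0} \<Longrightarrow> g t = t ^ m * k0 t"
    using holomorphic_extend_bounded[OF h1 open_ball _ h3] by auto
  \<comment> \<open>Without a point where \<open>e\<close> does not vanish, \<open>g\<close> could
    be zero and would have no order.\<close>
  have gnz: "g (exp \<zeta>0) \<noteq> 0" using g(2)[of "exp \<zeta>0"] k0(2)[OF nz(1)] nz unfolding p_def by auto
  define n where "n = nat (zorder g 0)"
  obtain r where r: "r > 0" "cball (0::complex) r \<subseteq> ball 0 (exp a)" "zor_poly g 0 holomorphic_on cball 0 r"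
    "\<And>w. w \<in> cball 0 r \<Longrightarrow> g w = zor_poly g 0 w * w ^ n \<and> zor_poly g 0 w \<noteq> 0"
  proof -
    have 1: "\<exists>w\<in>ball 0 (exp a). g w \<noteq> 0" using gnz nz(1) by (intro bexI[of _ "exp \<zeta>0"]) auto
    have 2: "(0::complex) \<in> ball 0 (exp a)" by simp
    note conjunct2[OF zorder_exist_zero[OF g(1) open_ball connected_ball 2 1]]
    then obtain r where "r > 0" "cball (0::complex) r \<subseteq> ball 0 (exp a)" "zor_poly g 0 holomorphic_on cball 0 r"
      "\<forall>w\<in>cball 0 r. g w = zor_poly g 0 w * (w - 0) ^ nat (zorder g 0) \<and> zor_poly g 0 w \<noteq> 0"
      by (elim exE conjE) (rule that)
    then show ?thesis using that[of r] unfolding n_def by simp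
  qed
  define k where "k t = (if t = 0 then zor_poly g 0 0 else g t / t ^ n)" for t
  have kh: "k t = zor_poly g 0 t" if "t \<in> ball 0 r" for t
    using r(4)[of t] that unfolding k_def by auto
  have "k holomorphic_on ball 0 (exp a) - {0}"
  proof -
    have "(\<lambda>t. g t / t ^ n) holomorphic_on ball 0 (exp a) - {0}"
      by (intro holomorphic_intros holomorphic_on_subset[OF g(1)]) auto
    then show ?thesis by (rule holomorphic_transform) (auto simp: k_def)
  qed
  moreover have "k holomorphic_on ball 0 r"
    using holomorphic_on_subset[OF r(3), of "ball 0 r"] holomorphic_transform[of _ "ball 0 r" k] kh by auto
  ultimately have "k holomorphic_on (ball 0 (exp a) - {0}) \<union> ball 0 r"
    by (intro holomorphic_on_Un) auto
  then have kh2: "k holomorphic_on ball 0 (exp a)"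
    by (rule holomorphic_on_subset) (use r(1) in auto)
  \<comment> \<open>The exponent of the multiplier, corrected by the order \<open>n\<close> of the
    zero of \<open>g\<close> and by the power \<open>m\<close> multiplied in. The correction is an
    integer, so the multiplier stays the same.\<close>
  define \<sigma> where "\<sigma> = s + real n - real m"
  have "e \<zeta> = exp (of_real \<sigma> * \<zeta>) * k (exp \<zeta>)" if z: "Re \<zeta> < a" for \<zeta>
  proof -
    have "g (exp \<zeta>) = exp \<zeta> ^ m * p \<zeta>" using g(2)[of "exp \<zeta>"] k0(2)[OF z] z by auto
    then have "exp \<zeta> ^ n * k (exp \<zeta>) = exp \<zeta> ^ m * p \<zeta>" unfolding k_def by simp
    then have "exp (of_nat m * \<zeta>) * p \<zeta> = exp (of_nat n * \<zeta>) * k (exp \<zeta>)" by (simp add: exp_of_nat_mult)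
    then have "exp (- (of_nat m * \<zeta>)) * exp (of_real s * \<zeta>) * (exp (of_nat m * \<zeta>) * p \<zeta>)
       = exp (- (of_nat m * \<zeta>)) * exp (of_real s * \<zeta>) * (exp (of_nat n * \<zeta>) * k (exp \<zeta>))" by simp
    moreover have "exp (- (of_nat m * \<zeta>)) * exp (of_real s * \<zeta>) * (exp (of_nat m * \<zeta>) * p \<zeta>) = e \<zeta>"
      unfolding p_def by (simp add: exp_minus field_simps)
    moreover have "exp (- (of_nat m * \<zeta>)) * exp (of_real s * \<zeta>) * (exp (of_nat n * \<zeta>) * k (exp \<zeta>)) = exp (of_real \<sigma> * \<zeta>) * k (exp \<zeta>)"
      unfolding \<sigma>_def mult.assoc[symmetric] by (simp add: mult_exp_exp algebra_simps)
    ultimately show ?thesis by simp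
  qed
  moreover have "k 0 \<noteq> 0" using r(4)[of 0] r(1) unfolding k_def by simp
  ultimately have "exponent_form a \<sigma> k e" unfolding exponent_form_def using kh2 by blast
  moreover have "\<mu> = exp (of_real \<sigma> * period)"
  proof -
    have "exp (of_real \<sigma> * period) = exp (of_real s * period) * (exp (of_nat n * period) / exp (of_nat m * period))"
      unfolding \<sigma>_def by (simp add: algebra_simps exp_add exp_diff)
    moreover have "exp (of_nat j * period) = 1" for j :: nat
      unfolding exp_eq_1 by (auto intro!: exI[of _ "int j"])
    ultimately show ?thesis using s by simp
  qed
  ultimately show ?thesis using that by blast
qed

text \<open>This is \<open>(t d/dt + \<sigma>)^2 k\<close>, the second derivative in \<zeta> after
  the factor \<open>exp (\<sigma> * \<zeta>)\<close> has been removed.\<close>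

definition theta_op :: "real \<Rightarrow> (complex \<Rightarrow> complex) \<Rightarrow> complex \<Rightarrow> complex"
  where "theta_op \<sigma> k t = t\<^sup>2 * deriv (deriv k) t + (1 + 2 * of_real \<sigma>) * t * deriv k t + (of_real \<sigma>)\<^sup>2 * k t"

lemma exponent_form_deriv:
  assumes e: "exponent_form a \<sigma> k e" and z: "Re \<zeta> < a"
  shows "deriv e \<zeta> = exp (of_real \<sigma> * \<zeta>) * (of_real \<sigma> * k (exp \<zeta>) + exp \<zeta> * deriv k (exp \<zeta>))"
    "deriv (deriv e) \<zeta> = exp (of_real \<sigma> * \<zeta>) * theta_op \<sigma> k (exp \<zeta>)"
proof -
  have k: "k holomorphic_on ball 0 (exp a)" using e unfolding exponent_form_def by blast
  let ?e1 = "\<lambda>\<zeta>. exp (of_real \<sigma> * \<zeta>) * (of_real \<sigma> * k (exp \<zeta>) + exp \<zeta> * deriv k (exp \<zeta>))"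
  have dk: "((\<lambda>\<zeta>. f (exp \<zeta>)) has_field_derivative deriv f (exp \<zeta>) * exp \<zeta>) (at \<zeta>)"
    if "f holomorphic_on ball 0 (exp a)" "Re \<zeta> < a" for \<zeta> f
    by (rule DERIV_chain2[of f "deriv f (exp \<zeta>)" exp]) (use that in \<open>auto intro!: holomorphic_derivI derivative_eq_intros\<close>)
  have op: "open (half_plane a)" by (rule open_halfspace_Re_lt)
  have d1: "(e has_field_derivative ?e1 \<zeta>) (at \<zeta>)" if z: "Re \<zeta> < a" for \<zeta>
  proof (rule has_field_derivative_transform_within_open[OF _ op])
    show "((\<lambda>\<zeta>. exp (of_real \<sigma> * \<zeta>) * k (exp \<zeta>)) has_field_derivative ?e1 \<zeta>) (at \<zeta>)"
      by (rule derivative_eq_intros dk[OF k z] refl)+ (simp add: algebra_simps)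
    show "exp (of_real \<sigma> * x) * k (exp x) = e x" if "x \<in> half_plane a" for x
      using e that unfolding exponent_form_def by simp
  qed (use z in simp)
  then show "deriv e \<zeta> = ?e1 \<zeta>" using z DERIV_imp_deriv by blast
  have "(deriv e has_field_derivative exp (of_real \<sigma> * \<zeta>) * theta_op \<sigma> k (exp \<zeta>)) (at \<zeta>)"
  proof (rule has_field_derivative_transform_within_open[OF _ op])
    have "deriv k holomorphic_on ball 0 (exp a)" using k by (intro holomorphic_deriv) auto
    note dk' = dk[OF k z] dk[OF this z]
    show "(?e1 has_field_derivative exp (of_real \<sigma> * \<zeta>) * theta_op \<sigma> k (exp \<zeta>)) (at \<zeta>)"
      by (rule derivative_eq_intros dk' refl)+ (simp add: theta_op_def algebra_simps power2_eq_square)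
    show "?e1 x = deriv e x" if "x \<in> half_plane a" for x
      using d1 that DERIV_imp_deriv by (metis mem_Collect_eq)
  qed (use z in simp)
  then show "deriv (deriv e) \<zeta> = exp (of_real \<sigma> * \<zeta>) * theta_op \<sigma> k (exp \<zeta>)" by (rule DERIV_imp_deriv)
qed

lemma exponent_form_equation:
  assumes "exponent_form a \<sigma> k e" "solves h (half_plane a) e" "Re \<zeta> < a"
  shows "theta_op \<sigma> k (exp \<zeta>) = h \<zeta> * k (exp \<zeta>)"
proof -
  have "exp (of_real \<sigma> * \<zeta>) * theta_op \<sigma> k (exp \<zeta>) = h \<zeta> * (exp (of_real \<sigma> * \<zeta>) * k (exp \<zeta>))"
    using exponent_form_deriv(2)[OF assms(1,3)] assms unfolding solves_def exponent_form_def by auto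
  then show ?thesis by simp
qed

lemma holomorphic_theta_op: "k holomorphic_on ball 0 r \<Longrightarrow> theta_op \<sigma> k holomorphic_on ball 0 r"
  unfolding theta_op_def[abs_def] by (intro holomorphic_intros) auto

text \<open>The indicial equation read backwards: as \<open>k\<close> does not vanish at 0, the
  coefficient is the quotient of \<open>theta_op \<sigma> k\<close> and \<open>k\<close>. One
  solution with an exponent thus forces the coefficient to be regular at the puncture.\<close>

lemma exponent_form_limit:
  assumes e: "exponent_form a \<sigma> k e" "solves h (half_plane a) e" and R: "\<And>\<zeta>. Re \<zeta> < a \<Longrightarrow> h \<zeta> = R (exp \<zeta>)"
  shows "(R \<longlongrightarrow> (of_real \<sigma>)\<^sup>2) (at 0)"
proof -
  have k: "k holomorphic_on ball 0 (exp a)" "k 0 \<noteq> 0" using e(1) unfolding exponent_form_def by auto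
  have k0: "(k \<longlongrightarrow> k 0) (at 0)" "(theta_op \<sigma> k \<longlongrightarrow> theta_op \<sigma> k 0) (at 0)"
    using holomorphic_on_imp_continuous_on[OF k(1)] holomorphic_on_imp_continuous_on[OF holomorphic_theta_op[OF k(1)]]
    by (auto simp: continuous_on_eq_continuous_at isCont_def)
  have "((\<lambda>t. theta_op \<sigma> k t / k t) \<longlongrightarrow> theta_op \<sigma> k 0 / k 0) (at 0)" by (intro tendsto_divide k0 k(2))
  moreover have "\<forall>\<^sub>F t in at 0. theta_op \<sigma> k t / k t = R t"
  proof -
    have 1: "\<forall>\<^sub>F t in at 0. k t \<noteq> 0" using tendsto_imp_eventually_ne[OF k0(1) k(2)] .
    have 2: "\<forall>\<^sub>F t in at 0. t \<in> ball 0 (exp a) - {0}" by (rule eventually_at_in_open) auto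
    show ?thesis using 1 2
    proof eventually_elim
      case (elim t)
      have t: "t \<noteq> 0" "cmod t < exp a" using elim(2) by auto
      then have r: "Re (Ln t) < a" by (metis Re_Ln exp_gt_zero ln_exp ln_less_cancel_iff zero_less_norm_iff)
      show ?case using exponent_form_equation[OF e r] R[OF r] t elim(1) by simp
    qed
  qed
  ultimately have "(R \<longlongrightarrow> theta_op \<sigma> k 0 / k 0) (at 0)" by (rule Lim_transform_eventually)
  then show ?thesis unfolding theta_op_def using k(2) by simp
qed

section \<open>Monodromy around the puncture\<close>

lemma shift_solves:
  assumes "solves h (half_plane a) y" "\<And>\<zeta>. Re \<zeta> < a \<Longrightarrow> h (\<zeta> + period) = h \<zeta>"
  shows "solves h (half_plane a) (\<lambda>\<zeta>. y (\<zeta> + period))"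
    "Re \<zeta> < a \<Longrightarrow> deriv (\<lambda>\<zeta>. y (\<zeta> + period)) \<zeta> = deriv y (\<zeta> + period)"
proof -
  have op: "open (half_plane a)" by (rule open_halfspace_Re_lt)
  have d: "((\<lambda>\<zeta>. f (\<zeta> + period)) has_field_derivative D) (at \<zeta>)"
    if "(f has_field_derivative D) (at (\<zeta> + period))" for f D \<zeta>
    using DERIV_shift[of f D \<zeta> period] that by simp
  have 1: "((\<lambda>\<zeta>. y (\<zeta> + period)) has_field_derivative deriv y (\<zeta> + period)) (at \<zeta>)" if "Re \<zeta> < a" for \<zeta>
    by (rule d, rule solves_deriv(1)[OF assms(1) op]) (use that in simp)
  then show 2: "deriv (\<lambda>\<zeta>. y (\<zeta> + period)) \<zeta> = deriv y (\<zeta> + period)" if "Re \<zeta> < a" for \<zeta>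
    using DERIV_imp_deriv that by blast
  have "deriv (deriv (\<lambda>\<zeta>. y (\<zeta> + period))) \<zeta> = h \<zeta> * y (\<zeta> + period)" if z: "Re \<zeta> < a" for \<zeta>
  proof (rule DERIV_imp_deriv, rule has_field_derivative_transform_within_open[OF _ op])
    show "((\<lambda>\<zeta>. deriv y (\<zeta> + period)) has_field_derivative h \<zeta> * y (\<zeta> + period)) (at \<zeta>)"
      by (rule d) (use solves_deriv(2)[OF assms(1) op, of "\<zeta> + period"] assms(2)[OF z] z in simp)
  qed (use z 2 in auto)
  then show "solves h (half_plane a) (\<lambda>\<zeta>. y (\<zeta> + period))"
    unfolding solves_def using 1 op holomorphic_on_open by blast
qed

lemma solution_partner:
  assumes u: "solves h (half_plane a) u" and h: "h holomorphic_on half_plane a"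
    and nz: "Re \<zeta>0 < a" "u \<zeta>0 \<noteq> 0"
  obtains v where "solves h (half_plane a) v" "\<And>\<zeta>. Re \<zeta> < a \<Longrightarrow> wronskian u v \<zeta> = 1"
proof -
  have op: "open (half_plane a)" and cv: "convex (half_plane a)"
    by (rule open_halfspace_Re_lt convex_halfspace_Re_lt)+
  obtain v where v: "v holomorphic_on half_plane a" "\<And>z. z \<in> half_plane a \<Longrightarrow> deriv (deriv v) z = h z * v z"
    "v \<zeta>0 = 0" "deriv v \<zeta>0 = 1 / u \<zeta>0"
    using linear_ode_exists[OF op cv _ h, of \<zeta>0 0 "1 / u \<zeta>0"] nz(1) by auto
  have sv: "solves h (half_plane a) v" unfolding solves_def using v by blast
  have "wronskian u v \<zeta> = 1" if "Re \<zeta> < a" for \<zeta>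
    using wronskian_constant[OF u sv op convex_connected[OF cv], of \<zeta> \<zeta>0] that nz v(3,4)
    by (simp add: wronskian_def[of u v \<zeta>0])
  then show ?thesis using that[OF sv] by blast
qed

lemma fundamental_system:
  assumes h: "h holomorphic_on half_plane a"
  obtains u v where "solves h (half_plane a) u" "solves h (half_plane a) v"
    "\<And>\<zeta>. Re \<zeta> < a \<Longrightarrow> wronskian u v \<zeta> = 1"
proof -
  let ?z = "of_real (a - 1) :: complex"
  have op: "open (half_plane a)" and cv: "convex (half_plane a)"
    by (rule open_halfspace_Re_lt convex_halfspace_Re_lt)+
  obtain u where u: "u holomorphic_on half_plane a" "\<And>z. z \<in> half_plane a \<Longrightarrow> deriv (deriv u) z = h z * u z" "u ?z = 1"
    using linear_ode_exists[OF op cv _ h, of ?z 1 0] by auto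
  have su: "solves h (half_plane a) u" unfolding solves_def using u by blast
  obtain v where "solves h (half_plane a) v" "\<And>\<zeta>. Re \<zeta> < a \<Longrightarrow> wronskian u v \<zeta> = 1"
    using solution_partner[OF su h, of ?z] u(3) by auto
  then show ?thesis using that su by blast
qed

text \<open>The determinant is one because the shift by a period carries a pair with Wronskian one
  to another such pair.\<close>

lemma monodromy_matrix:
  assumes uv: "solves h (half_plane a) u" "solves h (half_plane a) v" "\<And>\<zeta>. Re \<zeta> < a \<Longrightarrow> wronskian u v \<zeta> = 1"
    and per: "\<And>\<zeta>. Re \<zeta> < a \<Longrightarrow> h (\<zeta> + period) = h \<zeta>"
  obtains p q r s where "\<And>\<zeta>. Re \<zeta> < a \<Longrightarrow> u (\<zeta> + period) = p * u \<zeta> + q * v \<zeta>"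
    "\<And>\<zeta>. Re \<zeta> < a \<Longrightarrow> v (\<zeta> + period) = r * u \<zeta> + s * v \<zeta>" "p * s - q * r = 1"
proof -
  have op: "open (half_plane a)" and co: "connected (half_plane a)"
    by (rule open_halfspace_Re_lt connected_halfspace_Re_lt)+
  let ?w = "of_real (a - 1) :: complex"
  have w: "?w \<in> half_plane a" by simp
  have W: "wronskian u v ?w = 1" using uv(3) by simp
  define p where "p = wronskian (\<lambda>\<zeta>. u (\<zeta> + period)) v ?w"
  define q where "q = wronskian u (\<lambda>\<zeta>. u (\<zeta> + period)) ?w"
  define r where "r = wronskian (\<lambda>\<zeta>. v (\<zeta> + period)) v ?w"
  define s where "s = wronskian u (\<lambda>\<zeta>. v (\<zeta> + period)) ?w"
  have 1: "u (\<zeta> + period) = p * u \<zeta> + q * v \<zeta>" if "Re \<zeta> < a" for \<zeta>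
    using solves_eq_combination[OF shift_solves(1)[OF uv(1) per] uv(1,2) op co w W, of \<zeta>] that unfolding p_def q_def by simp
  have 2: "v (\<zeta> + period) = r * u \<zeta> + s * v \<zeta>" if "Re \<zeta> < a" for \<zeta>
    using solves_eq_combination[OF shift_solves(1)[OF uv(2) per] uv(1,2) op co w W, of \<zeta>] that unfolding r_def s_def by simp
  have d: "deriv u (?w + period) = p * deriv u ?w + q * deriv v ?w" "deriv v (?w + period) = r * deriv u ?w + s * deriv v ?w"
  proof -
    have "deriv (\<lambda>\<zeta>. u (\<zeta> + period)) ?w = deriv (\<lambda>\<zeta>. p * u \<zeta> + q * v \<zeta>) ?w"
      by (rule deriv_cong_ev) (use 1 w op eventually_nhds in \<open>blast, simp\<close>)
    then show "deriv u (?w + period) = p * deriv u ?w + q * deriv v ?w"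
      using shift_solves(2)[OF uv(1) per, of ?w] solves_combination(2)[OF uv(1,2) op w] by simp
    have "deriv (\<lambda>\<zeta>. v (\<zeta> + period)) ?w = deriv (\<lambda>\<zeta>. r * u \<zeta> + s * v \<zeta>) ?w"
      by (rule deriv_cong_ev) (use 2 w op eventually_nhds in \<open>blast, simp\<close>)
    then show "deriv v (?w + period) = r * deriv u ?w + s * deriv v ?w"
      using shift_solves(2)[OF uv(2) per, of ?w] solves_combination(2)[OF uv(1,2) op w] by simp
  qed
  have "1 = wronskian u v (?w + period)" using uv(3)[of "?w + period"] by simp
  also have "\<dots> = (p * s - q * r) * wronskian u v ?w"
    unfolding wronskian_def d using 1[of ?w] 2[of ?w] by (simp add: algebra_simps)
  finally have "p * s - q * r = 1" using W by simp
  then show ?thesis using that 1 2 by blast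
qed

lemma wronskian_nonzero:
  assumes "\<And>\<zeta>. Re \<zeta> < a \<Longrightarrow> wronskian u v \<zeta> \<noteq> 0" "u holomorphic_on half_plane a" "v holomorphic_on half_plane a"
  shows "\<exists>\<zeta>. Re \<zeta> < a \<and> u \<zeta> \<noteq> 0" "\<exists>\<zeta>. Re \<zeta> < a \<and> v \<zeta> \<noteq> 0"
proof -
  have op: "open (half_plane a)" by (rule open_halfspace_Re_lt)
  let ?z = "of_real (a - 1) :: complex"
  have d0: "deriv f ?z = 0 \<and> f ?z = 0" if "\<And>\<zeta>. Re \<zeta> < a \<Longrightarrow> f \<zeta> = 0" for f :: "complex \<Rightarrow> complex"
  proof -
    have "(f has_field_derivative 0) (at ?z)"
      by (rule has_field_derivative_transform_within_open[OF DERIV_const[of 0] op]) (use that in auto)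
    then show ?thesis using that[of ?z] DERIV_imp_deriv by auto
  qed
  show "\<exists>\<zeta>. Re \<zeta> < a \<and> u \<zeta> \<noteq> 0" using d0[of u] assms(1)[of ?z] unfolding wronskian_def by force
  show "\<exists>\<zeta>. Re \<zeta> < a \<and> v \<zeta> \<noteq> 0" using d0[of v] assms(1)[of ?z] unfolding wronskian_def by force
qed

section \<open>Liouville's equation and unitary monodromy\<close>

lemma form_determinant:
  fixes A :: complex
  shows "(A * u * U + b * u * V + c * v * U + d * v * V) * (A * u' * U' + b * u' * V' + c * v' * U' + d * v' * V')
    - (A * u' * U + b * u' * V + c * v' * U + d * v' * V) * (A * u * U' + b * u * V' + c * v * U' + d * v * V')
    = (A * d - b * c) * ((u * v' - u' * v) * (U * V' - U' * V))"
  by algebra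

text \<open>\<open>U\<close>, \<open>V\<close> and \<open>b'\<close> will be the conjugates of
  \<open>u\<close>, \<open>v\<close> and \<open>b\<close>; the hypothesis is then that the Hermitian
  form has determinant 1/4.\<close>

lemma form_complete_square:
  fixes A :: complex
  assumes "A * d = 1/4 + b * b'"
  shows "d * (A * u * U + b * u * V + b' * v * U + d * v * V) = (d * v + b * u) * (d * V + b' * U) + (1/4) * (u * U)"
proof -
  have "d * (A * u * U + b * u * V + b' * v * U + d * v * V) = (A * d) * (u * U) + d * (b * u * V + b' * v * U + d * v * V)"
    by (simp add: algebra_simps)
  then show ?thesis unfolding assms by (simp add: algebra_simps)
qed

lemma norm_one_of_mult_cnj: "z * cnj z = 1 \<Longrightarrow> cmod z = 1"
proof -
  assume "z * cnj z = 1"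
  then have "complex_of_real ((cmod z)\<^sup>2) = 1" by (simp only: complex_norm_square)
  then have "(cmod z)\<^sup>2 = 1" by (simp only: of_real_eq_1_iff)
  then show ?thesis using norm_ge_zero[of z] by (auto simp: power2_eq_1_iff)
qed

text \<open>The metric \<open>1 / \<phi>^2\<close> of curvature one on a punctured disc, lifted to
  the half-plane, where being single-valued has become periodicity.\<close>

locale periodic_liouville =
  fixes a :: real and \<phi> h :: "complex \<Rightarrow> complex"
  assumes smooth: "smooth_on \<phi> (half_plane a)"
    and real: "Re \<zeta> < a \<Longrightarrow> cnj (\<phi> \<zeta>) = \<phi> \<zeta>" and pos: "Re \<zeta> < a \<Longrightarrow> Re (\<phi> \<zeta>) > 0"
    and periodic: "Re \<zeta> < a \<Longrightarrow> \<phi> (\<zeta> + period) = \<phi> \<zeta>"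
    and liouville: "Re \<zeta> < a \<Longrightarrow> \<phi> \<zeta> * dz (dzb \<phi>) \<zeta> - dz \<phi> \<zeta> * dzb \<phi> \<zeta> = 1/4"
    and h: "Re \<zeta> < a \<Longrightarrow> h \<zeta> = dz (dz \<phi>) \<zeta> / \<phi> \<zeta>"
begin

lemma op: "open (half_plane a)" and co: "connected (half_plane a)"
  by (rule open_halfspace_Re_lt connected_halfspace_Re_lt)+

lemma phi_nonzero: "Re \<zeta> < a \<Longrightarrow> \<phi> \<zeta> \<noteq> 0"
  using pos by force

lemma h_holomorphic: "h holomorphic_on half_plane a"
proof -
  have "(\<lambda>z. dz (dz \<phi>) z / \<phi> z) holomorphic_on half_plane a"
    by (rule liouville_schwarzian_holomorphic[OF op smooth]) (use phi_nonzero liouville in auto)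
  then show ?thesis by (rule holomorphic_transform) (use h in auto)
qed

lemma h_periodic: "Re \<zeta> < a \<Longrightarrow> h (\<zeta> + period) = h \<zeta>"
proof -
  assume z: "Re \<zeta> < a"
  have sh: "dz f (\<zeta> + period) = dz (\<lambda>z. f (z + period)) \<zeta>" if "f differentiable (at (\<zeta> + period))" for f \<zeta>
  proof -
    have "((\<lambda>z. z + period) has_field_derivative 1) (at \<zeta>)" by (auto intro!: derivative_eq_intros)
    from has_wirtinger_imp(1)[OF has_wirtinger_o_holomorphic[OF differentiable_has_wirtinger[OF that] this]]
    show ?thesis by simp
  qed
  have 1: "dz \<phi> (\<omega> + period) = dz \<phi> \<omega>" if "Re \<omega> < a" for \<omega>
  proof -
    have "dz \<phi> (\<omega> + period) = dz (\<lambda>z. \<phi> (z + period)) \<omega>"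
      by (rule sh, rule smooth_on_differentiable[OF smooth op]) (use that in simp)
    also have "\<dots> = dz \<phi> \<omega>" by (rule dz_cong[OF op]) (use that periodic in auto)
    finally show ?thesis .
  qed
  have "dz (dz \<phi>) (\<zeta> + period) = dz (\<lambda>z. dz \<phi> (z + period)) \<zeta>"
    by (rule sh, rule smooth_on_differentiable[OF smooth_on_dz[OF op smooth] op]) (use z in simp)
  also have "\<dots> = dz (dz \<phi>) \<zeta>" by (rule dz_cong[OF op]) (use z 1 in auto)
  finally show ?thesis using h[OF z] h[of "\<zeta> + period"] z periodic[OF z] by simp
qed

text \<open>Liouville's equation states that the Hermitian form \<phi> in \<open>u\<close>,
  \<open>v\<close> has determinant 1/4, so with positivity it is definite. The square is completed
  in \<open>v\<close>: this keeps the given \<open>u\<close> and the Wronskian, and it fixes the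
  product of the two coefficients as 1/4.\<close>

lemma sum_of_squares:
  assumes uv: "solves h (half_plane a) u" "solves h (half_plane a) v" "\<And>\<zeta>. Re \<zeta> < a \<Longrightarrow> wronskian u v \<zeta> = 1"
  obtains v' C where "C > 0" "solves h (half_plane a) v'" "\<And>\<zeta>. Re \<zeta> < a \<Longrightarrow> wronskian u v' \<zeta> = 1"
    "\<And>\<zeta>. Re \<zeta> < a \<Longrightarrow> \<phi> \<zeta> = of_real (1 / (4 * C)) * (u \<zeta> * cnj (u \<zeta>)) + of_real C * (v' \<zeta> * cnj (v' \<zeta>))"
proof -
  let ?w = "of_real (a - 1) :: complex"
  have w: "?w \<in> half_plane a" by simp
  have hol: "u holomorphic_on half_plane a" "v holomorphic_on half_plane a" using uv unfolding solves_def by auto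
  have W: "wronskian u v ?w = 1" using uv(3) by simp
  have "\<And>z. z \<in> half_plane a \<Longrightarrow> dz (dz \<phi>) z = h z * \<phi> z" "\<And>z. z \<in> half_plane a \<Longrightarrow> cnj (\<phi> z) = \<phi> z"
    using h real phi_nonzero by auto
  from solves_form_decomposition[OF op co w smooth this uv(1,2) W]
  obtain A b c d where f': "\<And>\<zeta>. \<zeta> \<in> half_plane a \<Longrightarrow> \<phi> \<zeta> = A * u \<zeta> * cnj (u \<zeta>) + b * u \<zeta> * cnj (v \<zeta>) + c * v \<zeta> * cnj (u \<zeta>) + d * v \<zeta> * cnj (v \<zeta>)"
    by blast
  have f: "\<phi> \<zeta> = A * u \<zeta> * cnj (u \<zeta>) + b * u \<zeta> * cnj (v \<zeta>) + c * v \<zeta> * cnj (u \<zeta>) + d * v \<zeta> * cnj (v \<zeta>)"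
    if "Re \<zeta> < a" for \<zeta> using f'[of \<zeta>] that by simp
  \<comment> \<open>The form equals its conjugate; by independence its matrix is Hermitian.\<close>
  have "(A - cnj A) * u \<zeta> * cnj (u \<zeta>) + (b - cnj c) * u \<zeta> * cnj (v \<zeta>) + (c - cnj b) * v \<zeta> * cnj (u \<zeta>) + (d - cnj d) * v \<zeta> * cnj (v \<zeta>) = 0"
    if "\<zeta> \<in> half_plane a" for \<zeta>
  proof -
    have "\<phi> \<zeta> - cnj (\<phi> \<zeta>) = 0" using real that by simp
    then show ?thesis using f[of \<zeta>] that by (simp add: algebra_simps)
  qed
  note ind = solves_form_independent[OF op w hol _ this]
  have nz: "wronskian u v z \<noteq> 0" if "z \<in> half_plane a" for z using uv(3) that by simp
  have rl: "cnj A = A" "c = cnj b" "cnj d = d" using ind[OF nz] by auto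
  have D: "A * d - b * c = 1/4"
  proof -
    have hw: "has_wirtinger y (deriv y z) 0 z" if "y holomorphic_on half_plane a" "Re z < a" for y z
      using has_wirtinger_holomorphic holomorphic_derivI[OF that(1) op] that(2) by blast
    have t: "has_wirtinger (\<lambda>z. k * x z * cnj (y z)) (k * deriv x z * cnj (y z)) (k * x z * cnj (deriv y z)) z"
      if "x holomorphic_on half_plane a" "y holomorphic_on half_plane a" "Re z < a" for k x y z
      using has_wirtinger_mult[OF has_wirtinger_cmult[OF hw[OF that(1,3)], of k] has_wirtinger_cnj[OF hw[OF that(2,3)]]] by simp
    have sum4: "has_wirtinger (\<lambda>z. A * x1 z * cnj (y1 z) + b * x1 z * cnj (y2 z) + c * x2 z * cnj (y1 z) + d * x2 z * cnj (y2 z))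
       (A * deriv x1 z * cnj (y1 z) + b * deriv x1 z * cnj (y2 z) + c * deriv x2 z * cnj (y1 z) + d * deriv x2 z * cnj (y2 z))
       (A * x1 z * cnj (deriv y1 z) + b * x1 z * cnj (deriv y2 z) + c * x2 z * cnj (deriv y1 z) + d * x2 z * cnj (deriv y2 z)) z"
      if "x1 holomorphic_on half_plane a" "x2 holomorphic_on half_plane a" "y1 holomorphic_on half_plane a" "y2 holomorphic_on half_plane a" "Re z < a" for x1 x2 y1 y2 z
      by (intro has_wirtinger_add t that)
    have W0: "has_wirtinger \<phi> (A * deriv u z * cnj (u z) + b * deriv u z * cnj (v z) + c * deriv v z * cnj (u z) + d * deriv v z * cnj (v z))
       (A * u z * cnj (deriv u z) + b * u z * cnj (deriv v z) + c * v z * cnj (deriv u z) + d * v z * cnj (deriv v z)) z" if "Re z < a" for z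
      by (rule has_wirtinger_cong[OF sum4[OF hol hol that] op]) (use that f in auto)
    have hol': "deriv u holomorphic_on half_plane a" "deriv v holomorphic_on half_plane a"
      using hol op by (auto intro!: holomorphic_deriv)
    have "dz (dzb \<phi>) ?w = dz (\<lambda>z. A * u z * cnj (deriv u z) + b * u z * cnj (deriv v z) + c * v z * cnj (deriv u z) + d * v z * cnj (deriv v z)) ?w"
      by (rule dz_cong[OF op w]) (use has_wirtinger_imp(2)[OF W0] in auto)
    also have "\<dots> = A * deriv u ?w * cnj (deriv u ?w) + b * deriv u ?w * cnj (deriv v ?w) + c * deriv v ?w * cnj (deriv u ?w) + d * deriv v ?w * cnj (deriv v ?w)"
      by (rule has_wirtinger_imp(1)[OF sum4[OF hol hol']]) simp
    finally have f12: "dz (dzb \<phi>) ?w = \<dots>" .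
    have Rw: "Re ?w < a" by simp
    \<comment> \<open>The Liouville expression of a form in \<open>u\<close> and \<open>v\<close> is
      its determinant times the squared modulus of the Wronskian.\<close>
    have "1/4 = (A * d - b * c) * (wronskian u v ?w * cnj (wronskian u v ?w))"
      using liouville[OF Rw] unfolding f12 has_wirtinger_imp[OF W0[OF Rw]] f[OF Rw] form_determinant
      by (simp only: wronskian_def complex_cnj_diff complex_cnj_mult)
    then show ?thesis using uv(3)[OF Rw] by simp
  qed
  have dr: "d = of_real (Re d)" "A = of_real (Re A)" using rl by (auto simp: complex_eq_iff)
  have "of_real (Re A * Re d) - of_real ((cmod b)\<^sup>2) = (of_real (1/4) :: complex)"
    using D unfolding rl(2) by (subst (asm) dr(1), subst (asm) dr(2)) (simp only: complex_norm_square of_real_mult, simp)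
  then have "of_real (Re A * Re d - (cmod b)\<^sup>2) = (of_real (1/4) :: complex)" by simp
  then have Ad: "Re A * Re d - (cmod b)\<^sup>2 = 1/4" by (simp only: of_real_eq_iff)
  then have d0: "Re d \<noteq> 0" using zero_le_power2[of "cmod b"] by (cases "Re d = 0") auto
  then have dn: "d \<noteq> 0" by auto
  have sq: "d * \<phi> \<zeta> = (d * v \<zeta> + b * u \<zeta>) * cnj (d * v \<zeta> + b * u \<zeta>) + (1/4) * (u \<zeta> * cnj (u \<zeta>))" if z: "Re \<zeta> < a" for \<zeta>
  proof -
    have "A * d = 1/4 + b * cnj b" using D unfolding rl(2) diff_eq_eq by simp
    then show ?thesis unfolding f[OF z] rl(2) using form_complete_square[of A d b "cnj b"] rl(3) by simp
  qed
  define C where "C = Re d"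
  \<comment> \<open>The completed square is nonnegative, so the sign of \<open>d\<close> is that of
    \<phi>.\<close>
  have "C * Re (\<phi> ?w) \<ge> 0"
  proof -
    have nn: "Re (z * cnj z) \<ge> 0" "Re ((1/4) * (z * cnj z)) \<ge> 0" for z by simp_all
    have Rw: "Re ?w < a" by simp
    have "Re (d * \<phi> ?w) \<ge> 0"
      unfolding sq[OF Rw] plus_complex.sel(1) by (intro add_nonneg_nonneg nn)
    moreover have "Re (d * \<phi> ?w) = C * Re (\<phi> ?w)" unfolding C_def by (subst dr(1)) simp
    ultimately show ?thesis by simp
  qed
  then have C: "C > 0" using pos[of ?w] d0 unfolding C_def by (simp add: zero_le_mult_iff)
  have dC: "d = of_real C" unfolding C_def by (rule dr(1))
  define v' where "v' = (\<lambda>\<zeta>. (b / d) * u \<zeta> + 1 * v \<zeta>)"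
  have sv: "solves h (half_plane a) v'" unfolding v'_def by (rule solves_combination(1)[OF uv(1,2) op])
  have Wv: "wronskian u v' \<zeta> = 1" if "Re \<zeta> < a" for \<zeta>
    using uv(3)[OF that] solves_combination(2)[OF uv(1,2) op, of \<zeta> "b / d" 1] that unfolding v'_def wronskian_def by (simp add: algebra_simps)
  have "\<phi> \<zeta> = of_real (1 / (4 * C)) * (u \<zeta> * cnj (u \<zeta>)) + of_real C * (v' \<zeta> * cnj (v' \<zeta>))" if z: "Re \<zeta> < a" for \<zeta>
  proof -
    have "d * v \<zeta> + b * u \<zeta> = d * v' \<zeta>" unfolding v'_def using dn by (simp add: field_simps)
    then have "d * \<phi> \<zeta> = d * (d * (v' \<zeta> * cnj (v' \<zeta>)) + 1 / (4 * d) * (u \<zeta> * cnj (u \<zeta>)))"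
      using sq[OF z] rl(3) dn by (simp add: field_simps)
    then have "\<phi> \<zeta> = d * (v' \<zeta> * cnj (v' \<zeta>)) + 1 / (4 * d) * (u \<zeta> * cnj (u \<zeta>))" using dn by simp
    then show ?thesis unfolding dC by simp
  qed
  then show ?thesis using that C sv Wv by blast
qed

text \<open>The monodromy preserves the definite form \<open>\<phi>\<close>, so it is unitary and diagonalizable.\<close>

lemma orthogonal_eigensolution:
  assumes u: "solves h (half_plane a) u" "\<And>\<zeta>. Re \<zeta> < a \<Longrightarrow> u (\<zeta> + period) = \<mu> * u \<zeta>"
    and nz: "Re \<zeta>0 < a" "u \<zeta>0 \<noteq> 0"
  obtains v \<nu> C where "C > 0" "solves h (half_plane a) v" "\<And>\<zeta>. Re \<zeta> < a \<Longrightarrow> wronskian u v \<zeta> = 1"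
    "\<And>\<zeta>. Re \<zeta> < a \<Longrightarrow> \<phi> \<zeta> = of_real (1 / (4 * C)) * (u \<zeta> * cnj (u \<zeta>)) + of_real C * (v \<zeta> * cnj (v \<zeta>))"
    "\<And>\<zeta>. Re \<zeta> < a \<Longrightarrow> v (\<zeta> + period) = \<nu> * v \<zeta>" "cmod \<mu> = 1" "cmod \<nu> = 1"
proof -
  obtain v0 where v0: "solves h (half_plane a) v0" "\<And>\<zeta>. Re \<zeta> < a \<Longrightarrow> wronskian u v0 \<zeta> = 1"
    using solution_partner[OF u(1) h_holomorphic nz] by blast
  obtain v C where v: "C > 0" "solves h (half_plane a) v" "\<And>\<zeta>. Re \<zeta> < a \<Longrightarrow> wronskian u v \<zeta> = 1"
    "\<And>\<zeta>. Re \<zeta> < a \<Longrightarrow> \<phi> \<zeta> = of_real (1 / (4 * C)) * (u \<zeta> * cnj (u \<zeta>)) + of_real C * (v \<zeta> * cnj (v \<zeta>))"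
    by (rule sum_of_squares[OF u(1) v0]; (assumption | (rule that; (assumption | simp))))
  have hol: "u holomorphic_on half_plane a" "v holomorphic_on half_plane a" using u v unfolding solves_def by auto
  obtain p q r s where m: "\<And>\<zeta>. Re \<zeta> < a \<Longrightarrow> u (\<zeta> + period) = p * u \<zeta> + q * v \<zeta>"
    "\<And>\<zeta>. Re \<zeta> < a \<Longrightarrow> v (\<zeta> + period) = r * u \<zeta> + s * v \<zeta>" "p * s - q * r = 1"
    by (rule monodromy_matrix[OF u(1) v(2,3) h_periodic]; (assumption | (rule that; (assumption | simp))))
  define K where "K = (of_real (1 / (4 * C)) :: complex)"
  let ?C = "of_real C :: complex"
  let ?w = "of_real (a - 1) :: complex"
  have w: "?w \<in> half_plane a" by simp
  \<comment> \<open>Invariance of \<phi> under the period, expanded in the products of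
    \<open>u\<close>, \<open>v\<close> and their conjugates. Every coefficient vanishes, which
    removes the off-diagonal entry \<open>r\<close> and makes both multipliers unimodular.\<close>
  have id: "(K * (\<mu> * cnj \<mu> - 1) + ?C * (r * cnj r)) * u \<zeta> * cnj (u \<zeta>) + (?C * r * cnj s) * u \<zeta> * cnj (v \<zeta>)
      + (?C * s * cnj r) * v \<zeta> * cnj (u \<zeta>) + (?C * (s * cnj s - 1)) * v \<zeta> * cnj (v \<zeta>) = 0" if z: "\<zeta> \<in> half_plane a" for \<zeta>
  proof -
    have z': "Re (\<zeta> + period) < a" "Re \<zeta> < a" using z by auto
    have "\<phi> (\<zeta> + period) - \<phi> \<zeta> = 0" using periodic z by simp
    then show ?thesis unfolding v(4)[OF z'(1)] v(4)[OF z'(2)] u(2)[OF z'(2)] m(2)[OF z'(2)] K_def[symmetric]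
      by (simp add: algebra_simps)
  qed
  have nzW: "wronskian u v z \<noteq> 0" if "z \<in> half_plane a" for z using v(3) that by simp
  note ind = solves_form_independent[OF op w hol nzW id]
  have C0: "?C \<noteq> 0" "K \<noteq> 0" using v(1) unfolding K_def by auto
  have ss: "s * cnj s = 1" using ind(4) C0 by simp
  then have s1: "cmod s = 1" by (rule norm_one_of_mult_cnj)
  then have "s \<noteq> 0" by auto
  then have r0: "r = 0" using ind(2) C0 by simp
  have "\<mu> * cnj \<mu> = 1" using ind(1) r0 C0 by simp
  then have m1: "cmod \<mu> = 1" by (rule norm_one_of_mult_cnj)
  have "v (\<zeta> + period) = s * v \<zeta>" if "Re \<zeta> < a" for \<zeta> using m(2)[OF that] r0 by simp
  then show ?thesis using that[OF v _ m1 s1] by blast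
qed

text \<open>An eigenvector of the monodromy matrix. For \<open>r = 0\<close> it is \<open>v\<close>
  itself; otherwise the quadratic formula provides an eigenvalue.\<close>

lemma eigensolution_exists:
  obtains u \<mu> \<zeta>0 where "solves h (half_plane a) u" "\<And>\<zeta>. Re \<zeta> < a \<Longrightarrow> u (\<zeta> + period) = \<mu> * u \<zeta>"
    "Re \<zeta>0 < a" "u \<zeta>0 \<noteq> 0"
proof -
  obtain u v where uv: "solves h (half_plane a) u" "solves h (half_plane a) v" "\<And>\<zeta>. Re \<zeta> < a \<Longrightarrow> wronskian u v \<zeta> = 1"
    by (rule fundamental_system[OF h_holomorphic]; (assumption | (rule that; (assumption | simp))))
  have hol: "u holomorphic_on half_plane a" "v holomorphic_on half_plane a" using uv unfolding solves_def by auto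
  obtain p q r s where m: "\<And>\<zeta>. Re \<zeta> < a \<Longrightarrow> u (\<zeta> + period) = p * u \<zeta> + q * v \<zeta>"
    "\<And>\<zeta>. Re \<zeta> < a \<Longrightarrow> v (\<zeta> + period) = r * u \<zeta> + s * v \<zeta>" "p * s - q * r = 1"
    by (rule monodromy_matrix[OF uv h_periodic]; (assumption | (rule that; (assumption | simp))))
  have nzW: "wronskian u v \<zeta> \<noteq> 0" if "Re \<zeta> < a" for \<zeta> using uv(3)[OF that] by simp
  show ?thesis
  proof (cases "r = 0")
    case True
    then show ?thesis using that[OF uv(2), of s] m(2) wronskian_nonzero(2)[OF nzW hol] by auto
  next
    case False
    define R where "R = csqrt ((p + s)\<^sup>2 - 4 * (p * s - q * r))"
    define \<mu> where "\<mu> = ((p + s) + R) / 2"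
    have mu: "\<mu> * \<mu> - (p + s) * \<mu> + (p * s - q * r) = 0"
    proof -
      have "2 * \<mu> - (p + s) = R" unfolding \<mu>_def by (simp add: field_simps)
      then have "(2 * \<mu> - (p + s))\<^sup>2 = (p + s)\<^sup>2 - 4 * (p * s - q * r)" unfolding R_def by (simp only: power2_csqrt)
      then have "4 * (\<mu> * \<mu> - (p + s) * \<mu> + (p * s - q * r)) = 0" by (simp add: power2_eq_square algebra_simps)
      then show ?thesis using mult_eq_0_iff[of "4 :: complex"] by (simp only:) simp
    qed
    \<comment> \<open>The coordinates \<open>(r, \<mu> - p)\<close> solve the eigenvector equation
      in the first component identically, in the second by the characteristic equation; the first
      one is nonzero in this case.\<close>
    define e where "e = (\<lambda>\<zeta>. r * u \<zeta> + (\<mu> - p) * v \<zeta>)"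
    have se: "solves h (half_plane a) e" unfolding e_def by (rule solves_combination(1)[OF uv(1,2) op])
    have "e (\<zeta> + period) = \<mu> * e \<zeta>" if "Re \<zeta> < a" for \<zeta>
      unfolding e_def m(1)[OF that] m(2)[OF that] using mu by algebra
    moreover have "wronskian e v \<zeta> \<noteq> 0" if z: "Re \<zeta> < a" for \<zeta>
    proof -
      have de: "deriv e \<zeta> = r * deriv u \<zeta> + (\<mu> - p) * deriv v \<zeta>"
        unfolding e_def by (rule solves_combination(2)[OF uv(1,2) op]) (use z in simp)
      have "wronskian e v \<zeta> = r * wronskian u v \<zeta>"
        unfolding wronskian_def de by (simp add: e_def algebra_simps)
      then show ?thesis using False nzW[OF z] by simp
    qed
    ultimately show ?thesis
      using that[OF se] wronskian_nonzero(1)[of a e v] se hol unfolding solves_def by blast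
  qed
qed

text \<open>In the diagonal form of \<phi> both terms are nonnegative, so \<phi> dominates a
  multiple of the squared modulus of the eigensolution, which inherits its growth.\<close>

lemma exponent_solution:
  assumes growth: "\<And>\<zeta>. Re \<zeta> \<le> a0 \<Longrightarrow> Re (\<phi> \<zeta>) \<le> K * exp (M * \<bar>Re \<zeta>\<bar>)" and a0: "a0 < a"
  obtains \<sigma> k e where "exponent_form a \<sigma> k e" "solves h (half_plane a) e"
proof -
  obtain u \<mu> \<zeta>0 where u: "solves h (half_plane a) u" "\<And>\<zeta>. Re \<zeta> < a \<Longrightarrow> u (\<zeta> + period) = \<mu> * u \<zeta>"
    and nz: "Re \<zeta>0 < a" "u \<zeta>0 \<noteq> 0"
    by (rule eigensolution_exists; (assumption | (rule that; (assumption | simp))))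
  obtain v \<nu> C where C: "C > 0" and phi: "\<And>\<zeta>. Re \<zeta> < a \<Longrightarrow> \<phi> \<zeta> = of_real (1 / (4 * C)) * (u \<zeta> * cnj (u \<zeta>)) + of_real C * (v \<zeta> * cnj (v \<zeta>))"
    and mu: "cmod \<mu> = 1"
    by (rule orthogonal_eigensolution[OF u nz]; (assumption | (rule that; (assumption | simp))))
  have gr: "cmod (u \<zeta>) \<le> (1 + 4 * C * \<bar>K\<bar>) * exp (\<bar>M\<bar> * \<bar>Re \<zeta>\<bar>)" if z: "Re \<zeta> \<le> a0" for \<zeta>
  proof -
    have "\<phi> \<zeta> = of_real ((cmod (u \<zeta>))\<^sup>2 / (4 * C) + C * (cmod (v \<zeta>))\<^sup>2)"
      using phi[of \<zeta>] z a0 by (simp add: complex_norm_square[symmetric] mult.commute)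
    then have "Re (\<phi> \<zeta>) = (cmod (u \<zeta>))\<^sup>2 / (4 * C) + C * (cmod (v \<zeta>))\<^sup>2" by simp
    then have "(cmod (u \<zeta>))\<^sup>2 / (4 * C) \<le> K * exp (M * \<bar>Re \<zeta>\<bar>)" using growth[OF z] C by (smt (verit) mult_nonneg_nonneg zero_le_power2)
    also have "\<dots> \<le> \<bar>K\<bar> * exp (\<bar>M\<bar> * \<bar>Re \<zeta>\<bar>)" by (intro mult_mono) (auto intro!: mult_right_mono)
    finally have 1: "(cmod (u \<zeta>))\<^sup>2 \<le> 4 * C * \<bar>K\<bar> * exp (\<bar>M\<bar> * \<bar>Re \<zeta>\<bar>)" using C by (simp add: field_simps)
    have "2 * cmod (u \<zeta>) \<le> (cmod (u \<zeta>))\<^sup>2 + 1" using sum_squares_bound[of "cmod (u \<zeta>)" 1] by simp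
    then have "cmod (u \<zeta>) \<le> 1 + (cmod (u \<zeta>))\<^sup>2" using norm_ge_zero[of "u \<zeta>"] by linarith
    also have "\<dots> \<le> exp (\<bar>M\<bar> * \<bar>Re \<zeta>\<bar>) + 4 * C * \<bar>K\<bar> * exp (\<bar>M\<bar> * \<bar>Re \<zeta>\<bar>)" using 1 by (intro add_mono) auto
    finally show ?thesis by (simp add: algebra_simps)
  qed
  have uh: "u holomorphic_on half_plane a" using u(1) unfolding solves_def by simp
  obtain \<sigma> k where "exponent_form a \<sigma> k u" "\<mu> = exp (of_real \<sigma> * period)"
    by (rule exponent_form_exists[OF uh u(2) mu nz gr]; (assumption | (rule that; (assumption | simp))))
  then show ?thesis using that u(1) by blast
qed

end

section \<open>Equations with scalar monodromy\<close>

text \<open>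
  Four independent real solutions of the form \<open>\<Sum> c\<^sub>i\<^sub>j y\<^sub>i cnj y\<^sub>j\<close> exhaust all such forms, so if they are
  periodic, the monodromy is scalar.
\<close>

lemma scalar_monodromy:
  fixes \<Psi> :: "4 \<Rightarrow> complex \<Rightarrow> complex"
  assumes h: "h holomorphic_on half_plane a" "\<And>\<zeta>. Re \<zeta> < a \<Longrightarrow> h (\<zeta> + period) = h \<zeta>"
    and P: "\<And>j. smooth_on (\<Psi> j) (half_plane a)" "\<And>j \<zeta>. Re \<zeta> < a \<Longrightarrow> cnj (\<Psi> j \<zeta>) = \<Psi> j \<zeta>"
      "\<And>j \<zeta>. Re \<zeta> < a \<Longrightarrow> \<Psi> j (\<zeta> + period) = \<Psi> j \<zeta>" "\<And>j \<zeta>. Re \<zeta> < a \<Longrightarrow> dz (dz (\<Psi> j)) \<zeta> = h \<zeta> * \<Psi> j \<zeta>"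
    and ind: "\<And>c :: 4 \<Rightarrow> complex. (\<And>\<zeta>. Re \<zeta> < a \<Longrightarrow> (\<Sum>j\<in>UNIV. c j * \<Psi> j \<zeta>) = 0) \<Longrightarrow> \<forall>j. c j = 0"
  obtains u v \<mu> where "solves h (half_plane a) u" "solves h (half_plane a) v" "\<And>\<zeta>. Re \<zeta> < a \<Longrightarrow> wronskian u v \<zeta> = 1"
    "\<And>\<zeta>. Re \<zeta> < a \<Longrightarrow> u (\<zeta> + period) = \<mu> * u \<zeta>" "\<And>\<zeta>. Re \<zeta> < a \<Longrightarrow> v (\<zeta> + period) = \<mu> * v \<zeta>" "cmod \<mu> = 1"
proof -
  have op: "open (half_plane a)" and co: "connected (half_plane a)"
    by (rule open_halfspace_Re_lt connected_halfspace_Re_lt)+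
  let ?w = "of_real (a - 1) :: complex"
  have w: "?w \<in> half_plane a" by simp
  obtain u v where uv: "solves h (half_plane a) u" "solves h (half_plane a) v" "\<And>\<zeta>. Re \<zeta> < a \<Longrightarrow> wronskian u v \<zeta> = 1"
    by (rule fundamental_system[OF h(1)]; (assumption | (rule that; (assumption | simp))))
  have hol: "u holomorphic_on half_plane a" "v holomorphic_on half_plane a" using uv unfolding solves_def by auto
  have nzW: "wronskian u v z \<noteq> 0" if "Re z < a" for z using uv(3)[OF that] by simp
  have W1: "wronskian u v ?w = 1" using uv(3) by simp
  \<comment> \<open>The four products that span the forms in \<open>u\<close> and
    \<open>v\<close>.\<close>
  define Bs where "Bs i \<zeta> = (if i = 1 then u \<zeta> * cnj (u \<zeta>) else if i = 2 then u \<zeta> * cnj (v \<zeta>)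
     else if i = 3 then v \<zeta> * cnj (u \<zeta>) else v \<zeta> * cnj (v \<zeta>))" for i :: 4 and \<zeta>
  have "\<exists>c. \<forall>\<zeta>\<in>half_plane a. \<Psi> j \<zeta> = (\<Sum>i\<in>UNIV. c i * Bs i \<zeta>)" for j
  proof -
    have "\<And>z. z \<in> half_plane a \<Longrightarrow> dz (dz (\<Psi> j)) z = h z * \<Psi> j z" "\<And>z. z \<in> half_plane a \<Longrightarrow> cnj (\<Psi> j z) = \<Psi> j z"
      using P by auto
    from solves_form_decomposition[OF op co w P(1)[of j] this uv(1,2) W1]
    obtain A b c d where f: "\<And>\<zeta>. \<zeta> \<in> half_plane a \<Longrightarrow> \<Psi> j \<zeta> = A * u \<zeta> * cnj (u \<zeta>) + b * u \<zeta> * cnj (v \<zeta>) + c * v \<zeta> * cnj (u \<zeta>) + d * v \<zeta> * cnj (v \<zeta>)"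
      by blast
    show ?thesis
      by (rule exI[of _ "\<lambda>i. if i = 1 then A else if i = 2 then b else if i = 3 then c else d"])
        (use f in \<open>auto simp: sum_4 Bs_def mult.assoc\<close>)
  qed
  then obtain c where c: "\<And>j \<zeta>. Re \<zeta> < a \<Longrightarrow> \<Psi> j \<zeta> = (\<Sum>i\<in>UNIV. c j i * Bs i \<zeta>)" by (metis mem_Collect_eq)
  define A where "A = (\<chi> i j. c j i)"
  \<comment> \<open>Independence of the four given solutions makes the square coefficient matrix
    injective, hence invertible. The products \<open>Bs\<close> are then combinations of periodic
    functions.\<close>
  have "\<exists>B. B ** A = mat 1"
    unfolding matrix_left_invertible_ker
  proof (intro allI impI)
    fix x :: "complex ^ 4" assume x: "A *v x = 0"
    have "(\<Sum>j\<in>UNIV. x $ j * \<Psi> j \<zeta>) = 0" if z: "Re \<zeta> < a" for \<zeta>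
    proof -
      have "(\<Sum>j\<in>UNIV. x $ j * \<Psi> j \<zeta>) = (\<Sum>j\<in>UNIV. \<Sum>i\<in>UNIV. x $ j * (c j i * Bs i \<zeta>))"
        by (simp add: c[OF z] sum_distrib_left)
      also have "\<dots> = (\<Sum>i\<in>UNIV. \<Sum>j\<in>UNIV. x $ j * (c j i * Bs i \<zeta>))" by (rule sum.swap)
      also have "\<dots> = (\<Sum>i\<in>UNIV. (A *v x) $ i * Bs i \<zeta>)"
        unfolding A_def matrix_vector_mult_def by (simp add: sum_distrib_right sum_distrib_left mult_ac)
      finally show ?thesis using x by simp
    qed
    then have "\<forall>j. x $ j = 0" by (rule ind)
    then show "x = 0" by (simp add: vec_eq_iff)
  qed
  then obtain B where BA: "B ** A = mat 1" by blast
  then have AB: "A ** B = mat 1" by (rule matrix_left_right_inverse[THEN iffD1])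
  have Bs: "Bs i \<zeta> = (\<Sum>j\<in>UNIV. B $ j $ i * \<Psi> j \<zeta>)" if z: "Re \<zeta> < a" for i \<zeta>
  proof -
    have "(\<Sum>j\<in>UNIV. B $ j $ i * \<Psi> j \<zeta>) = (\<Sum>j\<in>UNIV. \<Sum>l\<in>UNIV. B $ j $ i * (c j l * Bs l \<zeta>))"
      by (simp add: c[OF z] sum_distrib_left)
    also have "\<dots> = (\<Sum>l\<in>UNIV. \<Sum>j\<in>UNIV. B $ j $ i * (c j l * Bs l \<zeta>))" by (rule sum.swap)
    also have "\<dots> = (\<Sum>l\<in>UNIV. (A ** B) $ l $ i * Bs l \<zeta>)"
      unfolding A_def matrix_matrix_mult_def by (simp add: sum_distrib_right sum_distrib_left mult_ac)
    also have "\<dots> = Bs i \<zeta>" unfolding AB using exhaust_4[of i] by (auto simp: mat_def sum_4)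
    finally show ?thesis by simp
  qed
  have Bper: "Bs i (\<zeta> + period) = Bs i \<zeta>" if "Re \<zeta> < a" for i \<zeta>
    using Bs[of \<zeta> i] Bs[of "\<zeta> + period" i] P(3) that by simp
  obtain p q r s where mm: "\<And>\<zeta>. Re \<zeta> < a \<Longrightarrow> u (\<zeta> + period) = p * u \<zeta> + q * v \<zeta>"
    "\<And>\<zeta>. Re \<zeta> < a \<Longrightarrow> v (\<zeta> + period) = r * u \<zeta> + s * v \<zeta>" "p * s - q * r = 1"
    by (rule monodromy_matrix[OF uv h(2)]; (assumption | (rule that; (assumption | simp))))
  note indep = solves_form_independent[OF op w hol nzW]
  \<comment> \<open>Periodicity of \<open>u * cnj u\<close> forces \<open>q = 0\<close>, that of
    \<open>v * cnj v\<close> forces \<open>r = 0\<close>, and that of \<open>u * cnj v\<close> makes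
    the two multipliers equal.\<close>
  have "(p * cnj p - 1) * u \<zeta> * cnj (u \<zeta>) + (p * cnj q) * u \<zeta> * cnj (v \<zeta>) + (q * cnj p) * v \<zeta> * cnj (u \<zeta>) + (q * cnj q) * v \<zeta> * cnj (v \<zeta>) = 0"
    if "\<zeta> \<in> half_plane a" for \<zeta>
    using Bper[of \<zeta> 1] mm(1)[of \<zeta>] that unfolding Bs_def by (simp add: algebra_simps)
  from indep[OF _ this] have pq: "p * cnj p = 1" "q = 0" by auto
  have "(r * cnj r) * u \<zeta> * cnj (u \<zeta>) + (r * cnj s) * u \<zeta> * cnj (v \<zeta>) + (s * cnj r) * v \<zeta> * cnj (u \<zeta>) + (s * cnj s - 1) * v \<zeta> * cnj (v \<zeta>) = 0"
    if "\<zeta> \<in> half_plane a" for \<zeta>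
    using Bper[of \<zeta> 4] mm(2)[of \<zeta>] that unfolding Bs_def by (simp add: algebra_simps)
  from indep[OF _ this] have rs: "s * cnj s = 1" "r = 0" by auto
  have "0 * u \<zeta> * cnj (u \<zeta>) + (p * cnj s - 1) * u \<zeta> * cnj (v \<zeta>) + 0 * v \<zeta> * cnj (u \<zeta>) + 0 * v \<zeta> * cnj (v \<zeta>) = 0"
    if "\<zeta> \<in> half_plane a" for \<zeta>
    using Bper[of \<zeta> 2] mm(1,2)[of \<zeta>] that pq rs unfolding Bs_def by (simp add: algebra_simps)
  from indep[OF _ this] have "p * cnj s = 1" by auto
  then have ps: "s = p" using rs(1) by (metis mult.assoc mult.commute mult_1_right)
  have p1: "cmod p = 1" by (rule norm_one_of_mult_cnj[OF pq(1)])
  have mu: "u (\<zeta> + period) = p * u \<zeta>" "v (\<zeta> + period) = p * v \<zeta>" if "Re \<zeta> < a" for \<zeta>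
    using mm(1,2)[OF that] pq rs ps by auto
  show ?thesis by (rule that[OF uv mu p1]; assumption)
qed

section \<open>Planar integrals\<close>

text \<open>Substitution is carried out on \<open>real ^ 2\<close> and iterated integration on pairs
  of reals; this lemma and the next move the planar measure to either side.\<close>

lemma lborel_complex_vec2:
  "(lborel :: complex measure) = distr (lborel :: (real ^ 2) measure) borel (\<lambda>v. Complex (v $ 1) (v $ 2))"
proof (rule lborel_eqI)
  let ?f = "\<lambda>v :: real ^ 2. Complex (v $ 1) (v $ 2)"
  fix l u :: complex assume lu: "\<And>b. b \<in> Basis \<Longrightarrow> l \<bullet> b \<le> u \<bullet> b"
  have le: "Re l \<le> Re u" "Im l \<le> Im u" using lu[of 1] lu[of \<i>] by (simp_all add: Basis_complex_def)
  have m: "?f \<in> borel_measurable borel"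
    by (intro borel_measurable_continuous_onI continuous_on_Complex continuous_intros)
  let ?l = "vector [Re l, Im l] :: real ^ 2" and ?u = "vector [Re u, Im u] :: real ^ 2"
  have pre: "?f -` box l u = box ?l ?u"
    by (auto simp: in_box_complex_iff mem_box_cart forall_2)
  have "emeasure (distr (lborel :: (real ^ 2) measure) borel ?f) (box l u) = emeasure lborel (box ?l ?u)"
    using m by (simp add: emeasure_distr pre)
  also have "\<dots> = ennreal (\<Prod>b\<in>Basis. (?u - ?l) \<bullet> b)"
    using le by (intro emeasure_lborel_box) (auto simp: Basis_vec_def inner_axis UNIV_2)
  also have "(\<Prod>b\<in>Basis. (?u - ?l) \<bullet> b) = (Re u - Re l) * (Im u - Im l)"
  proof -
    have B: "(Basis :: (real ^ 2) set) = {axis 1 1, axis 2 1}" by (auto simp: Basis_vec_def UNIV_2)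
    have "axis 1 (1::real) \<noteq> (axis 2 1 :: real ^ 2)" by (simp add: axis_eq_axis)
    then show ?thesis unfolding B by (simp add: inner_axis)
  qed
  also have "\<dots> = (\<Prod>b\<in>Basis. (u - l) \<bullet> b)" by (simp add: Basis_complex_def)
  finally show "emeasure (distr lborel borel ?f) (box l u) = ennreal (\<Prod>b\<in>Basis. (u - l) \<bullet> b)" .
qed simp

lemma lborel_complex_prod:
  "(lborel :: complex measure) = distr (lborel :: (real \<times> real) measure) borel (\<lambda>p. Complex (fst p) (snd p))"
proof (rule lborel_eqI)
  let ?f = "\<lambda>p :: real \<times> real. Complex (fst p) (snd p)"
  fix l u :: complex assume lu: "\<And>b. b \<in> Basis \<Longrightarrow> l \<bullet> b \<le> u \<bullet> b"
  have le: "Re l \<le> Re u" "Im l \<le> Im u" using lu[of 1] lu[of \<i>] by (simp_all add: Basis_complex_def)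
  have m: "?f \<in> borel_measurable borel"
    by (intro borel_measurable_continuous_onI continuous_on_Complex continuous_intros)
  have B: "(Basis :: (real \<times> real) set) = {(1, 0), (0, 1)}" by (auto simp: Basis_prod_def)
  have pre: "?f -` box l u = box (Re l, Im l) (Re u, Im u)"
    by (auto simp: in_box_complex_iff box_def B Basis_complex_def)
  have "emeasure (distr (lborel :: (real \<times> real) measure) borel ?f) (box l u) = emeasure lborel (box (Re l, Im l) (Re u, Im u))"
    using m by (simp add: emeasure_distr pre)
  also have "\<dots> = ennreal (\<Prod>b\<in>Basis. ((Re u, Im u) - (Re l, Im l)) \<bullet> b)"
    using le by (intro emeasure_lborel_box) (auto simp: B)
  also have "\<dots> = ennreal (\<Prod>b\<in>Basis. (u - l) \<bullet> b)" by (simp add: B Basis_complex_def)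
  finally show "emeasure (distr lborel borel ?f) (box l u) = ennreal (\<Prod>b\<in>Basis. (u - l) \<bullet> b)" .
qed simp

lemma nn_integral_complex_iterated:
  assumes "F \<in> borel_measurable borel"
  shows "(\<integral>\<^sup>+z. F z \<partial>(lborel :: complex measure)) = (\<integral>\<^sup>+x. \<integral>\<^sup>+y. F (Complex x y) \<partial>lborel \<partial>lborel)"
proof -
  have m: "(\<lambda>p :: real \<times> real. Complex (fst p) (snd p)) \<in> borel_measurable borel"
    by (intro borel_measurable_continuous_onI continuous_on_Complex continuous_intros)
  have "(\<integral>\<^sup>+z. F z \<partial>(lborel :: complex measure)) = (\<integral>\<^sup>+p. F (Complex (fst p) (snd p)) \<partial>(lborel :: (real \<times> real) measure))"
    unfolding lborel_complex_prod using assms m by (intro nn_integral_distr) simp_all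
  also have "\<dots> = (\<integral>\<^sup>+p. F (Complex (fst p) (snd p)) \<partial>(lborel \<Otimes>\<^sub>M lborel))" by (simp add: lborel_prod)
  also have "\<dots> = (\<integral>\<^sup>+x. \<integral>\<^sup>+y. F (Complex x y) \<partial>lborel \<partial>lborel)"
  proof -
    have "(\<lambda>p. F (Complex (fst p) (snd p))) \<in> borel_measurable (lborel \<Otimes>\<^sub>M lborel)"
      using measurable_compose[OF m assms] by (simp add: lborel_prod)
    from lborel.nn_integral_fst[OF this] show ?thesis by simp
  qed
  finally show ?thesis .
qed

lemma continuous_on_iterated:
  fixes E :: "complex \<Rightarrow> real"
  assumes "continuous_on (cbox (Complex x1 y1) (Complex x2 y2)) E"
  shows "continuous_on {x1..x2} (\<lambda>x. integral {y1..y2} (\<lambda>y. E (Complex x y)))"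
    and "x \<in> {x1..x2} \<Longrightarrow> continuous_on {y1..y2} (\<lambda>y. E (Complex x y))"
proof -
  have "continuous_on ({x1..x2} \<times> cbox y1 y2) (\<lambda>(x, y). E (Complex x y))"
    unfolding split_beta
    by (rule continuous_on_compose2[OF assms])
      (auto intro!: continuous_on_Complex continuous_intros simp: in_cbox_complex_iff)
  from integral_continuous_on_param[OF this]
  show "continuous_on {x1..x2} (\<lambda>x. integral {y1..y2} (\<lambda>y. E (Complex x y)))" by simp
  show "continuous_on {y1..y2} (\<lambda>y. E (Complex x y))" if "x \<in> {x1..x2}"
    by (rule continuous_on_compose2[OF assms])
      (use that in \<open>auto intro!: continuous_on_Complex continuous_intros simp: in_cbox_complex_iff\<close>)
qed

text \<open>Bridges the two integrals in use: total curvature is a nonnegative Lebesgue integral,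
  whereas circle means are differentiated as gauge integrals.\<close>

lemma nn_integral_rectangle:
  fixes E :: "complex \<Rightarrow> real"
  assumes E: "continuous_on (cbox (Complex x1 y1) (Complex x2 y2)) E"
    and nonneg: "\<And>z. z \<in> cbox (Complex x1 y1) (Complex x2 y2) \<Longrightarrow> 0 \<le> E z"
  shows "(\<integral>\<^sup>+z. ennreal (E z) * indicator (cbox (Complex x1 y1) (Complex x2 y2)) z \<partial>lborel)
    = ennreal (integral {x1..x2} (\<lambda>x. integral {y1..y2} (\<lambda>y. E (Complex x y))))"
proof -
  let ?R = "cbox (Complex x1 y1) (Complex x2 y2)"
  let ?F = "\<lambda>z. ennreal (E z) * indicator ?R z"
  have "(\<lambda>z. indicator ?R z *\<^sub>R E z) \<in> borel_measurable borel"
    by (rule borel_measurable_continuous_on_indicator[OF _ E]) simp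
  then have "(\<lambda>z. ennreal (indicator ?R z *\<^sub>R E z)) \<in> borel_measurable borel" by measurable
  moreover have "?F = (\<lambda>z. ennreal (indicator ?R z *\<^sub>R E z))" by (auto simp: indicator_def)
  ultimately have m: "?F \<in> borel_measurable borel" by simp
  have ind: "indicator ?R (Complex x y) = (indicator {x1..x2} x * indicator {y1..y2} y :: ennreal)" for x y
    by (auto simp: indicator_def in_cbox_complex_iff)
  have inner: "(\<integral>\<^sup>+y. ?F (Complex x y) \<partial>lborel) = ennreal (integral {y1..y2} (\<lambda>y. E (Complex x y))) * indicator {x1..x2} x" for x
  proof (cases "x \<in> {x1..x2}")
    case True
    have "((\<lambda>y. E (Complex x y)) has_integral integral {y1..y2} (\<lambda>y. E (Complex x y))) {y1..y2}"
      by (intro integrable_integral integrable_continuous_interval continuous_on_iterated(2)[OF E True])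
    from nn_integral_has_integral_lebesgue'[OF _ this]
    have "(\<integral>\<^sup>+y. ennreal (E (Complex x y)) * indicator {y1..y2} y \<partial>lborel) = ennreal (integral {y1..y2} (\<lambda>y. E (Complex x y)))"
      using nonneg True by (simp add: in_cbox_complex_iff)
    then show ?thesis using True by (simp add: ind)
  qed (simp add: ind)
  have "(\<integral>\<^sup>+z. ?F z \<partial>lborel) = (\<integral>\<^sup>+x. ennreal (integral {y1..y2} (\<lambda>y. E (Complex x y))) * indicator {x1..x2} x \<partial>lborel)"
    unfolding nn_integral_complex_iterated[OF m] inner ..
  also have "\<dots> = ennreal (integral {x1..x2} (\<lambda>x. integral {y1..y2} (\<lambda>y. E (Complex x y))))"
  proof (rule nn_integral_has_integral_lebesgue')
    show "0 \<le> integral {y1..y2} (\<lambda>y. E (Complex x y))" if "x \<in> {x1..x2}" for x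
      using that nonneg by (intro integral_nonneg integrable_continuous_interval continuous_on_iterated(2)[OF E]) (auto simp: in_cbox_complex_iff)
    show "((\<lambda>x. integral {y1..y2} (\<lambda>y. E (Complex x y))) has_integral integral {x1..x2} (\<lambda>x. integral {y1..y2} (\<lambda>y. E (Complex x y)))) {x1..x2}"
      by (intro integrable_integral integrable_continuous_interval continuous_on_iterated(1)[OF E])
  qed
  finally show ?thesis .
qed

lemma nn_integral_complex_vec2:
  assumes "F \<in> borel_measurable borel"
  shows "(\<integral>\<^sup>+z. F z \<partial>(lborel :: complex measure)) = (\<integral>\<^sup>+v. F (Complex (v $ 1) (v $ 2)) \<partial>(lborel :: (real ^ 2) measure))"
proof -
  have m: "(\<lambda>v :: real ^ 2. Complex (v $ 1) (v $ 2)) \<in> borel_measurable borel"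
    by (intro borel_measurable_continuous_onI continuous_on_Complex continuous_intros)
  show ?thesis unfolding lborel_complex_vec2 using assms m by (intro nn_integral_distr) simp_all
qed

text \<open>The real Jacobian determinant of a holomorphic map is the squared modulus of its
  derivative. Finiteness allows the passage through absolutely integrable functions, for which the
  substitution rule is applied.\<close>

lemma nn_integral_holomorphic_substitution:
  fixes D :: "complex \<Rightarrow> real"
  assumes U: "open U" and k: "\<kappa> holomorphic_on U" "inj_on \<kappa> U"
    and D: "continuous_on (\<kappa> ` U) D" "\<And>z. z \<in> \<kappa> ` U \<Longrightarrow> 0 \<le> D z"
    and fin: "(\<integral>\<^sup>+z. ennreal (D z) * indicator (\<kappa> ` U) z \<partial>lborel) < \<infinity>"
  shows "(\<integral>\<^sup>+z. ennreal (D (\<kappa> z) * (cmod (deriv \<kappa> z))\<^sup>2) * indicator U z \<partial>lborel)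
    = (\<integral>\<^sup>+z. ennreal (D z) * indicator (\<kappa> ` U) z \<partial>lborel)"
proof -
  let ?c = "\<lambda>v :: real ^ 2. Complex (v $ 1) (v $ 2)"
  let ?v = "\<lambda>z :: complex. vector [Re z, Im z] :: real ^ 2"
  have cv: "?c (?v z) = z" "?v (?c w) = w" for z w by (simp_all add: vec_eq_iff forall_2)
  have oK: "open (\<kappa> ` U)" by (rule open_mapping_thm3[OF k(1) U k(2)])
  have cont_c: "continuous_on UNIV ?c" by (intro continuous_on_Complex continuous_intros)
  define S where "S = ?c -` U"
  define g where "g = (\<lambda>w. ?v (\<kappa> (?c w)))"
  define g' where "g' w h = ?v (deriv \<kappa> (?c w) * ?c h)" for w h
  have oS: "open S" unfolding S_def by (rule open_vimage[OF U cont_c])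
  have lv: "bounded_linear ?v"
    by (rule bounded_linearI'[where 'a = complex]) (simp_all add: vec_eq_iff forall_2)
  have lc: "bounded_linear ?c"
    by (rule bounded_linearI'[where 'a = "real ^ 2"]) (simp_all add: complex_eq_iff)
  have der: "(g has_derivative g' w) (at w within S)" if "w \<in> S" for w
  proof -
    have "(\<kappa> has_derivative (\<lambda>h. deriv \<kappa> (?c w) * h)) (at (?c w))"
      using holomorphic_derivI[OF k(1) U] that unfolding S_def has_field_derivative_def by simp
    from diff_chain_at[OF bounded_linear_imp_has_derivative[OF lc] this]
    have "((\<lambda>w. \<kappa> (?c w)) has_derivative (\<lambda>h. deriv \<kappa> (?c w) * ?c h)) (at w)" by (simp add: o_def)
    from bounded_linear.has_derivative[OF lv this]
    show ?thesis unfolding g_def g'_def[abs_def] by (rule has_derivative_at_withinI)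
  qed
  have det: "\<bar>det (matrix (g' w))\<bar> = (cmod (deriv \<kappa> (?c w)))\<^sup>2" for w
  proof -
    have "det (matrix (g' w)) = (Re (deriv \<kappa> (?c w)))\<^sup>2 + (Im (deriv \<kappa> (?c w)))\<^sup>2"
      unfolding matrix_def g'_def by (simp add: det_2 axis_def power2_eq_square)
    then show ?thesis by (simp add: cmod_power2)
  qed
  have inj: "inj_on g S"
  proof (rule inj_onI)
    fix w1 w2 assume w: "w1 \<in> S" "w2 \<in> S" "g w1 = g w2"
    then have "?c (g w1) = ?c (g w2)" by simp
    then have "\<kappa> (?c w1) = \<kappa> (?c w2)" unfolding g_def cv .
    then have "?c w1 = ?c w2" by (rule inj_onD[OF k(2)]) (use w in \<open>simp_all add: S_def\<close>)
    then show "w1 = w2" using cv(2) by metis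
  qed
  have gS: "w \<in> g ` S \<longleftrightarrow> ?c w \<in> \<kappa> ` U" for w
  proof
    assume "w \<in> g ` S"
    then obtain x where "x \<in> S" "w = g x" by blast
    then show "?c w \<in> \<kappa> ` U" unfolding g_def S_def by (simp only: cv) blast
  next
    assume "?c w \<in> \<kappa> ` U"
    then obtain z where z: "z \<in> U" "?c w = \<kappa> z" by blast
    have "w = g (?v z)" unfolding g_def cv(1) z(2)[symmetric] cv(2) ..
    moreover have "?v z \<in> S" using z(1) unfolding S_def by simp
    ultimately show "w \<in> g ` S" by blast
  qed
  \<comment> \<open>The substitution rule concerns vector-valued integrands, so the density is
    placed in \<open>real ^ 1\<close>.\<close>
  define f where "f w = (vec (D (?c w)) :: real ^ 1)" for w
  have ind: "indicator (\<kappa> ` U) (?c w) = indicator (g ` S) w" for w using gS[of w] by (simp add: indicator_def)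
  have mD: "(\<lambda>z. indicator (\<kappa> ` U) z *\<^sub>R D z) \<in> borel_measurable borel"
    by (rule borel_measurable_continuous_on_indicator[OF _ D(1)]) (use oK in simp)
  have mFe: "(\<lambda>z. ennreal (D z) * indicator (\<kappa> ` U) z) = (\<lambda>z. ennreal (indicator (\<kappa> ` U) z *\<^sub>R D z))"
    by (auto simp: indicator_def)
  have mF: "(\<lambda>z. ennreal (D z) * indicator (\<kappa> ` U) z) \<in> borel_measurable borel"
    unfolding mFe using mD by measurable
  obtain r where r: "(\<integral>\<^sup>+z. ennreal (D z) * indicator (\<kappa> ` U) z \<partial>lborel) = ennreal r" "r \<ge> 0"
    using fin by (metis ennreal_cases infinity_ennreal_def less_irrefl)
  have "(\<integral>\<^sup>+w. ennreal (indicator (g ` S) w * D (?c w)) \<partial>lborel) = ennreal r"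
  proof -
    have "ennreal (indicator (g ` S) w * D (?c w)) = ennreal (D (?c w)) * indicator (\<kappa> ` U) (?c w)" for w
      unfolding ind by (simp add: indicator_def)
    then show ?thesis using nn_integral_complex_vec2[OF mF] r(1) by simp
  qed
  moreover have "(\<lambda>w. indicator (g ` S) w * D (?c w)) \<in> borel_measurable borel"
  proof -
    have "?c \<in> borel_measurable borel" by (rule borel_measurable_continuous_onI[OF cont_c])
    from measurable_compose[OF this mD] show ?thesis unfolding ind by simp
  qed
  moreover have "0 \<le> indicator (g ` S) w * D (?c w)" for w
    using D(2) gS[of w] by (simp add: indicator_def)
  ultimately have "((\<lambda>w. indicator (g ` S) w * D (?c w)) has_integral r) UNIV"
    using nn_integral_has_integral r(2) by blast
  moreover have "(\<lambda>w. indicator (g ` S) w * D (?c w)) = (\<lambda>w. if w \<in> g ` S then D (?c w) else 0)"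
    by (auto simp: indicator_def)
  ultimately have hi: "((\<lambda>w. D (?c w)) has_integral r) (g ` S)" by (simp add: has_integral_restrict_UNIV)
  then have "(\<lambda>w. D (?c w)) absolutely_integrable_on (g ` S)"
    by (intro nonnegative_absolutely_integrable_1) (use D(2) gS in auto)
  then have "f absolutely_integrable_on (g ` S)" "integral (g ` S) f = vec r"
    using hi unfolding f_def absolutely_integrable_on_1_iff by (auto simp: integral_on_1_eq has_integral_iff vec_eq_iff)
  then have cvr: "(\<lambda>w. \<bar>det (matrix (g' w))\<bar> *\<^sub>R f (g w)) absolutely_integrable_on S"
    "integral S (\<lambda>w. \<bar>det (matrix (g' w))\<bar> *\<^sub>R f (g w)) = vec r"
    using has_absolute_integral_change_of_variables[OF _ der inj, of f "vec r"] oS by auto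
  have cg: "?c (g w) = \<kappa> (?c w)" for w unfolding g_def cv ..
  have "(\<lambda>w. (cmod (deriv \<kappa> (?c w)))\<^sup>2 * D (\<kappa> (?c w))) absolutely_integrable_on S"
    using cvr(1) unfolding absolutely_integrable_on_1_iff det f_def cg by simp
  moreover have "integral S (\<lambda>w. (cmod (deriv \<kappa> (?c w)))\<^sup>2 * D (\<kappa> (?c w))) = r"
    using cvr(2) unfolding integral_on_1_eq det f_def cg by (simp add: vec_eq_iff)
  ultimately have hi2: "((\<lambda>w. (cmod (deriv \<kappa> (?c w)))\<^sup>2 * D (\<kappa> (?c w))) has_integral r) S"
    using has_integral_iff set_lebesgue_integral_eq_integral(1) by blast
  have e: "(\<integral>\<^sup>+w. ennreal ((cmod (deriv \<kappa> (?c w)))\<^sup>2 * D (\<kappa> (?c w))) * indicator S w \<partial>lborel) = ennreal r"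
    by (rule nn_integral_has_integral_lebesgue'[OF _ hi2]) (use D(2) in \<open>simp add: S_def\<close>)
  have mG: "(\<lambda>z. ennreal (D (\<kappa> z) * (cmod (deriv \<kappa> z))\<^sup>2) * indicator U z) \<in> borel_measurable borel"
  proof -
    have "continuous_on U (\<lambda>z. D (\<kappa> z) * (cmod (deriv \<kappa> z))\<^sup>2)"
      using k(1) U by (intro continuous_intros continuous_on_compose2[OF D(1)] holomorphic_on_imp_continuous_on holomorphic_deriv) auto
    then have "(\<lambda>z. indicator U z *\<^sub>R (D (\<kappa> z) * (cmod (deriv \<kappa> z))\<^sup>2)) \<in> borel_measurable borel"
      by (rule borel_measurable_continuous_on_indicator[rotated]) (use U in simp)
    moreover have "(\<lambda>z. ennreal (D (\<kappa> z) * (cmod (deriv \<kappa> z))\<^sup>2) * indicator U z) = (\<lambda>z. ennreal (indicator U z *\<^sub>R (D (\<kappa> z) * (cmod (deriv \<kappa> z))\<^sup>2)))"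
      by (auto simp: indicator_def)
    ultimately show ?thesis by simp
  qed
  have "(\<integral>\<^sup>+z. ennreal (D (\<kappa> z) * (cmod (deriv \<kappa> z))\<^sup>2) * indicator U z \<partial>lborel) = ennreal r"
    unfolding nn_integral_complex_vec2[OF mG] using e by (simp add: S_def mult.commute[of "D _"] indicator_def vimage_def)
  then show ?thesis using r(1) by simp
qed

text \<open>The map is to be the exponential on a rectangle of height \<open>2 * pi\<close>, which
  identifies the two horizontal edges. Injectivity is therefore required on \<open>U\<close> only,
  and the remainder of the closed rectangle is a null set.\<close>

lemma rectangle_integral_le_area:
  fixes D E :: "complex \<Rightarrow> real"
  assumes U: "open U" "U \<subseteq> cbox (Complex x1 y1) (Complex x2 y2)" "negligible (cbox (Complex x1 y1) (Complex x2 y2) - U)"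
    and k: "\<kappa> holomorphic_on U" "inj_on \<kappa> U" "\<kappa> ` U \<subseteq> W"
    and D: "continuous_on W D" "\<And>z. z \<in> W \<Longrightarrow> 0 \<le> D z" "(\<integral>\<^sup>+z. ennreal (D z) * indicator W z \<partial>lborel) \<le> ennreal A" "0 \<le> A"
    and E: "continuous_on (cbox (Complex x1 y1) (Complex x2 y2)) E" "\<And>z. z \<in> cbox (Complex x1 y1) (Complex x2 y2) \<Longrightarrow> 0 \<le> E z"
      "\<And>z. z \<in> U \<Longrightarrow> E z = D (\<kappa> z) * (cmod (deriv \<kappa> z))\<^sup>2"
  shows "integral {x1..x2} (\<lambda>x. integral {y1..y2} (\<lambda>y. E (Complex x y))) \<le> A"
proof -
  let ?R = "cbox (Complex x1 y1) (Complex x2 y2)"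
  have le: "(\<integral>\<^sup>+z. ennreal (D z) * indicator (\<kappa> ` U) z \<partial>lborel) \<le> ennreal A"
  proof -
    have "(\<integral>\<^sup>+z. ennreal (D z) * indicator (\<kappa> ` U) z \<partial>lborel) \<le> (\<integral>\<^sup>+z. ennreal (D z) * indicator W z \<partial>lborel)"
      using k(3) by (intro nn_integral_mono) (auto simp: indicator_def)
    then show ?thesis using D(3) by (rule order_trans)
  qed
  have "ennreal (integral {x1..x2} (\<lambda>x. integral {y1..y2} (\<lambda>y. E (Complex x y)))) = (\<integral>\<^sup>+z. ennreal (E z) * indicator ?R z \<partial>lborel)"
    using nn_integral_rectangle[OF E(1,2)] by simp
  also have "\<dots> = (\<integral>\<^sup>+z. ennreal (E z) * indicator ?R z \<partial>lebesgue)" by (simp add: nn_integral_completion)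
  also have "\<dots> = (\<integral>\<^sup>+z. ennreal (D (\<kappa> z) * (cmod (deriv \<kappa> z))\<^sup>2) * indicator U z \<partial>lebesgue)"
  proof (rule nn_integral_cong_AE)
    have "?R - U \<in> null_sets lebesgue" using U(3) negligible_iff_null_sets by blast
    then show "AE z in lebesgue. ennreal (E z) * indicator ?R z = ennreal (D (\<kappa> z) * (cmod (deriv \<kappa> z))\<^sup>2) * indicator U z"
      by (rule AE_I') (use U(2) E(3) in \<open>auto simp: indicator_def\<close>)
  qed
  also have "\<dots> = (\<integral>\<^sup>+z. ennreal (D (\<kappa> z) * (cmod (deriv \<kappa> z))\<^sup>2) * indicator U z \<partial>lborel)" by (simp add: nn_integral_completion)
  also have "\<dots> = (\<integral>\<^sup>+z. ennreal (D z) * indicator (\<kappa> ` U) z \<partial>lborel)"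
  proof (rule nn_integral_holomorphic_substitution[OF U(1) k(1,2)])
    show "continuous_on (\<kappa> ` U) D" by (rule continuous_on_subset[OF D(1) k(3)])
    show "0 \<le> D z" if "z \<in> \<kappa> ` U" for z using that k(3) D(2) by blast
    show "(\<integral>\<^sup>+z. ennreal (D z) * indicator (\<kappa> ` U) z \<partial>lborel) < \<infinity>"
      using le by (simp add: order_le_less_trans)
  qed
  also have "\<dots> \<le> ennreal A" by (rule le)
  finally show ?thesis using D(4) by (simp add: ennreal_le_iff)
qed

lemma exp_eq_representative:
  obtains \<omega> where "exp \<omega> = exp \<zeta>" "Re \<omega> = Re \<zeta>" "0 \<le> Im \<omega>" "Im \<omega> \<le> 2 * pi"
proof -
  define n where "n = \<lfloor>Im \<zeta> / (2 * pi)\<rfloor>"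
  define \<omega> where "\<omega> = \<zeta> - of_int (2 * n) * pi * \<i>"
  have "exp \<zeta> = exp \<omega>" unfolding exp_eq by (rule exI[of _ n]) (simp add: \<omega>_def)
  moreover have "of_int n \<le> Im \<zeta> / (2 * pi)" "Im \<zeta> / (2 * pi) < of_int n + 1" unfolding n_def by linarith+
  then have "of_int n * (2 * pi) \<le> Im \<zeta>" "Im \<zeta> < (of_int n + 1) * (2 * pi)"
    by (simp_all add: pos_le_divide_eq pos_divide_less_eq)
  then have "0 \<le> Im \<omega>" "Im \<omega> \<le> 2 * pi" unfolding \<omega>_def by (simp_all add: algebra_simps)
  ultimately show ?thesis using that[of \<omega>] unfolding \<omega>_def by simp
qed



section \<open>Circle means\<close>

definition laplacian :: "(complex \<Rightarrow> real) \<Rightarrow> complex \<Rightarrow> real"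
  where "laplacian F z = dir_deriv 1 (dir_deriv 1 F) z + dir_deriv \<i> (dir_deriv \<i> F) z"

lemma laplacian_eq_wirtinger:
  assumes "open S" "smooth_on F S" "z \<in> S"
  shows "laplacian F z = Re (4 * dz (dzb (\<lambda>z. of_real (F z))) z)"
proof -
  have s: "smooth_on (\<lambda>z. complex_of_real (F z)) S" by (rule smooth_on_of_real[OF assms(1,2)])
  have "dir_deriv v (dir_deriv v (\<lambda>z. complex_of_real (F z))) z = of_real (dir_deriv v (dir_deriv v F) z)" for v
    by (rule dir_deriv2_linear[OF bounded_linear_of_real assms])
  then show ?thesis unfolding laplacian_def dz2_dir_deriv(2)[OF assms(1) s assms(3)] by simp
qed

lemma laplacian_Re:
  assumes "open S" "smooth_on F S" "z \<in> S"
  shows "laplacian (\<lambda>z. Re (F z)) z = Re (4 * dz (dzb F) z)"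
  unfolding laplacian_def dz2_dir_deriv(2)[OF assms] dir_deriv2_linear[OF bounded_linear_Re assms] by simp

lemma laplacian_cong:
  assumes "open S" "z \<in> S" "\<And>y. y \<in> S \<Longrightarrow> F y = G y"
  shows "laplacian F z = laplacian G z"
proof -
  have "dir_deriv v (dir_deriv v F) z = dir_deriv v (dir_deriv v G) z" for v
    by (intro dir_deriv_cong[OF assms(1)] assms)
  then show ?thesis unfolding laplacian_def by simp
qed

lemma laplacian_o_holomorphic:
  assumes S: "open S" "smooth_on F S" and V: "open V" "\<tau> holomorphic_on V" "\<tau> ` V \<subseteq> S" and z: "z \<in> V"
  shows "laplacian (\<lambda>z. F (\<tau> z)) z = (cmod (deriv \<tau> z))\<^sup>2 * laplacian F (\<tau> z)"
proof -
  let ?F = "\<lambda>z. complex_of_real (F z)"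
  have s: "smooth_on ?F S" by (rule smooth_on_of_real[OF S])
  have sV: "smooth_on (\<lambda>z. F (\<tau> z)) V" by (rule smooth_on_o_holomorphic[OF S(1) V(1,2,3) S(2)])
  have d: "(\<tau> has_field_derivative deriv \<tau> z) (at z)" if "z \<in> V" for z using holomorphic_derivI[OF V(2,1) that] .
  have w: "has_wirtinger (\<lambda>z. G (\<tau> z)) (dz G (\<tau> z) * deriv \<tau> z) (dzb G (\<tau> z) * cnj (deriv \<tau> z)) z"
    if "smooth_on G S" "z \<in> V" for G z
    by (rule has_wirtinger_o_holomorphic[OF smooth_on_has_wirtinger[OF that(1) S(1)] d[OF that(2)]]) (use V that in auto)
  have "dz (dzb (\<lambda>z. ?F (\<tau> z))) z = dz (\<lambda>z. dzb ?F (\<tau> z) * cnj (deriv \<tau> z)) z"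
    by (rule dz_cong[OF V(1) z]) (rule has_wirtinger_imp(2)[OF w[OF s]])
  also have "\<dots> = (dz (dzb ?F) (\<tau> z) * deriv \<tau> z) * cnj (deriv \<tau> z) + dzb ?F (\<tau> z) * cnj 0"
  proof (rule has_wirtinger_imp(1)[OF has_wirtinger_mult[OF w[OF smooth_on_dzb[OF S(1) s] z]]])
    have "(deriv \<tau> has_field_derivative deriv (deriv \<tau>) z) (at z)"
      using holomorphic_derivI[OF holomorphic_deriv[OF V(2,1)] V(1) z] .
    from has_wirtinger_cnj[OF has_wirtinger_holomorphic[OF this]]
    show "has_wirtinger (\<lambda>z. cnj (deriv \<tau> z)) (cnj 0) (cnj (deriv (deriv \<tau>) z)) z" .
  qed
  also have "\<dots> = of_real ((cmod (deriv \<tau> z))\<^sup>2) * dz (dzb ?F) (\<tau> z)"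
    by (simp only: complex_norm_square) simp
  finally have "4 * dz (dzb (\<lambda>z. ?F (\<tau> z))) z = of_real ((cmod (deriv \<tau> z))\<^sup>2) * (4 * dz (dzb ?F) (\<tau> z))" by simp
  then have "Re (4 * dz (dzb (\<lambda>z. ?F (\<tau> z))) z) = (cmod (deriv \<tau> z))\<^sup>2 * Re (4 * dz (dzb ?F) (\<tau> z))"
    by (simp only: Re_complex_of_real Im_complex_of_real times_complex.sel)
  then show ?thesis using laplacian_eq_wirtinger[OF V(1) sV z] laplacian_eq_wirtinger[OF S, of "\<tau> z"] V(3) z by auto
qed

text \<open>The right-hand side is a function \<open>c\<close> because the lemma serves twice: with
  1/4 for Liouville's equation and with the Gauss equation for the curvature of the induced
  metric.\<close>

lemma ln_laplacian:
  assumes U: "open U" and f: "smooth_on \<phi> U" "\<And>z. z \<in> U \<Longrightarrow> cnj (\<phi> z) = \<phi> z" "\<And>z. z \<in> U \<Longrightarrow> Re (\<phi> z) > 0"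
    and l: "\<And>z. z \<in> U \<Longrightarrow> \<phi> z * dz (dzb \<phi>) z - dz \<phi> z * dzb \<phi> z = of_real (c z)"
  shows "smooth_on (\<lambda>z. ln (Re (\<phi> z))) U"
    "z \<in> U \<Longrightarrow> laplacian (\<lambda>z. ln (Re (\<phi> z))) z = 4 * c z / (Re (\<phi> z))\<^sup>2"
proof -
  have r: "\<phi> z = of_real (Re (\<phi> z))" if "z \<in> U" for z using f(2)[OF that] by (metis Reals_cnj_iff of_real_Re)
  have np: "\<phi> ` U \<subseteq> - \<real>\<^sub>\<le>\<^sub>0" using f(3) complex_nonpos_Reals_iff by fastforce
  have nz: "\<phi> z \<noteq> 0" if "z \<in> U" for z using f(3)[OF that] by auto
  have sL: "smooth_on (\<lambda>z. Ln (\<phi> z)) U"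
    by (rule smooth_on_holomorphic_o[OF U _ _ np f(1)]) (auto intro!: holomorphic_intros simp: open_Compl)
  have e: "Re (Ln (\<phi> z)) = ln (Re (\<phi> z))" if "z \<in> U" for z
  proof -
    have "Ln (\<phi> z) = Ln (of_real (Re (\<phi> z)))" using r[OF that] by simp
    also have "\<dots> = of_real (ln (Re (\<phi> z)))" by (rule Ln_of_real[OF f(3)[OF that]])
    finally show ?thesis by simp
  qed
  show "smooth_on (\<lambda>z. ln (Re (\<phi> z))) U"
    by (rule smooth_on_cong[OF U e smooth_on_Re[OF U sL]])
  fix z assume z: "z \<in> U"
  note w = smooth_on_has_wirtinger[OF _ U]
  have wL: "has_wirtinger (\<lambda>z. Ln (\<phi> z)) (inverse (\<phi> z) * dz \<phi> z) (inverse (\<phi> z) * dzb \<phi> z) z" if "z \<in> U" for z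
    by (rule has_wirtinger_holomorphic_o[OF has_field_derivative_Ln w[OF f(1) that]]) (use np that in auto)
  have "dz (dzb (\<lambda>z. Ln (\<phi> z))) z = dz (\<lambda>z. dzb \<phi> z / \<phi> z) z"
    by (rule dz_cong[OF U z]) (use has_wirtinger_imp(2)[OF wL] in \<open>simp add: field_simps\<close>)
  also have "\<dots> = (dz (dzb \<phi>) z * \<phi> z - dzb \<phi> z * dz \<phi> z) / (\<phi> z)\<^sup>2"
    by (rule has_wirtinger_imp(1)[OF has_wirtinger_divide[OF w[OF smooth_on_dzb[OF U f(1)] z] w[OF f(1) z] nz[OF z]]])
  also have "\<dots> = of_real (c z) / (\<phi> z)\<^sup>2" using l[OF z] by (simp add: mult.commute)
  also have "\<dots> = of_real (c z / (Re (\<phi> z))\<^sup>2)" by (subst r[OF z]) simp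
  finally have d: "dz (dzb (\<lambda>z. Ln (\<phi> z))) z = of_real (c z / (Re (\<phi> z))\<^sup>2)" .
  have "laplacian (\<lambda>z. ln (Re (\<phi> z))) z = laplacian (\<lambda>z. Re (Ln (\<phi> z))) z"
    by (rule laplacian_cong[OF U z]) (simp add: e)
  also have "\<dots> = 4 * c z / (Re (\<phi> z))\<^sup>2" unfolding laplacian_Re[OF U sL z] d by simp
  finally show "laplacian (\<lambda>z. ln (Re (\<phi> z))) z = 4 * c z / (Re (\<phi> z))\<^sup>2" .
qed

section \<open>Integrals over one period of the angle\<close>

lemma horizontal_derivative:
  fixes w :: "complex \<Rightarrow> real"
  assumes "open S" "smooth_on w S" "Complex x \<theta> \<in> S"
  shows "((\<lambda>x. w (Complex x \<theta>)) has_real_derivative dir_deriv 1 w (Complex x \<theta>)) (at x)"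
    "((\<lambda>\<theta>. w (Complex x \<theta>)) has_real_derivative dir_deriv \<i> w (Complex x \<theta>)) (at \<theta>)"
proof -
  have D: "(w has_derivative (\<lambda>v. dir_deriv v w (Complex x \<theta>))) (at (Complex x \<theta>))"
    using differentiable_has_derivative_dir smooth_on_differentiable assms by blast
  then have l: "linear (\<lambda>v. dir_deriv v w (Complex x \<theta>))" by (rule has_derivative_linear)
  have c: "Complex s t = of_real s + \<i> * of_real t" for s t by (simp add: complex_eq_iff)
  have "((\<lambda>x. Complex x \<theta>) has_derivative (\<lambda>k. k *\<^sub>R 1)) (at x)"
    unfolding c by (auto intro!: derivative_eq_intros simp: scaleR_conv_of_real)
  from diff_chain_at[OF this D] show "((\<lambda>x. w (Complex x \<theta>)) has_real_derivative dir_deriv 1 w (Complex x \<theta>)) (at x)"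
    unfolding has_field_derivative_def o_def linear_scale[OF l] by (simp add: mult_commute_abs)
  have "((\<lambda>\<theta>. Complex x \<theta>) has_derivative (\<lambda>k. k *\<^sub>R \<i>)) (at \<theta>)"
    unfolding c by (auto intro!: derivative_eq_intros simp: scaleR_conv_of_real)
  from diff_chain_at[OF this D] show "((\<lambda>\<theta>. w (Complex x \<theta>)) has_real_derivative dir_deriv \<i> w (Complex x \<theta>)) (at \<theta>)"
    unfolding has_field_derivative_def o_def linear_scale[OF l] by (simp add: mult_commute_abs)
qed

abbreviation strip :: "real set \<Rightarrow> complex set"
  where "strip I \<equiv> {\<zeta>. Re \<zeta> \<in> I}"

text \<open>Circle mean in the coordinate \<zeta>, not divided by \<open>2 * pi\<close>.\<close>

definition cmean :: "(complex \<Rightarrow> real) \<Rightarrow> real \<Rightarrow> real"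
  where "cmean w x = integral {0..2*pi} (\<lambda>\<theta>. w (Complex x \<theta>))"

lemma open_strip: "open I \<Longrightarrow> open (strip I)"
  using open_vimage[of I Re] continuous_on_Re[OF continuous_on_id] by (simp add: vimage_def)

lemma continuous_on_vertical:
  fixes w :: "complex \<Rightarrow> real"
  assumes "continuous_on (strip I) w" "x \<in> I"
  shows "continuous_on A (\<lambda>\<theta>. w (Complex x \<theta>))"
  by (rule continuous_on_compose2[OF assms(1)]) (use assms(2) in \<open>auto intro!: continuous_on_Complex continuous_intros\<close>)

lemma cmean_derivative:
  fixes w :: "complex \<Rightarrow> real"
  assumes I: "open I" "convex I" "x \<in> I" and w: "smooth_on w (strip I)"
  shows "(cmean w has_real_derivative cmean (dir_deriv 1 w) x) (at x)"
proof -
  have c: "continuous_on (strip I) w" "continuous_on (strip I) (dir_deriv 1 w)"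
    using smooth_on_continuous w smooth_on_dir_deriv by blast+
  have "((\<lambda>x. integral (cbox 0 (2*pi)) (\<lambda>\<theta>. w (Complex x \<theta>))) has_field_derivative
      integral (cbox 0 (2*pi)) (\<lambda>\<theta>. dir_deriv 1 w (Complex x \<theta>))) (at x within I)"
  proof (rule leibniz_rule_field_derivative[where U = I and fx = "\<lambda>x \<theta>. dir_deriv 1 w (Complex x \<theta>)"])
    show "((\<lambda>x. w (Complex x \<theta>)) has_real_derivative dir_deriv 1 w (Complex x \<theta>)) (at x within I)" if "x \<in> I" for x \<theta>
      by (rule has_field_derivative_at_within, rule horizontal_derivative(1)[OF open_strip[OF I(1)] w]) (use that in simp)
    show "(\<lambda>\<theta>. w (Complex x \<theta>)) integrable_on cbox 0 (2*pi)" if "x \<in> I" for x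
      by (rule integrable_continuous, rule continuous_on_vertical[OF c(1) that])
    show "continuous_on (I \<times> cbox 0 (2*pi)) (\<lambda>(x, \<theta>). dir_deriv 1 w (Complex x \<theta>))"
      unfolding split_beta
      by (rule continuous_on_compose2[OF c(2)]) (auto intro!: continuous_on_Complex continuous_intros)
  qed (use I in auto)
  then show ?thesis unfolding cmean_def[abs_def] using at_within_open[OF I(3,1)] by simp
qed

text \<open>The second derivative along the circle integrates to zero by periodicity, so the full
  Laplacian may replace the radial second derivative.\<close>

lemma cmean_second_derivative:
  fixes w :: "complex \<Rightarrow> real"
  assumes I: "open I" "convex I" "x \<in> I" and w: "smooth_on w (strip I)"
    and per: "\<And>\<zeta>. Re \<zeta> \<in> I \<Longrightarrow> w (\<zeta> + period) = w \<zeta>"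
  shows "(cmean (dir_deriv 1 w) has_real_derivative cmean (laplacian w) x) (at x)"
proof -
  note op = open_strip[OF I(1)]
  have s: "smooth_on (dir_deriv v w) (strip I)" "smooth_on (dir_deriv u (dir_deriv v w)) (strip I)" for u v
    using w smooth_on_dir_deriv by blast+
  have D: "dir_deriv \<i> w (\<zeta> + period) = dir_deriv \<i> w \<zeta>" if z: "Re \<zeta> \<in> I" for \<zeta>
  proof -
    have d: "w differentiable (at (\<zeta> + period))" by (rule smooth_on_differentiable[OF w op]) (use z in simp)
    have "((\<lambda>z. z + period) has_field_derivative 1) (at \<zeta>)" by (auto intro!: derivative_eq_intros)
    from has_derivative_compose_holomorphic[OF differentiable_has_derivative_dir[OF d] this]
    have "dir_deriv \<i> (\<lambda>z. w (z + period)) \<zeta> = dir_deriv \<i> w (\<zeta> + period)" using dir_deriv_eqI by fastforce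
    moreover have "dir_deriv \<i> (\<lambda>z. w (z + period)) \<zeta> = dir_deriv \<i> w \<zeta>"
      by (rule dir_deriv_cong[OF op]) (use z per in auto)
    ultimately show ?thesis by simp
  qed
  have "((\<lambda>\<theta>. dir_deriv \<i> (dir_deriv \<i> w) (Complex x \<theta>)) has_integral
      dir_deriv \<i> w (Complex x (2*pi)) - dir_deriv \<i> w (Complex x 0)) {0..2*pi}"
  proof (rule fundamental_theorem_of_calculus)
    show "((\<lambda>\<theta>. dir_deriv \<i> w (Complex x \<theta>)) has_vector_derivative dir_deriv \<i> (dir_deriv \<i> w) (Complex x \<theta>)) (at \<theta> within {0..2*pi})" for \<theta>
      using horizontal_derivative(2)[OF op s(1), of x \<theta>] I(3)
      by (auto simp: has_real_derivative_iff_has_vector_derivative intro: has_vector_derivative_at_within)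
  qed simp
  moreover have "dir_deriv \<i> w (Complex x (2*pi)) = dir_deriv \<i> w (Complex x 0)"
  proof -
    have "Complex x 0 + period = Complex x (2 * pi)" by (simp add: complex_eq_iff)
    then show ?thesis using D[of "Complex x 0"] I(3) by simp
  qed
  ultimately have i0: "integral {0..2*pi} (\<lambda>\<theta>. dir_deriv \<i> (dir_deriv \<i> w) (Complex x \<theta>)) = 0" by (simp add: integral_unique)
  have ig: "(\<lambda>\<theta>. dir_deriv u (dir_deriv v w) (Complex x \<theta>)) integrable_on {0..2*pi}" for u v
    by (rule integrable_continuous_interval, rule continuous_on_vertical[OF smooth_on_continuous[OF s(2)] I(3)])
  have "cmean (laplacian w) x = cmean (dir_deriv 1 (dir_deriv 1 w)) x"
    unfolding cmean_def laplacian_def integral_add[OF ig ig] i0 by simp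
  then show ?thesis using cmean_derivative[OF I s(1)] by simp
qed

text \<open>In the coordinate \<open>p + exp \<zeta>\<close> the slope of the circle mean is
  nonincreasing. A positive slope would persist towards smaller radii and make the means unbounded
  below. Hence the means decrease with the radius, starting from the value at the centre.\<close>

lemma superharmonic_mean_le:
  fixes w :: "complex \<Rightarrow> real"
  assumes w: "smooth_on w (ball p 2)" "\<And>z. z \<in> ball p 2 \<Longrightarrow> laplacian w z \<le> 0" and \<rho>: "\<rho> \<le> 0"
  shows "integral {0..2*pi} (\<lambda>\<theta>. w (p + exp (Complex \<rho> \<theta>))) \<le> 2 * pi * w p"
proof -
  define I where "I = {..< ln (2::real)}"
  have I: "open I" "convex I" "\<rho> \<in> I" using \<rho> by (auto simp: I_def order_le_less_trans[of _ 0])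
  let ?\<tau> = "\<lambda>\<zeta>. p + exp \<zeta>"
  define v where "v = (\<lambda>\<zeta>. w (?\<tau> \<zeta>))"
  have im: "?\<tau> ` strip I \<subseteq> ball p 2"
  proof -
    have "exp (Re \<zeta>) < 2" if "Re \<zeta> < ln 2" for \<zeta> using that by (metis exp_less_cancel_iff exp_ln zero_less_numeral)
    then show ?thesis unfolding I_def by (auto simp: dist_norm)
  qed
  have hol: "?\<tau> holomorphic_on strip I" by (intro holomorphic_intros)
  have sv: "smooth_on v (strip I)" unfolding v_def
    by (rule smooth_on_o_holomorphic[OF open_ball open_strip[OF I(1)] hol im w(1)])
  have per: "v (\<zeta> + period) = v \<zeta>" for \<zeta> unfolding v_def exp_period ..
  have lap: "laplacian v \<zeta> \<le> 0" if "Re \<zeta> \<in> I" for \<zeta>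
  proof -
    have "laplacian v \<zeta> = (cmod (deriv ?\<tau> \<zeta>))\<^sup>2 * laplacian w (?\<tau> \<zeta>)"
      unfolding v_def by (rule laplacian_o_holomorphic[OF open_ball w(1) open_strip[OF I(1)] hol im]) (use that in simp)
    moreover have "laplacian w (?\<tau> \<zeta>) \<le> 0" using w(2) im that by blast
    ultimately show ?thesis by (simp add: mult_nonneg_nonpos)
  qed
  define G1 where "G1 = cmean (dir_deriv 1 v)"
  have d1: "(cmean v has_real_derivative G1 x) (at x)" if "x \<in> I" for x
    unfolding G1_def by (rule cmean_derivative[OF I(1,2) that sv])
  have d2: "(G1 has_real_derivative cmean (laplacian v) x) (at x)" if "x \<in> I" for x
    unfolding G1_def by (rule cmean_second_derivative[OF I(1,2) that sv per])
  have neg: "cmean (laplacian v) x \<le> 0" if "x \<in> I" for x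
  proof -
    have "continuous_on (strip I) (laplacian v)"
      unfolding laplacian_def[abs_def]
      by (intro continuous_on_add smooth_on_continuous smooth_on_dir_deriv sv)
    then have "(\<lambda>\<theta>. laplacian v (Complex x \<theta>)) integrable_on {0..2*pi}"
      by (intro integrable_continuous_interval continuous_on_vertical[OF _ that])
    then have "integral {0..2*pi} (\<lambda>\<theta>. laplacian v (Complex x \<theta>)) \<le> integral {0..2*pi} (\<lambda>\<theta>. 0)"
      by (rule integral_le) (use lap that in auto)
    then show ?thesis unfolding cmean_def by simp
  qed
  have G1_mono: "G1 y \<le> G1 x" if "x \<le> y" "y \<in> I" for x y
    by (rule DERIV_nonpos_imp_nonincreasing[OF that(1)])
      (use d2 neg that(2) in \<open>unfold I_def, metis lessThan_iff order_le_less_trans\<close>)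
  have igv: "(\<lambda>\<theta>. v (Complex x \<theta>)) integrable_on {0..2*pi}" if "x \<in> I" for x
    by (intro integrable_continuous_interval continuous_on_vertical[OF smooth_on_continuous[OF sv] that])
  have G1_neg: "G1 x \<le> 0" if x: "x \<in> I" for x
  proof (rule ccontr)
    assume "\<not> G1 x \<le> 0"
    then have c: "G1 x > 0" by simp
    have "bounded (w ` cball p (exp x))"
    proof (intro compact_imp_bounded compact_continuous_image compact_cball)
      have "exp x < 2" using x unfolding I_def by (metis exp_less_cancel_iff exp_ln lessThan_iff zero_less_numeral)
      then show "continuous_on (cball p (exp x)) w"
        by (intro continuous_on_subset[OF smooth_on_continuous[OF w(1)]]) auto
    qed
    then obtain B where B: "B > 0" "\<And>z. z \<in> cball p (exp x) \<Longrightarrow> \<bar>w z\<bar> \<le> B" unfolding bounded_pos by auto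
    have Fb: "\<bar>cmean v y\<bar> \<le> B * (2 * pi)" if y: "y \<le> x" for y
    proof -
      have yI: "y \<in> I" using y x unfolding I_def by auto
      have vb: "\<bar>v (Complex y \<theta>)\<bar> \<le> B" for \<theta> unfolding v_def by (rule B(2)) (use y in \<open>simp add: dist_norm\<close>)
      have "norm (integral {0..2*pi} (\<lambda>\<theta>. v (Complex y \<theta>))) \<le> integral {0..2*pi} (\<lambda>\<theta>. B)"
        by (rule integral_norm_bound_integral[OF igv[OF yI]]) (use vb in auto)
      then show ?thesis unfolding cmean_def by (simp add: mult.commute)
    qed
    \<comment> \<open>So far to the left that a slope of at least \<open>G1 x\<close> changes the
      mean by more than twice its bound \<open>B * (2 * pi)\<close>.\<close>
    define y where "y = x - (2 * (B * (2 * pi)) + 1) / G1 x"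
    have y: "y < x" unfolding y_def using c B(1) by (simp add: add_nonneg_pos)
    obtain z where z: "y < z" "z < x" "cmean v x - cmean v y = (x - y) * G1 z"
      using MVT2[OF y, of "cmean v" G1] d1 x unfolding I_def by force
    have "(x - y) * G1 x \<le> (x - y) * G1 z" using G1_mono[of z x] z x y by (intro mult_left_mono) auto
    moreover have "(x - y) * G1 x = 2 * (B * (2 * pi)) + 1" unfolding y_def using c by simp
    ultimately show False using z(3) Fb[of x] Fb[of y] y by linarith
  qed
  have mono: "cmean v \<rho> \<le> cmean v s" if "s \<le> \<rho>" for s
    by (rule DERIV_nonpos_imp_nonincreasing[OF that])
      (use d1 G1_neg I(3) in \<open>unfold I_def, metis lessThan_iff order_le_less_trans\<close>)
  have "cmean v \<rho> \<le> 2 * pi * w p + e" if e: "e > 0" for e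
  proof -
    have "isCont w p" using smooth_on_continuous[OF w(1)] continuous_on_eq_continuous_at[of "ball p 2" w] by auto
    then obtain d where d: "d > 0" "\<And>z. dist z p < d \<Longrightarrow> dist (w z) (w p) < e / (2 * pi)"
      using e unfolding continuous_at_eps_delta by (metis divide_pos_pos mult_pos_pos pi_gt_zero zero_less_numeral)
    define s where "s = min \<rho> (ln (d / 2))"
    have s: "s \<le> \<rho>" "exp s < d"
    proof -
      have "exp s \<le> exp (ln (d / 2))" unfolding s_def by (intro exp_le_cancel_iff[THEN iffD2] min.cobounded2)
      then show "exp s < d" using d(1) by simp
    qed (simp add: s_def)
    have sI: "s \<in> I" using s(1) I(3) unfolding I_def by auto
    have vb: "v (Complex s \<theta>) \<le> w p + e / (2 * pi)" for \<theta>
      using d(2)[of "p + exp (Complex s \<theta>)"] s(2) unfolding v_def by (simp add: dist_norm abs_le_iff abs_less_iff)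
    have "integral {0..2*pi} (\<lambda>\<theta>. v (Complex s \<theta>)) \<le> integral {0..2*pi} (\<lambda>\<theta>. w p + e / (2 * pi))"
      by (rule integral_le[OF igv[OF sI]]) (use vb in auto)
    also have "\<dots> = 2 * pi * w p + e" by (simp add: field_simps)
    finally show ?thesis using mono[OF s(1)] unfolding cmean_def by linarith
  qed
  then have "cmean v \<rho> \<le> 2 * pi * w p" by (rule field_le_epsilon)
  then show ?thesis unfolding cmean_def v_def .
qed

lemma integral_periodic_shift:
  fixes f :: "real \<Rightarrow> real"
  assumes f: "continuous_on UNIV f" "\<And>\<theta>. f (\<theta> + 2 * pi) = f \<theta>" and y: "0 \<le> y" "y \<le> 2 * pi"
  shows "integral {y..y + 2 * pi} f = integral {0..2 * pi} f"
proof -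
  have ig: "f integrable_on {a..b}" for a b
    by (rule integrable_continuous_interval) (rule continuous_on_subset[OF f(1)], simp)
  have 1: "integral {y..2*pi} f + integral {2*pi..y+2*pi} f = integral {y..y+2*pi} f"
    by (rule Henstock_Kurzweil_Integration.integral_combine) (use y ig in auto)
  have 2: "integral {0..y} f + integral {y..2*pi} f = integral {0..2*pi} f"
    by (rule Henstock_Kurzweil_Integration.integral_combine) (use y ig in auto)
  have "integral {0..y} (f \<circ> ((+) (2*pi))) = integral {0 + 2*pi..y + 2*pi} f" by (rule integral_shift_Icc_real)
  moreover have "f \<circ> ((+) (2*pi)) = f" using f(2) by (simp add: fun_eq_iff add.commute)
  ultimately show ?thesis using 1 2 by simp
qed

section \<open>Finite area bounds the growth\<close>

text \<open>Put \<open>w = - ln \<phi>\<close>; the area density is \<open>m = exp (2 * w)\<close>,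
  and \<open>w\<close> has Laplacian \<open>- m\<close>. Finite area bounds the slope of the circle
  means of \<open>w\<close>, which therefore grow at most linearly. The superharmonic mean value
  inequality then converts this into a pointwise lower bound of \<open>w\<close> that is linear in
  the real part, that is, into exponential growth of \<phi>.\<close>

lemma (in periodic_liouville) growth_of_area:
  assumes area: "\<And>x1 x2. x1 \<le> x2 \<Longrightarrow> x2 < a \<Longrightarrow>
    integral {x1..x2} (\<lambda>x. integral {0..2*pi} (\<lambda>\<theta>. 1 / (Re (\<phi> (Complex x \<theta>)))\<^sup>2)) \<le> A"
  obtains K M a0 where "a0 < a" "\<And>\<zeta>. Re \<zeta> \<le> a0 \<Longrightarrow> Re (\<phi> \<zeta>) \<le> K * exp (M * \<bar>Re \<zeta>\<bar>)"
proof -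
  define I where "I = {..<a}"
  have I: "open I" "convex I" unfolding I_def by auto
  have sI: "strip I = half_plane a" unfolding I_def by auto
  define w where "w \<zeta> = - ln (Re (\<phi> \<zeta>))" for \<zeta>
  define m where "m \<zeta> = 1 / (Re (\<phi> \<zeta>))\<^sup>2" for \<zeta>
  have l4: "\<And>z. z \<in> half_plane a \<Longrightarrow> \<phi> z * dz (dzb \<phi>) z - dz \<phi> z * dzb \<phi> z = of_real (1/4)"
    using liouville by simp
  have sln: "smooth_on (\<lambda>z. ln (Re (\<phi> z))) (half_plane a)"
    by (rule ln_laplacian(1)[OF op smooth _ _ l4]) (use real pos in auto)
  have lapln: "laplacian (\<lambda>z. ln (Re (\<phi> z))) z = m z" if "Re z < a" for z
  proof -
    have "laplacian (\<lambda>z. ln (Re (\<phi> z))) z = 4 * (1/4) / (Re (\<phi> z))\<^sup>2"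
      by (rule ln_laplacian(2)[OF op smooth _ _ l4]) (use real pos that in auto)
    then show ?thesis unfolding m_def by simp
  qed
  have sw: "smooth_on w (half_plane a)" unfolding w_def[abs_def] by (rule smooth_on_uminus[OF op sln])
  have lap: "laplacian w z = - m z" if z: "Re z < a" for z
  proof -
    have "dir_deriv v (dir_deriv v w) z = - dir_deriv v (dir_deriv v (\<lambda>z. ln (Re (\<phi> z)))) z" for v
      unfolding w_def[abs_def]
      by (rule dir_deriv2_linear[OF bounded_linear_minus[OF bounded_linear_ident] op sln]) (use z in simp)
    then have "laplacian w z = - laplacian (\<lambda>z. ln (Re (\<phi> z))) z" unfolding laplacian_def by simp
    then show ?thesis using lapln[OF z] by simp
  qed
  have cphi: "continuous_on (half_plane a) (\<lambda>z. Re (\<phi> z))"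
    by (intro continuous_intros smooth_on_continuous[OF smooth])
  have cm: "continuous_on (half_plane a) m"
    unfolding m_def[abs_def] by (intro continuous_intros cphi) (use pos in force)
  have cw: "continuous_on (half_plane a) w" by (rule smooth_on_continuous[OF sw])
  have wper: "w (\<zeta> + period) = w \<zeta>" if "Re \<zeta> < a" for \<zeta> unfolding w_def periodic[OF that] ..
  define F where "F = cmean w"
  define F1 where "F1 = cmean (dir_deriv 1 w)"
  have dF: "(F has_real_derivative F1 x) (at x)" if "x < a" for x
    unfolding F_def F1_def by (rule cmean_derivative[OF I]) (use that sw sI I_def in auto)
  have lapm: "cmean (laplacian w) x = - cmean m x" if "x < a" for x
  proof -
    have "cmean (laplacian w) x = integral {0..2*pi} (\<lambda>\<theta>. - m (Complex x \<theta>))"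
      unfolding cmean_def by (rule integral_cong) (use lap that in simp)
    then show ?thesis unfolding cmean_def by simp
  qed
  have dF1: "(F1 has_real_derivative - cmean m x) (at x)" if "x < a" for x
    unfolding F1_def lapm[OF that, symmetric] by (rule cmean_second_derivative[OF I]) (use that sw sI wper I_def in auto)
  have area': "integral {x1..x2} (cmean m) \<le> A" if "x1 \<le> x2" "x2 < a" for x1 x2
    using area[OF that] unfolding cmean_def m_def .
  have ftc: "(cmean m has_integral F1 x1 - F1 x2) {x1..x2}" if "x1 \<le> x2" "x2 < a" for x1 x2
  proof -
    have "((\<lambda>x. - cmean m x) has_integral F1 x2 - F1 x1) {x1..x2}"
    proof (rule fundamental_theorem_of_calculus[OF that(1)])
      fix x assume "x \<in> {x1..x2}"
      then have "x < a" using that(2) by simp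
      from dF1[OF this] show "(F1 has_vector_derivative - cmean m x) (at x within {x1..x2})"
        unfolding has_real_derivative_iff_has_vector_derivative by (rule has_vector_derivative_at_within)
    qed
    from has_integral_neg[OF this] show ?thesis by simp
  qed
  define x0 where "x0 = a - 1"
  \<comment> \<open>The slope is nonincreasing, and its increase towards the left is exactly the
    area swept.\<close>
  have F1b: "F1 x0 \<le> F1 x" "F1 x \<le> F1 x0 + A" if "x \<le> x0" for x
  proof -
    have xa: "x0 < a" unfolding x0_def by simp
    have "integral {x..x0} (cmean m) = F1 x - F1 x0" using ftc[OF that xa] by (rule integral_unique)
    then show "F1 x \<le> F1 x0 + A" using area'[OF that xa] by simp
    have "F1 x - F1 x0 \<ge> 0"
    proof (rule has_integral_nonneg[OF ftc[OF that xa]])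
      show "0 \<le> cmean m y" if "y \<in> {x..x0}" for y
        unfolding cmean_def using that xa
        by (intro integral_nonneg integrable_continuous_interval continuous_on_vertical[OF cm[folded sI]]) (auto simp: m_def I_def)
    qed
    then show "F1 x0 \<le> F1 x" by simp
  qed
  have A0: "A \<ge> 0" using F1b[of x0] by simp
  define B where "B = \<bar>F x0\<bar> + (\<bar>F1 x0\<bar> + A) * (1 + \<bar>x0\<bar>)"
  have Fb: "\<bar>F x\<bar> \<le> B * (1 + \<bar>x\<bar>)" if x: "x \<le> x0" for x
  proof -
    have "\<bar>F x0 - F x\<bar> \<le> (\<bar>F1 x0\<bar> + A) * (x0 - x)"
    proof (cases "x = x0")
      case False
      then have lt: "x < x0" using x by simp
      obtain z where z: "x < z" "z < x0" "F x0 - F x = (x0 - x) * F1 z"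
        using MVT2[OF lt, of F F1] dF unfolding x0_def by force
      have "\<bar>F1 z\<bar> \<le> \<bar>F1 x0\<bar> + A" using F1b[of z] z A0 by linarith
      then have "\<bar>F1 z\<bar> * (x0 - x) \<le> (\<bar>F1 x0\<bar> + A) * (x0 - x)" using lt by (intro mult_right_mono) auto
      then show ?thesis using z(3) lt by (simp add: abs_mult mult.commute)
    qed simp
    also have "\<dots> \<le> (\<bar>F1 x0\<bar> + A) * ((1 + \<bar>x0\<bar>) * (1 + \<bar>x\<bar>))"
    proof (rule mult_left_mono)
      have "x0 - x \<le> \<bar>x0\<bar> + \<bar>x\<bar>" by simp
      moreover have "0 \<le> \<bar>x0\<bar> * \<bar>x\<bar>" by simp
      moreover have "(1 + \<bar>x0\<bar>) * (1 + \<bar>x\<bar>) = 1 + \<bar>x0\<bar> + \<bar>x\<bar> + \<bar>x0\<bar> * \<bar>x\<bar>" by (simp add: algebra_simps)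
      ultimately show "x0 - x \<le> (1 + \<bar>x0\<bar>) * (1 + \<bar>x\<bar>)" by linarith
    qed (use A0 in simp)
    finally have "\<bar>F x\<bar> \<le> \<bar>F x0\<bar> + (\<bar>F1 x0\<bar> + A) * (1 + \<bar>x0\<bar>) * (1 + \<bar>x\<bar>)" unfolding mult.assoc by linarith
    moreover have "\<bar>F x0\<bar> * 1 \<le> \<bar>F x0\<bar> * (1 + \<bar>x\<bar>)" by (rule mult_left_mono) simp_all
    ultimately show ?thesis unfolding B_def distrib_right by linarith
  qed
  have B0: "B \<ge> 0" unfolding B_def using A0 by simp
  \<comment> \<open>A continuous nonnegative bound for the negative part of \<open>w\<close>:
    nonnegative because \<open>w\<close> is less than \<open>exp (2 * w)\<close>, and its integral
    consists of area and circle means, both of which are controlled.\<close>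
  define P where "P \<zeta> = m \<zeta> - w \<zeta>" for \<zeta>
  have P: "P \<zeta> \<ge> 0" "- P \<zeta> \<le> w \<zeta>" if "Re \<zeta> < a" for \<zeta>
  proof -
    have mw: "m \<zeta> = exp (2 * w \<zeta>)"
    proof -
      have "exp (2 * w \<zeta>) = (exp (w \<zeta>))\<^sup>2" by (simp add: power2_eq_square mult_exp_exp)
      also have "exp (w \<zeta>) = 1 / Re (\<phi> \<zeta>)" unfolding w_def using pos[OF that] by (simp add: exp_minus field_simps)
      finally show ?thesis unfolding m_def by (simp add: power_divide)
    qed
    have "1 + 2 * w \<zeta> \<le> exp (2 * w \<zeta>)" by (rule exp_ge_add_one_self)
    moreover have "0 < exp (2 * w \<zeta>)" by simp
    ultimately show "P \<zeta> \<ge> 0" unfolding P_def mw by linarith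
    show "- P \<zeta> \<le> w \<zeta>" unfolding P_def mw by simp
  qed
  have cP: "continuous_on (half_plane a) P" unfolding P_def[abs_def] by (intro continuous_intros cm cw)
  \<comment> \<open>Radial weight of the annulus with radii \<open>exp (-1)\<close> and 1, where
    \<open>exp (2 * \<rho>)\<close> is the Jacobian of polar coordinates with logarithmic
    radius.\<close>
  define c0 where "c0 = integral {-1..0::real} (\<lambda>\<rho>. exp (2 * \<rho>))"
  have c0: "c0 > 0"
  proof -
    have "((\<lambda>\<rho>::real. exp (2 * \<rho>)) has_integral (exp (2 * 0) / 2 - exp (2 * (-1)) / 2)) {-1..0}"
      by (rule fundamental_theorem_of_calculus)
        (auto simp flip: has_real_derivative_iff_has_vector_derivative intro!: derivative_eq_intros)
    then have "c0 = 1 / 2 - exp (- 2) / 2" unfolding c0_def by (simp add: integral_unique)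
    moreover have "exp (- 2 :: real) < 1" by simp
    ultimately show ?thesis by linarith
  qed
  \<comment> \<open>The mean value inequality at \<open>p\<close>, averaged over the annulus around
    \<open>p\<close>. The range of \<open>Im p\<close> lets the window of height
    \<open>2 * pi\<close> centred at \<open>p\<close> start between 0 and
    \<open>2 * pi\<close>.\<close>
  have lower: "- (A + 4 * (B * (3 + \<bar>Re p\<bar>))) \<le> 2 * pi * w p * c0" if p: "Re p \<le> a - 4" "pi \<le> Im p" "Im p \<le> 3 * pi" for p
  proof -
    define y where "y = Im p - pi"
    have y: "0 \<le> y" "y \<le> 2 * pi" unfolding y_def using p by auto
    \<comment> \<open>Contains the unit disc around \<open>p\<close> and has the height of one full
      period, so that the inner integrals of \<open>P\<close> are circle means.\<close>
    let ?W = "cbox (Complex (Re p - 2) y) (Complex (Re p + 2) (y + 2 * pi))"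
    have WH: "?W \<subseteq> half_plane a" using p by (auto simp: in_cbox_complex_iff)
    have PW: "P z \<ge> 0" if "z \<in> ?W" for z using P(1) WH that by blast
    define Ap where "Ap = integral {Re p - 2..Re p + 2} (\<lambda>x. integral {y..y + 2*pi} (\<lambda>\<theta>. P (Complex x \<theta>)))"
    have nn: "(\<integral>\<^sup>+z. ennreal (P z) * indicator ?W z \<partial>lborel) = ennreal Ap"
      unfolding Ap_def by (rule nn_integral_rectangle[OF continuous_on_subset[OF cP WH] PW])
    have inner: "integral {y..y + 2*pi} (\<lambda>\<theta>. P (Complex x \<theta>)) = cmean m x - F x" if "x < a" for x
    proof -
      have "integral {y..y + 2*pi} (\<lambda>\<theta>. P (Complex x \<theta>)) = integral {0..2*pi} (\<lambda>\<theta>. P (Complex x \<theta>))"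
      proof (rule integral_periodic_shift[OF _ _ y])
        show "continuous_on UNIV (\<lambda>\<theta>. P (Complex x \<theta>))"
          by (rule continuous_on_vertical[OF cP[folded sI]]) (use that I_def in simp)
        show "P (Complex x (\<theta> + 2 * pi)) = P (Complex x \<theta>)" for \<theta>
        proof -
          have "Complex x (\<theta> + 2 * pi) = Complex x \<theta> + period" by (simp add: complex_eq_iff)
          then show ?thesis unfolding P_def m_def w_def using periodic[of "Complex x \<theta>"] that by simp
        qed
      qed
      also have "\<dots> = cmean m x - F x"
        unfolding P_def cmean_def F_def using that
        by (intro integral_diff integrable_continuous_interval continuous_on_vertical[OF cm[folded sI]] continuous_on_vertical[OF cw[folded sI]])
          (auto simp: I_def)
      finally show ?thesis .
    qed
    have xa: "Re p - 2 \<le> Re p + 2" "Re p + 2 < a" using p by auto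
    have cF: "continuous_on {Re p - 2..Re p + 2} F"
      by (intro continuous_at_imp_continuous_on ballI DERIV_isCont[OF dF]) (use p in auto)
    have ApA: "Ap \<le> A + 4 * (B * (3 + \<bar>Re p\<bar>))"
    proof -
      have "Ap = integral {Re p - 2..Re p + 2} (\<lambda>x. cmean m x - F x)"
        unfolding Ap_def by (rule integral_cong) (use inner p in auto)
      also have "\<dots> = integral {Re p - 2..Re p + 2} (cmean m) - integral {Re p - 2..Re p + 2} F"
        by (rule integral_diff) (use has_integral_integrable[OF ftc[OF xa]] integrable_continuous_interval[OF cF] in auto)
      also have "\<dots> \<le> A + 4 * (B * (3 + \<bar>Re p\<bar>))"
      proof -
        have "integral {Re p - 2..Re p + 2} (\<lambda>x. - (B * (3 + \<bar>Re p\<bar>))) \<le> integral {Re p - 2..Re p + 2} F"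
        proof (rule integral_le[OF _ integrable_continuous_interval[OF cF]])
          show "- (B * (3 + \<bar>Re p\<bar>)) \<le> F x" if "x \<in> {Re p - 2..Re p + 2}" for x
          proof -
            have "\<bar>F x\<bar> \<le> B * (1 + \<bar>x\<bar>)" using Fb[of x] that p unfolding x0_def by auto
            also have "\<dots> \<le> B * (3 + \<bar>Re p\<bar>)" using that B0 by (intro mult_left_mono) auto
            finally show ?thesis by linarith
          qed
        qed (intro integrable_continuous_interval continuous_intros)
        moreover have "integral {Re p - 2..Re p + 2} (\<lambda>x. - k) = - (4 * k)" for k :: real by simp
        ultimately show ?thesis using area'[OF xa] by (simp only:)
      qed
      finally show ?thesis .
    qed
    let ?\<kappa> = "\<lambda>\<zeta>. p + exp \<zeta>"
    define E where "E \<zeta> = P (?\<kappa> \<zeta>) * exp (2 * Re \<zeta>)" for \<zeta>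
    have kW: "?\<kappa> \<zeta> \<in> ?W" if "Re \<zeta> \<le> 0" for \<zeta>
    proof -
      have "cmod (exp \<zeta>) \<le> 1" using that by simp
      then have "\<bar>Re (exp \<zeta>)\<bar> \<le> 1" "\<bar>Im (exp \<zeta>)\<bar> \<le> 1" 
        using abs_Re_le_cmod[of "exp \<zeta>"] abs_Im_le_cmod[of "exp \<zeta>"] by linarith+
      then show ?thesis unfolding y_def using pi_ge_two by (auto simp: in_cbox_complex_iff abs_le_iff)
    qed
    have cE: "continuous_on (cbox (Complex (-1) 0) (Complex 0 (2*pi))) E"
      unfolding E_def[abs_def]
      by (intro continuous_intros continuous_on_compose2[OF continuous_on_subset[OF cP WH]])
        (auto intro!: kW simp: in_cbox_complex_iff)
    \<comment> \<open>The annulus lies in the window and \<open>P\<close> is nonnegative, so its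
      integral in polar coordinates is at most that over the window.\<close>
    have EA: "integral {-1..0} (\<lambda>x. integral {0..2*pi} (\<lambda>\<theta>. E (Complex x \<theta>))) \<le> Ap"
    proof (rule rectangle_integral_le_area[where U = "box (Complex (-1) 0) (Complex 0 (2*pi))" and \<kappa> = ?\<kappa> and W = ?W and D = P])
      show "inj_on ?\<kappa> (box (Complex (-1) 0) (Complex 0 (2*pi)))"
      proof (rule inj_onI)
        fix u v assume u: "u \<in> box (Complex (-1) 0) (Complex 0 (2*pi))" "v \<in> box (Complex (-1) 0) (Complex 0 (2*pi))" "p + exp u = p + exp v"
        have 1: "exp u = exp v" using u(3) by simp
        have 2: "\<bar>Im u - Im v\<bar> < 2 * pi" using u(1,2) by (simp add: in_box_complex_iff abs_less_iff)
        show "u = v" by (rule exp_complex_eqI[OF 2 1])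
      qed
      have cPW: "continuous_on ?W P" by (rule continuous_on_subset[OF cP WH])
      show "0 \<le> Ap" unfolding Ap_def
      proof (rule integral_nonneg[OF integrable_continuous_interval[OF continuous_on_iterated(1)[OF cPW]]])
        fix x assume x: "x \<in> {Re p - 2..Re p + 2}"
        show "0 \<le> integral {y..y + 2 * pi} (\<lambda>\<theta>. P (Complex x \<theta>))"
          by (rule integral_nonneg[OF integrable_continuous_interval[OF continuous_on_iterated(2)[OF cPW x]]])
            (use x PW in \<open>simp add: in_cbox_complex_iff\<close>)
      qed
      show "E z = P (?\<kappa> z) * (cmod (deriv ?\<kappa> z))\<^sup>2" for z
      proof -
        have "(?\<kappa> has_field_derivative exp z) (at z)" by (auto intro!: derivative_eq_intros)
        then have "deriv ?\<kappa> z = exp z" by (rule DERIV_imp_deriv)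
        then show ?thesis unfolding E_def by (simp add: power2_eq_square mult_exp_exp)
      qed
      show "0 \<le> E z" if "z \<in> cbox (Complex (-1) 0) (Complex 0 (2*pi))" for z
        unfolding E_def using that PW kW by (auto simp: in_cbox_complex_iff)
      show "(\<integral>\<^sup>+z. ennreal (P z) * indicator ?W z \<partial>lborel) \<le> ennreal Ap" using nn by simp
    qed (use kW in \<open>auto intro!: holomorphic_intros negligible_frontier_interval box_subset_cbox cE continuous_on_subset[OF cP WH] PW simp: in_box_complex_iff\<close>)
    \<comment> \<open>On each circle \<open>- P\<close> is below \<open>w\<close>, and the circle
      integral of \<open>w\<close> is at most its value at the centre times
      \<open>2 * pi\<close>.\<close>
    have inner2: "- integral {0..2*pi} (\<lambda>\<theta>. E (Complex \<rho> \<theta>)) \<le> 2 * pi * w p * exp (2 * \<rho>)" if \<rho>: "\<rho> \<in> {-1..0}" for \<rho>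
    proof -
      have cwk: "continuous_on {0..2*pi} (\<lambda>\<theta>. w (?\<kappa> (Complex \<rho> \<theta>)))"
        by (rule continuous_on_compose2[OF continuous_on_subset[OF cw WH]])
          (use \<rho> in \<open>auto intro!: kW continuous_intros continuous_on_Complex\<close>)
      have "- integral {0..2*pi} (\<lambda>\<theta>. E (Complex \<rho> \<theta>)) = integral {0..2*pi} (\<lambda>\<theta>. - E (Complex \<rho> \<theta>))" by simp
      also have "\<dots> \<le> integral {0..2*pi} (\<lambda>\<theta>. w (?\<kappa> (Complex \<rho> \<theta>)) * exp (2 * \<rho>))"
      proof (rule integral_le)
        show "(\<lambda>\<theta>. - E (Complex \<rho> \<theta>)) integrable_on {0..2*pi}"
          by (intro integrable_continuous_interval continuous_intros continuous_on_iterated(2)[OF cE \<rho>])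
        show "(\<lambda>\<theta>. w (?\<kappa> (Complex \<rho> \<theta>)) * exp (2 * \<rho>)) integrable_on {0..2*pi}"
          by (intro integrable_continuous_interval continuous_intros cwk)
        show "- E (Complex \<rho> \<theta>) \<le> w (?\<kappa> (Complex \<rho> \<theta>)) * exp (2 * \<rho>)" if "\<theta> \<in> {0..2*pi}" for \<theta>
        proof -
          have "Re (?\<kappa> (Complex \<rho> \<theta>)) < a" using kW[of "Complex \<rho> \<theta>"] WH \<rho> by auto
          from P(2)[OF this] have "- P (?\<kappa> (Complex \<rho> \<theta>)) * exp (2 * \<rho>) \<le> w (?\<kappa> (Complex \<rho> \<theta>)) * exp (2 * \<rho>)"
            by (rule mult_right_mono) simp
          then show ?thesis unfolding E_def by simp
        qed
      qed
      also have "\<dots> = integral {0..2*pi} (\<lambda>\<theta>. w (?\<kappa> (Complex \<rho> \<theta>))) * exp (2 * \<rho>)" by simp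
      also have "\<dots> \<le> 2 * pi * w p * exp (2 * \<rho>)"
      proof (rule mult_right_mono[OF superharmonic_mean_le])
        have b: "ball p 2 \<subseteq> half_plane a"
        proof
          fix z assume "z \<in> ball p 2"
          then have "\<bar>Re (z - p)\<bar> < 2" using abs_Re_le_cmod[of "z - p"] by (simp add: dist_norm norm_minus_commute)
          then show "z \<in> half_plane a" using p by simp
        qed
        then show "smooth_on w (ball p 2)" by (rule smooth_on_subset[OF sw op])
        show "laplacian w z \<le> 0" if "z \<in> ball p 2" for z using lap[of z] b that by (auto simp: m_def)
      qed (use \<rho> in auto)
      finally show ?thesis .
    qed
    have "- Ap \<le> integral {-1..0} (\<lambda>\<rho>. - integral {0..2*pi} (\<lambda>\<theta>. E (Complex \<rho> \<theta>)))" using EA by simp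
    also have "\<dots> \<le> integral {-1..0} (\<lambda>\<rho>. 2 * pi * w p * exp (2 * \<rho>))"
      by (rule integral_le) (auto intro!: inner2 integrable_continuous_interval continuous_intros continuous_on_iterated(1)[OF cE])
    also have "\<dots> = 2 * pi * w p * c0" unfolding c0_def by simp
    finally show ?thesis using ApA by simp
  qed
  define k where "k = 1 / (2 * pi * c0)"
  have k: "k > 0" unfolding k_def using c0 by simp
  define K where "K = exp (k * (A + 12 * B))"
  define M where "M = k * (4 * B)"
  have "Re (\<phi> \<zeta>) \<le> K * exp (M * \<bar>Re \<zeta>\<bar>)" if z: "Re \<zeta> \<le> a - 4" for \<zeta>
  proof -
    \<comment> \<open>Shifts the point by periods until its imaginary part lies between
      \<open>pi\<close> and \<open>3 * pi\<close>, the range of \<open>lower\<close>.\<close>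
    obtain \<omega> where om: "exp \<omega> = exp (\<zeta> - of_real pi * \<i>)" "Re \<omega> = Re (\<zeta> - of_real pi * \<i>)" "0 \<le> Im \<omega>" "Im \<omega> \<le> 2 * pi"
      by (rule exp_eq_representative)
    define p where "p = \<omega> + of_real pi * \<i>"
    have p: "Re p = Re \<zeta>" "pi \<le> Im p" "Im p \<le> 3 * pi" unfolding p_def using om by auto
    have "exp p = exp \<zeta>" unfolding p_def exp_add om(1) exp_diff by simp
    then have "\<phi> \<zeta> = \<phi> p" using periodic_int[where f = \<phi> and a = a and \<zeta> = \<zeta> and \<omega> = p] periodic z by simp
    moreover have "Re (\<phi> p) = exp (- w p)" unfolding w_def using pos[of p] p z by simp
    moreover have "- w p \<le> k * (A + 4 * (B * (3 + \<bar>Re \<zeta>\<bar>)))"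
    proof -
      have "k * (- (A + 4 * (B * (3 + \<bar>Re \<zeta>\<bar>)))) \<le> k * (2 * pi * w p * c0)"
        using lower[of p] p z k by (intro mult_left_mono) auto
      also have "k * (2 * pi * w p * c0) = w p" unfolding k_def using c0 by simp
      finally show ?thesis unfolding mult_minus_right by linarith
    qed
    moreover have "k * (A + 4 * (B * (3 + \<bar>Re \<zeta>\<bar>))) = k * (A + 12 * B) + M * \<bar>Re \<zeta>\<bar>" unfolding M_def by (simp add: algebra_simps)
    ultimately show ?thesis unfolding K_def by (simp add: mult_exp_exp)
  qed
  then show ?thesis using that[of "a - 4" K M] by simp
qed

section \<open>Surfaces in coordinates\<close>

definition mcomp :: "4 \<Rightarrow> minkowski \<Rightarrow> real"
  where "mcomp j x = (if j = 1 then snd x $ 1 else if j = 2 then snd x $ 2 else if j = 3 then snd x $ 3 else fst x)"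

definition coords :: "(complex \<Rightarrow> minkowski) \<Rightarrow> 4 \<Rightarrow> complex \<Rightarrow> complex"
  where "coords g j z = of_real (mcomp j (g z))"

lemma bounded_linear_mcomp: "bounded_linear (mcomp j)"
proof -
  have "bounded_linear (\<lambda>x :: minkowski. snd x $ i)" for i
    by (rule bounded_linear_compose[OF bounded_linear_vec_nth bounded_linear_snd, unfolded o_def])
  then show ?thesis using bounded_linear_fst
    by (cases "j = 1"; cases "j = 2"; cases "j = 3") (simp_all add: mcomp_def[abs_def])
qed

lemma cmink_mcomp: "cmink (\<lambda>j. of_real (mcomp j x)) (\<lambda>j. of_real (mcomp j y)) = of_real (mink x y)"
  unfolding cmink_def mink_def mcomp_def eta_def by (simp add: sum_4 inner_vec_def sum_3)

lemma mink_bilinear: "bounded_bilinear mink"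
proof -
  have 1: "bounded_bilinear (\<lambda>(x :: minkowski) (y :: minkowski). snd x \<bullet> snd y)"
    by (rule bounded_bilinear.comp[OF bounded_bilinear_inner bounded_linear_snd bounded_linear_snd])
  have 2: "bounded_bilinear (\<lambda>(x :: minkowski) (y :: minkowski). fst x * fst y)"
    by (rule bounded_bilinear.comp[OF bounded_bilinear_mult bounded_linear_fst bounded_linear_fst])
  obtain K1 where K1: "\<And>(x :: minkowski) (y :: minkowski). norm (snd x \<bullet> snd y) \<le> norm x * norm y * K1"
    using bounded_bilinear.bounded[OF 1] by blast
  obtain K2 where K2: "\<And>(x :: minkowski) (y :: minkowski). norm (fst x * fst y) \<le> norm x * norm y * K2"
    using bounded_bilinear.bounded[OF 2] by blast
  show ?thesis
  proof
    show "\<exists>K. \<forall>x y. norm (mink x y) \<le> norm x * norm y * K"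
    proof (intro exI allI)
      fix x y :: minkowski show "norm (mink x y) \<le> norm x * norm y * (K1 + K2)"
        using K1[of x y] K2[of x y] norm_triangle_ineq4[of "snd x \<bullet> snd y" "fst x * fst y"]
        unfolding mink_def by (simp add: algebra_simps)
    qed
  qed (simp_all add: mink_def algebra_simps inner_add_left inner_add_right)
qed

lemma mink_commute: "mink x y = mink y x"
  unfolding mink_def by (simp add: inner_commute mult.commute)

text \<open>Tangent vectors of the hyperboloid are spacelike: the Cauchy-Schwarz inequality for the
  space parts beats the time part because \<open>fst x\<close> squared exceeds the squared norm of
  \<open>snd x\<close>.\<close>

lemma mink_tangent_pos:
  assumes "x \<in> hyp3" "mink x v = 0" "v \<noteq> 0"
  shows "mink v v > 0"
proof -
  have x: "(fst x)\<^sup>2 = 1 + (norm (snd x))\<^sup>2"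
    using assms(1) unfolding hyp3_def mink_def by (simp add: power2_eq_square power2_norm_eq_inner[symmetric] norm_eq_sqrt_inner[symmetric])
  have v: "fst x * fst v = snd x \<bullet> snd v" using assms(2) unfolding mink_def by simp
  have sv: "snd v \<noteq> 0"
  proof
    assume s0: "snd v = 0"
    have "fst x \<noteq> 0" using assms(1) unfolding hyp3_def by auto
    then have "fst v = 0" using v s0 by simp
    then show False using s0 assms(3) by (simp add: prod_eq_iff)
  qed
  have "(1 + (norm (snd x))\<^sup>2) * (fst v)\<^sup>2 = (snd x \<bullet> snd v)\<^sup>2" using v x by (metis power_mult_distrib)
  also have "\<dots> \<le> (norm (snd x) * norm (snd v))\<^sup>2"
    using Cauchy_Schwarz_ineq2[of "snd x" "snd v"] by (metis abs_le_square_iff abs_mult abs_norm_cancel)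
  also have "\<dots> < (1 + (norm (snd x))\<^sup>2) * (norm (snd v))\<^sup>2" using sv by (simp add: power_mult_distrib algebra_simps)
  finally have "(fst v)\<^sup>2 < (norm (snd v))\<^sup>2"
    by (rule mult_less_cancel_left_pos[THEN iffD1, rotated]) (simp add: add_pos_nonneg)
  then show ?thesis unfolding mink_def by (simp add: power2_eq_square power2_norm_eq_inner[symmetric])
qed

lemma fst_form_symmetric: "fst_form g z u v = fst_form g z v u"
  unfolding fst_form_def by (rule mink_commute)

lemma smooth_on_coords:
  assumes "open U" "smooth_on g U"
  shows "smooth_on (coords g j) U"
proof -
  have L: "bounded_linear (\<lambda>x. complex_of_real (mcomp j x))"
    by (rule bounded_linear_compose[OF bounded_linear_of_real bounded_linear_mcomp, unfolded o_def])
  show ?thesis unfolding coords_def[abs_def] by (rule smooth_on_linear[OF L assms])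
qed

lemma coords_dz:
  assumes U: "open U" "smooth_on g U" "z \<in> U"
  shows "dz (coords g j) z = of_real (mcomp j (dir_deriv 1 g z)) * (1/2) + of_real (mcomp j (dir_deriv \<i> g z)) * (- \<i>/2)"
    "dzb (coords g j) z = of_real (mcomp j (dir_deriv 1 g z)) * (1/2) + of_real (mcomp j (dir_deriv \<i> g z)) * (\<i>/2)"
    "dz (dz (coords g j)) z = of_real (mcomp j (dir_deriv 1 (dir_deriv 1 g) z)) * (1/4)
       + of_real (mcomp j (dir_deriv \<i> (dir_deriv \<i> g) z)) * (-1/4) + of_real (mcomp j (dir_deriv 1 (dir_deriv \<i> g) z)) * (- \<i>/2)"
    "dz (dzb (coords g j)) z = of_real (mcomp j (dir_deriv 1 (dir_deriv 1 g) z)) * (1/4)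
       + of_real (mcomp j (dir_deriv \<i> (dir_deriv \<i> g) z)) * (1/4)"
proof -
  have L: "bounded_linear (\<lambda>x. complex_of_real (mcomp j x))"
    by (rule bounded_linear_compose[OF bounded_linear_of_real bounded_linear_mcomp, unfolded o_def])
  have c: "coords g j = (\<lambda>z. complex_of_real (mcomp j (g z)))" by (auto simp: coords_def)
  note s = smooth_on_coords[OF U(1,2)]
  have d1: "dir_deriv v (coords g j) z = of_real (mcomp j (dir_deriv v g z))" for v
    unfolding c by (rule dir_deriv_linear[OF L smooth_on_differentiable[OF U(2,1,3)]])
  have d2: "dir_deriv u (dir_deriv v (coords g j)) z = of_real (mcomp j (dir_deriv u (dir_deriv v g) z))" for u v
    unfolding c by (rule dir_deriv2_linear[OF L U])
  show "dz (coords g j) z = of_real (mcomp j (dir_deriv 1 g z)) * (1/2) + of_real (mcomp j (dir_deriv \<i> g z)) * (- \<i>/2)"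
    "dzb (coords g j) z = of_real (mcomp j (dir_deriv 1 g z)) * (1/2) + of_real (mcomp j (dir_deriv \<i> g z)) * (\<i>/2)"
    unfolding dz_def dzb_def d1 by (simp_all add: field_simps)
  show "dz (dz (coords g j)) z = of_real (mcomp j (dir_deriv 1 (dir_deriv 1 g) z)) * (1/4)
       + of_real (mcomp j (dir_deriv \<i> (dir_deriv \<i> g) z)) * (-1/4) + of_real (mcomp j (dir_deriv 1 (dir_deriv \<i> g) z)) * (- \<i>/2)"
    "dz (dzb (coords g j)) z = of_real (mcomp j (dir_deriv 1 (dir_deriv 1 g) z)) * (1/4)
       + of_real (mcomp j (dir_deriv \<i> (dir_deriv \<i> g) z)) * (1/4)"
    unfolding dz2_dir_deriv[OF U(1) s U(3)] d2 by (simp_all add: field_simps)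
qed

lemma cmink_expand2:
  "cmink (\<lambda>j. x j * a + y j * b) w = a * cmink x w + b * cmink y w"
  "cmink w (\<lambda>j. x j * a + y j * b) = a * cmink w x + b * cmink w y"
  "cmink (\<lambda>j. x j * a) w = a * cmink x w"
  using cmink_add(1)[of "\<lambda>j. a * x j" "\<lambda>j. b * y j" w] cmink_add(2)[of w "\<lambda>j. a * x j" "\<lambda>j. b * y j"]
  by (simp_all add: cmink_scale mult.commute)

lemma cmc_chart_of_surface:
  assumes U: "open U" and g: "smooth_on g U" "g ` U \<subseteq> hyp3" and n: "smooth_on n U"
    and imm: "\<And>z. z \<in> U \<Longrightarrow> inj (frechet_derivative g (at z))" "\<And>z. z \<in> U \<Longrightarrow> conformal_at g z"
    and un: "\<And>z. z \<in> U \<Longrightarrow> unit_normal_at g n z" "\<And>z. z \<in> U \<Longrightarrow> mean_curv g n z = 1"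
  shows "cmc_chart (coords g) (coords n) U"
    "z \<in> U \<Longrightarrow> half_metric (coords g) z = of_real (fst_form g z 1 1 / 2)"
    "z \<in> U \<Longrightarrow> hopf (coords g) (coords n) z = hopf_coeff g n z"
proof -
  have N: "vec_at (coords n) z = (\<lambda>j. of_real (mcomp j (n z)))" "vec_at (coords g) z = (\<lambda>j. of_real (mcomp j (g z)))" for z
    by (auto simp: coords_def)
  have ii: "\<i> * \<i> = (-1 :: complex)" by simp
  have form1: "cmink (vec_at (vdz (coords g)) z) (vec_at (vdz (coords g)) z) = 0"
    "half_metric (coords g) z = of_real (fst_form g z 1 1 / 2)" if z: "z \<in> U" for z
  proof -
    have c: "fst_form g z 1 1 = fst_form g z \<i> \<i>" "fst_form g z 1 \<i> = 0" "fst_form g z \<i> 1 = 0"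
      using imm(2)[OF z] fst_form_symmetric unfolding conformal_at_def by auto
    show "cmink (vec_at (vdz (coords g)) z) (vec_at (vdz (coords g)) z) = 0"
      unfolding coords_dz[OF U g(1) z] cmink_expand2 cmink_mcomp fst_form_def[symmetric] c(2,3) c(1)[symmetric]
      by (simp add: field_simps)
    show "half_metric (coords g) z = of_real (fst_form g z 1 1 / 2)"
      unfolding half_metric_def coords_dz[OF U g(1) z] cmink_expand2 cmink_mcomp fst_form_def[symmetric] c(2,3) c(1)[symmetric]
      by (simp add: field_simps)
  qed
  \<comment> \<open>Differentiating \<open>mink g g = -1\<close> shows that the image of the
    coordinate vector is tangent to the hyperboloid, and it is nonzero for an immersion.\<close>
  have epos: "fst_form g z 1 1 > 0" if z: "z \<in> U" for z
  proof -
    have d: "g differentiable (at z)" by (rule smooth_on_differentiable[OF g(1) U z])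
    let ?D = "frechet_derivative g (at z)"
    have l: "linear ?D" using d frechet_derivative_works has_derivative_linear by blast
    then have "?D 0 = 0" by (rule linear_0)
    then have nz: "?D 1 \<noteq> 0" using imm(1)[OF z] by (metis injD zero_neq_one)
    have "((\<lambda>z. mink (g z) (g z)) has_derivative (\<lambda>v. mink (g z) (?D v) + mink (?D v) (g z))) (at z)"
      by (rule bounded_bilinear.FDERIV[OF mink_bilinear]) (use d frechet_derivative_works in blast)+
    moreover have "((\<lambda>z. mink (g z) (g z)) has_derivative (\<lambda>v. 0)) (at z)"
      by (rule has_derivative_transform_within_open[OF has_derivative_const[of "-1"] U z])
        (use g(2) in \<open>auto simp: hyp3_def\<close>)
    ultimately have "(\<lambda>v. mink (g z) (?D v) + mink (?D v) (g z)) = (\<lambda>v. 0)" by (rule has_derivative_unique)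
    then have "mink (g z) (?D 1) + mink (?D 1) (g z) = 0" by (rule fun_cong)
    then have t: "mink (g z) (?D 1) = 0" using mink_commute[of "?D 1" "g z"] by simp
    have "mink (?D 1) (?D 1) > 0" by (rule mink_tangent_pos[OF _ t nz]) (use g(2) z in blast)
    then show ?thesis unfolding fst_form_def dir_deriv_def .
  qed
  have mean: "snd_form g n z 1 1 + snd_form g n z \<i> \<i> = 2 * fst_form g z 1 1" if z: "z \<in> U" for z
  proof -
    have c: "fst_form g z \<i> \<i> = fst_form g z 1 1" "fst_form g z 1 \<i> = 0" using imm(2)[OF z] unfolding conformal_at_def by auto
    have eq: "fst_form g z 1 1 * (snd_form g n z 1 1 + snd_form g n z \<i> \<i>) / (2 * (fst_form g z 1 1 * fst_form g z 1 1)) = 1"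
      using un(2)[OF z] unfolding mean_curv_def c by (simp only: power_zero_numeral mult_zero_right mult_zero_left diff_zero distrib_left add.commute)
    have cancel: "S = 2 * X" if "X * S / (2 * (X * X)) = 1" "X > 0" for X S :: real
      using that by (simp add: field_simps)
    show ?thesis by (rule cancel[OF eq epos[OF z]])
  qed
  have nrm: "mink (n z) (n z) = 1" "mink (n z) (g z) = 0" "mink (n z) (dir_deriv v g z) = 0" if "z \<in> U" for z v
    using un(1)[OF that] unfolding unit_normal_at_def by auto
  show "cmc_chart (coords g) (coords n) U"
  proof
    fix z j assume z: "z \<in> U"
    show "cmink (vec_at (coords g) z) (vec_at (coords g) z) = -1"
      unfolding N cmink_mcomp using g(2) z unfolding hyp3_def by auto
    show "cmink (vec_at (coords n) z) (vec_at (coords n) z) = 1" unfolding N cmink_mcomp nrm(1)[OF z] by simp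
    show "cmink (vec_at (coords n) z) (vec_at (coords g) z) = 0" unfolding N cmink_mcomp nrm(2)[OF z] by simp
    show "cmink (vec_at (coords n) z) (vec_at (vdz (coords g)) z) = 0"
      unfolding N coords_dz[OF U g(1) z] cmink_expand2 cmink_mcomp nrm(3)[OF z] by simp
    show "cmink (vec_at (vdz (coords g)) z) (vec_at (vdz (coords g)) z) = 0" by (rule form1[OF z])
    show "0 < Re (half_metric (coords g) z)" unfolding form1(2)[OF z] using epos[OF z] by simp
    show "cmink (vec_at (vdz (vdzb (coords g))) z) (vec_at (coords n) z) = half_metric (coords g) z"
    proof -
      have "cmink (vec_at (vdz (vdzb (coords g))) z) (vec_at (coords n) z) = of_real ((snd_form g n z 1 1 + snd_form g n z \<i> \<i>) / 4)"
        unfolding N coords_dz[OF U g(1) z] cmink_expand2 cmink_mcomp snd_form_def[symmetric] by (simp add: field_simps)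
      then show ?thesis unfolding form1(2)[OF z] mean[OF z] by simp
    qed
    show "cnj (coords g j z) = coords g j z" "cnj (coords n j z) = coords n j z" by (simp_all add: coords_def)
  qed (intro U smooth_on_coords g(1) n)+
  show "half_metric (coords g) z = of_real (fst_form g z 1 1 / 2)" if "z \<in> U" by (rule form1(2)[OF that])
  show "hopf (coords g) (coords n) z = hopf_coeff g n z" if z: "z \<in> U"
    unfolding hopf_def hopf_coeff_def N coords_dz[OF U g(1) z] cmink_expand2 cmink_add(1) cmink_mcomp snd_form_def[symmetric]
    by (simp add: field_simps)
qed

lemma dz_o_holomorphic:
  assumes "open U" "smooth_on F U" "open V" "\<tau> holomorphic_on V" "\<tau> ` V \<subseteq> U" "z \<in> V"
  shows "dz (\<lambda>z. F (\<tau> z)) z = dz F (\<tau> z) * deriv \<tau> z" "dzb (\<lambda>z. F (\<tau> z)) z = dzb F (\<tau> z) * cnj (deriv \<tau> z)"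
proof -
  have "has_wirtinger (\<lambda>z. F (\<tau> z)) (dz F (\<tau> z) * deriv \<tau> z) (dzb F (\<tau> z) * cnj (deriv \<tau> z)) z"
    by (rule has_wirtinger_o_holomorphic[OF smooth_on_has_wirtinger[OF assms(2,1)] holomorphic_derivI[OF assms(4,3,6)]])
      (use assms in auto)
  then show "dz (\<lambda>z. F (\<tau> z)) z = dz F (\<tau> z) * deriv \<tau> z" "dzb (\<lambda>z. F (\<tau> z)) z = dzb F (\<tau> z) * cnj (deriv \<tau> z)"
    by (rule has_wirtinger_imp)+
qed

text \<open>The second derivative of \<tau> enters \<open>vdz (vdz G')\<close> only along
  \<open>vdz G\<close>, which is orthogonal to the normal. The Hopf coefficient thus transforms as a
  quadratic differential.\<close>

lemma (in cmc_chart) pull_back: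
  assumes V: "open V" "\<tau> holomorphic_on V" "\<tau> ` V \<subseteq> U" "\<And>z. z \<in> V \<Longrightarrow> deriv \<tau> z \<noteq> 0"
  defines "G' \<equiv> \<lambda>j z. G j (\<tau> z)" and "N' \<equiv> \<lambda>j z. N j (\<tau> z)"
  shows "cmc_chart G' N' V"
    "z \<in> V \<Longrightarrow> half_metric G' z = E (\<tau> z) * (deriv \<tau> z * cnj (deriv \<tau> z))"
    "z \<in> V \<Longrightarrow> hopf G' N' z = Q (\<tau> z) * (deriv \<tau> z)\<^sup>2"
proof -
  note o = dz_o_holomorphic[OF open_U _ V(1-3)]
  have d1: "vdz G' j z = deriv \<tau> z * vdz G j (\<tau> z)" "vdzb G' j z = cnj (deriv \<tau> z) * vdzb G j (\<tau> z)" if "z \<in> V" for z j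
    unfolding G'_def using o[OF smG that] by (simp_all add: mult.commute)
  have hol': "deriv \<tau> holomorphic_on V" by (rule holomorphic_deriv[OF V(2,1)])
  have wd: "has_wirtinger (deriv \<tau>) (deriv (deriv \<tau>) z) 0 z" "has_wirtinger (\<lambda>z. cnj (deriv \<tau> z)) 0 (cnj (deriv (deriv \<tau>) z)) z" if "z \<in> V" for z
    using has_wirtinger_holomorphic[OF holomorphic_derivI[OF hol' V(1) that]] has_wirtinger_cnj[of "deriv \<tau>" "deriv (deriv \<tau>) z" 0 z] by auto
  have wo: "has_wirtinger (\<lambda>z. F (\<tau> z)) (dz F (\<tau> z) * deriv \<tau> z) (dzb F (\<tau> z) * cnj (deriv \<tau> z)) z"
    if "smooth_on F U" "z \<in> V" for F z
    using smooth_on_has_wirtinger[OF smooth_on_o_holomorphic[OF open_U V(1-3) that(1)] V(1) that(2)] o[OF that] by simp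
  have d11: "vdz (vdz G') j z = (deriv \<tau> z)\<^sup>2 * vdz (vdz G) j (\<tau> z) + deriv (deriv \<tau>) z * vdz G j (\<tau> z)" if z: "z \<in> V" for z j
  proof -
    have "dz (dz (G' j)) z = dz (\<lambda>z. deriv \<tau> z * vdz G j (\<tau> z)) z" by (rule dz_cong[OF V(1) z d1(1)])
    also have "\<dots> = deriv (deriv \<tau>) z * vdz G j (\<tau> z) + deriv \<tau> z * (vdz (vdz G) j (\<tau> z) * deriv \<tau> z)"
      by (rule has_wirtinger_imp(1)[OF has_wirtinger_mult[OF wd(1)[OF z] wo[OF smooth_derivs(1) z]]])
    finally show ?thesis by (simp add: power2_eq_square algebra_simps)
  qed
  have d12: "vdz (vdzb G') j z = (deriv \<tau> z * cnj (deriv \<tau> z)) * vdz (vdzb G) j (\<tau> z)" if z: "z \<in> V" for z j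
  proof -
    have "dz (dzb (G' j)) z = dz (\<lambda>z. cnj (deriv \<tau> z) * vdzb G j (\<tau> z)) z" by (rule dz_cong[OF V(1) z d1(2)])
    also have "\<dots> = 0 * vdzb G j (\<tau> z) + cnj (deriv \<tau> z) * (vdz (vdzb G) j (\<tau> z) * deriv \<tau> z)"
      by (rule has_wirtinger_imp(1)[OF has_wirtinger_mult[OF wd(2)[OF z] wo[OF smooth_derivs(2) z]]])
    finally show ?thesis by (simp add: algebra_simps)
  qed
  have in_U: "\<tau> z \<in> U" if "z \<in> V" for z using V(3) that by blast
  have N'e: "vec_at N' z = vec_at N (\<tau> z)" "vec_at G' z = vec_at G (\<tau> z)" for z by (simp_all add: N'_def G'_def)
  show hm: "half_metric G' z = E (\<tau> z) * (deriv \<tau> z * cnj (deriv \<tau> z))" if "z \<in> V" for z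
    unfolding half_metric_def d1[OF that] cmink_scale by simp
  show "hopf G' N' z = Q (\<tau> z) * (deriv \<tau> z)\<^sup>2" if z: "z \<in> V" for z
    unfolding hopf_def N'e d11[OF z] cmink_add cmink_scale
    using cmink_commute[of "vec_at (vdz G) (\<tau> z)"] NGz[OF in_U[OF z]] by simp
  show "cmc_chart G' N' V"
  proof
    show "open V" by (rule V(1))
    show "smooth_on (G' j) V" "smooth_on (N' j) V" for j
      unfolding G'_def N'_def by (intro smooth_on_o_holomorphic[OF open_U V(1-3)] smG smN)+
    fix z j assume z: "z \<in> V"
    note u = in_U[OF z]
    show "cnj (G' j z) = G' j z" "cnj (N' j z) = N' j z" unfolding G'_def N'_def by (rule realG[OF u] realN[OF u])+
    show "cmink (vec_at G' z) (vec_at G' z) = -1" "cmink (vec_at N' z) (vec_at N' z) = 1" "cmink (vec_at N' z) (vec_at G' z) = 0"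
      unfolding N'e by (rule GG[OF u] NN[OF u] NG[OF u])+
    show "cmink (vec_at N' z) (vec_at (vdz G') z) = 0" unfolding N'e d1[OF z] cmink_scale NGz[OF u] by simp
    show "cmink (vec_at (vdz G') z) (vec_at (vdz G') z) = 0" unfolding d1[OF z] cmink_scale conf[OF u] by simp
    have r: "deriv \<tau> z * cnj (deriv \<tau> z) = of_real ((cmod (deriv \<tau> z))\<^sup>2)" by (simp only: complex_norm_square)
    show "Re (half_metric G' z) > 0"
      unfolding hm[OF z] r using pos[OF u] V(4)[OF z] by simp
    show "cmink (vec_at (vdz (vdzb G')) z) (vec_at N' z) = half_metric G' z"
      unfolding hm[OF z] N'e d12[OF z] cmink_scale mean1[OF u] by simp
  qed
qed

lemma half_metric_hopf_cong:
  assumes "open S" "z \<in> S" "\<And>j y. y \<in> S \<Longrightarrow> G j y = G' j y" "\<And>j y. y \<in> S \<Longrightarrow> N j y = N' j y"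
  shows "half_metric G z = half_metric G' z" "hopf G N z = hopf G' N' z"
proof -
  have 1: "dz (G j) y = dz (G' j) y" "dzb (G j) y = dzb (G' j) y" if "y \<in> S" for j y
    using dz_cong[OF assms(1) that assms(3)] by auto
  have "dz (dz (G j)) z = dz (dz (G' j)) z" for j using dz_cong(1)[OF assms(1,2) 1(1)] .
  then show "half_metric G z = half_metric G' z" "hopf G N z = hopf G' N' z"
    unfolding half_metric_def hopf_def using 1 assms by auto
qed

text \<open>The conformal factor in the curvature cancels against the area density, and the Gauss
  equation evaluates what is left. Where \<open>Q\<close> does not vanish, this is the density of
  the metric of curvature one.\<close>

lemma curvature_density:
  assumes chart: "cmc_chart (coords g) (coords n) U" and c: "\<And>z. z \<in> U \<Longrightarrow> conformal_at g z"
    and e: "\<And>z. z \<in> U \<Longrightarrow> half_metric (coords g) z = of_real (fst_form g z 1 1 / 2)" and z: "z \<in> U"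
  shows "- gauss_curv g z * area_density g z = 2 * (cmod (hopf (coords g) (coords n) z))\<^sup>2 / Re (half_metric (coords g) z)"
proof -
  interpret cmc_chart "coords g" "coords n" U by fact
  have er: "fst_form g z 1 1 = Re (2 * E z)" if "z \<in> U" for z unfolding e[OF that] by simp
  have s2: "smooth_on (\<lambda>z. 2 * E z) U" by (intro smooth_on_mult smooth_on_const open_U smooth_half_metric)
  have rE: "E z = of_real (Re (E z))" if "z \<in> U" for z unfolding e[OF that] by simp
  have l: "2 * E z * dz (dzb (\<lambda>z. 2 * E z)) z - dz (\<lambda>z. 2 * E z) z * dzb (\<lambda>z. 2 * E z) z = of_real (4 * (cmod (Q z))\<^sup>2 * Re (E z))" if z: "z \<in> U" for z
  proof -
    note w = has_wirtinger_cmult[OF smooth_on_has_wirtinger[OF smooth_half_metric open_U], of _ 2]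
    have d: "dz (\<lambda>z. 2 * E z) z = 2 * dz E z" "dzb (\<lambda>z. 2 * E z) z = 2 * dzb E z" if "z \<in> U" for z
      using has_wirtinger_imp[OF w[OF that]] by auto
    have "dz (dzb (\<lambda>z. 2 * E z)) z = dz (\<lambda>z. 2 * dzb E z) z" by (rule dz_cong[OF open_U z d(2)])
    also have "\<dots> = 2 * dz (dzb E) z"
      by (rule has_wirtinger_imp(1)[OF has_wirtinger_cmult[OF smooth_on_has_wirtinger[OF smooth_on_dzb[OF open_U smooth_half_metric] open_U z]]])
    finally have "2 * E z * dz (dzb (\<lambda>z. 2 * E z)) z - dz (\<lambda>z. 2 * E z) z * dzb (\<lambda>z. 2 * E z) z = 4 * (Q z * cnj (Q z) * E z)"
      unfolding d[OF z] gauss_equation[OF z, symmetric] by (simp add: algebra_simps)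
    also have "Q z * cnj (Q z) = of_real ((cmod (Q z))\<^sup>2)" by (simp only: complex_norm_square)
    finally show ?thesis using rE[OF z] by simp
  qed
  have lln: "laplacian (\<lambda>z. ln (Re (2 * E z))) z = 4 * (4 * (cmod (Q z))\<^sup>2 * Re (E z)) / (Re (2 * E z))\<^sup>2"
    by (rule ln_laplacian(2)[OF open_U s2 _ _ l z]) (use cnj_half_metric pos in auto)
  have sln: "smooth_on (\<lambda>z. ln (Re (2 * E z))) U"
    by (rule ln_laplacian(1)[OF open_U s2 _ _ l]) (use cnj_half_metric pos in auto)
  have half: "bounded_linear (\<lambda>x::real. x / 2)" by (rule bounded_linear_divide)
  let ?u = "\<lambda>w. ln (fst_form g w 1 1) / 2"
  have "laplacian ?u z = laplacian (\<lambda>z. ln (Re (2 * E z)) / 2) z"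
    by (rule laplacian_cong[OF open_U z]) (simp add: er)
  also have "\<dots> = laplacian (\<lambda>z. ln (Re (2 * E z))) z / 2"
    unfolding laplacian_def dir_deriv2_linear[OF half open_U sln z] by simp
  also have "\<dots> = 2 * (cmod (Q z))\<^sup>2 / Re (E z)" unfolding lln using pos[OF z] by (simp add: power2_eq_square field_simps)
  finally have lu: "laplacian ?u z = 2 * (cmod (Q z))\<^sup>2 / Re (E z)" .
  have gc: "gauss_curv g z = - laplacian ?u z / fst_form g z 1 1" unfolding gauss_curv_def Let_def laplacian_def by simp
  have e0: "fst_form g z 1 1 > 0" using er[OF z] pos[OF z] by simp
  have "area_density g z = fst_form g z 1 1"
    using c[OF z] e0 unfolding area_density_def conformal_at_def by (metis abs_of_pos diff_zero power2_eq_square power_zero_numeral real_sqrt_abs)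
  then have "- gauss_curv g z * area_density g z = laplacian ?u z" unfolding gc using e0 by simp
  then show ?thesis using lu by simp
qed

section \<open>An irregular end\<close>

text \<open>
  The function \<open>V + (e\<^bsup>2 (s - \<sigma>)\<^esup> - 1) V' / 2\<close>, where \<open>V = U e\<^sup>\<sigma>\<close>, joins \<open>V(s)\<close> to the value at \<open>n\<close>, and its derivative along the segment
  from \<open>s\<close> to \<open>n\<close> is small.
\<close>

lemma recessive_solution_bound:
  fixes U U' \<rho> :: "complex \<Rightarrow> complex" and n m R C :: real
  assumes U: "\<And>s. Re s > 0 \<Longrightarrow> cmod s > R \<Longrightarrow> (U has_field_derivative U' s) (at s)"
      "\<And>s. Re s > 0 \<Longrightarrow> cmod s > R \<Longrightarrow> (U' has_field_derivative (1 + \<rho> s) * U s) (at s)"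
    and \<rho>: "\<And>s. Re s > 0 \<Longrightarrow> cmod s > R \<Longrightarrow> cmod (\<rho> s) \<le> C / (cmod s)\<^sup>2"
    and init: "U (of_real n) = of_real (exp (- n))" "U' (of_real n) = - of_real (exp (- n))"
    and m: "m > 0" "m \<ge> 16 * C" "m \<ge> 2 * R" "R \<ge> 0" "C \<ge> 0"
    and n: "n \<ge> m" and s: "Re s > 0" "Re s \<le> n" "cmod s \<ge> m"
  shows "cmod (U s * exp s - 1) \<le> 1/3"
proof -
  define p where "p = cmod s"
  have p: "p \<ge> m" "p > 0" "n > 0" using s m n unfolding p_def by auto
  \<comment> \<open>The segment from \<open>s\<close> to \<open>n\<close>; \<open>L\<close>
    interpolates the moduli of its ends linearly.\<close>
  define \<sigma> where "\<sigma> x = s + of_real x * (of_real n - s)" for x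
  define L where "L x = (1 - x) * p + x * n" for x
  have L: "L x \<ge> m" if "0 \<le> x" "x \<le> 1" for x
  proof -
    have "(1 - x) * m + x * m \<le> L x" unfolding L_def using that p n by (intro add_mono mult_left_mono) auto
    then show ?thesis by (simp add: algebra_simps)
  qed
  have Re_s: "Re (\<sigma> x) > 0" if "0 \<le> x" "x \<le> 1" for x
  proof -
    have e: "Re (\<sigma> x) = (1 - x) * Re s + x * n" unfolding \<sigma>_def by (simp add: algebra_simps)
    show ?thesis unfolding e
    proof (cases "x = 1")
      case False
      then have "(1 - x) * Re s > 0" "x * n \<ge> 0" using that s p by simp_all
      then show "(1 - x) * Re s + x * n > 0" by linarith
    qed (use p in simp)
  qed
  \<comment> \<open>Both ends have positive real part, so the mixed term in the squared modulus is
    nonnegative and the segment comes no closer to the origin than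
    \<open>L x / sqrt 2\<close>.\<close>
  have sq: "(cmod (\<sigma> x))\<^sup>2 \<ge> (L x)\<^sup>2 / 2" if x: "0 \<le> x" "x \<le> 1" for x
  proof -
    have r: "(cmod (\<sigma> x))\<^sup>2 = ((1 - x) * Re s + x * n)\<^sup>2 + ((1 - x) * Im s)\<^sup>2"
      unfolding cmod_power2 \<sigma>_def by (simp add: algebra_simps)
    have pp: "p\<^sup>2 = (Re s)\<^sup>2 + (Im s)\<^sup>2" unfolding p_def cmod_power2 ..
    have c: "0 \<le> 2 * ((1 - x) * Re s) * (x * n)" using x s p by (intro mult_nonneg_nonneg) auto
    have "((1 - x) * Re s + x * n)\<^sup>2 + ((1 - x) * Im s)\<^sup>2 = (1 - x)\<^sup>2 * p\<^sup>2 + (x * n)\<^sup>2 + 2 * ((1 - x) * Re s) * (x * n)"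
      unfolding pp by (simp add: power2_eq_square algebra_simps)
    then have "(cmod (\<sigma> x))\<^sup>2 \<ge> ((1 - x) * p)\<^sup>2 + (x * n)\<^sup>2" using c unfolding r by (simp add: power_mult_distrib)
    moreover have "(L x)\<^sup>2 \<le> 2 * (((1 - x) * p)\<^sup>2 + (x * n)\<^sup>2)"
      using sum_squares_bound[of "(1 - x) * p" "x * n"] unfolding L_def by (simp add: power2_sum)
    moreover have "l / 2 \<le> r" if "q \<le> r" "l \<le> 2 * q" for l q r :: real using that by simp
    ultimately show ?thesis by blast
  qed
  have far: "cmod (\<sigma> x) > R" if x: "0 \<le> x" "x \<le> 1" for x
  proof -
    have "R\<^sup>2 \<le> (m / 2)\<^sup>2" using m by (intro power_mono) auto
    also have "\<dots> < m\<^sup>2 / 2" using m(1) by (simp add: power_divide)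
    also have "\<dots> \<le> (L x)\<^sup>2 / 2" using L[OF x] m(1) by (simp add: power_mono)
    also have "\<dots> \<le> (cmod (\<sigma> x))\<^sup>2" by (rule sq[OF x])
    finally show ?thesis by (rule power_less_imp_less_base) simp
  qed
  \<comment> \<open>\<open>V\<close> compares \<open>U\<close> with the model solution
    \<open>exp (- s)\<close>, and \<open>W\<close> is its complex derivative. The initial values are
    those of the model, hence \<open>V 1 = 1\<close> and \<open>W 1 = 0\<close>.\<close>
  define V where "V x = U (\<sigma> x) * exp (\<sigma> x)" for x
  define W where "W x = (U' (\<sigma> x) + U (\<sigma> x)) * exp (\<sigma> x)" for x
  have d\<sigma>: "(\<sigma> has_vector_derivative (of_real n - s)) (at x)" for x
    unfolding \<sigma>_def[abs_def] has_vector_derivative_def by (auto intro!: derivative_eq_intros simp: scaleR_conv_of_real)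
  note chain = field_vector_diff_chain_at[OF d\<sigma>, unfolded o_def]
  have dV: "(V has_vector_derivative (of_real n - s) * W x) (at x)" if x: "0 \<le> x" "x \<le> 1" for x
  proof -
    have "((\<lambda>z. U z * exp z) has_field_derivative (U' (\<sigma> x) + U (\<sigma> x)) * exp (\<sigma> x)) (at (\<sigma> x))"
      by (auto intro!: derivative_eq_intros U(1)[OF Re_s[OF x] far[OF x]] simp: algebra_simps)
    from chain[OF this] show ?thesis unfolding V_def[abs_def] W_def .
  qed
  have dW: "(W has_vector_derivative (of_real n - s) * (2 * W x + \<rho> (\<sigma> x) * V x)) (at x)" if x: "0 \<le> x" "x \<le> 1" for x
  proof -
    have "((\<lambda>z. (U' z + U z) * exp z) has_field_derivative ((1 + \<rho> (\<sigma> x)) * U (\<sigma> x) + 2 * U' (\<sigma> x) + U (\<sigma> x)) * exp (\<sigma> x)) (at (\<sigma> x))"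
      by (auto intro!: derivative_eq_intros U(1,2)[OF Re_s[OF x] far[OF x]] simp: algebra_simps)
    moreover have "((1 + \<rho> (\<sigma> x)) * U (\<sigma> x) + 2 * U' (\<sigma> x) + U (\<sigma> x)) * exp (\<sigma> x) = 2 * W x + \<rho> (\<sigma> x) * V x"
      unfolding W_def V_def by (simp add: algebra_simps)
    ultimately have D: "((\<lambda>z. (U' z + U z) * exp z) has_field_derivative 2 * W x + \<rho> (\<sigma> x) * V x) (at (\<sigma> x))"
      by (simp only:)
    have "W = (\<lambda>x. (U' (\<sigma> x) + U (\<sigma> x)) * exp (\<sigma> x))" by (rule ext) (rule W_def)
    then show ?thesis using chain[OF D] by (simp only:)
  qed
  have cV: "continuous_on {0..1} V"
    using dV by (intro continuous_at_imp_continuous_on ballI) (auto intro: has_vector_derivative_continuous)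
  obtain x0 where x0: "x0 \<in> {0..1}" "\<And>x. x \<in> {0..1} \<Longrightarrow> cmod (V x) \<le> cmod (V x0)"
  proof -
    have "\<exists>x\<in>{0..1}. \<forall>y\<in>{0..1}. cmod (V y) \<le> cmod (V x)"
      by (rule continuous_attains_sup) (auto intro!: continuous_intros cV)
    then show ?thesis using that by blast
  qed
  define B where "B = cmod (V x0)"
  have s1: "\<sigma> 1 = of_real n" unfolding \<sigma>_def by simp
  have V1: "V 1 = 1" "W 1 = 0" unfolding V_def W_def s1 init by (simp_all flip: exp_of_real exp_add)
  have est: "cmod (V x1 - 1) \<le> B / 4" if x1: "0 \<le> x1" "x1 \<le> 1" for x1
  proof (cases "x1 = 1")
    case True then show ?thesis using V1 unfolding B_def by simp
  next
    case False
    then have lt: "x1 < 1" using x1 by simp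
    \<comment> \<open>The weight makes the terms of \<open>Z\<close> without \<rho> cancel on
      differentiation. At \<open>x1\<close> the coefficient of \<open>W\<close> is zero, and at 1
      the function \<open>W\<close> itself is.\<close>
    define ee where "ee x = exp (2 * (\<sigma> x1 - \<sigma> x))" for x
    define Z where "Z x = V x + (ee x - 1) / 2 * W x" for x
    \<comment> \<open>An antiderivative of the bound for the derivative of \<open>Z\<close>: the
      quotient \<open>x / L x\<close> has derivative \<open>p / (L x)^2\<close>.\<close>
    define f where "f x = 2 * C * B * (p + n) / p * (x / L x)" for x
    have h: "((\<lambda>x. (ee x - 1) / 2) has_vector_derivative (of_real n - s) * (- ee x)) (at x)" for x
    proof -
      have "((\<lambda>z. (exp (2 * (\<sigma> x1 - z)) - 1) / 2) has_field_derivative (- exp (2 * (\<sigma> x1 - \<sigma> x)))) (at (\<sigma> x))"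
        by (auto intro!: derivative_eq_intros)
      from chain[OF this] show ?thesis unfolding ee_def[abs_def] .
    qed
    have dZ: "(Z has_vector_derivative (of_real n - s) * ((ee x - 1) / 2 * (\<rho> (\<sigma> x) * V x))) (at x)" if x: "0 \<le> x" "x \<le> 1" for x
    proof -
      show ?thesis unfolding Z_def[abs_def]
        by (rule has_vector_derivative_eq_rhs[OF has_vector_derivative_add[OF dV[OF x] has_vector_derivative_mult[OF h dW[OF x]]]])
          (simp add: field_simps)
    qed
    have Lp: "L x > 0" if "0 \<le> x" "x \<le> 1" for x using L[OF that] m(1) by simp
    have df: "(f has_real_derivative 2 * C * B * (p + n) / (L x)\<^sup>2) (at x)" if x: "0 \<le> x" "x \<le> 1" for x
    proof -
      have "((\<lambda>x. x / L x) has_real_derivative (L x - x * (n - p)) / (L x)\<^sup>2) (at x)"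
        unfolding L_def[abs_def] using Lp[OF x] unfolding L_def
        by (auto intro!: derivative_eq_intros simp: power2_eq_square)
      moreover have "L x - x * (n - p) = p" unfolding L_def by (simp add: algebra_simps)
      ultimately have "(f has_real_derivative 2 * C * B * (p + n) / p * (p / (L x)\<^sup>2)) (at x)"
        unfolding f_def[abs_def] by (intro DERIV_cmult) simp
      then show ?thesis using p by simp
    qed
    have "cmod (Z 1 - Z x1) \<le> f 1 - f x1"
    proof (rule differentiable_bound_general[OF lt, where f' = "\<lambda>x. (of_real n - s) * ((ee x - 1) / 2 * (\<rho> (\<sigma> x) * V x))"
          and \<phi>' = "\<lambda>x. 2 * C * B * (p + n) / (L x)\<^sup>2"])
      show "continuous_on {x1..1} Z"
        by (intro continuous_at_imp_continuous_on ballI, rule has_vector_derivative_continuous[OF dZ]) (use x1 in auto)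
      show "continuous_on {x1..1} f"
        by (intro continuous_at_imp_continuous_on ballI, rule DERIV_isCont[OF df]) (use x1 in auto)
      fix x assume xx: "x1 < x" "x < 1"
      then have x: "0 \<le> x" "x \<le> 1" using x1 by auto
      show "(Z has_vector_derivative (of_real n - s) * ((ee x - 1) / 2 * (\<rho> (\<sigma> x) * V x))) (at x)" by (rule dZ[OF x])
      show "(f has_vector_derivative 2 * C * B * (p + n) / (L x)\<^sup>2) (at x)"
        using df[OF x] by (simp add: has_real_derivative_iff_has_vector_derivative)
      \<comment> \<open>This is where \<open>Re s\<close> at most \<open>n\<close> is needed: real
        parts do not decrease along the segment, so the exponential weight stays bounded by
        one.\<close>
      have "Re (\<sigma> x1 - \<sigma> x) = (x1 - x) * (n - Re s)" unfolding \<sigma>_def by (simp add: algebra_simps)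
      also have "\<dots> \<le> 0" using xx s by (intro mult_nonpos_nonneg) auto
      finally have "cmod (ee x) \<le> 1" unfolding ee_def by simp
      then have 1: "cmod ((ee x - 1) / 2) \<le> 1" using norm_triangle_ineq4[of "ee x" 1] by (simp add: norm_divide)
      have "cmod (\<rho> (\<sigma> x)) \<le> C / (cmod (\<sigma> x))\<^sup>2" by (rule \<rho>[OF Re_s[OF x] far[OF x]])
      also have "\<dots> \<le> C / ((L x)\<^sup>2 / 2)"
      proof (rule divide_left_mono[OF sq[OF x] m(5)])
        have "cmod (\<sigma> x) > 0" using far[OF x] m(4) by linarith
        then show "0 < (cmod (\<sigma> x))\<^sup>2 * ((L x)\<^sup>2 / 2)" using Lp[OF x] by simp
      qed
      finally have 2: "cmod (\<rho> (\<sigma> x)) \<le> 2 * C / (L x)\<^sup>2" by (simp add: mult.commute)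
      have 3: "cmod (V x) \<le> B" unfolding B_def using x0(2) x by simp
      have 4: "cmod (of_real n - s) \<le> p + n" using norm_triangle_ineq4[of "of_real n" s] p unfolding p_def by simp
      have "cmod ((of_real n - s) * ((ee x - 1) / 2 * (\<rho> (\<sigma> x) * V x)))
        = cmod (of_real n - s) * (cmod ((ee x - 1) / 2) * (cmod (\<rho> (\<sigma> x)) * cmod (V x)))" by (simp only: norm_mult)
      also have "\<dots> \<le> (p + n) * (1 * (2 * C / (L x)\<^sup>2 * B))"
        using 1 2 3 4 p m(5) by (intro mult_mono) (auto simp: B_def)
      finally show "cmod ((of_real n - s) * ((ee x - 1) / 2 * (\<rho> (\<sigma> x) * V x))) \<le> 2 * C * B * (p + n) / (L x)\<^sup>2"
        by (simp add: mult_ac)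
    qed
    moreover have "Z 1 = 1" "Z x1 = V x1" unfolding Z_def using V1 by (simp_all add: ee_def)
    moreover have "f x1 \<ge> 0" unfolding f_def using x1 Lp[OF x1] p m(5) by (simp add: B_def)
    moreover have "f 1 \<le> B / 4"
    proof -
      \<comment> \<open>Both \<open>n\<close> and \<open>p\<close> are at least \<open>m\<close>,
        hence at least \<open>16 * C\<close>.\<close>
      have "f 1 = 2 * B * (C / n + C / p)" unfolding f_def L_def using p by (simp add: field_simps)
      also have "\<dots> \<le> 2 * B * (1/16 + 1/16)"
        using p n m by (intro mult_left_mono add_mono) (auto simp: B_def pos_divide_le_eq)
      finally show ?thesis by simp
    qed
    ultimately show ?thesis by (simp add: norm_minus_commute)
  qed
  \<comment> \<open>The maximum \<open>B\<close> is bounded through itself: it is at most 4/3, and a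
    quarter of that is the claimed 1/3.\<close>
  have "B \<le> 1 + B / 4"
    using est[of x0] x0(1) norm_triangle_ineq2[of "V x0" 1] unfolding B_def by simp
  moreover have "cmod (V 0 - 1) \<le> B / 4" by (rule est) auto
  ultimately have "cmod (V 0 - 1) \<le> 1/3" by linarith
  then show ?thesis unfolding V_def \<sigma>_def by simp
qed

lemma holomorphic_lipschitz_at:
  assumes "f holomorphic_on ball 0 r" "r > 0"
  obtains B \<delta> where "0 < \<delta>" "\<delta> < r" "B \<ge> 0" "\<And>t. cmod t < \<delta> \<Longrightarrow> cmod (f t - f 0) \<le> B * cmod t"
proof -
  have "((\<lambda>t. (f t - f 0) / (t - 0)) \<longlongrightarrow> deriv f 0) (at 0)"
    using holomorphic_derivI[OF assms(1) open_ball, of 0] assms(2) unfolding has_field_derivative_iff by simp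
  then have "\<forall>\<^sub>F t in at 0. cmod ((f t - f 0) / (t - 0)) < cmod (deriv f 0) + 1"
    by (intro order_tendstoD(2)[OF tendsto_norm]) auto
  then obtain d where d: "d > 0" "\<And>t. t \<noteq> 0 \<Longrightarrow> dist t 0 < d \<Longrightarrow> cmod ((f t - f 0) / (t - 0)) < cmod (deriv f 0) + 1"
    unfolding eventually_at by auto
  show ?thesis
  proof (rule that[of "min d (r / 2)" "cmod (deriv f 0) + 1"])
    fix t assume t: "cmod t < min d (r / 2)"
    show "cmod (f t - f 0) \<le> (cmod (deriv f 0) + 1) * cmod t"
    proof (cases "t = 0")
      case False
      then have "cmod (f t - f 0) / cmod t < cmod (deriv f 0) + 1" using d(2)[of t] t by (simp add: norm_divide)
      then show ?thesis using False by (simp add: pos_divide_less_eq)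
    qed simp
  qed (use d assms in auto)
qed

text \<open>
  If the coefficient has a simple pole in \<open>t = e\<^sup>\<zeta>\<close>, the solutions behave like \<open>s\<^bsup>-1/2\<^esup> e\<^bsup>\<plusminus>s\<^esup>\<close> with \<open>s = (\<kappa> / t)\<^bsup>1/2\<^esup>\<close>.
  One of them is \<open>O(e\<^bsup>-s\<^esup>)\<close> in the whole half plane \<open>Re s > 0\<close>, which covers a full turn of \<open>t\<close>. With scalar monodromy
  it would be bounded around \<open>t = 0\<close>, hence a power of \<open>t\<close> times a convergent power series, which contradicts its decay.
\<close>

lemma irregular_monodromy_not_scalar:
  assumes S: "S holomorphic_on ball 0 (exp a)" "S 0 \<noteq> 0" and h: "\<And>\<zeta>. Re \<zeta> < a \<Longrightarrow> h \<zeta> = S (exp \<zeta>) / exp \<zeta>"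
    and uv: "solves h (half_plane a) u" "solves h (half_plane a) v" "\<And>\<zeta>. Re \<zeta> < a \<Longrightarrow> wronskian u v \<zeta> = 1"
    and per: "\<And>\<zeta>. Re \<zeta> < a \<Longrightarrow> u (\<zeta> + period) = \<mu> * u \<zeta>" "\<And>\<zeta>. Re \<zeta> < a \<Longrightarrow> v (\<zeta> + period) = \<mu> * v \<zeta>" "cmod \<mu> = 1"
  shows False
proof -
  have op: "open (half_plane a)" by (rule open_halfspace_Re_lt)
  obtain B \<delta> where lip: "0 < \<delta>" "\<delta> < exp a" "B \<ge> 0" "\<And>t. cmod t < \<delta> \<Longrightarrow> cmod (S t - S 0) \<le> B * cmod t"
    by (rule holomorphic_lipschitz_at[OF S(1)]; (simp | (rule that; (assumption | simp))))
  \<comment> \<open>With \<open>t = \<kappa> / s^2\<close> one has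
    \<open>d\<zeta> = - 2 ds / s\<close>, and the factor 4 normalizes the leading coefficient of the
    equation in \<open>s\<close> to one.\<close>
  define \<kappa> where "\<kappa> = 4 * S 0"
  have k0: "\<kappa> \<noteq> 0" unfolding \<kappa>_def using S(2) by simp
  define c where "c = Ln \<kappa>"
  have expc: "exp c = \<kappa>" unfolding c_def using k0 by simp
  \<comment> \<open>Outside radius \<open>R\<close> in \<open>s\<close> the point \<open>t\<close>
    lies in the disc where the Lipschitz bound for \<open>S\<close> holds.\<close>
  define R where "R = sqrt (cmod \<kappa> / \<delta>)"
  have R: "R > 0" "R\<^sup>2 = cmod \<kappa> / \<delta>" unfolding R_def using k0 lip(1) by simp_all
  have small: "cmod (\<kappa> / s\<^sup>2) < \<delta>" "s \<noteq> 0" if "cmod s > R" for s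
  proof -
    show s0: "s \<noteq> 0" using that R by auto
    have "R\<^sup>2 < (cmod s)\<^sup>2" using that R by (intro power_strict_mono) auto
    then show "cmod (\<kappa> / s\<^sup>2) < \<delta>" unfolding R(2) using lip(1) s0 by (simp add: norm_divide norm_power field_simps)
  qed
  define Z where "Z s = c - 2 * Ln s" for s
  have eZ: "exp (Z s) = \<kappa> / s\<^sup>2" if "s \<noteq> 0" for s
    unfolding Z_def exp_diff expc exp_double using that by simp
  have Zin: "Re (Z s) < a" if "cmod s > R" for s
  proof -
    have "exp (Re (Z s)) = cmod (\<kappa> / s\<^sup>2)" using eZ[OF small(2)[OF that]] by (metis norm_exp_eq_Re)
    then have "exp (Re (Z s)) < exp a" using small(1)[OF that] lip(2) by simp
    then show ?thesis by simp
  qed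
  \<comment> \<open>The first part is the relative deviation of \<open>S\<close> from
    \<open>S 0\<close>, of size \<open>t\<close>; the second is produced by the factor
    \<open>s^(1/2)\<close> in \<open>U\<close>. Both are of order \<open>1 / s^2\<close>.\<close>
  define \<rho> where "\<rho> s = (S (\<kappa> / s\<^sup>2) - S 0) / S 0 - 1 / (4 * s\<^sup>2)" for s
  define C where "C = 4 * B + 1/4"
  have C0: "C \<ge> 0" unfolding C_def using lip(3) by simp
  have rho: "cmod (\<rho> s) \<le> C / (cmod s)\<^sup>2" if "cmod s > R" for s
  proof -
    have "cmod ((S (\<kappa> / s\<^sup>2) - S 0) / S 0) \<le> B * cmod (\<kappa> / s\<^sup>2) / cmod (S 0)"
      unfolding norm_divide by (intro divide_right_mono lip(4)[unfolded norm_divide] ) (use small(1)[OF that] lip(4)[OF small(1)[OF that]] in \<open>simp_all add: norm_divide\<close>)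
    also have "\<dots> = 4 * B / (cmod s)\<^sup>2" unfolding \<kappa>_def using S(2) by (simp add: norm_divide norm_mult norm_power)
    finally have 1: "cmod ((S (\<kappa> / s\<^sup>2) - S 0) / S 0) \<le> 4 * B / (cmod s)\<^sup>2" .
    have 2: "cmod (1 / (4 * s\<^sup>2)) = (1/4) / (cmod s)\<^sup>2" by (simp add: norm_divide norm_mult norm_power)
    have "cmod (\<rho> s) \<le> 4 * B / (cmod s)\<^sup>2 + (1/4) / (cmod s)\<^sup>2"
      unfolding \<rho>_def using norm_triangle_ineq4[of "(S (\<kappa> / s\<^sup>2) - S 0) / S 0" "1 / (4 * s\<^sup>2)"] 1 2 by linarith
    then show ?thesis unfolding C_def by (simp add: add_divide_distrib)
  qed
  \<comment> \<open>The square root of \<open>s\<close>, which removes the first-derivative term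
    that the substitution creates.\<close>
  define r where "r s = exp (Ln s / 2)" for s :: complex
  define U where "U y s = r s * y (Z s)" for y s
  define U' where "U' y s = r s / s * (y (Z s) / 2 - 2 * deriv y (Z s))" for y s
  have dU: "(U y has_field_derivative U' y s) (at s)" "(U' y has_field_derivative (1 + \<rho> s) * U y s) (at s)"
    if y: "solves h (half_plane a) y" and s: "Re s > 0" "cmod s > R" for y s
  proof -
    have s0: "s \<noteq> 0" "s \<notin> \<real>\<^sub>\<le>\<^sub>0" using small(2)[OF s(2)] s(1) by (simp_all add: complex_nonpos_Reals_iff)
    have zin: "Z s \<in> half_plane a" using Zin[OF s(2)] by simp
    have dr: "(r has_field_derivative r s / (2 * s)) (at s)"
      unfolding r_def[abs_def] using s0 by (auto intro!: derivative_eq_intros simp: field_simps)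
    have dZ: "(Z has_field_derivative - 2 / s) (at s)"
      unfolding Z_def[abs_def] using s0 by (auto intro!: derivative_eq_intros simp: field_simps)
    have d1: "((\<lambda>s. y (Z s)) has_field_derivative deriv y (Z s) * (- 2 / s)) (at s)"
      by (rule DERIV_chain2[OF solves_deriv(1)[OF y op zin] dZ])
    have d2: "((\<lambda>s. deriv y (Z s)) has_field_derivative (h (Z s) * y (Z s)) * (- 2 / s)) (at s)"
      by (rule DERIV_chain2[OF solves_deriv(2)[OF y op zin] dZ])
    show "(U y has_field_derivative U' y s) (at s)"
      unfolding U_def[abs_def] U'_def by (rule DERIV_cong[OF DERIV_mult[OF dr d1]]) (use s0 in \<open>simp add: field_simps\<close>)
    have hh: "h (Z s) = S (\<kappa> / s\<^sup>2) * s\<^sup>2 / (4 * S 0)"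
      unfolding h[OF Zin[OF s(2)]] eZ[OF s0(1)] \<kappa>_def by simp
    have d3: "((\<lambda>s. r s / s) has_field_derivative (r s / (2 * s) * s - r s * 1) / (s * s)) (at s)"
      by (rule DERIV_divide[OF dr DERIV_ident s0(1)])
    have d4: "((\<lambda>s. y (Z s) / 2 - 2 * deriv y (Z s)) has_field_derivative
        deriv y (Z s) * (- 2 / s) / 2 - 2 * ((h (Z s) * y (Z s)) * (- 2 / s))) (at s)"
      by (intro DERIV_diff DERIV_cdivide DERIV_cmult d1 d2)
    have alg: "(q / (2 * s) * s - q * 1) / (s * s) * (x / 2 - 2 * x') + (x' * (- 2 / s) / 2 - 2 * ((T * s\<^sup>2 / (4 * S 0) * x) * (- 2 / s))) * (q / s)
        = (1 + ((T - S 0) / S 0 - 1 / (4 * s\<^sup>2))) * (q * x)" for q x x' T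
      using s0(1) S(2) by (simp add: field_simps power2_eq_square)
    show "(U' y has_field_derivative (1 + \<rho> s) * U y s) (at s)"
      unfolding U'_def[abs_def] by (rule DERIV_cong[OF DERIV_mult[OF d3 d4]]) (unfold hh \<rho>_def U_def, rule alg)
  qed
  \<comment> \<open>The thresholds of the recessive estimate, and at least 1 so that
    \<open>r\<close> later has modulus at least one.\<close>
  define m where "m = max (max 1 (16 * C)) (2 * R)"
  have m: "m > 0" "m \<ge> 1" "m \<ge> 16 * C" "m \<ge> 2 * R" "m > R" unfolding m_def using R by auto
  \<comment> \<open>For every \<open>n\<close> there is a solution with the data of
    \<open>exp (- s)\<close> at \<open>s = n\<close>, controlled up to real part \<open>n\<close>.
    The decaying solution is the limit of these for growing \<open>n\<close>.\<close>
  have "\<exists>p q. \<forall>s. Re s > 0 \<longrightarrow> Re s \<le> n \<longrightarrow> cmod s \<ge> m \<longrightarrow> cmod (U (\<lambda>\<zeta>. p * u \<zeta> + q * v \<zeta>) s * exp s - 1) \<le> 1/3"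
    if n: "n \<ge> m" for n :: real
  proof -
    have n0: "n > 0" "cmod (of_real n) > R" using n m by auto
    let ?z = "Z (of_real n)"
    have z: "Re ?z < a" by (rule Zin[OF n0(2)])
    define e where "e = r (of_real n)"
    have e0: "e \<noteq> 0" unfolding e_def r_def by simp
    \<comment> \<open>The values of \<open>y\<close> and its derivative at \<open>Z n\<close> that
      give \<open>U y\<close> and \<open>U' y\<close> the required data at \<open>n\<close>;
      \<open>p\<close> and \<open>q\<close> follow by Cramer's rule.\<close>
    define A where "A = of_real (exp (- n)) / e"
    define A' where "A' = (A / 2 + of_real n * of_real (exp (- n)) / e) / 2"
    define p where "p = A * deriv v ?z - A' * v ?z"
    define q where "q = u ?z * A' - deriv u ?z * A"
    define y where "y = (\<lambda>\<zeta>. p * u \<zeta> + q * v \<zeta>)"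
    have y: "solves h (half_plane a) y" unfolding y_def by (rule solves_combination(1)[OF uv(1,2) op])
    have W: "u ?z * deriv v ?z - deriv u ?z * v ?z = 1" using uv(3)[OF z] unfolding wronskian_def .
    have "y ?z = A * (u ?z * deriv v ?z - deriv u ?z * v ?z)" unfolding y_def p_def q_def by (simp add: algebra_simps)
    then have y1: "y ?z = A" unfolding W by simp
    have "deriv y ?z = p * deriv u ?z + q * deriv v ?z" unfolding y_def
      by (rule solves_combination(2)[OF uv(1,2) op]) (use z in simp)
    also have "\<dots> = A' * (u ?z * deriv v ?z - deriv u ?z * v ?z)" unfolding p_def q_def by (simp add: algebra_simps)
    finally have y2: "deriv y ?z = A'" unfolding W by simp
    have i1: "U y (of_real n) = of_real (exp (- n))" unfolding U_def y1 A_def e_def[symmetric] using e0 by simp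
    have i2: "U' y (of_real n) = - of_real (exp (- n))"
      unfolding U'_def y1 y2 A'_def e_def[symmetric] using e0 n0(1) by (simp add: field_simps)
    have "cmod (U y s * exp s - 1) \<le> 1/3" if "Re s > 0" "Re s \<le> n" "cmod s \<ge> m" for s
      by (rule recessive_solution_bound[OF dU[OF y] rho i1 i2 m(1,3,4) _ C0 n that]) (use R in auto)
    then show ?thesis unfolding y_def by blast
  qed
  then have "\<forall>k::nat. \<exists>p q. \<forall>s. Re s > 0 \<longrightarrow> Re s \<le> m + real k \<longrightarrow> cmod s \<ge> m \<longrightarrow> cmod (U (\<lambda>\<zeta>. p * u \<zeta> + q * v \<zeta>) s * exp s - 1) \<le> 1/3"
    by simp
  then obtain p q where pq: "\<And>k s. Re s > 0 \<Longrightarrow> Re s \<le> m + real k \<Longrightarrow> cmod s \<ge> m \<Longrightarrow> cmod (U (\<lambda>\<zeta>. p k * u \<zeta> + q k * v \<zeta>) s * exp s - 1) \<le> 1/3"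
    by metis
  have Ulin: "U (\<lambda>\<zeta>. x * u \<zeta> + y * v \<zeta>) s = x * U u s + y * U v s" for x y s unfolding U_def by (simp add: algebra_simps)
  define P where "P k = (p k, q k)" for k
  \<comment> \<open>At \<open>s = m\<close> every approximating solution has size at least
    \<open>2/3 * exp (- m)\<close>, so its coefficient vector cannot tend to zero. Normalizing it
    therefore keeps the estimate, with constant \<open>2 * T\<close>.\<close>
  define T where "T = (cmod (U u (of_real m)) + cmod (U v (of_real m))) * exp m"
  have nP: "2/3 \<le> norm (P k) * T" for k
  proof -
    have "cmod (U (\<lambda>\<zeta>. p k * u \<zeta> + q k * v \<zeta>) (of_real m) * exp (of_real m) - 1) \<le> 1/3"
      by (rule pq) (use m in auto)
    then have "2/3 \<le> cmod (U (\<lambda>\<zeta>. p k * u \<zeta> + q k * v \<zeta>) (of_real m) * exp (of_real m))"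
      using norm_triangle_ineq2[of 1 "1 - U (\<lambda>\<zeta>. p k * u \<zeta> + q k * v \<zeta>) (of_real m) * exp (of_real m)"]
      by (simp add: norm_minus_commute)
    also have "\<dots> = cmod (p k * U u (of_real m) + q k * U v (of_real m)) * exp m" unfolding Ulin norm_mult by simp
    also have "cmod (p k * U u (of_real m) + q k * U v (of_real m)) \<le> norm (P k) * cmod (U u (of_real m)) + norm (P k) * cmod (U v (of_real m))"
      using norm_fst_le[of "p k" "q k"] norm_snd_le[of "q k" "p k"]
      by (intro norm_triangle_le add_mono) (auto simp: norm_mult P_def intro!: mult_right_mono)
    finally show ?thesis unfolding T_def by (simp add: algebra_simps)
  qed
  have P0: "norm (P k) > 0" for k using nP[of k] by (cases "P k = 0") auto
  have T0: "T \<ge> 0" unfolding T_def by simp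
  have invP: "1 / norm (P k) \<le> 3/2 * T" for k using nP[of k] P0[of k] by (simp add: field_simps)
  \<comment> \<open>Unit coefficient vectors lie in a compact sphere; a limit point defines a
    solution whose decay holds in the whole half-plane.\<close>
  define Q where "Q k = P k /\<^sub>R norm (P k)" for k
  have "Q k \<in> sphere 0 1" for k unfolding Q_def using P0[of k] by simp
  then obtain l f where l: "l \<in> sphere 0 1" and f: "strict_mono f" "(Q \<circ> f) \<longlonglongrightarrow> l"
    using compact_imp_seq_compact[OF compact_sphere] unfolding seq_compact_def by metis
  define y where "y = (\<lambda>\<zeta>. fst l * u \<zeta> + snd l * v \<zeta>)"
  have y: "solves h (half_plane a) y" unfolding y_def by (rule solves_combination(1)[OF uv(1,2) op])
  have decay: "cmod (U y s) * exp (Re s) \<le> 2 * T" if s: "Re s > 0" "cmod s \<ge> m" for s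
  proof -
    have "(\<lambda>k. fst (Q (f k)) * U u s + snd (Q (f k)) * U v s) \<longlonglongrightarrow> fst l * U u s + snd l * U v s"
      using f(2) by (intro tendsto_intros) (auto simp: o_def)
    then have lim: "(\<lambda>k. cmod (fst (Q (f k)) * U u s + snd (Q (f k)) * U v s) * exp (Re s)) \<longlonglongrightarrow> cmod (U y s) * exp (Re s)"
      unfolding y_def Ulin by (intro tendsto_mult tendsto_norm tendsto_const)
    have b: "cmod (fst (Q (f k)) * U u s + snd (Q (f k)) * U v s) * exp (Re s) \<le> 2 * T" if k: "k \<ge> nat \<lceil>Re s\<rceil>" for k
    proof -
      have "real k \<le> real (f k)" using seq_suble[OF f(1), of k] by simp
      moreover have "Re s \<le> real k" using k by linarith
      ultimately have "Re s \<le> m + real (f k)" using m(1) by linarith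
      then have "cmod (U (\<lambda>\<zeta>. p (f k) * u \<zeta> + q (f k) * v \<zeta>) s * exp s - 1) \<le> 1/3" using pq s by blast
      then have 1: "cmod ((p (f k) * U u s + q (f k) * U v s) * exp s) \<le> 4/3"
        unfolding Ulin using norm_triangle_ineq2[of "(p (f k) * U u s + q (f k) * U v s) * exp s" 1] by simp
      have "fst (Q (f k)) * U u s + snd (Q (f k)) * U v s = (p (f k) * U u s + q (f k) * U v s) / of_real (norm (P (f k)))"
        unfolding Q_def P_def by (simp add: scaleR_conv_of_real divide_inverse algebra_simps)
      then have "cmod (fst (Q (f k)) * U u s + snd (Q (f k)) * U v s) * exp (Re s) = cmod ((p (f k) * U u s + q (f k) * U v s) * exp s) * (1 / norm (P (f k)))"
        by (simp add: norm_mult norm_divide)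
      also have "\<dots> \<le> 4/3 * (3/2 * T)" using 1 invP P0[of "f k"] by (intro mult_mono) auto
      finally show ?thesis by simp
    qed
    show ?thesis by (rule LIMSEQ_le_const2[OF lim]) (use b in blast)
  qed
  \<comment> \<open>The real part of \<zeta> that corresponds to modulus \<open>m\<close> of
    \<open>s\<close>.\<close>
  define a0 where "a0 = ln (cmod \<kappa> / m\<^sup>2)"
  have ea0: "exp a0 = cmod \<kappa> / m\<^sup>2" unfolding a0_def using k0 m by simp
  have a0: "a0 < a"
  proof -
    have "exp a0 = cmod (\<kappa> / (of_real m)\<^sup>2)" unfolding ea0 by (simp add: norm_divide norm_power)
    also have "\<dots> < \<delta>" by (rule small(1)) (use m in auto)
    finally have "exp a0 < exp a" using lip(2) by (rule less_trans)
    then show ?thesis by simp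
  qed
  define s where "s \<zeta> = exp ((c - \<zeta>) / 2)" for \<zeta>
  have ns: "(cmod (s \<zeta>))\<^sup>2 = cmod \<kappa> / exp (Re \<zeta>)" for \<zeta>
  proof -
    have "(s \<zeta>)\<^sup>2 = exp (2 * ((c - \<zeta>) / 2))" unfolding s_def by (simp only: exp_double)
    also have "2 * ((c - \<zeta>) / 2) = c - \<zeta>" by (simp add: field_simps)
    finally have "(s \<zeta>)\<^sup>2 = exp (c - \<zeta>)" .
    then have "cmod ((s \<zeta>)\<^sup>2) = cmod \<kappa> / exp (Re \<zeta>)" by (simp add: exp_diff expc norm_divide)
    then show ?thesis by (simp add: norm_power)
  qed
  have ms: "cmod (s \<zeta>) \<ge> m" if "Re \<zeta> \<le> a0" for \<zeta>
  proof -
    have "cmod \<kappa> / exp a0 \<le> cmod \<kappa> / exp (Re \<zeta>)" using that by (intro divide_left_mono) auto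
    moreover have "cmod \<kappa> / exp a0 = m\<^sup>2" unfolding ea0 using k0 by simp
    ultimately have "m\<^sup>2 \<le> (cmod (s \<zeta>))\<^sup>2" unfolding ns by simp
    then show ?thesis by (rule power2_le_imp_le) simp
  qed
  \<comment> \<open>The strip is where \<open>s\<close> has positive real part. Its width
    \<open>2 * pi\<close> is a full turn of \<open>t\<close>, because \<open>s\<close> involves only
    the square root of \<open>t\<close>.\<close>
  have strip_bound: "cmod (y \<zeta>) * exp (Re (s \<zeta>)) \<le> 2 * T" if z: "Re \<zeta> \<le> a0" "\<bar>Im (\<zeta> - c)\<bar> < pi" for \<zeta>
  proof -
    have "\<bar>Im ((c - \<zeta>) / 2)\<bar> < pi / 2" using z(2) by (auto simp: abs_less_iff)
    then have im: "- (pi / 2) < Im ((c - \<zeta>) / 2)" "Im ((c - \<zeta>) / 2) < pi / 2" by linarith+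
    have re: "Re (s \<zeta>) > 0" unfolding s_def Re_exp using cos_gt_zero_pi[OF im] by simp
    have L: "Ln (s \<zeta>) = (c - \<zeta>) / 2" unfolding s_def by (rule Ln_exp) (use im pi_gt_zero in linarith)+
    have Z: "Z (s \<zeta>) = \<zeta>" unfolding Z_def L by (simp add: field_simps)
    have rs: "cmod (r (s \<zeta>)) = exp (Re ((c - \<zeta>) / 2) / 2)" unfolding r_def L by simp
    have "cmod (s \<zeta>) \<ge> 1" using ms[OF z(1)] m(2) by linarith
    then have "exp (Re ((c - \<zeta>) / 2)) \<ge> exp 0" unfolding s_def by simp
    then have "cmod (r (s \<zeta>)) \<ge> 1" unfolding rs by simp
    then have "cmod (y \<zeta>) \<le> cmod (U y (s \<zeta>))" unfolding U_def Z norm_mult using mult_right_mono[of 1 "cmod (r (s \<zeta>))" "cmod (y \<zeta>)"] by simp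
    then have "cmod (y \<zeta>) * exp (Re (s \<zeta>)) \<le> cmod (U y (s \<zeta>)) * exp (Re (s \<zeta>))" by (rule mult_right_mono) simp
    also have "\<dots> \<le> 2 * T" by (rule decay[OF re ms[OF z(1)]])
    finally show ?thesis .
  qed
  have sb: "cmod (y \<zeta>) \<le> 2 * T" if "Re \<zeta> \<le> a0" "\<bar>Im (\<zeta> - c)\<bar> < pi" for \<zeta>
  proof -
    have "\<bar>Im ((c - \<zeta>) / 2)\<bar> < pi / 2" using that(2) by (auto simp: abs_less_iff)
    then have im: "- (pi / 2) < Im ((c - \<zeta>) / 2)" "Im ((c - \<zeta>) / 2) < pi / 2" by linarith+
    have re: "Re (s \<zeta>) > 0" unfolding s_def Re_exp using cos_gt_zero_pi[OF im] by simp
    then have "1 \<le> exp (Re (s \<zeta>))" by simp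
    then have "cmod (y \<zeta>) * 1 \<le> cmod (y \<zeta>) * exp (Re (s \<zeta>))" by (intro mult_left_mono) auto
    then show ?thesis using strip_bound[OF that] by simp
  qed
  have yhol: "y holomorphic_on half_plane a" using y unfolding solves_def by simp
  have yper: "y (\<zeta> + period) = \<mu> * y \<zeta>" if "Re \<zeta> < a" for \<zeta> unfolding y_def using per(1,2)[OF that] by (simp add: algebra_simps)
  have bd: "cmod (y \<zeta>) \<le> 2 * T * exp (0 * \<bar>Re \<zeta>\<bar>)" if z: "Re \<zeta> \<le> a0" for \<zeta>
  proof -
    \<comment> \<open>The representative modulo the period with imaginary part of
      \<open>\<omega> - c\<close> in the half-open interval up to \<open>pi\<close>. Scalar
      monodromy enters here: the modulus of \<open>y\<close> is periodic.\<close>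
    define \<omega> where "\<omega> = c + Ln (exp (\<zeta> - c))"
    have w: "exp \<omega> = exp \<zeta>" unfolding \<omega>_def exp_add by (simp add: exp_diff)
    have rw: "Re \<omega> = Re \<zeta>" using w by (metis exp_inj_iff norm_exp_eq_Re)
    have iw: "- pi < Im (\<omega> - c)" "Im (\<omega> - c) \<le> pi" unfolding \<omega>_def using mpi_less_Im_Ln Im_Ln_le_pi by auto
    have "complex_of_real (cmod (y \<zeta>)) = complex_of_real (cmod (y \<omega>))"
      by (rule periodic_int[where f = "\<lambda>\<zeta>. complex_of_real (cmod (y \<zeta>))" and a = a])
        (use yper per(3) z a0 w in \<open>auto simp: norm_mult\<close>)
    then have e: "cmod (y \<zeta>) = cmod (y \<omega>)" by simp
    \<comment> \<open>The strip is open, so the edge value \<open>pi\<close> is approached from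
      below and the bound passes to the limit.\<close>
    define g where "g k = \<omega> - \<i> * of_real (inverse (real (Suc k)))" for k
    have gl: "g \<longlonglongrightarrow> \<omega> - \<i> * of_real 0" unfolding g_def[abs_def] by (intro tendsto_intros LIMSEQ_inverse_real_of_nat)
    have "isCont y \<omega>" using holomorphic_on_imp_continuous_on[OF yhol] op z a0 rw by (simp add: continuous_on_eq_continuous_at)
    then have yl: "(\<lambda>k. cmod (y (g k))) \<longlonglongrightarrow> cmod (y \<omega>)" using gl by (intro tendsto_norm) (auto intro: isCont_tendsto_compose)
    have "\<forall>\<^sub>F k in sequentially. cmod (y (g k)) \<le> 2 * T"
    proof -
      have "(\<lambda>k. Im (g k - c)) \<longlonglongrightarrow> Im (\<omega> - \<i> * of_real 0 - c)" by (intro tendsto_intros gl)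
      then have "\<forall>\<^sub>F k in sequentially. - pi < Im (g k - c)" by (rule order_tendstoD(1)) (use iw in simp)
      then show ?thesis
      proof eventually_elim
        case (elim k)
        have "Im (\<omega> - \<i> * of_real x - c) = Im (\<omega> - c) - x" for x by simp
        then have "Im (g k - c) = Im (\<omega> - c) - inverse (real (Suc k))" unfolding g_def by blast
        moreover have "inverse (real (Suc k)) > 0" by simp
        ultimately have "Im (g k - c) < pi" using iw by linarith
        moreover have "Re (g k) = Re \<zeta>" unfolding g_def using rw by simp
        ultimately show ?case using elim z by (intro sb) auto
      qed
    qed
    then have "cmod (y \<omega>) \<le> 2 * T" by (rule tendsto_upperbound[OF yl _ sequentially_bot])
    then show ?thesis unfolding e by simp
  qed
  \<comment> \<open>The coefficient vector of \<open>y\<close> is a unit vector, and Cramer's rule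
    would make it zero if \<open>y\<close> vanished identically.\<close>
  have "\<exists>\<zeta>. Re \<zeta> < a \<and> y \<zeta> \<noteq> 0"
  proof (rule ccontr)
    assume "\<not> ?thesis"
    then have y0: "y \<zeta> = 0" if "\<zeta> \<in> half_plane a" for \<zeta> using that by auto
    let ?w = "of_real (a - 1) :: complex"
    have w: "?w \<in> half_plane a" by simp
    have "(y has_field_derivative 0) (at ?w)"
      by (rule has_field_derivative_transform_within_open[OF DERIV_const[of 0] op w]) (simp add: y0)
    then have d0: "deriv y ?w = 0" by (rule DERIV_imp_deriv)
    have dy: "deriv y ?w = fst l * deriv u ?w + snd l * deriv v ?w" unfolding y_def by (rule solves_combination(2)[OF uv(1,2) op w])
    have W: "u ?w * deriv v ?w - deriv u ?w * v ?w = 1" using uv(3)[of ?w] unfolding wronskian_def by simp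
    have yw: "fst l * u ?w + snd l * v ?w = 0" using y0[OF w] unfolding y_def .
    have "fst l = (fst l * u ?w + snd l * v ?w) * deriv v ?w - (fst l * deriv u ?w + snd l * deriv v ?w) * v ?w"
      using W by algebra
    then have f0: "fst l = 0" unfolding yw dy[symmetric] d0 by simp
    have "snd l = (fst l * deriv u ?w + snd l * deriv v ?w) * u ?w - (fst l * u ?w + snd l * v ?w) * deriv u ?w"
      using W by algebra
    then have "snd l = 0" unfolding yw dy[symmetric] d0 by simp
    then have "l = 0" using f0 by (simp add: prod_eq_iff)
    then show False using l by simp
  qed
  then obtain z0 where z0: "Re z0 < a" "y z0 \<noteq> 0" by blast
  obtain \<sigma> k where ef: "exponent_form a \<sigma> k y"
    by (rule exponent_form_exists[OF yhol yper per(3) z0 bd]; (assumption | (rule that; (assumption | simp))))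
  have k: "k holomorphic_on ball 0 (exp a)" "k 0 \<noteq> 0" "\<And>\<zeta>. Re \<zeta> < a \<Longrightarrow> y \<zeta> = exp (of_real \<sigma> * \<zeta>) * k (exp \<zeta>)"
    using ef unfolding exponent_form_def by auto
  \<comment> \<open>An integer at least \<open>2 * \<sigma>\<close>: on the curve
    \<open>t = \<kappa> / x^2\<close> the factor \<open>t^\<sigma>\<close> costs at most the power
    \<open>x ^ N\<close>.\<close>
  define N where "N = nat \<lceil>2 * \<sigma>\<rceil>"
  define K where "K = 2 * T * exp (- \<sigma> * Re c)"
  \<comment> \<open>Along positive real \<open>s = x\<close>, the middle line of the strip, the
    decay of \<open>y\<close> is fully exponential, while \<open>k\<close> should tend to its
    nonzero value at 0.\<close>
  have kb: "cmod (k (\<kappa> / (of_real x)\<^sup>2)) \<le> K * (x ^ N / exp x)" if x: "x \<ge> m" for x :: real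
  proof -
    have x1: "x \<ge> 1" "x > 0" using x m by auto
    let ?z = "c - 2 * of_real (ln x)"
    have ez: "exp ?z = \<kappa> / (of_real x)\<^sup>2"
    proof -
      have "exp (complex_of_real (ln x)) = of_real x" using x1 by (simp add: exp_of_real)
      then show ?thesis unfolding exp_diff expc exp_double by simp
    qed
    have rz: "Re ?z \<le> a0"
    proof -
      have "exp (Re ?z) = cmod \<kappa> / x\<^sup>2" using ez by (metis norm_divide norm_exp_eq_Re norm_of_real norm_power power2_abs)
      also have "\<dots> \<le> cmod \<kappa> / m\<^sup>2" using x m by (intro divide_left_mono power_mono) auto
      finally show ?thesis unfolding ea0[symmetric] by simp
    qed
    have sz: "s ?z = of_real x"
    proof -
      have "(c - ?z) / 2 = of_real (ln x)" by simp
      then show ?thesis unfolding s_def using x1 by (simp add: exp_of_real)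
    qed
    have "cmod (y ?z) * exp x \<le> 2 * T" using strip_bound[OF rz] unfolding sz by simp
    then have 1: "cmod (y ?z) \<le> 2 * T / exp x" by (simp add: pos_le_divide_eq)
    have rza: "Re ?z < a" using rz a0 by linarith
    have "cmod (exp (of_real \<sigma> * ?z)) = exp (\<sigma> * (Re c - 2 * ln x))" by simp
    then have yk: "cmod (y ?z) = exp (\<sigma> * (Re c - 2 * ln x)) * cmod (k (\<kappa> / (of_real x)\<^sup>2))"
      unfolding k(3)[OF rza, unfolded ez] by (simp only: norm_mult)
    have E: "exp (- \<sigma> * Re c) * exp (2 * \<sigma> * ln x) * exp (\<sigma> * (Re c - 2 * ln x)) = 1"
      unfolding exp_add[symmetric] by (simp add: algebra_simps)
    have "cmod (k (\<kappa> / (of_real x)\<^sup>2)) = exp (- \<sigma> * Re c) * exp (2 * \<sigma> * ln x) * exp (\<sigma> * (Re c - 2 * ln x)) * cmod (k (\<kappa> / (of_real x)\<^sup>2))"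
      unfolding E by simp
    also have "\<dots> = exp (- \<sigma> * Re c) * exp (2 * \<sigma> * ln x) * cmod (y ?z)" by (simp only: yk mult.assoc)
    also have "\<dots> \<le> exp (- \<sigma> * Re c) * x ^ N * (2 * T / exp x)"
    proof (intro mult_mono 1 order_refl)
      have "2 * \<sigma> * ln x \<le> real N * ln x" unfolding N_def using x1 by (intro mult_right_mono) (auto simp: of_nat_ceiling)
      then have "exp (2 * \<sigma> * ln x) \<le> exp (real N * ln x)" by simp
      also have "\<dots> = x ^ N" using x1 by (simp add: exp_of_nat_mult)
      finally show "exp (2 * \<sigma> * ln x) \<le> x ^ N" .
    qed (use x1 in auto)
    finally show ?thesis unfolding K_def by (simp add: mult_ac)
  qed
  have "((\<lambda>x. K * (x ^ N / exp x)) \<longlongrightarrow> K * 0) at_top" by (intro tendsto_intros tendsto_power_div_exp_0)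
  then have lim0: "((\<lambda>x. K * (x ^ N / exp x)) \<longlongrightarrow> 0) at_top" by simp
  have "((\<lambda>x. k (\<kappa> / (of_real x)\<^sup>2)) \<longlongrightarrow> 0) at_top"
    by (rule Lim_null_comparison[OF eventually_mono[OF eventually_ge_at_top[of m] kb] lim0])
  moreover have "((\<lambda>x. k (\<kappa> / (of_real x)\<^sup>2)) \<longlongrightarrow> k 0) at_top"
  proof -
    have "isCont k 0" using holomorphic_on_imp_continuous_on[OF k(1)] by (simp add: continuous_on_eq_continuous_at)
    moreover have "((\<lambda>x::real. \<kappa> / (of_real x)\<^sup>2) \<longlongrightarrow> 0) at_top"
    proof (rule tendsto_norm_zero_cancel)
      have "((\<lambda>x::real. cmod \<kappa> / x\<^sup>2) \<longlongrightarrow> 0) at_top" by real_asymp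
      then show "((\<lambda>x::real. cmod (\<kappa> / (of_real x)\<^sup>2)) \<longlongrightarrow> 0) at_top" by (simp add: norm_divide norm_power)
    qed
    ultimately show ?thesis by (rule isCont_tendsto_compose)
  qed
  ultimately have "k 0 = 0" using tendsto_unique[OF trivial_limit_at_top_linorder] by blast
  then show False using k(2) by simp
qed

text \<open>A metric \<open>F^(-2) |dt|^2\<close> becomes \<open>P^(-2) |d\<zeta>|^2\<close> with
  \<open>P = F / |t|\<close>; the same weight keeps the linear equations free of first-order terms.
  The summand with 1/4 is \<open>-1/2\<close> times the Schwarzian of the exponential function, and
  the Liouville expression is invariant.\<close>

lemma exp_pull_back:
  assumes U: "open U" "smooth_on F U" and V: "open V" "\<And>\<zeta>. \<zeta> \<in> V \<Longrightarrow> exp \<zeta> \<in> U"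
  defines "P \<equiv> \<lambda>\<zeta>. F (exp \<zeta>) * of_real (exp (- Re \<zeta>))"
  shows "smooth_on P V"
    "\<zeta> \<in> V \<Longrightarrow> dz (dz P) \<zeta> = of_real (exp (- Re \<zeta>)) * ((exp \<zeta>)\<^sup>2 * dz (dz F) (exp \<zeta>) + F (exp \<zeta>) / 4)"
    "\<zeta> \<in> V \<Longrightarrow> P \<zeta> * dz (dzb P) \<zeta> - dz P \<zeta> * dzb P \<zeta>
      = F (exp \<zeta>) * dz (dzb F) (exp \<zeta>) - dz F (exp \<zeta>) * dzb F (exp \<zeta>)"
proof -
  \<comment> \<open>\<open>H\<close> stands for \<open>1/2\<close> so that the identities below are ring identities modulo \<open>H + H = 1\<close>.\<close>
  define H where "H = (1/2 :: complex)"
  define g where "g = (\<lambda>\<zeta>. exp (- H * \<zeta>))"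
  define G where "G = (\<lambda>\<zeta>. exp (H * \<zeta>))"
  have HH: "H + H = 1" "cnj H = H" unfolding H_def by simp_all
  have gG: "g \<zeta> * G \<zeta> = 1" for \<zeta> unfolding g_def G_def by (simp add: exp_minus)
  have GG: "exp \<zeta> = G \<zeta> * G \<zeta>" for \<zeta>
  proof -
    have "G \<zeta> * G \<zeta> = exp ((H + H) * \<zeta>)" unfolding G_def by (simp add: mult_exp_exp algebra_simps)
    then show ?thesis by (simp add: HH(1))
  qed
  have cgG: "cnj (g \<zeta>) * cnj (G \<zeta>) = 1" for \<zeta> using gG[of \<zeta>] by (metis complex_cnj_mult complex_cnj_one)
  have weight: "complex_of_real (exp (- Re \<zeta>)) = g \<zeta> * cnj (g \<zeta>)" for \<zeta>
  proof -
    have "cnj (g \<zeta>) = exp (- H * cnj \<zeta>)" unfolding g_def by (simp add: exp_cnj HH)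
    then have "g \<zeta> * cnj (g \<zeta>) = exp (- H * (\<zeta> + cnj \<zeta>))" unfolding g_def by (simp add: mult_exp_exp algebra_simps)
    also have "- H * (\<zeta> + cnj \<zeta>) = of_real (- Re \<zeta>)" unfolding complex_add_cnj H_def by simp
    finally show ?thesis by (simp only: exp_of_real[symmetric])
  qed
  have P: "P = (\<lambda>\<zeta>. F (exp \<zeta>) * (g \<zeta> * cnj (g \<zeta>)))" unfolding P_def weight ..
  have dk: "(exp has_field_derivative (G \<zeta> * G \<zeta>)) (at \<zeta>)" for \<zeta> :: complex unfolding GG[symmetric] by (rule DERIV_exp)
  have hol: "exp holomorphic_on V" "g holomorphic_on V" "G holomorphic_on V" unfolding g_def G_def by (intro holomorphic_intros)+
  have wg: "has_wirtinger g (- H * g \<zeta>) 0 \<zeta>" "has_wirtinger G (H * G \<zeta>) 0 \<zeta>" for \<zeta>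
    by (rule has_wirtinger_holomorphic; unfold g_def G_def; auto intro!: derivative_eq_intros)+
  have wgc: "has_wirtinger (\<lambda>\<zeta>. cnj (g \<zeta>)) 0 (- H * cnj (g \<zeta>)) \<zeta>" "has_wirtinger (\<lambda>\<zeta>. cnj (G \<zeta>)) 0 (H * cnj (G \<zeta>)) \<zeta>" for \<zeta>
    using has_wirtinger_cnj[OF wg(1)] has_wirtinger_cnj[OF wg(2)] by (simp_all add: HH)
  have wF: "has_wirtinger (\<lambda>\<zeta>. f (exp \<zeta>)) (dz f (exp \<zeta>) * (G \<zeta> * G \<zeta>)) (dzb f (exp \<zeta>) * cnj (G \<zeta> * G \<zeta>)) \<zeta>"
    if "smooth_on f U" "\<zeta> \<in> V" for f \<zeta>
    by (rule has_wirtinger_o_holomorphic[OF smooth_on_has_wirtinger[OF that(1) U(1) V(2)[OF that(2)]] dk])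
  have wP: "has_wirtinger P (cnj (g \<zeta>) * (dz F (exp \<zeta>) * G \<zeta> - F (exp \<zeta>) * (H * g \<zeta>)))
      (g \<zeta> * (dzb F (exp \<zeta>) * cnj (G \<zeta>) - F (exp \<zeta>) * (H * cnj (g \<zeta>)))) \<zeta>" if z: "\<zeta> \<in> V" for \<zeta>
  proof -
    note w = has_wirtinger_mult[OF wF[OF U(2) z] has_wirtinger_mult[OF wg(1) wgc(1)]]
    show ?thesis unfolding P
    proof (rule has_wirtinger_eq[OF w])
      show "dz F (exp \<zeta>) * (G \<zeta> * G \<zeta>) * (g \<zeta> * cnj (g \<zeta>)) + F (exp \<zeta>) * (- H * g \<zeta> * cnj (g \<zeta>) + g \<zeta> * 0)
        = cnj (g \<zeta>) * (dz F (exp \<zeta>) * G \<zeta> - F (exp \<zeta>) * (H * g \<zeta>))" using gG[of \<zeta>] by algebra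
      show "dzb F (exp \<zeta>) * cnj (G \<zeta> * G \<zeta>) * (g \<zeta> * cnj (g \<zeta>)) + F (exp \<zeta>) * (0 * cnj (g \<zeta>) + g \<zeta> * (- H * cnj (g \<zeta>)))
        = g \<zeta> * (dzb F (exp \<zeta>) * cnj (G \<zeta>) - F (exp \<zeta>) * (H * cnj (g \<zeta>)))"
        unfolding complex_cnj_mult using cgG[of \<zeta>] by algebra
    qed
  qed
  show "smooth_on P V" unfolding P
    by (intro smooth_on_mult V(1) smooth_on_o_holomorphic[OF U(1) V(1) hol(1) _ U(2)] smooth_on_cnj smooth_on_holomorphic hol) (use V(2) in blast)
  note sm = smooth_on_dz[OF U] smooth_on_dzb[OF U]
  have dP: "dz P \<zeta> = cnj (g \<zeta>) * (dz F (exp \<zeta>) * G \<zeta> - F (exp \<zeta>) * (H * g \<zeta>))"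
    "dzb P \<zeta> = g \<zeta> * (dzb F (exp \<zeta>) * cnj (G \<zeta>) - F (exp \<zeta>) * (H * cnj (g \<zeta>)))" if "\<zeta> \<in> V" for \<zeta>
    using has_wirtinger_imp[OF wP[OF that]] by auto
  note cH = has_wirtinger_const[of H]
  show "dz (dz P) \<zeta> = of_real (exp (- Re \<zeta>)) * ((exp \<zeta>)\<^sup>2 * dz (dz F) (exp \<zeta>) + F (exp \<zeta>) / 4)" if z: "\<zeta> \<in> V"
  proof -
    note w = has_wirtinger_mult[OF wgc(1)
        has_wirtinger_diff[OF has_wirtinger_mult[OF wF[OF sm(1) z] wg(2)] has_wirtinger_mult[OF wF[OF U(2) z] has_wirtinger_mult[OF cH wg(1)]]]]
    have 1: "(exp \<zeta>)\<^sup>2 = G \<zeta> * G \<zeta> * (G \<zeta> * G \<zeta>)" unfolding GG power2_eq_square ..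
    have 2: "F (exp \<zeta>) / 4 = H * H * F (exp \<zeta>)" unfolding H_def by simp
    have "dz (dz P) \<zeta> = dz (\<lambda>\<zeta>. cnj (g \<zeta>) * (dz F (exp \<zeta>) * G \<zeta> - F (exp \<zeta>) * (H * g \<zeta>))) \<zeta>"
      by (rule dz_cong[OF V(1) z dP(1)])
    then show ?thesis unfolding has_wirtinger_imp(1)[OF w] weight 1 2
      using gG[of \<zeta>] HH(1) by algebra
  qed
  show "P \<zeta> * dz (dzb P) \<zeta> - dz P \<zeta> * dzb P \<zeta>
      = F (exp \<zeta>) * dz (dzb F) (exp \<zeta>) - dz F (exp \<zeta>) * dzb F (exp \<zeta>)" if z: "\<zeta> \<in> V"
  proof -
    note w = has_wirtinger_mult[OF wg(1)
        has_wirtinger_diff[OF has_wirtinger_mult[OF wF[OF sm(2) z] wgc(2)] has_wirtinger_mult[OF wF[OF U(2) z] has_wirtinger_mult[OF cH wgc(1)]]]]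
    have "dz (dzb P) \<zeta> = dz (\<lambda>\<zeta>. g \<zeta> * (dzb F (exp \<zeta>) * cnj (G \<zeta>) - F (exp \<zeta>) * (H * cnj (g \<zeta>)))) \<zeta>"
      by (rule dz_cong[OF V(1) z dP(2)])
    moreover have "P \<zeta> = F (exp \<zeta>) * (g \<zeta> * cnj (g \<zeta>))" by (simp add: P)
    ultimately show ?thesis unfolding has_wirtinger_imp(1)[OF w] dP[OF z]
      using gG[of \<zeta>] cgG[of \<zeta>] HH(1) by algebra
  qed
qed

text \<open>A pole of order at most two of \<open>phi_tt / phi\<close> cannot cancel one of order
  three of \<open>Q\<close>. In \<zeta> the coefficient of the equation for \<open>Y\<close> is
  therefore \<open>S / t\<close> with \<open>S 0 = g 0\<close> nonzero: an irregular point, although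
  single-valuedness of \<open>Y\<close> makes the monodromy scalar.\<close>

lemma (in cmc_chart) no_end_of_order_three:
  assumes r: "r > 0" and U: "U = ball 0 r - {0}"
    and g: "g holomorphic_on ball 0 r" "\<And>t. t \<in> ball 0 r \<Longrightarrow> g t \<noteq> 0" "\<And>t. t \<in> U \<Longrightarrow> Q t = g t / t ^ 3"
    and area: "(\<integral>\<^sup>+z. ennreal (2 * (cmod (Q z))\<^sup>2 / Re (E z)) * indicator U z \<partial>lborel) \<le> ennreal A" "A \<ge> 0"
  shows False
proof -
  define a where "a = ln r"
  have ea: "exp a = r" unfolding a_def using r by simp
  have op: "open (half_plane a)" by (rule open_halfspace_Re_lt)
  have inU: "exp \<zeta> \<in> U" if "Re \<zeta> < a" for \<zeta> using that unfolding U ea[symmetric] by simp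
  have Qnz: "\<And>z. z \<in> U \<Longrightarrow> Q z \<noteq> 0" using g(2,3) unfolding U by auto
  have phi_pos: "Re (phi z) > 0" "cnj (phi z) = phi z" "phi z \<noteq> 0" if "z \<in> U" for z
    using phi_pos[of z] Qnz that by blast+
  have smooth_phi: "smooth_on phi U" using smooth_phi Qnz by blast
  have phi_liouville: "phi z * dz (dzb phi) z - dz phi z * dzb phi z = 1/4" if "z \<in> U" for z
    using phi_liouville[of z] Qnz that by blast
  have phi_sq: "E z = phi z * phi z * (2 * (Q z * cnj (Q z)))" if "z \<in> U" for z
    using phi_sq[of z] Qnz that by blast
  have smooth_Y: "smooth_on (Y j) U" for j using smooth_Y[of j] Qnz by blast
  have Y_real: "cnj (Y j z) = Y j z" if "z \<in> U" for j z using Y_real[of z j] Qnz that by blast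
  have dz_dz_Y: "dz (dz (Y j)) z = (dz (dz phi) z / phi z + Q z) * Y j z" if "z \<in> U" for j z
    using dz_dz_Y[of z j] Qnz that by blast
  have Y_independent: "d j = 0" if "\<And>z. z \<in> U \<Longrightarrow> (\<Sum>j\<in>UNIV. d j * Y j z) = 0" "U \<noteq> {}" for d j
    by (rule Y_independent[where V = U and c = d]) (use Qnz open_U that in auto)
  define H where "H t = dz (dz phi) t / phi t" for t
  \<comment> \<open>Lift to the half-plane with the weight of \<open>exp_pull_back\<close>; it is
    applied to \<open>phi\<close> and to every component of \<open>Y\<close>.\<close>
  define hat where "hat F \<zeta> = F (exp \<zeta>) * of_real (exp (- Re \<zeta>))" for F :: "complex \<Rightarrow> complex" and \<zeta>
  have hat: "smooth_on (hat F) (half_plane a)"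
    "Re \<zeta> < a \<Longrightarrow> dz (dz (hat F)) \<zeta> = of_real (exp (- Re \<zeta>)) * ((exp \<zeta>)\<^sup>2 * dz (dz F) (exp \<zeta>) + F (exp \<zeta>) / 4)"
    "Re \<zeta> < a \<Longrightarrow> hat F \<zeta> * dz (dzb (hat F)) \<zeta> - dz (hat F) \<zeta> * dzb (hat F) \<zeta>
      = F (exp \<zeta>) * dz (dzb F) (exp \<zeta>) - dz F (exp \<zeta>) * dzb F (exp \<zeta>)"
    "hat F (\<zeta> + period) = hat F \<zeta>" if "smooth_on F U" for F \<zeta>
  proof -
    note c = exp_pull_back[OF open_U that op, folded hat_def, unfolded mem_Collect_eq, OF inU]
    show "smooth_on (hat F) (half_plane a)" using c(1) unfolding hat_def[abs_def] .
    show "Re \<zeta> < a \<Longrightarrow> dz (dz (hat F)) \<zeta> = of_real (exp (- Re \<zeta>)) * ((exp \<zeta>)\<^sup>2 * dz (dz F) (exp \<zeta>) + F (exp \<zeta>) / 4)"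
      using c(2) unfolding hat_def[abs_def] by simp
    show "Re \<zeta> < a \<Longrightarrow> hat F \<zeta> * dz (dzb (hat F)) \<zeta> - dz (hat F) \<zeta> * dzb (hat F) \<zeta>
      = F (exp \<zeta>) * dz (dzb F) (exp \<zeta>) - dz F (exp \<zeta>) * dzb F (exp \<zeta>)"
      using c(3) unfolding hat_def[abs_def] by simp
    show "hat F (\<zeta> + period) = hat F \<zeta>" unfolding hat_def exp_period by simp
  qed
  \<comment> \<open>Coefficient of the equation that the lifted \<open>phi\<close>
    satisfies.\<close>
  define hp where "hp \<zeta> = (exp \<zeta>)\<^sup>2 * H (exp \<zeta>) + 1/4" for \<zeta>
  interpret pl: periodic_liouville a "hat phi" hp
  proof
    fix \<zeta> :: complex assume z: "Re \<zeta> < a"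
    note u = inU[OF z]
    show "cnj (hat phi \<zeta>) = hat phi \<zeta>" unfolding hat_def using phi_pos(2)[OF u] by simp
    show "0 < Re (hat phi \<zeta>)" unfolding hat_def using phi_pos(1)[OF u] by simp
    show "hat phi (\<zeta> + period) = hat phi \<zeta>" by (rule hat(4)[OF smooth_phi])
    show "hat phi \<zeta> * dz (dzb (hat phi)) \<zeta> - dz (hat phi) \<zeta> * dzb (hat phi) \<zeta> = 1/4"
      unfolding hat(3)[OF smooth_phi z] by (rule phi_liouville[OF u])
    show "hp \<zeta> = dz (dz (hat phi)) \<zeta> / hat phi \<zeta>"
      unfolding hat(2)[OF smooth_phi z] hp_def hat_def[of phi \<zeta>] H_def using phi_pos(3)[OF u] by (simp add: field_simps)
  qed (rule hat(1)[OF smooth_phi])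
  have dens: "2 * (cmod (Q z))\<^sup>2 / Re (E z) = 1 / (Re (phi z))\<^sup>2" if z: "z \<in> U" for z
  proof -
    have rp: "phi z = of_real (Re (phi z))" using phi_pos(2)[OF z] by (metis Reals_cnj_iff of_real_Re)
    have "E z = phi z * phi z * (2 * of_real ((cmod (Q z))\<^sup>2))" using phi_sq[OF z] by (simp only: complex_norm_square)
    also have "\<dots> = of_real ((Re (phi z))\<^sup>2 * (2 * (cmod (Q z))\<^sup>2))" by (subst (1 2) rp) (simp add: power2_eq_square)
    finally have "Re (E z) = (Re (phi z))\<^sup>2 * (2 * (cmod (Q z))\<^sup>2)" by simp
    then show ?thesis using Qnz[OF z] by simp
  qed
  have nzR: "Re (phi z) \<noteq> 0" if "z \<in> U" for z using phi_pos(1)[OF that] by simp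
  have D: "continuous_on U (\<lambda>z. 1 / (Re (phi z))\<^sup>2)"
    by (intro continuous_intros smooth_on_continuous[OF smooth_phi]) (use nzR in auto)
  have area': "(\<integral>\<^sup>+z. ennreal (1 / (Re (phi z))\<^sup>2) * indicator U z \<partial>lborel) \<le> ennreal A"
    using area(1) by (subst nn_integral_cong[where v = "\<lambda>z. ennreal (2 * (cmod (Q z))\<^sup>2 / Re (E z)) * indicator U z"])
      (auto simp: dens split: split_indicator)
  have bound: "integral {x1..x2} (\<lambda>x. integral {0..2*pi} (\<lambda>\<theta>. 1 / (Re (hat phi (Complex x \<theta>)))\<^sup>2)) \<le> A"
    if x: "x1 \<le> x2" "x2 < a" for x1 x2
  proof -
    let ?B = "cbox (Complex x1 0) (Complex x2 (2 * pi))"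
    let ?I = "box (Complex x1 0) (Complex x2 (2 * pi))"
    have B: "Re \<zeta> < a" if "\<zeta> \<in> ?B" for \<zeta> using that x by (auto simp: mem_box Basis_complex_def)
    have I: "\<zeta> \<in> ?I \<Longrightarrow> 0 < Im \<zeta> \<and> Im \<zeta> < 2 * pi \<and> Re \<zeta> < a" for \<zeta> using x by (auto simp: mem_box Basis_complex_def)
    have nz: "Re (hat phi \<zeta>) \<noteq> 0" if "\<zeta> \<in> ?B" for \<zeta> using pl.pos[OF B[OF that]] by simp
    have c: "continuous_on ?B (hat phi)" using smooth_on_continuous[OF pl.smooth] by (rule continuous_on_subset) (use B in auto)
    have cE: "continuous_on ?B (\<lambda>\<zeta>. 1 / (Re (hat phi \<zeta>))\<^sup>2)" by (intro continuous_intros c) (use nz in auto)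
    have inj: "inj_on exp ?I"
    \<comment> \<open>On the open rectangle imaginary parts differ by less than
      \<open>2 * pi\<close>, so the exponential function is injective.\<close>
    proof (rule inj_onI)
      fix z w assume zw: "z \<in> ?I" "w \<in> ?I" "exp z = exp w"
      show "z = w" by (rule exp_complex_eqI[OF _ zw(3)]) (use I[OF zw(1)] I[OF zw(2)] in auto)
    qed
    show ?thesis
    proof (rule rectangle_integral_le_area[where U = ?I and \<kappa> = exp and W = U and D = "\<lambda>z. 1 / (Re (phi z))\<^sup>2"])
      show "exp ` ?I \<subseteq> U" by (intro image_subsetI inU) (use I in auto)
      show "negligible (?B - ?I)" by (rule negligible_frontier_interval)
      fix z assume z: "z \<in> ?I"
      have d: "deriv exp z = exp z" by (rule DERIV_imp_deriv[OF DERIV_exp])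
      have "Re (hat phi z) = Re (phi (exp z)) * exp (- Re z)" unfolding hat_def by simp
      then have "Re (hat phi z) = Re (phi (exp z)) / cmod (deriv exp z)" unfolding d by (simp add: exp_minus divide_inverse)
      then show "1 / (Re (hat phi z))\<^sup>2 = 1 / (Re (phi (exp z)))\<^sup>2 * (cmod (deriv exp z))\<^sup>2" by (simp add: power_divide)
    qed (use inj cE D area' area(2) box_subset_cbox in \<open>auto intro: holomorphic_intros\<close>)
  qed
  obtain K M a0 where gr: "a0 < a" "\<And>\<zeta>. Re \<zeta> \<le> a0 \<Longrightarrow> Re (hat phi \<zeta>) \<le> K * exp (M * \<bar>Re \<zeta>\<bar>)"
    by (rule pl.growth_of_area[OF bound]; (assumption | (rule that; (assumption | simp))))
  obtain \<sigma> k e where ke: "exponent_form a \<sigma> k e" "solves hp (half_plane a) e"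
    by (rule pl.exponent_solution[OF gr(2,1)]; (assumption | (rule that; (assumption | simp))))
  \<comment> \<open>The exponent of one solution shows that \<open>t^2 * H t\<close> converges: the
    pole of \<open>H\<close> has order at most two.\<close>
  have lim: "((\<lambda>t. t\<^sup>2 * H t + 1/4) \<longlongrightarrow> (of_real \<sigma>)\<^sup>2) (at 0)"
    by (rule exponent_form_limit[OF ke]) (simp add: hp_def)
  have Hhol: "H holomorphic_on U" unfolding H_def[abs_def]
    by (rule liouville_schwarzian_holomorphic[OF open_U smooth_phi phi_pos(3) phi_liouville])
  \<comment> \<open>This is \<open>t\<close> times the lifted coefficient with \<open>Q\<close>
    included, and 0 is filled in by continuity: by \<open>lim\<close> the contribution of
    \<open>H\<close> disappears there.\<close>
  define S where "S t = (if t = 0 then g 0 else t * (t\<^sup>2 * H t + 1/4) + g t)" for t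
  have gl: "(g \<longlongrightarrow> g 0) (at 0)"
    using holomorphic_on_imp_continuous_on[OF g(1)] r by (simp add: continuous_on_eq_continuous_at isCont_def)
  have Shol: "S holomorphic_on ball 0 (exp a)" unfolding ea
  proof (rule no_isolated_singularity'[where K = "{0}"])
    have "((\<lambda>t. t * (t\<^sup>2 * H t + 1/4) + g t) \<longlongrightarrow> 0 * (of_real \<sigma>)\<^sup>2 + g 0) (at 0)" by (intro tendsto_intros lim gl)
    then have "((\<lambda>t. t * (t\<^sup>2 * H t + 1/4) + g t) \<longlongrightarrow> S 0) (at 0)" by (simp add: S_def)
    moreover have "\<forall>\<^sub>F t in at 0. t * (t\<^sup>2 * H t + 1/4) + g t = S t" unfolding eventually_at_filter by (simp add: S_def)
    ultimately have "(S \<longlongrightarrow> S 0) (at 0)" by (rule Lim_transform_eventually)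
    then show "(S \<longlongrightarrow> S z) (at z within ball 0 r)" if "z \<in> {0}" for z
      using that by (auto intro: tendsto_within_subset)
    have "(\<lambda>t. t * (t\<^sup>2 * H t + 1/4) + g t) holomorphic_on U"
      by (intro holomorphic_intros Hhol holomorphic_on_subset[OF g(1)]) (auto simp: U)
    then show "S holomorphic_on ball 0 r - {0}" unfolding U by (rule holomorphic_transform) (auto simp: S_def)
  qed auto
  define h where "h \<zeta> = S (exp \<zeta>) / exp \<zeta>" for \<zeta>
  have hh: "h \<zeta> = (exp \<zeta>)\<^sup>2 * (H (exp \<zeta>) + Q (exp \<zeta>)) + 1/4" if "Re \<zeta> < a" for \<zeta>
    unfolding h_def S_def g(3)[OF inU[OF that]] by (simp add: field_simps power2_eq_square power3_eq_cube)
  have hhol: "h holomorphic_on half_plane a" unfolding h_def[abs_def]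
    by (intro holomorphic_intros holomorphic_on_compose_gen[OF _ Shol, unfolded o_def]) auto
  have hper: "h (\<zeta> + period) = h \<zeta>" for \<zeta> unfolding h_def exp_period ..
  obtain u v \<mu> where "solves h (half_plane a) u" "solves h (half_plane a) v" "\<And>\<zeta>. Re \<zeta> < a \<Longrightarrow> wronskian u v \<zeta> = 1"
    "\<And>\<zeta>. Re \<zeta> < a \<Longrightarrow> u (\<zeta> + period) = \<mu> * u \<zeta>" "\<And>\<zeta>. Re \<zeta> < a \<Longrightarrow> v (\<zeta> + period) = \<mu> * v \<zeta>" "cmod \<mu> = 1"
  proof (rule scalar_monodromy[OF hhol hper, where \<Psi> = "\<lambda>j. hat (Y j)"])
    fix j
    show "smooth_on (hat (Y j)) (half_plane a)" by (rule hat(1)[OF smooth_Y])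
    fix \<zeta> :: complex assume z: "Re \<zeta> < a"
    show "cnj (hat (Y j) \<zeta>) = hat (Y j) \<zeta>" unfolding hat_def using Y_real[OF inU[OF z]] by simp
    show "hat (Y j) (\<zeta> + period) = hat (Y j) \<zeta>" by (rule hat(4)[OF smooth_Y])
    show "dz (dz (hat (Y j))) \<zeta> = h \<zeta> * hat (Y j) \<zeta>"
      unfolding hat(2)[OF smooth_Y z] dz_dz_Y[OF inU[OF z]] hh[OF z] H_def hat_def[of "Y j" \<zeta>] by (simp add: algebra_simps)
  next
    fix d :: "4 \<Rightarrow> complex"
    assume d: "\<And>\<zeta>. Re \<zeta> < a \<Longrightarrow> (\<Sum>j\<in>UNIV. d j * hat (Y j) \<zeta>) = 0"
    show "\<forall>j. d j = 0"
    proof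
      fix j
      show "d j = 0"
      proof (rule Y_independent)
        show "U \<noteq> {}" using inU[of "of_real (a - 1)"] by auto
        fix z assume z: "z \<in> U"
        have "Re (Ln z) < ln r" using z r unfolding U by (simp add: Re_Ln ln_less_cancel_iff)
        then have rz: "Re (Ln z) < a" "exp (Ln z) = z" using z unfolding a_def U by auto
        have "(\<Sum>j\<in>UNIV. d j * hat (Y j) (Ln z)) = (\<Sum>j\<in>UNIV. d j * Y j z) * of_real (exp (- Re (Ln z)))"
          unfolding hat_def rz(2) sum_distrib_right by (simp add: mult.assoc)
        then show "(\<Sum>j\<in>UNIV. d j * Y j z) = 0" using d[OF rz(1)] by simp
      qed
    qed
  qed (assumption | (rule that; assumption))+
  moreover have "S 0 \<noteq> 0" unfolding S_def using g(2)[of 0] r by simp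
  ultimately show False using irregular_monodromy_not_scalar[OF Shol _ h_def] by blast
qed

text \<open>Serves ends in either coordinate of the sphere. The curvature density scales with the
  squared modulus of the derivative of \<tau>, and \<tau> is injective, so the curvature over the
  punctured disc is at most that over \<open>U\<close>.\<close>

lemma (in cmc_chart) no_holomorphic_end_of_order_three:
  assumes r: "r > 0" and \<tau>: "\<tau> holomorphic_on ball 0 r - {0}" "inj_on \<tau> (ball 0 r - {0})" "\<tau> ` (ball 0 r - {0}) \<subseteq> U"
    and g: "g holomorphic_on ball 0 r" "\<And>t. t \<in> ball 0 r \<Longrightarrow> g t \<noteq> 0"
      "\<And>t. t \<in> ball 0 r - {0} \<Longrightarrow> hopf (\<lambda>j z. G j (\<tau> z)) (\<lambda>j z. N j (\<tau> z)) t = g t / t ^ 3"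
    and area: "(\<integral>\<^sup>+z. ennreal (2 * (cmod (Q z))\<^sup>2 / Re (E z)) * indicator U z \<partial>lborel) < \<infinity>"
  shows False
proof -
  let ?V = "ball 0 r - {0 :: complex}"
  have oV: "open ?V" by (intro open_Diff open_ball closed_singleton)
  have d: "deriv \<tau> z \<noteq> 0" if "z \<in> ?V" for z by (rule holomorphic_injective_imp_regular[OF \<tau>(1) oV \<tau>(2) that])
  note pb = pull_back[OF oV \<tau>(1,3)]
  interpret P: cmc_chart "\<lambda>j z. G j (\<tau> z)" "\<lambda>j z. N j (\<tau> z)" ?V by (rule pb(1)) (rule d)
  have pbE: "P.E z = E (\<tau> z) * (deriv \<tau> z * cnj (deriv \<tau> z))" if "z \<in> ?V" for z by (rule pb(2)[OF d that])
  have pbQ: "P.Q z = Q (\<tau> z) * (deriv \<tau> z)\<^sup>2" if "z \<in> ?V" for z by (rule pb(3)[OF d that])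
  define D where "D z = 2 * (cmod (Q z))\<^sup>2 / Re (E z)" for z
  have Dpos: "D z \<ge> 0" if "z \<in> U" for z unfolding D_def using pos[OF that] by simp
  have "continuous_on U D" unfolding D_def[abs_def]
    by (intro continuous_intros smooth_on_continuous[OF smooth_half_metric] smooth_on_continuous[OF smooth_hopf])
      (use pos in force)
  then have cD: "continuous_on (\<tau> ` ?V) D" by (rule continuous_on_subset[OF _ \<tau>(3)])
  have le: "(\<integral>\<^sup>+z. ennreal (D z) * indicator (\<tau> ` ?V) z \<partial>lborel) \<le> (\<integral>\<^sup>+z. ennreal (D z) * indicator U z \<partial>lborel)"
    by (intro nn_integral_mono mult_left_mono) (use \<tau>(3) in \<open>auto split: split_indicator\<close>)
  have fin: "(\<integral>\<^sup>+z. ennreal (D z) * indicator (\<tau> ` ?V) z \<partial>lborel) < \<infinity>"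
    using le_less_trans[OF le area[folded D_def]] .
  have tr: "2 * (cmod (P.Q z))\<^sup>2 / Re (P.E z) = D (\<tau> z) * (cmod (deriv \<tau> z))\<^sup>2" if z: "z \<in> ?V" for z
  proof -
    have "deriv \<tau> z * cnj (deriv \<tau> z) = of_real ((cmod (deriv \<tau> z))\<^sup>2)" by (simp only: complex_norm_square)
    then have e: "Re (P.E z) = Re (E (\<tau> z)) * (cmod (deriv \<tau> z))\<^sup>2" unfolding pbE[OF z] by simp
    have q: "(cmod (P.Q z))\<^sup>2 = (cmod (Q (\<tau> z)))\<^sup>2 * ((cmod (deriv \<tau> z))\<^sup>2 * (cmod (deriv \<tau> z))\<^sup>2)"
      unfolding pbQ[OF z] by (simp add: norm_mult norm_power power_mult_distrib power2_eq_square)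
    have cancel: "2 * (x * (b * b)) / (y * b) = 2 * x / y * b" if "b \<noteq> 0" for x y b :: real using that by simp
    show ?thesis unfolding e q D_def by (rule cancel) (use d[OF z] in simp)
  qed
  have "(\<integral>\<^sup>+z. ennreal (2 * (cmod (P.Q z))\<^sup>2 / Re (P.E z)) * indicator ?V z \<partial>lborel)
    = (\<integral>\<^sup>+z. ennreal (D (\<tau> z) * (cmod (deriv \<tau> z))\<^sup>2) * indicator ?V z \<partial>lborel)"
    by (intro nn_integral_cong) (auto simp: tr split: split_indicator)
  also have "\<dots> = (\<integral>\<^sup>+z. ennreal (D z) * indicator (\<tau> ` ?V) z \<partial>lborel)"
    by (rule nn_integral_holomorphic_substitution[OF oV \<tau>(1,2) cD _ fin]) (use Dpos \<tau>(3) in auto)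
  finally have ar: "(\<integral>\<^sup>+z. ennreal (2 * (cmod (P.Q z))\<^sup>2 / Re (P.E z)) * indicator ?V z \<partial>lborel)
    \<le> ennreal (enn2real (\<integral>\<^sup>+z. ennreal (D z) * indicator (\<tau> ` ?V) z \<partial>lborel))" using fin by simp
  show False by (rule P.no_end_of_order_three[OF r refl g ar enn2real_nonneg])
qed

section \<open>From the surface on the sphere to a chart at the end\<close>

lemma has_order_at_factor:
  assumes "has_order_at q a d"
  obtains g r where "r > 0" "g holomorphic_on ball a r" "\<And>w. w \<in> ball a r \<Longrightarrow> g w \<noteq> 0"
    "\<And>w. w \<in> ball a r - {a} \<Longrightarrow> q w = g w * (w - a) powi d"
proof -
  have q: "isolated_singularity_at q a" "not_essential q a" "\<exists>\<^sub>F z in at a. q z \<noteq> 0" "zorder q a = d"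
    using assms unfolding has_order_at_def meromorphic_at_iff by auto
  obtain r where r: "r > 0" "zor_poly q a a \<noteq> 0" "zor_poly q a holomorphic_on cball a r"
    "\<forall>w\<in>cball a r - {a}. q w = zor_poly q a w * (w - a) powi zorder q a \<and> zor_poly q a w \<noteq> 0"
    using zorder_exist[OF q(1-3)] by blast
  show ?thesis
  proof (rule that[of r "zor_poly q a"])
    show "zor_poly q a holomorphic_on ball a r" by (rule holomorphic_on_subset[OF r(3) ball_subset_cball])
    show "zor_poly q a w \<noteq> 0" if "w \<in> ball a r" for w using r(2,4) that by (cases "w = a") auto
    show "q w = zor_poly q a w * (w - a) powi d" if "w \<in> ball a r - {a}" for w using r(4) q(4) that by auto
  qed (rule r(1))
qed

lemma inj_at_inf: "inj at_inf"
  by (rule injI) (auto simp: at_inf_def split: if_splits)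

text \<open>Total curvature is measured in the coordinate \<open>z\<close>, so the chart
  \<open>Some\<close> is used throughout. A finite end is moved to 0 by translation, and the end at
  infinity is reached through \<open>inverse\<close>.\<close>

lemma no_pole_of_order_three:
  assumes f: "conformal_immersion (- P) f" "cmc1_with_normal (- P) f N" and fin: "finite P"
    and p: "p \<in> P" "hopf_order_at f N p (- 3)" and area: "total_abs_curv (- P) f < \<infinity>"
  shows False
proof -
  have injp: "inj \<phi>" if "\<phi> \<in> sphere_params" for \<phi> using that inj_at_inf unfolding sphere_params_def by auto
  have finv: "finite (\<phi> -` P)" if "\<phi> \<in> sphere_params" for \<phi> by (rule finite_vimageI[OF fin injp[OF that]])
  have opV: "open (\<phi> -` (- P))" if "\<phi> \<in> sphere_params" for \<phi>
    unfolding vimage_Compl by (intro open_Compl finite_imp_closed finv that)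
  have charts: "cmc_chart (coords (f \<circ> \<phi>)) (coords (N \<circ> \<phi>)) (\<phi> -` (- P))"
    "z \<in> \<phi> -` (- P) \<Longrightarrow> half_metric (coords (f \<circ> \<phi>)) z = of_real (fst_form (f \<circ> \<phi>) z 1 1 / 2)"
    "z \<in> \<phi> -` (- P) \<Longrightarrow> hopf (coords (f \<circ> \<phi>)) (coords (N \<circ> \<phi>)) z = hopf_coeff (f \<circ> \<phi>) (N \<circ> \<phi>) z"
    if ph: "\<phi> \<in> sphere_params" for \<phi> z
    by (rule cmc_chart_of_surface[OF opV[OF ph]]; use f ph in \<open>force simp: conformal_immersion_def cmc1_with_normal_def\<close>)+
  have S: "Some \<in> sphere_params" "at_inf \<in> sphere_params" unfolding sphere_params_def by auto
  interpret W: cmc_chart "coords (f \<circ> Some)" "coords (N \<circ> Some)" "Some -` (- P)" by (rule charts(1)[OF S(1)])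
  have ci: "conformal_at (f \<circ> Some) z" if "z \<in> Some -` (- P)" for z
    using f(1) S(1) that unfolding conformal_immersion_def by blast
  have ar: "(\<integral>\<^sup>+z. ennreal (2 * (cmod (W.Q z))\<^sup>2 / Re (W.E z)) * indicator (Some -` (- P)) z \<partial>lborel) < \<infinity>"
  proof -
    have cd: "- gauss_curv (f \<circ> Some) z * area_density (f \<circ> Some) z = 2 * (cmod (W.Q z))\<^sup>2 / Re (W.E z)"
      if "z \<in> Some -` (- P)" for z
      by (rule curvature_density[OF charts(1)[OF S(1)] ci charts(2)[OF S(1)] that])
    have "(\<integral>\<^sup>+z. ennreal (2 * (cmod (W.Q z))\<^sup>2 / Re (W.E z)) * indicator (Some -` (- P)) z \<partial>lborel) = total_abs_curv (- P) f"
      unfolding total_abs_curv_def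
    proof (rule nn_integral_cong)
      fix z
      show "ennreal (2 * (cmod (W.Q z))\<^sup>2 / Re (W.E z)) * indicator (Some -` (- P)) z
        = ennreal (- gauss_curv (f \<circ> Some) z * area_density (f \<circ> Some) z) * indicator (Some -` (- P)) z"
      proof (cases "z \<in> Some -` (- P)")
        case True
        show ?thesis unfolding cd[OF True] ..
      qed simp
    qed
    then show ?thesis using area by simp
  qed
  have isolated: "\<exists>\<delta>>0. \<forall>w. dist a w < \<delta> \<longrightarrow> w \<noteq> a \<longrightarrow> \<phi> w \<notin> P" if "\<phi> \<in> sphere_params" for \<phi> a
    using finite_set_avoid[OF finv[OF that], of a] by (metis not_less vimageI)
  show False
  proof (cases p)
    case (Some a)
    have o: "has_order_at (hopf_coeff (f \<circ> Some) (N \<circ> Some)) a (- 3)" using p(2) unfolding Some hopf_order_at_def by simp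
    obtain g r where g: "r > 0" "g holomorphic_on ball a r" "\<And>w. w \<in> ball a r \<Longrightarrow> g w \<noteq> 0"
      "\<And>w. w \<in> ball a r - {a} \<Longrightarrow> hopf_coeff (f \<circ> Some) (N \<circ> Some) w = g w * (w - a) powi - 3"
      by (rule has_order_at_factor[OF o]; (assumption | (rule that; assumption)))
    obtain \<delta> where \<delta>: "\<delta> > 0" "\<And>w. dist a w < \<delta> \<Longrightarrow> w \<noteq> a \<Longrightarrow> Some w \<notin> P" using isolated[OF S(1), of a] by blast
    define \<rho> where "\<rho> = min r \<delta>"
    let ?\<tau> = "\<lambda>t. a + t"
    have V: "a + t \<in> Some -` (- P)" "a + t \<in> ball a r - {a}" if "t \<in> ball 0 \<rho> - {0}" for t
      using that \<delta>(2)[of "a + t"] unfolding \<rho>_def by (auto simp: dist_norm)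
    have oV: "open (ball 0 \<rho> - {0 :: complex})" by (intro open_Diff open_ball closed_singleton)
    have d1: "deriv ?\<tau> t = 1" for t by (rule DERIV_imp_deriv) (auto intro!: derivative_eq_intros)
    have hol: "?\<tau> holomorphic_on ball 0 \<rho> - {0}" by (intro holomorphic_intros)
    have im: "?\<tau> ` (ball 0 \<rho> - {0}) \<subseteq> Some -` (- P)" using V(1) by blast
    show False
    proof (rule W.no_holomorphic_end_of_order_three[OF _ hol _ im _ _ _ ar])
      show "\<rho> > 0" unfolding \<rho>_def using g(1) \<delta>(1) by simp
      show "inj_on ?\<tau> (ball 0 \<rho> - {0})" by (auto intro: inj_onI)
      show "(\<lambda>t. g (a + t)) holomorphic_on ball 0 \<rho>"
        by (rule holomorphic_on_compose_gen[OF _ g(2), unfolded o_def]) (auto intro: holomorphic_intros simp: dist_norm \<rho>_def)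
      show "g (a + t) \<noteq> 0" if "t \<in> ball 0 \<rho>" for t using that by (intro g(3)) (auto simp: dist_norm \<rho>_def)
      fix t :: complex assume t: "t \<in> ball 0 \<rho> - {0}"
      have "hopf (\<lambda>j z. coords (f \<circ> Some) j (a + z)) (\<lambda>j z. coords (N \<circ> Some) j (a + z)) t = W.Q (a + t) * (deriv ?\<tau> t)\<^sup>2"
        by (rule W.pull_back(3)[OF oV hol im _ t]) (simp add: d1)
      also have "\<dots> = g (a + t) / t ^ 3"
        unfolding charts(3)[OF S(1) V(1)[OF t]] g(4)[OF V(2)[OF t]] d1 by (simp add: power_int_minus divide_inverse)
      finally show "hopf (\<lambda>j z. coords (f \<circ> Some) j (a + z)) (\<lambda>j z. coords (N \<circ> Some) j (a + z)) t = g (a + t) / t ^ 3" .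
    qed
  next
    case None
    have o: "has_order_at (hopf_coeff (f \<circ> at_inf) (N \<circ> at_inf)) 0 (- 3)" using p(2) unfolding None hopf_order_at_def by simp
    obtain g r where g: "r > 0" "g holomorphic_on ball 0 r" "\<And>w. w \<in> ball 0 r \<Longrightarrow> g w \<noteq> 0"
      "\<And>w. w \<in> ball 0 r - {0} \<Longrightarrow> hopf_coeff (f \<circ> at_inf) (N \<circ> at_inf) w = g w * (w - 0) powi - 3"
      by (rule has_order_at_factor[OF o]; (assumption | (rule that; assumption)))
    obtain \<delta> where \<delta>: "\<delta> > 0" "\<And>w. dist 0 w < \<delta> \<Longrightarrow> w \<noteq> 0 \<Longrightarrow> at_inf w \<notin> P" using isolated[OF S(2), of 0] by blast
    define \<rho> where "\<rho> = min r \<delta>"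
    let ?V = "ball 0 \<rho> - {0 :: complex}"
    have V: "t \<in> at_inf -` (- P)" "t \<in> ball 0 r - {0}" "at_inf t = Some (inverse t)" if "t \<in> ?V" for t
      using that \<delta>(2)[of t] unfolding \<rho>_def at_inf_def by auto
    have oV: "open ?V" by (intro open_Diff open_ball closed_singleton)
    have im: "inverse ` ?V \<subseteq> Some -` (- P)" using V(1,3) by force
    have hol: "inverse holomorphic_on ?V" by (intro holomorphic_intros) auto
    show False
    proof (rule W.no_holomorphic_end_of_order_three[OF _ hol _ im _ _ _ ar])
      show "\<rho> > 0" unfolding \<rho>_def using g(1) \<delta>(1) by simp
      show "inj_on inverse ?V" by (auto intro: inj_onI)
      show "g holomorphic_on ball 0 \<rho>" by (rule holomorphic_on_subset[OF g(2)]) (auto simp: \<rho>_def)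
      show "g t \<noteq> 0" if "t \<in> ball 0 \<rho>" for t using that by (intro g(3)) (auto simp: \<rho>_def)
      fix t :: complex assume t: "t \<in> ?V"
      \<comment> \<open>Away from 0 the parametrization \<open>at_inf\<close> is \<open>Some\<close>
        after \<open>inverse\<close>, so the order prescribed at infinity is that of the pulled back
        Hopf coefficient.\<close>
      have "hopf (\<lambda>j z. coords (f \<circ> Some) j (inverse z)) (\<lambda>j z. coords (N \<circ> Some) j (inverse z)) t
        = hopf (coords (f \<circ> at_inf)) (coords (N \<circ> at_inf)) t"
        by (rule half_metric_hopf_cong(2)[OF oV t]) (simp_all add: coords_def V(3))
      also have "\<dots> = g t / t ^ 3"
        unfolding charts(3)[OF S(2) V(1)[OF t]] g(4)[OF V(2)[OF t]] by (simp add: power_int_minus divide_inverse)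
      finally show "hopf (\<lambda>j z. coords (f \<circ> Some) j (inverse z)) (\<lambda>j z. coords (N \<circ> Some) j (inverse z)) t = g t / t ^ 3" .
    qed
  qed
qed

theorem proposition7p9:
  fixes p1 p2 p3 :: sphere
  assumes "distinct [p1, p2, p3]"
  shows "\<not> (\<exists>f N. conformal_immersion (- {p1, p2, p3}) f \<and>
                 cmc1_with_normal (- {p1, p2, p3}) f N \<and>
                 complete_surface (- {p1, p2, p3}) f \<and>
                 of_type_O {p1, p2, p3} f N [1, -2, -3] \<and>
                 total_abs_curv (- {p1, p2, p3}) f \<le> ennreal (8 * pi))"
proof
  assume "\<exists>f N. conformal_immersion (- {p1, p2, p3}) f \<and>
                 cmc1_with_normal (- {p1, p2, p3}) f N \<and>
                 complete_surface (- {p1, p2, p3}) f \<and>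
                 of_type_O {p1, p2, p3} f N [1, -2, -3] \<and>
                 total_abs_curv (- {p1, p2, p3}) f \<le> ennreal (8 * pi)"
  then obtain f N where f: "conformal_immersion (- {p1, p2, p3}) f" "cmc1_with_normal (- {p1, p2, p3}) f N"
    and o: "of_type_O {p1, p2, p3} f N [1, -2, -3]" and a: "total_abs_curv (- {p1, p2, p3}) f \<le> ennreal (8 * pi)" by blast
  obtain ps where ps: "set ps = {p1, p2, p3}" "list_all2 (hopf_order_at f N) ps [1, -2, -3]"
    using o unfolding of_type_O_def by blast
  \<comment> \<open>The ends are listed in the order of the prescribed orders, so the third one
    carries the pole of order three.\<close>
  obtain x y p where p: "ps = [x, y, p]" "hopf_order_at f N p (- 3)" using ps(2) by (auto simp: list_all2_Cons2)
  have "total_abs_curv (- {p1, p2, p3}) f < \<infinity>" using le_less_trans[OF a ennreal_less_top] by simp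
  then show False using no_pole_of_order_three[OF f _ _ p(2)] p(1) ps(1) by auto
qed

end
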